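(* Let $$\mathcal A=\begin{pmatrix}A&B^T\\-B&0\end{pmatrix},\quad \mathcal B_L=\begin{pmatrix}A&0\\-B&BD_A^{-1}B^T\end{pmatrix}^{-1},\quad \mathcal B_D=\begin{pmatrix}A&0\\0&BD_A^{-1}B^T\end{pmatrix}^{-1}.$$ There exist constants $\xi_1,\xi_2>0$, independent of discretization and physical parameters, such that for every $\bm x=(\bm w_h,p_h)\in\bm W_h\times Q_h$, $\bm x\ne\bm 0$, $$\xi_1\le\frac{(\mathcal B_L\mathcal A\bm x,\bm x)_{\mathcal B_D^{-1}}}{(\bm x,\bm x)_{\mathcal B_D^{-1}}}\qquad\text{and}\qquad\frac{\|\mathcal B_L\mathcal A\bm x\|_{\mathcal B_D^{-1}}}{\|\bm x\|_{\mathcal B_D^{-1}}}\le\xi_2.$$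
   Context: **Geometry.** Let $n\in\{2,3\}$. A fractured porous medium of rectangular type (fractures are line segments if $n=2$, flat surfaces if $n=3$) is decomposed by the fractures into $n$-dimensional subdomains $\Omega_i^n$, $i\in I^n$; fractures and their intersections are lower-dimensional subdomains $\Omega_i^d$, $i\in I^d$, $0\le d<n$. For $0\le d\le n-1$ and $i\in I^d$, $\Gamma_{ij}^d$ ($j\in J_i^d$) are the interfaces between $\Omega_i^d$ and the adjacent $(d+1)$-dimensional subdomains. Set $\Omega^d=\bigcup_i\Omega_i^d$, $\Gamma^d=\bigcup_i\bigcup_j\Gamma_{ij}^d$, $\Omega=\bigcup_{d=0}^n\Omega^d$, $\Gamma=\bigcup_{d=0}^{n-1}\Gamma^d$. The boundary splits disjointly as $\partial\Omega=\partial\Omega_D\cup\partial\Omega_N$ with $\partial\Omega_D$ of positive measure; $\partial\Omega_N^d$ is the part of $\partial\Omega_N$ on $\partial\Omega^d$; $\bm\nu$ is the outward unit normal. **Physical parameters.** The permeability $K$ (on $\Omega$) and normal permeability $K_{\bm\nu}$ (on $\Gamma$) are symmetric positive definite tensors bounded above and below; $\gamma>0$ on $\Gamma$ (distance from $\Gamma_{ij}^d$ to $\Omega_i^d$; the aperture for $d=n-1$). All are assumed constant on each subdomain/interface. **Spaces.** $\bm V^d=\{\bm v\in (L^2(\Omega^d))^d:\nabla\cdot\bm v\in L^2(\Omega^d),\ \bm v\cdot\bm\nu=0 \text{ on }\partial\Omega_N^d\}$ for $1\le d\le n$; $\bm V_0^d=\{\bm v\in\bm V^d:\bm v\cdot\bm\nu=0\text{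 on }\Gamma^{d-1}\}$; $\Lambda^d=L^2(\Gamma^d)$ for $0\le d\le n-1$; $Q^d=L^2(\Omega^d)$ for $0\le d\le n$. On shape-regular simplicial triangulations $\mathcal T^d_\Omega$ of $\Omega^d$ and $\mathcal T^d_\Gamma$ of $\Gamma^d$ (maximal mesh size $h$), $\bm V_h^d\subset\bm V^d$ and $\bm V_{0h}^d\subset\bm V_0^d$ are lowest-order Raviart–Thomas spaces $\mathbb{RT}_0(\mathcal T_\Omega^d)$, $\Lambda_h^d=\mathbb P_0(\mathcal T_\Gamma^d)$ and $Q_h^d=\mathbb P_0(\mathcal T_\Omega^d)$ (piecewise constants). Put $\bm V_{0h}=\bigoplus_{d=1}^n\bm V_{0h}^d$, $\Lambda_h=\bigoplus_{d=0}^{n-1}\Lambda_h^d$, $Q_h=\bigoplus_{d=0}^nQ_h^d$, $\bm W_h=\bm V_{0h}\times\Lambda_h$. **Discrete extension.** $\widehat\Pi_h^d:\Lambda_h^d\to\bm V_h^{d+1}\cdot\bm\nu|_{\Gamma^d}$ is the $L^2$-projection, $(\widehat\Pi_h^d\mu-\mu,\bm v\cdot\bm\nu)_{L^2(\Gamma^d)}=0$ for all $\bm v\in\bm V_h^{d+1}$. $R_h^d:\Lambda_h^d\to\bm V_h^{d+1}$ is defined by $R_h^d\lambda\cdot\bm\nu=\widehat\Pi_h^d\lambda$ on $\Gamma^d$ and $0$ elsewhere (all other facet normal components vanish); $R_h=\bigoplus_{d=0}^{n-1}R_h^d$. **Forms.** $(\cdot,\cdot)_\Omega$, $(\cdot,\cdot)_\Gamma$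 are the sums of the $L^2$ inner products over all subdomains, respectively interfaces, with the convention that flux components for $d=0$ and mortar components for $d=n$ are zero. The jump is $\llbracket\lambda\rrbracket|_{\Omega_i^d}=-\sum_{j\in J_i^d}\lambda_{ij}^d$, and $\bm D\cdot[\bm u,\lambda]=\nabla\cdot\bm u+\llbracket\lambda\rrbracket$. For $\bm w_h=[\bm u_{0h},\lambda_h]$, $\bm r_h=[\bm v_{0h},\mu_h]\in\bm W_h$, $q_h\in Q_h$: $$a(\bm w_h,\bm r_h)=(K^{-1}(\bm u_{0h}+R_h\lambda_h),\bm v_{0h}+R_h\mu_h)_\Omega+(\gamma K_{\bm\nu}^{-1}\lambda_h,\mu_h)_\Gamma,$$ $$b(\bm r_h,q_h)=-(q_h,\bm D\cdot[\bm v_{0h}+R_h\mu_h,\mu_h])_\Omega,$$ $$a^D(\bm w_h,\bm r_h)=(K^{-1}(\bm u_{0h}+R_h\lambda_h),\bm v_{0h}+R_h\mu_h)_{D,\Omega}+(\gamma K_{\bm\nu}^{-1}\lambda_h,\mu_h)_\Gamma,$$ where $$(K^{-1}\bm u,\bm v)_{D,\Omega}=\sum_{d=0}^n\sum_{T\in\mathcal T_\Omega^d}\sum_{f\in\partial T}(\bm u\cdot\bm\nu_f)(\bm v\cdot\bm\nu_f)(K^{-1}\bm\phi_f,\bm\phi_f)_T.$$ Here $f$ runs over the faces of the element $T$, $\bm\nu_f$ is the unit outer normal of $f$, and $\bm\phi_f\in\mathbb{RT}_0(T)$ is the basis function of face $f$ (so $\bm v|_T=\sum_f(\bm v\cdot\bm\nu_f)\bm\phi_f$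 for $\bm v\in\mathbb{RT}_0(T)$). **Operators.** With primes for dual spaces and $\langle\cdot,\cdot\rangle$ for duality pairings: $A:\bm W_h\to\bm W_h'$, $\langle A\bm w_h,\bm r_h\rangle=a(\bm w_h,\bm r_h)$; $D_A:\bm W_h\to\bm W_h'$, $\langle D_A\bm w_h,\bm r_h\rangle=a^D(\bm w_h,\bm r_h)$; $B:\bm W_h\to Q_h'$, $\langle B\bm r_h,q_h\rangle=b(\bm r_h,q_h)$, with transpose $B^T:Q_h\to\bm W_h'$. For a symmetric positive definite $\mathcal M:(\bm W_h\times Q_h)'\to\bm W_h\times Q_h$, $(\bm x,\bm y)_{\mathcal M^{-1}}=\langle\mathcal M^{-1}\bm x,\bm y\rangle$ and $\|\bm x\|_{\mathcal M^{-1}}^2=(\bm x,\bm x)_{\mathcal M^{-1}}$. **Convention.** "Independent of discretization and physical parameters" means independent of $h$, $K$, $K_{\bm\nu}$, $\gamma$; dependence on the shape regularity of the mesh is allowed.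
   Formalization: The upper constant ξ₂ may depend on a bound for the anisotropy ratio (largest over smallest eigenvalue) of K on each subdomain; independence of arbitrarily anisotropic K fails for K = diag(1,ε) with ε ≤ h². ξ₁ is independent of all of K. *)

theory Defs
  imports "HOL-Analysis.Analysis" "HOL-Library.Function_Algebras"
begin

section \<open>Function spaces as real vector spaces\<close>

instantiation "fun" :: (type, real_vector) real_vector
begin

definition scaleR_fun :: "real \<Rightarrow> ('a \<Rightarrow> 'b) \<Rightarrow> 'a \<Rightarrow> 'b" where
  "scaleR_fun c f = (\<lambda>x. c *\<^sub>R f x)"

instance
  by standard (simp_all add: scaleR_fun_def fun_eq_iff algebra_simps)

end

text \<open>Functionals on a subspace are represented by functions that are undefined outside of it,
  so that equality of functionals is equality of functions.\<close>

definition dual :: "'v::real_vector set \<Rightarrow> ('v \<Rightarrow> real) set" where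
  "dual V = {f \<in> extensional V. (\<forall>x\<in>V. \<forall>y\<in>V. f (x + y) = f x + f y) \<and>
                                (\<forall>c. \<forall>x\<in>V. f (c *\<^sub>R x) = c * f x)}"


section \<open>Lower-dimensional flat geometry\<close>

definition tangent :: "'a::euclidean_space set \<Rightarrow> 'a set" where
  "tangent S = span {x - y |x y. x \<in> S \<and> y \<in> S}"

definition onb :: "'a::euclidean_space set \<Rightarrow> 'a set" where
  "onb V = (SOME B. B \<subseteq> V \<and> pairwise orthogonal B \<and> (\<forall>b\<in>B. norm b = 1) \<and> independent B \<and> span B = V)"

text \<open>The \<open>d\<close>-dimensional Lebesgue measure on the \<open>d\<close>-dimensional affine hull of \<open>S\<close>, as a Borel
  measure on the ambient space: the analogue of the definition of \<open>lborel\<close>, in orthonormal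
  coordinates of the affine hull. For \<open>d = 0\<close> it is a unit point mass.\<close>

definition flat_measure :: "'a::euclidean_space set \<Rightarrow> 'a measure" where
  "flat_measure S =
     distr (\<Pi>\<^sub>M b\<in>onb (tangent S). lborel) borel
       (\<lambda>c. (SOME x. x \<in> affine hull S) + (\<Sum>b\<in>onb (tangent S). c b *\<^sub>R b))"

text \<open>The divergence along \<open>S\<close>; the trace of the derivative does not depend on the basis.\<close>

definition tangential_div :: "'a::euclidean_space set \<Rightarrow> ('a \<Rightarrow> 'a) \<Rightarrow> 'a \<Rightarrow> real" where
  "tangential_div S v x =
     (\<Sum>e\<in>onb (tangent S). vector_derivative (\<lambda>t. v (x + t *\<^sub>R e)) (at 0) \<bullet> e)"

text \<open>The unit normal of the facet \<open>f\<close> of \<open>T\<close>, tangent to \<open>T\<close> and pointing out of \<open>T\<close>.\<close>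

definition outer_normal :: "'a::euclidean_space set \<Rightarrow> 'a set \<Rightarrow> 'a" where
  "outer_normal T f =
     (THE \<nu>. \<nu> \<in> tangent T \<and> norm \<nu> = 1 \<and> (\<forall>x\<in>T. \<forall>y\<in>f. \<nu> \<bullet> (x - y) \<le> 0))"


section \<open>The mixed-dimensional medium\<close>

text \<open>The index sets are left implicit: a subdomain is its own index, and its dimension is its
  affine dimension. An interface \<open>(S, U, \<nu>)\<close> is the side with normal \<open>\<nu>\<close> (pointing from \<open>U\<close> towards
  \<open>S\<close>) of the adjacent subdomain \<open>U\<close>, of one dimension more; as a point set it coincides with \<open>S\<close>.
  The normal keeps apart the two sides of a fracture along which \<open>U\<close> is slit.\<close>

type_synonym 'a iface = "'a set \<times> 'a set \<times> 'a"

record 'a medium =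
  region :: "'a set"
  subdoms :: "'a set set"
  dirichlet :: "'a set"
  neumann :: "'a set"

definition lower_subdoms :: "'a::euclidean_space medium \<Rightarrow> 'a set set" where
  "lower_subdoms \<Omega> = {S \<in> subdoms \<Omega>. aff_dim S < int DIM('a)}"

definition ifaces :: "'a::euclidean_space medium \<Rightarrow> 'a iface set" where
  "ifaces \<Omega> = {(S, U, \<nu>). S \<in> subdoms \<Omega> \<and> U \<in> subdoms \<Omega> \<and> aff_dim U = aff_dim S + 1 \<and>
     \<nu> \<in> tangent U \<and> norm \<nu> = 1 \<and> (\<forall>\<tau>\<in>tangent S. \<nu> \<bullet> \<tau> = 0) \<and>
     (\<forall>x\<in>S. \<forall>\<^sub>F t in at_right 0. x - t *\<^sub>R \<nu> \<in> U)}"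

text \<open>The boundary of the medium consists of the frontier of the region and of the immersed tips
  and edges of fractures.\<close>

definition outer_boundary :: "'a::euclidean_space medium \<Rightarrow> 'a set" where
  "outer_boundary \<Omega> = closure (\<Union>(subdoms \<Omega>)) - \<Union>(subdoms \<Omega>)"

text \<open>Every subdomain is a connected, relatively open piece of an affine subspace. The
  full-dimensional ones are what the closed fractures leave of the region, and a subdomain is
  disjoint from the closures of the others of the same or a smaller dimension, that is, fractures are
  cut at their intersections. The Dirichlet boundary has positive surface measure if some
  hyperplane meets it in a set of positive measure, the boundary being polyhedral whenever
  the medium can be triangulated.\<close>

definition fractured_medium :: "'a::euclidean_space medium \<Rightarrow> bool" where
  "fractured_medium \<Omega> \<longleftrightarrow>
     open (region \<Omega>) \<and> connected (region \<Omega>) \<and> bounded (region \<Omega>) \<and> region \<Omega> \<noteq> {} \<and>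
     finite (subdoms \<Omega>) \<and> \<Union>(subdoms \<Omega>) \<subseteq> region \<Omega> \<and>
     (\<forall>S\<in>subdoms \<Omega>. S \<noteq> {} \<and> connected S \<and> openin (top_of_set (affine hull S)) S) \<and>
     {S \<in> subdoms \<Omega>. aff_dim S = int DIM('a)}
       = components (region \<Omega> - (\<Union>S\<in>lower_subdoms \<Omega>. closure S)) \<and>
     (\<forall>S\<in>subdoms \<Omega>. \<forall>U\<in>subdoms \<Omega>. S \<noteq> U \<and> aff_dim U \<le> aff_dim S \<longrightarrow> S \<inter> closure U = {}) \<and>
     (\<forall>S\<in>lower_subdoms \<Omega>. \<exists>U \<nu>. (S, U, \<nu>) \<in> ifaces \<Omega>) \<and>
     dirichlet \<Omega> \<union> neumann \<Omega> = outer_boundary \<Omega> \<and> dirichlet \<Omega> \<inter> neumann \<Omega> = {} \<and>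
     (\<exists>H. affine H \<and> aff_dim H = int DIM('a) - 1 \<and> 0 < emeasure (flat_measure H) (dirichlet \<Omega> \<inter> H))"


section \<open>Physical parameters\<close>

text \<open>The normal direction of an interface is one-dimensional, so the normal permeability is a
  positive number.\<close>

record 'a params =
  perm :: "'a set \<Rightarrow> 'a \<Rightarrow> 'a"
  normal_perm :: "'a iface \<Rightarrow> real"
  gap :: "'a iface \<Rightarrow> real"

definition spd_tensor :: "'a::euclidean_space set \<Rightarrow> ('a \<Rightarrow> 'a) \<Rightarrow> bool" where
  "spd_tensor V k \<longleftrightarrow> linear k \<and> k ` V \<subseteq> V \<and> (\<forall>x\<in>V. \<forall>y\<in>V. k x \<bullet> y = x \<bullet> k y) \<and>
     (\<forall>x\<in>V. x \<noteq> 0 \<longrightarrow> 0 < k x \<bullet> x)"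

definition physical_params :: "'a::euclidean_space medium \<Rightarrow> 'a params \<Rightarrow> bool" where
  "physical_params \<Omega> P \<longleftrightarrow>
     (\<forall>S\<in>subdoms \<Omega>. spd_tensor (tangent S) (perm P S)) \<and>
     (\<forall>g\<in>ifaces \<Omega>. 0 < normal_perm P g \<and> 0 < gap P g)"

text \<open>Each permeability tensor is bounded below and above by multiples of the identity whose quotient
  is at most \<open>\<kappa>\<close>. Neither the size of the permeability nor its variation between subdomains is
  restricted; the anisotropy has to be, since \<open>D\<^sub>A\<close> is not equivalent to \<open>A\<close> uniformly in it.\<close>

definition perm_bounded :: "'a::euclidean_space medium \<Rightarrow> real \<Rightarrow> 'a params \<Rightarrow> bool" where
  "perm_bounded \<Omega> \<kappa> P \<longleftrightarrow>
     (\<forall>S\<in>subdoms \<Omega>. \<exists>k>0. \<forall>x\<in>tangent S.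
        k * (norm x)\<^sup>2 \<le> perm P S x \<bullet> x \<and> perm P S x \<bullet> x \<le> \<kappa> * k * (norm x)\<^sup>2)"

definition inv_perm :: "'a::euclidean_space params \<Rightarrow> 'a set \<Rightarrow> 'a \<Rightarrow> 'a" where
  "inv_perm P S = inv_into (tangent S) (perm P S)"


section \<open>Triangulations\<close>

text \<open>Two cells have to match if they meet inside \<open>S\<close>; along a slit the meshes of the two sides
  are independent of each other.\<close>

definition simplicial_mesh :: "'a::euclidean_space set \<Rightarrow> 'a set set \<Rightarrow> bool" where
  "simplicial_mesh S C \<longleftrightarrow> finite C \<and> \<Union>C = closure S \<and>
     (\<forall>T\<in>C. aff_dim S simplex T \<and> rel_interior T \<subseteq> S) \<and>
     (\<forall>T\<in>C. \<forall>T'\<in>C. T \<inter> T' \<inter> S \<noteq> {} \<longrightarrow> T \<inter> T' face_of T \<and> T \<inter> T' face_of T')"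

definition shape_regular :: "real \<Rightarrow> 'a::euclidean_space set \<Rightarrow> bool" where
  "shape_regular \<sigma> T \<longleftrightarrow>
     (\<exists>z\<in>T. \<exists>r>0. cball z r \<inter> affine hull T \<subseteq> T \<and> diameter T \<le> \<sigma> * r)"

record 'a mesh =
  cells :: "'a set \<Rightarrow> 'a set set"
  mortar_cells :: "'a iface \<Rightarrow> 'a set set"

text \<open>The cells resolve the decomposition and the splitting of the boundary. The interface meshes need
  not match the meshes of the adjacent subdomains.\<close>

definition medium_mesh :: "'a::euclidean_space medium \<Rightarrow> real \<Rightarrow> 'a mesh \<Rightarrow> bool" where
  "medium_mesh \<Omega> \<sigma> M \<longleftrightarrow>
     (\<forall>S\<in>subdoms \<Omega>. simplicial_mesh S (cells M S) \<and> (\<forall>T\<in>cells M S. shape_regular \<sigma> T)) \<and>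
     (\<forall>(S, U, \<nu>)\<in>ifaces \<Omega>. simplicial_mesh S (mortar_cells M (S, U, \<nu>)) \<and>
        (\<forall>E\<in>mortar_cells M (S, U, \<nu>). shape_regular \<sigma> E)) \<and>
     (\<forall>S\<in>subdoms \<Omega>. \<forall>T\<in>cells M S. \<forall>f. f facet_of T \<longrightarrow>
        (\<forall>A\<in>subdoms \<Omega> \<union> {dirichlet \<Omega>, neumann \<Omega>}. rel_interior f \<subseteq> A \<or> rel_interior f \<inter> A = {}))"


section \<open>Finite element spaces\<close>

text \<open>A discrete flux assigns to each cell a polynomial vector field, given by its extension to the
  ambient space; mortars and pressures assign to each cell the value of the piecewise constant function.
  They vanish outside of the respective meshes, and fluxes vanish on zero-dimensional cells.
  The components of all dimensions are collected in one function, which realizes the direct sums over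
  the dimension.\<close>

type_synonym 'a flux = "'a set \<Rightarrow> 'a \<Rightarrow> 'a"
type_synonym 'a mortar = "'a iface \<Rightarrow> 'a set \<Rightarrow> real"
type_synonym 'a pressure = "'a set \<Rightarrow> real"

definition RT0 :: "'a::euclidean_space set \<Rightarrow> ('a \<Rightarrow> 'a) set" where
  "RT0 T = {v. (\<exists>a b. \<forall>x. v x = a + b *\<^sub>R x) \<and> (\<forall>x\<in>T. v x \<in> tangent T)}"

text \<open>The normal component of a field in \<open>RT0 T\<close> is constant on each facet of \<open>T\<close>.\<close>

definition normal_comp :: "'a::euclidean_space set \<Rightarrow> 'a set \<Rightarrow> ('a \<Rightarrow> 'a) \<Rightarrow> real" where
  "normal_comp T f v = (THE c. \<forall>x\<in>f. v x \<bullet> outer_normal T f = c)"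

definition RT0_basis :: "'a::euclidean_space set \<Rightarrow> 'a set \<Rightarrow> 'a \<Rightarrow> 'a" where
  "RT0_basis T f = (THE v. v \<in> RT0 T \<and>
     (\<forall>g. g facet_of T \<longrightarrow> normal_comp T g v = (if g = f then 1 else 0)))"

definition lies_on :: "'a::euclidean_space set \<Rightarrow> 'a set \<Rightarrow> 'a set \<Rightarrow> 'a iface \<Rightarrow> bool" where
  "lies_on U T f g \<longleftrightarrow>
     (\<exists>S. g = (S, U, outer_normal T f) \<and> rel_interior f \<subseteq> S)"

text \<open>A piecewise \<open>RT0\<close> field has a square integrable divergence on a subdomain iff its
  normal component is continuous across the facets inside the subdomain; the outer normals of the two
  cells are opposite.\<close>

definition flux_space :: "'a::euclidean_space medium \<Rightarrow> 'a mesh \<Rightarrow> 'a flux set" where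
  "flux_space \<Omega> M = {v.
     (\<forall>T. (\<forall>S\<in>subdoms \<Omega>. 1 \<le> aff_dim S \<longrightarrow> T \<notin> cells M S) \<longrightarrow> v T = 0) \<and>
     (\<forall>S\<in>subdoms \<Omega>. 1 \<le> aff_dim S \<longrightarrow>
        (\<forall>T\<in>cells M S. v T \<in> RT0 T \<and>
           (\<forall>f. f facet_of T \<and> rel_interior f \<subseteq> neumann \<Omega> \<longrightarrow> normal_comp T f (v T) = 0)) \<and>
        (\<forall>T\<in>cells M S. \<forall>T'\<in>cells M S. \<forall>f.
           T \<noteq> T' \<and> f facet_of T \<and> f facet_of T' \<and> rel_interior f \<subseteq> S \<longrightarrow>
             normal_comp T f (v T) + normal_comp T' f (v T') = 0))}"

definition flux_space0 :: "'a::euclidean_space medium \<Rightarrow> 'a mesh \<Rightarrow> 'a flux set" where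
  "flux_space0 \<Omega> M = {v \<in> flux_space \<Omega> M.
     \<forall>S\<in>subdoms \<Omega>. \<forall>T\<in>cells M S. \<forall>f. f facet_of T \<longrightarrow>
       (\<exists>g\<in>ifaces \<Omega>. lies_on S T f g) \<longrightarrow> normal_comp T f (v T) = 0}"

definition mortar_space :: "'a::euclidean_space medium \<Rightarrow> 'a mesh \<Rightarrow> 'a mortar set" where
  "mortar_space \<Omega> M = {\<mu>. \<forall>g E. \<not> (g \<in> ifaces \<Omega> \<and> E \<in> mortar_cells M g) \<longrightarrow> \<mu> g E = 0}"

definition pressure_space :: "'a::euclidean_space medium \<Rightarrow> 'a mesh \<Rightarrow> 'a pressure set" where
  "pressure_space \<Omega> M = {q. \<forall>T. (\<forall>S\<in>subdoms \<Omega>. T \<notin> cells M S) \<longrightarrow> q T = 0}"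

definition W_space :: "'a::euclidean_space medium \<Rightarrow> 'a mesh \<Rightarrow> ('a flux \<times> 'a mortar) set" where
  "W_space \<Omega> M = flux_space0 \<Omega> M \<times> mortar_space \<Omega> M"

definition piecewise_const :: "'a::euclidean_space set set \<Rightarrow> ('a set \<Rightarrow> real) \<Rightarrow> 'a \<Rightarrow> real" where
  "piecewise_const C q x = (\<Sum>T\<in>C. q T * indicat_real (rel_interior T) x)"


section \<open>Discrete extension of mortars\<close>

definition normal_trace ::
    "'a::euclidean_space medium \<Rightarrow> 'a mesh \<Rightarrow> 'a flux \<Rightarrow> 'a iface \<Rightarrow> 'a \<Rightarrow> real" where
  "normal_trace \<Omega> M v g x =
     (if g \<in> ifaces \<Omega>
      then \<Sum>T\<in>cells M (fst (snd g)). \<Sum>f | f facet_of T \<and> lies_on (fst (snd g)) T f g.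
             normal_comp T f (v T) * indicat_real (rel_interior f) x
      else 0)"

definition mortar_fun :: "'a::euclidean_space mesh \<Rightarrow> 'a mortar \<Rightarrow> 'a iface \<Rightarrow> 'a \<Rightarrow> real" where
  "mortar_fun M \<mu> g = piecewise_const (mortar_cells M g) (\<mu> g)"

definition L2_ifaces ::
    "'a::euclidean_space medium \<Rightarrow> ('a iface \<Rightarrow> 'a \<Rightarrow> real) \<Rightarrow> ('a iface \<Rightarrow> 'a \<Rightarrow> real) \<Rightarrow> real" where
  "L2_ifaces \<Omega> \<alpha> \<beta> =
     (\<Sum>g\<in>ifaces \<Omega>. LINT x:fst g|flat_measure (fst g). \<alpha> g x * \<beta> g x)"

definition mortar_proj ::
    "'a::euclidean_space medium \<Rightarrow> 'a mesh \<Rightarrow> 'a mortar \<Rightarrow> 'a iface \<Rightarrow> 'a \<Rightarrow> real" where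
  "mortar_proj \<Omega> M \<mu> = (THE t. t \<in> normal_trace \<Omega> M ` flux_space \<Omega> M \<and>
     (\<forall>v\<in>flux_space \<Omega> M.
        L2_ifaces \<Omega> (\<lambda>g x. t g x - mortar_fun M \<mu> g x) (normal_trace \<Omega> M v) = 0))"

definition extension :: "'a::euclidean_space medium \<Rightarrow> 'a mesh \<Rightarrow> 'a mortar \<Rightarrow> 'a flux" where
  "extension \<Omega> M \<mu> = (THE v. v \<in> flux_space \<Omega> M \<and>
     normal_trace \<Omega> M v = mortar_proj \<Omega> M \<mu> \<and>
     (\<forall>S\<in>subdoms \<Omega>. \<forall>T\<in>cells M S. \<forall>f. f facet_of T \<longrightarrow>
       \<not> (\<exists>g\<in>ifaces \<Omega>. lies_on S T f g) \<longrightarrow> normal_comp T f (v T) = 0))"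


section \<open>Bilinear forms\<close>

definition flux_form ::
    "'a::euclidean_space medium \<Rightarrow> 'a mesh \<Rightarrow> 'a params \<Rightarrow> 'a flux \<Rightarrow> 'a flux \<Rightarrow> real" where
  "flux_form \<Omega> M P u v =
     (\<Sum>S\<in>subdoms \<Omega>. \<Sum>T\<in>cells M S.
        LINT x:T|flat_measure T. inv_perm P S (u T x) \<bullet> v T x)"

definition flux_form_D ::
    "'a::euclidean_space medium \<Rightarrow> 'a mesh \<Rightarrow> 'a params \<Rightarrow> 'a flux \<Rightarrow> 'a flux \<Rightarrow> real" where
  "flux_form_D \<Omega> M P u v =
     (\<Sum>S\<in>subdoms \<Omega>. \<Sum>T\<in>cells M S. \<Sum>f | f facet_of T.
        normal_comp T f (u T) * normal_comp T f (v T) *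
        (LINT x:T|flat_measure T. inv_perm P S (RT0_basis T f x) \<bullet> RT0_basis T f x))"

definition mortar_form ::
    "'a::euclidean_space medium \<Rightarrow> 'a mesh \<Rightarrow> 'a params \<Rightarrow> 'a mortar \<Rightarrow> 'a mortar \<Rightarrow> real" where
  "mortar_form \<Omega> M P \<eta> \<mu> =
     L2_ifaces \<Omega> (\<lambda>g x. gap P g / normal_perm P g * mortar_fun M \<eta> g x) (mortar_fun M \<mu>)"

definition jump :: "'a::euclidean_space medium \<Rightarrow> 'a mesh \<Rightarrow> 'a mortar \<Rightarrow> 'a set \<Rightarrow> 'a \<Rightarrow> real" where
  "jump \<Omega> M \<mu> S x = - (\<Sum>g | g \<in> ifaces \<Omega> \<and> fst g = S. mortar_fun M \<mu> g x)"

definition flux_div :: "'a::euclidean_space mesh \<Rightarrow> 'a flux \<Rightarrow> 'a set \<Rightarrow> 'a \<Rightarrow> real" where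
  "flux_div M v S x =
     (\<Sum>T\<in>cells M S. tangential_div T (v T) x * indicat_real (rel_interior T) x)"

definition mixed_div ::
    "'a::euclidean_space medium \<Rightarrow> 'a mesh \<Rightarrow> 'a flux \<times> 'a mortar \<Rightarrow> 'a set \<Rightarrow> 'a \<Rightarrow> real" where
  "mixed_div \<Omega> M = (\<lambda>(v, \<mu>) S x. flux_div M v S x + jump \<Omega> M \<mu> S x)"

definition form_a :: "'a::euclidean_space medium \<Rightarrow> 'a mesh \<Rightarrow> 'a params \<Rightarrow>
    'a flux \<times> 'a mortar \<Rightarrow> 'a flux \<times> 'a mortar \<Rightarrow> real" where
  "form_a \<Omega> M P = (\<lambda>(u, \<eta>) (v, \<mu>).
     flux_form \<Omega> M P (u + extension \<Omega> M \<eta>) (v + extension \<Omega> M \<mu>) + mortar_form \<Omega> M P \<eta> \<mu>)"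

definition form_aD :: "'a::euclidean_space medium \<Rightarrow> 'a mesh \<Rightarrow> 'a params \<Rightarrow>
    'a flux \<times> 'a mortar \<Rightarrow> 'a flux \<times> 'a mortar \<Rightarrow> real" where
  "form_aD \<Omega> M P = (\<lambda>(u, \<eta>) (v, \<mu>).
     flux_form_D \<Omega> M P (u + extension \<Omega> M \<eta>) (v + extension \<Omega> M \<mu>) + mortar_form \<Omega> M P \<eta> \<mu>)"

definition form_b ::
    "'a::euclidean_space medium \<Rightarrow> 'a mesh \<Rightarrow> 'a flux \<times> 'a mortar \<Rightarrow> 'a pressure \<Rightarrow> real" where
  "form_b \<Omega> M = (\<lambda>(v, \<mu>) q.
     - (\<Sum>S\<in>subdoms \<Omega>. LINT x:S|flat_measure S.
          piecewise_const (cells M S) q x * mixed_div \<Omega> M (v + extension \<Omega> M \<mu>, \<mu>) S x))"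


section \<open>Operators\<close>

text \<open>The dual of the product space is identified with the product of the duals.\<close>

type_synonym 'a W_dual = "'a flux \<times> 'a mortar \<Rightarrow> real"
type_synonym 'a Q_dual = "'a pressure \<Rightarrow> real"
type_synonym 'a X = "('a flux \<times> 'a mortar) \<times> 'a pressure"
type_synonym 'a X_dual = "'a W_dual \<times> 'a Q_dual"

definition X_space :: "'a::euclidean_space medium \<Rightarrow> 'a mesh \<Rightarrow> 'a X set" where
  "X_space \<Omega> M = W_space \<Omega> M \<times> pressure_space \<Omega> M"

definition X_dual_space :: "'a::euclidean_space medium \<Rightarrow> 'a mesh \<Rightarrow> 'a X_dual set" where
  "X_dual_space \<Omega> M = dual (W_space \<Omega> M) \<times> dual (pressure_space \<Omega> M)"

definition pairing :: "'a X_dual \<Rightarrow> 'a X \<Rightarrow> real" where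
  "pairing = (\<lambda>(f, g) (r, q). f r + g q)"

definition op_A :: "'a::euclidean_space medium \<Rightarrow> 'a mesh \<Rightarrow> 'a params \<Rightarrow> 'a flux \<times> 'a mortar \<Rightarrow> 'a W_dual"
  where "op_A \<Omega> M P w = restrict (form_a \<Omega> M P w) (W_space \<Omega> M)"

definition op_DA :: "'a::euclidean_space medium \<Rightarrow> 'a mesh \<Rightarrow> 'a params \<Rightarrow> 'a flux \<times> 'a mortar \<Rightarrow> 'a W_dual"
  where "op_DA \<Omega> M P w = restrict (form_aD \<Omega> M P w) (W_space \<Omega> M)"

definition op_B :: "'a::euclidean_space medium \<Rightarrow> 'a mesh \<Rightarrow> 'a flux \<times> 'a mortar \<Rightarrow> 'a Q_dual"
  where "op_B \<Omega> M w = restrict (form_b \<Omega> M w) (pressure_space \<Omega> M)"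

definition op_BT :: "'a::euclidean_space medium \<Rightarrow> 'a mesh \<Rightarrow> 'a pressure \<Rightarrow> 'a W_dual"
  where "op_BT \<Omega> M p = restrict (\<lambda>r. form_b \<Omega> M r p) (W_space \<Omega> M)"

text \<open>The approximate Schur complement \<open>B D\<^sub>A\<^sup>-\<^sup>1 B\<^sup>T\<close>.\<close>

definition op_S :: "'a::euclidean_space medium \<Rightarrow> 'a mesh \<Rightarrow> 'a params \<Rightarrow> 'a pressure \<Rightarrow> 'a Q_dual"
  where "op_S \<Omega> M P p = op_B \<Omega> M (inv_into (W_space \<Omega> M) (op_DA \<Omega> M P) (op_BT \<Omega> M p))"

definition block_op :: "'a::euclidean_space medium \<Rightarrow> 'a mesh \<Rightarrow>
    ('a flux \<times> 'a mortar \<Rightarrow> 'a W_dual) \<Rightarrow> ('a pressure \<Rightarrow> 'a W_dual) \<Rightarrow>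
    ('a flux \<times> 'a mortar \<Rightarrow> 'a Q_dual) \<Rightarrow> ('a pressure \<Rightarrow> 'a Q_dual) \<Rightarrow> 'a X \<Rightarrow> 'a X_dual" where
  "block_op \<Omega> M F\<^sub>1\<^sub>1 F\<^sub>1\<^sub>2 F\<^sub>2\<^sub>1 F\<^sub>2\<^sub>2 = (\<lambda>(w, p).
     (restrict (F\<^sub>1\<^sub>1 w + F\<^sub>1\<^sub>2 p) (W_space \<Omega> M), restrict (F\<^sub>2\<^sub>1 w + F\<^sub>2\<^sub>2 p) (pressure_space \<Omega> M)))"

definition calA :: "'a::euclidean_space medium \<Rightarrow> 'a mesh \<Rightarrow> 'a params \<Rightarrow> 'a X \<Rightarrow> 'a X_dual" where
  "calA \<Omega> M P = block_op \<Omega> M (op_A \<Omega> M P) (op_BT \<Omega> M) (- op_B \<Omega> M) 0"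

definition precond_L :: "'a::euclidean_space medium \<Rightarrow> 'a mesh \<Rightarrow> 'a params \<Rightarrow> 'a X_dual \<Rightarrow> 'a X" where
  "precond_L \<Omega> M P = inv_into (X_space \<Omega> M)
     (block_op \<Omega> M (op_A \<Omega> M P) 0 (- op_B \<Omega> M) (op_S \<Omega> M P))"

definition precond_D :: "'a::euclidean_space medium \<Rightarrow> 'a mesh \<Rightarrow> 'a params \<Rightarrow> 'a X_dual \<Rightarrow> 'a X" where
  "precond_D \<Omega> M P = inv_into (X_space \<Omega> M)
     (block_op \<Omega> M (op_A \<Omega> M P) 0 0 (op_S \<Omega> M P))"

definition inner_inv :: "'a::euclidean_space medium \<Rightarrow> 'a mesh \<Rightarrow> ('a X_dual \<Rightarrow> 'a X) \<Rightarrow> 'a X \<Rightarrow> 'a X \<Rightarrow> real"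
  where "inner_inv \<Omega> M F x y = pairing (inv_into (X_dual_space \<Omega> M) F x) y"

definition norm_inv :: "'a::euclidean_space medium \<Rightarrow> 'a mesh \<Rightarrow> ('a X_dual \<Rightarrow> 'a X) \<Rightarrow> 'a X \<Rightarrow> real"
  where "norm_inv \<Omega> M F x = sqrt (inner_inv \<Omega> M F x x)"

end

theory Submission
  imports Defs
begin

text \<open>Write \<open>a\<close> and \<open>d\<close> for the forms of \<open>A\<close> and \<open>D\<^sub>A\<close>. With \<open>z = A\<^sup>-\<^sup>1 B\<^sup>T p\<close>, the preconditioned
  operator maps \<open>(w, p)\<close> to \<open>(w + z, p')\<close>, where \<open>p'\<close> is determined by \<open>s(p', q) = b(z, q)\<close> for the
  form \<open>s\<close> of \<open>B D\<^sub>A\<^sup>-\<^sup>1 B\<^sup>T\<close>. Hence both bounds follow from the equivalence of \<open>a\<close> and \<open>d\<close>. That \<open>a\<close> is at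
  most \<open>n + 1\<close> times \<open>d\<close> is the Cauchy--Schwarz inequality for the sum over the facets of a cell; the
  converse bound compares the size of a Raviart--Thomas field with its facet fluxes on a
  shape-regular cell. For \<open>s\<close> to be definite, \<open>B\<^sup>T\<close> has to be injective: a pressure in its kernel
  has no jumps across facets or interfaces, hence is constant along generic segments, which avoid
  the sets of codimension two, and it vanishes at a Dirichlet facet.\<close>

section \<open>Saddle point problems in finite-dimensional spaces\<close>

text \<open>No inf-sup constant enters. B D_A^{-1} B^T and the exact Schur complement B A^{-1} B^T
  pull back the dual quadratic forms of d and a along B^T, so they are equivalent with the same two
  constants as a and d; injectivity of B^T only makes them definite. With a \<le> \<alpha> d and d
  \<le> \<beta> a, the lower bound is 1 / (2 \<alpha>) and involves \<alpha> alone, while the upper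
  bound is governed by \<beta>. As \<alpha> = n + 1 is a facet count, the lower constant is free of
  shape regularity and anisotropy; \<beta> carries both. The size of the permeability cancels cell
  by cell, and the mortar term is shared by a and d. What shapes the rest is that the objects are
  specified rather than computed: \<open>flat_measure\<close> through a chosen frame; normals, basis
  functions, projection and extension through \<open>THE\<close>; operators through
  \<open>inv_into\<close>. Each is first identified with a closed formula. Since the mortar meshes
  need not match the facets, the extension becomes a mean over each facet, and b a finite sum of
  facet fluxes and overlaps.\<close>

locale spd_form =
  fixes V :: "'v::real_vector set" and a :: "'v \<Rightarrow> 'v \<Rightarrow> real"
  assumes subspace: "subspace V"
    and finite_dim: "\<exists>F. finite F \<and> V \<subseteq> span F"
    and add_left: "\<lbrakk>x \<in> V; y \<in> V; z \<in> V\<rbrakk> \<Longrightarrow> a (x + y) z = a x z + a y z"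
    and scale_left: "\<lbrakk>x \<in> V; z \<in> V\<rbrakk> \<Longrightarrow> a (c *\<^sub>R x) z = c * a x z"
    and sym: "\<lbrakk>x \<in> V; y \<in> V\<rbrakk> \<Longrightarrow> a x y = a y x"
    and pos: "\<lbrakk>x \<in> V; x \<noteq> 0\<rbrakk> \<Longrightarrow> 0 < a x x"
begin

lemma closed:
  shows add_closed: "\<lbrakk>x \<in> V; y \<in> V\<rbrakk> \<Longrightarrow> x + y \<in> V"
    and scale_closed: "x \<in> V \<Longrightarrow> c *\<^sub>R x \<in> V"
    and zero_closed: "0 \<in> V"
    and diff_closed: "\<lbrakk>x \<in> V; y \<in> V\<rbrakk> \<Longrightarrow> x - y \<in> V"
  using subspace by (auto simp: subspace_add subspace_scale subspace_0 subspace_diff)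

lemma add_right: "\<lbrakk>x \<in> V; y \<in> V; z \<in> V\<rbrakk> \<Longrightarrow> a z (x + y) = a z x + a z y"
  by (metis add_closed add_left sym)

lemma scale_right: "\<lbrakk>x \<in> V; z \<in> V\<rbrakk> \<Longrightarrow> a z (c *\<^sub>R x) = c * a z x"
  by (metis scale_closed scale_left sym)

lemma zero_left: "z \<in> V \<Longrightarrow> a 0 z = 0"
  using scale_left[of z z 0] by simp

lemma zero_right: "z \<in> V \<Longrightarrow> a z 0 = 0"
  using scale_right[of z z 0] by simp

lemma diff_left: "\<lbrakk>x \<in> V; y \<in> V; z \<in> V\<rbrakk> \<Longrightarrow> a (x - y) z = a x z - a y z"
  using add_left[of x "(-1) *\<^sub>R y" z] scale_left[of y z "-1"] scale_closed[of y "-1"] by simp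

lemma diff_right: "\<lbrakk>x \<in> V; y \<in> V; z \<in> V\<rbrakk> \<Longrightarrow> a z (x - y) = a z x - a z y"
  by (metis diff_closed diff_left sym)

lemma nonneg: "x \<in> V \<Longrightarrow> 0 \<le> a x x"
  by (metis less_eq_real_def pos zero_left)

lemma eq_zero: "\<lbrakk>x \<in> V; a x x \<le> 0\<rbrakk> \<Longrightarrow> x = 0"
  using pos by fastforce

lemma Cauchy_Schwarz:
  assumes "x \<in> V" "y \<in> V"
  shows "(a x y)\<^sup>2 \<le> a x x * a y y"
proof (cases "y = 0")
  case False
  with assms have p: "0 < a y y" by (simp add: pos)
  define t where "t = a x y / a y y"
  have "0 \<le> a (x - t *\<^sub>R y) (x - t *\<^sub>R y)"
    by (intro nonneg diff_closed scale_closed assms)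
  also have "\<dots> = a x x - 2 * t * a x y + t\<^sup>2 * a y y"
    using assms by (simp add: diff_left diff_right scale_left scale_right scale_closed diff_closed
        sym[of y x] algebra_simps power2_eq_square)
  also have "\<dots> = a x x - (a x y)\<^sup>2 / a y y"
    using p by (simp add: t_def power2_eq_square field_simps)
  finally show ?thesis using p by (simp add: field_simps)
qed (use assms in \<open>simp add: zero_right\<close>)

text \<open>One Gram--Schmidt step per vector: the new vector is split into its representer x0 in
  the old span and an a-orthogonal remainder y. Adding a multiple of y to the old representer leaves
  its values on the old span unchanged and corrects the value at y.\<close>

lemma riesz_on_span:
  assumes "finite F" "F \<subseteq> V"
    and f: "\<And>x y. \<lbrakk>x \<in> V; y \<in> V\<rbrakk> \<Longrightarrow> f (x + y) = f x + f y" "\<And>c x. x \<in> V \<Longrightarrow> f (c *\<^sub>R x) = c * f x"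
  shows "\<exists>w\<in>span F. \<forall>v\<in>span F. a w v = f v"
  using assms(1,2) f
proof (induction F arbitrary: f rule: finite_induct)
  case empty
  have "f 0 = 0" using empty(3)[OF zero_closed, of 0] by simp
  then show ?case by (simp add: zero_left zero_closed)
next
  case (insert x F)
  have x: "x \<in> V" and FV: "span F \<subseteq> V"
    using insert.prems(1) span_minimal[of F V] subspace by auto
  obtain w where w: "w \<in> span F" "\<And>v. v \<in> span F \<Longrightarrow> a w v = f v"
    using insert.IH[of f] insert.prems by auto
  obtain x0 where x0: "x0 \<in> span F" "\<And>v. v \<in> span F \<Longrightarrow> a x0 v = a x v"
    using insert.IH[of "a x"] insert.prems x by (auto simp: add_right scale_right)
  define y where "y = x - x0"
  have yV: "y \<in> V" and wV: "w \<in> V" using x x0 w FV by (auto simp: y_def intro: diff_closed)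
  have orth: "a y v = 0" if "v \<in> span F" for v
    using that x x0 FV by (auto simp: y_def diff_left subset_iff)
  \<comment> \<open>If y = 0, the new vector already lies in the old span; the value 0 keeps
    \<open>ty\<close> true, since both sides vanish.\<close>
  define t where "t = (if y = 0 then 0 else (f y - a w y) / a y y)"
  have ty: "t * a y y = f y - a w y"
  proof (cases "y = 0")
    case True
    have "f 0 = 0" using insert.prems(3)[OF zero_closed, of 0] by simp
    then show ?thesis using True wV by (simp add: zero_right t_def)
  next
    case False
    then have "0 < a y y" using pos yV by blast
    then show ?thesis using False by (simp add: t_def)
  qed
  have yi: "y \<in> span (insert x F)"
    unfolding y_def using x0(1) span_mono[of F "insert x F"] by (intro span_diff) (auto intro: span_base)
  show ?case
  proof (intro bexI[of _ "w + t *\<^sub>R y"] ballI)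
    show "w + t *\<^sub>R y \<in> span (insert x F)"
      using w(1) span_mono[of F "insert x F"] yi by (intro span_add span_scale) auto
    fix v assume "v \<in> span (insert x F)"
    then obtain k where k: "v - k *\<^sub>R x \<in> span F" by (auto simp: span_breakdown_eq)
    define u where "u = v - k *\<^sub>R y"
    have u: "u \<in> span F"
      using span_add[OF k span_scale[OF x0(1), of k]] by (simp add: u_def y_def algebra_simps)
    have uV: "u \<in> V" using u FV by auto
    have v: "v = u + k *\<^sub>R y" by (simp add: u_def)
    have "a (w + t *\<^sub>R y) v = a w u + k * (a w y + t * a y y)"
      unfolding v using uV yV wV orth[OF u] sym[OF yV uV]
      by (simp add: add_left add_right scale_left scale_right scale_closed add_closed algebra_simps)
    also have "\<dots> = f v"
      unfolding v ty using uV yV w(2)[OF u] insert.prems by (simp add: scale_closed)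
    finally show "a (w + t *\<^sub>R y) v = f v" .
  qed
qed

lemma riesz_ex:
  assumes f: "\<And>x y. \<lbrakk>x \<in> V; y \<in> V\<rbrakk> \<Longrightarrow> f (x + y) = f x + f y" "\<And>c x. x \<in> V \<Longrightarrow> f (c *\<^sub>R x) = c * f x"
  shows "\<exists>w\<in>V. \<forall>v\<in>V. a w v = f v"
proof -
  obtain F where F: "finite F" "V \<subseteq> span F" using finite_dim by auto
  obtain B where B: "B \<subseteq> V" "independent B" "V \<subseteq> span B" by (rule maximal_independent_subset)
  have "finite B" using independent_span_bound[OF F(1) B(2)] B(1) F(2) by auto
  moreover have "span B = V" using B subspace by (simp add: span_minimal subset_antisym)
  ultimately show ?thesis using riesz_on_span[of B f] B(1) f by auto
qed

definition riesz :: "'v \<Rightarrow> 'v \<Rightarrow> real" where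
  "riesz w = restrict (a w) V"

lemma riesz_in_dual: "w \<in> V \<Longrightarrow> riesz w \<in> dual V"
  by (auto simp: riesz_def dual_def add_right scale_right add_closed scale_closed)

lemma riesz_inj: "inj_on riesz V"
proof (rule inj_onI)
  fix x y assume xy: "x \<in> V" "y \<in> V" and eq: "riesz x = riesz y"
  have "a x (x - y) = a y (x - y)"
    using fun_cong[OF eq, of "x - y"] xy by (simp add: riesz_def diff_closed)
  then have "a (x - y) (x - y) = 0" using xy by (simp add: diff_left diff_closed)
  then show "x = y" using eq_zero[of "x - y"] xy by (simp add: diff_closed)
qed

lemma riesz_bij: "bij_betw riesz V (dual V)"
proof (rule bij_betw_imageI[OF riesz_inj], intro subset_antisym subsetI)
  fix f assume f: "f \<in> dual V"
  obtain w where w: "w \<in> V" "\<forall>v\<in>V. a w v = f v"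
    using riesz_ex[of f] f by (auto simp: dual_def)
  have "riesz w = f" using w f by (auto simp: riesz_def dual_def restrict_def extensional_def)
  then show "f \<in> riesz ` V" using w by auto
qed (auto intro: riesz_in_dual)

lemma riesz_inv:
  assumes "f \<in> dual V"
  shows "inv_into V riesz f \<in> V" and "v \<in> V \<Longrightarrow> a (inv_into V riesz f) v = f v"
proof -
  have im: "f \<in> riesz ` V" using assms riesz_bij by (simp add: bij_betw_def)
  show "inv_into V riesz f \<in> V" using im by (rule inv_into_into)
  show "a (inv_into V riesz f) v = f v" if "v \<in> V"
    using fun_cong[OF f_inv_into_f[OF im], of v] that by (simp add: riesz_def)
qed

end

text \<open>\<open>d\<close> is the form of the preconditioner of \<open>a\<close>, and \<open>s\<close> is that of the resulting approximate Schur
  complement.\<close>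

locale saddle_point = A: spd_form W a + D: spd_form W d
  for W :: "'w::real_vector set" and a d :: "'w \<Rightarrow> 'w \<Rightarrow> real" +
  fixes Q :: "'q::real_vector set" and b :: "'w \<Rightarrow> 'q \<Rightarrow> real" and \<alpha> \<beta> :: real
  assumes Q_subspace: "subspace Q"
    and Q_finite_dim: "\<exists>F. finite F \<and> Q \<subseteq> span F"
    and b_add_left: "\<lbrakk>x \<in> W; y \<in> W; q \<in> Q\<rbrakk> \<Longrightarrow> b (x + y) q = b x q + b y q"
    and b_scale_left: "\<lbrakk>x \<in> W; q \<in> Q\<rbrakk> \<Longrightarrow> b (c *\<^sub>R x) q = c * b x q"
    and b_add_right: "\<lbrakk>x \<in> W; p \<in> Q; q \<in> Q\<rbrakk> \<Longrightarrow> b x (p + q) = b x p + b x q"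
    and b_scale_right: "\<lbrakk>x \<in> W; q \<in> Q\<rbrakk> \<Longrightarrow> b x (c *\<^sub>R q) = c * b x q"
    and b_nondegenerate: "\<lbrakk>q \<in> Q; \<forall>x\<in>W. b x q = 0\<rbrakk> \<Longrightarrow> q = 0"
    and a_le: "w \<in> W \<Longrightarrow> a w w \<le> \<alpha> * d w w"
    and d_le: "w \<in> W \<Longrightarrow> d w w \<le> \<beta> * a w w"
    and \<alpha>: "1 \<le> \<alpha>" and \<beta>: "1 \<le> \<beta>"
begin

definition BT :: "'q \<Rightarrow> 'w \<Rightarrow> real" where "BT p = restrict (\<lambda>r. b r p) W"

text \<open>The vector D^{-1} B^T p; \<open>lift_a\<close> is A^{-1} B^T p. Thus \<open>s\<close>
  below is the form of B D^{-1} B^T, and \<open>a (lift_a p) (lift_a p)\<close> is the quadratic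
  form of the exact Schur complement B A^{-1} B^T.\<close>

definition lift_d :: "'q \<Rightarrow> 'w" where "lift_d p = inv_into W D.riesz (BT p)"

definition lift_a :: "'q \<Rightarrow> 'w" where "lift_a p = inv_into W A.riesz (BT p)"

definition s :: "'q \<Rightarrow> 'q \<Rightarrow> real" where "s p q = b (lift_d p) q"

lemma BT_dual: "p \<in> Q \<Longrightarrow> BT p \<in> dual W"
  by (auto simp: BT_def dual_def A.add_closed A.scale_closed b_add_left b_scale_left)

lemma lift_d: "p \<in> Q \<Longrightarrow> lift_d p \<in> W" "\<lbrakk>p \<in> Q; r \<in> W\<rbrakk> \<Longrightarrow> d (lift_d p) r = b r p"
  using D.riesz_inv[OF BT_dual, of p] by (auto simp: lift_d_def BT_def)

lemma lift_a: "p \<in> Q \<Longrightarrow> lift_a p \<in> W" "\<lbrakk>p \<in> Q; r \<in> W\<rbrakk> \<Longrightarrow> a (lift_a p) r = b r p"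
  using A.riesz_inv[OF BT_dual, of p] by (auto simp: lift_a_def BT_def)

lemma s_eq: "\<lbrakk>p \<in> Q; q \<in> Q\<rbrakk> \<Longrightarrow> s p q = d (lift_d p) (lift_d q)"
  using lift_d by (simp add: s_def D.sym)

sublocale S: spd_form Q s
proof
  note Qc = subspace_add[OF Q_subspace] subspace_scale[OF Q_subspace]
  fix p q r :: 'q and c :: real assume p: "p \<in> Q"
  show "s (c *\<^sub>R p) q = c * s p q" if "q \<in> Q"
    using p that by (simp add: s_eq Qc D.sym[of "lift_d _" "lift_d q"] lift_d b_scale_right)
  show "s p q = s q p" if "q \<in> Q"
    using p that by (simp add: s_eq D.sym lift_d)
  show "s (p + q) r = s p r + s q r" if "q \<in> Q" "r \<in> Q"
    using p that by (simp add: s_eq Qc D.sym[of "lift_d _" "lift_d r"] lift_d b_add_right)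
  show "0 < s p p" if "p \<noteq> 0"
  proof (rule ccontr)
    assume "\<not> 0 < s p p"
    then have "lift_d p = 0" using p by (intro D.eq_zero) (auto simp: s_eq lift_d)
    then have "\<forall>x\<in>W. b x p = 0" using lift_d(2)[OF p] by (simp add: D.zero_left)
    with p that show False using b_nondegenerate by auto
  qed
qed (use Q_subspace Q_finite_dim in auto)

text \<open>Both lifts represent the same functional, so s p p = b (lift_d p) p = a (lift_a p)
  (lift_d p). Cauchy--Schwarz in a leaves the factor a (lift_d p) (lift_d p), which is at most
  \<alpha> s p p and is divided out.\<close>

lemma s_le: assumes p: "p \<in> Q" shows "s p p \<le> \<alpha> * a (lift_a p) (lift_a p)"
proof -
  note W = lift_d[OF p] lift_a[OF p]
  have "(s p p)\<^sup>2 = (a (lift_a p) (lift_d p))\<^sup>2" using W by (simp add: s_def)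
  also have "\<dots> \<le> a (lift_a p) (lift_a p) * a (lift_d p) (lift_d p)"
    using W by (intro A.Cauchy_Schwarz)
  also have "\<dots> \<le> a (lift_a p) (lift_a p) * (\<alpha> * s p p)"
    unfolding s_eq[OF p p] using W by (intro mult_left_mono a_le A.nonneg)
  finally have "s p p * s p p \<le> s p p * (\<alpha> * a (lift_a p) (lift_a p))"
    by (simp add: power2_eq_square mult_ac)
  then show ?thesis
    using S.nonneg[OF p] A.nonneg[OF W(3)] \<alpha> by (cases "s p p = 0") auto
qed

text \<open>The mirror image of \<open>s_le\<close>: the functional is represented through d and
  Cauchy--Schwarz is applied in d, so that the other half of the equivalence enters.\<close>

lemma lift_a_le: assumes p: "p \<in> Q" shows "a (lift_a p) (lift_a p) \<le> \<beta> * s p p"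
proof -
  note W = lift_d[OF p] lift_a[OF p]
  let ?z = "lift_a p"
  have "(a ?z ?z)\<^sup>2 = (d (lift_d p) ?z)\<^sup>2" using W by simp
  also have "\<dots> \<le> s p p * d ?z ?z"
    unfolding s_eq[OF p p] using W by (intro D.Cauchy_Schwarz)
  also have "\<dots> \<le> s p p * (\<beta> * a ?z ?z)"
    using W p by (intro mult_left_mono d_le S.nonneg)
  finally have "a ?z ?z * a ?z ?z \<le> a ?z ?z * (\<beta> * s p p)"
    by (simp add: power2_eq_square mult_ac)
  then show ?thesis
    using A.nonneg[OF W(3)] S.nonneg[OF p] \<beta> by (cases "a ?z ?z = 0") auto
qed

definition block_L :: "'w \<times> 'q \<Rightarrow> ('w \<Rightarrow> real) \<times> ('q \<Rightarrow> real)" where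
  "block_L = (\<lambda>(w, p). (A.riesz w, restrict (\<lambda>q. s p q - b w q) Q))"

definition block_D :: "'w \<times> 'q \<Rightarrow> ('w \<Rightarrow> real) \<times> ('q \<Rightarrow> real)" where
  "block_D = (\<lambda>(w, p). (A.riesz w, S.riesz p))"

definition block_A :: "'w \<times> 'q \<Rightarrow> ('w \<Rightarrow> real) \<times> ('q \<Rightarrow> real)" where
  "block_A = (\<lambda>(w, p). (restrict (\<lambda>r. a w r + b r p) W, restrict (\<lambda>q. - b w q) Q))"

text \<open>The inner product of the theorem inverts \<open>precond_D\<close>, which is itself an
  \<open>inv_into\<close>. Bijectivity onto the dual makes the double inverse collapse to
  \<open>block_D\<close>, whose pairing is \<open>inner_D\<close>.\<close>

lemma block_D_bij: "bij_betw block_D (W \<times> Q) (dual W \<times> dual Q)"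
  using map_prod_inj_on[OF A.riesz_inj S.riesz_inj] map_prod_surj_on[of A.riesz W "dual W" S.riesz Q "dual Q"]
    A.riesz_bij S.riesz_bij
  by (simp add: block_D_def map_prod_def bij_betw_def)

definition inner_D :: "'w \<times> 'q \<Rightarrow> 'w \<times> 'q \<Rightarrow> real" where
  "inner_D = (\<lambda>(w, p) (r, q). a w r + s p q)"

text \<open>Forward substitution in a block triangular system. An explicit preimage is exhibited
  first, because \<open>inv_into\<close> inverts only on the range of \<open>block_L\<close>; the
  two rows are then read off the preimage that it picks.\<close>

lemma precond_L_block_A:
  assumes "w \<in> W" "p \<in> Q"
  obtains w' p' where "inv_into (W \<times> Q) block_L (block_A (w, p)) = (w', p')" "w' \<in> W" "p' \<in> Q"
    "w' = w + lift_a p" "\<And>q. q \<in> Q \<Longrightarrow> s p' q = b (lift_a p) q"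
proof -
  have za: "lift_a p \<in> W" using assms lift_a by simp
  obtain p0 where p0: "p0 \<in> Q" "\<And>q. q \<in> Q \<Longrightarrow> s p0 q = b (lift_a p) q"
    using S.riesz_ex[of "b (lift_a p)"] za by (auto simp: b_add_right b_scale_right)
  have "block_L (w + lift_a p, p0) = block_A (w, p)"
    using assms za p0
    by (auto simp: block_L_def block_A_def A.riesz_def A.add_left lift_a b_add_left fun_eq_iff restrict_def)
  then have im: "block_A (w, p) \<in> block_L ` (W \<times> Q)"
    using assms za p0 A.add_closed by (intro image_eqI[of _ _ "(w + lift_a p, p0)"]) auto
  obtain w' p' where y: "inv_into (W \<times> Q) block_L (block_A (w, p)) = (w', p')" by fastforce
  have W: "w' \<in> W" "p' \<in> Q" using inv_into_into[OF im] y by auto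
  have eq: "block_L (w', p') = block_A (w, p)" using f_inv_into_f[OF im] y by simp
  then have "A.riesz w' = A.riesz (w + lift_a p)"
    using assms za by (auto simp: block_L_def block_A_def A.riesz_def A.add_left lift_a fun_eq_iff restrict_def)
  then have w': "w' = w + lift_a p"
    using A.riesz_inj W assms za A.add_closed by (auto simp: inj_on_def)
  have "s p' q = b (lift_a p) q" if "q \<in> Q" for q
  proof -
    have "s p' q - b w' q = - b w q"
      using eq that by (auto simp: block_L_def block_A_def fun_eq_iff restrict_def split: if_splits)
    then show ?thesis using that assms za by (simp add: w' b_add_left)
  qed
  then show thesis using that y W w' by blast
qed

text \<open>Positivity of a at w + z gives a w z \<ge> - (a w w + a z z) / 2, which costs the factor
  2 below; s p p \<le> \<alpha> a z z and 1 \<le> \<alpha> account for \<alpha>. Above, positivity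
  at w - z gives a (w + z) (w + z) \<le> 2 a w w + 2 a z z, the bound a z z \<le> \<beta> s p p
  gives 2 \<beta>, and the pressure part gives the square of \<beta>.\<close>

theorem precond_L_bounds:
  assumes "w \<in> W" "p \<in> Q"
  defines "y \<equiv> inv_into (W \<times> Q) block_L (block_A (w, p))"
  shows "inner_D (w, p) (w, p) / (2 * \<alpha>) \<le> inner_D y (w, p)"
    and "inner_D y y \<le> (2 + 2 * \<beta> + \<beta>\<^sup>2) * inner_D (w, p) (w, p)"
    and "y \<in> W \<times> Q"
proof -
  define z where "z = lift_a p"
  have z: "z \<in> W" "\<And>r. r \<in> W \<Longrightarrow> a z r = b r p" using assms lift_a by (auto simp: z_def)
  obtain w' p' where y: "y = (w', p')" "w' \<in> W" "p' \<in> Q" "w' = w + z"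
    and p': "\<And>q. q \<in> Q \<Longrightarrow> s p' q = b z q"
    by (rule precond_L_block_A[OF assms(1,2)]) (simp add: y_def z_def)
  show "y \<in> W \<times> Q" using y by simp
  have sz: "s p p \<le> \<alpha> * a z z" "a z z \<le> \<beta> * s p p"
    unfolding z_def by (fact s_le[OF assms(2)], fact lift_a_le[OF assms(2)])
  have nn: "0 \<le> a w w" "0 \<le> a z z" "0 \<le> s p p" "0 \<le> a (w - z) (w - z)" "0 \<le> a (w + z) (w + z)"
    using assms(1,2) z(1) by (auto intro!: A.nonneg S.nonneg A.diff_closed A.add_closed)
  have zw: "a z w = a w z" using assms(1) z(1) by (simp add: A.sym)
  have exp: "a (w + z) (w + z) = a w w + 2 * a w z + a z z" "a (w - z) (w - z) = a w w - 2 * a w z + a z z"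
    using assms(1) z(1) zw by (auto simp: A.add_left A.add_right A.diff_left A.diff_right A.add_closed A.diff_closed)
  \<comment> \<open>The pressure component contributes s p' p = b z p = a z z, so the indefinite
    coupling disappears from the numerator.\<close>
  have num: "inner_D y (w, p) = a w w + a w z + a z z"
    using assms(1,2) z zw by (simp add: y inner_D_def A.add_left p')
  have "inner_D (w, p) (w, p) \<le> \<alpha> * a w w + \<alpha> * a z z"
    using sz nn \<alpha> mult_right_mono[of 1 \<alpha> "a w w"] by (simp add: inner_D_def)
  also have "\<dots> \<le> \<alpha> * (2 * inner_D y (w, p))"
    unfolding distrib_left[symmetric] using nn exp \<alpha> by (intro mult_left_mono) (auto simp: num)
  finally show "inner_D (w, p) (w, p) / (2 * \<alpha>) \<le> inner_D y (w, p)"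
    using \<alpha> by (simp add: field_simps)
  \<comment> \<open>Since s p' p' = b z p' = d (lift_d p') z, Cauchy--Schwarz in d shows that p' is
    no larger in s than z is in d. The two following factors \<beta> lead from d to a and from a z z
    back to s p p.\<close>
  have "(s p' p')\<^sup>2 = (d (lift_d p') z)\<^sup>2" using y z by (simp add: p' lift_d)
  also have "\<dots> \<le> s p' p' * d z z"
    unfolding s_eq[OF y(3) y(3)] using y z lift_d by (intro D.Cauchy_Schwarz)
  finally have "s p' p' * s p' p' \<le> s p' p' * d z z" by (simp add: power2_eq_square)
  then have "s p' p' \<le> d z z"
    using S.nonneg[OF y(3)] D.nonneg[OF z(1)] by (cases "s p' p' = 0") auto
  also have "\<dots> \<le> \<beta> * a z z" by (rule d_le[OF z(1)])
  also have "\<dots> \<le> \<beta> * (\<beta> * s p p)" using sz \<beta> by (intro mult_left_mono) auto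
  finally have s': "s p' p' \<le> \<beta>\<^sup>2 * s p p" by (simp add: power2_eq_square)
  have "inner_D y y \<le> 2 * a w w + 2 * a z z + \<beta>\<^sup>2 * s p p"
    using s' nn exp by (simp add: y inner_D_def)
  also have "\<dots> \<le> 2 * a w w + 2 * (\<beta> * s p p) + \<beta>\<^sup>2 * s p p" using sz by simp
  also have "\<dots> \<le> (2 + 2 * \<beta> + \<beta>\<^sup>2) * (a w w + s p p)"
    using nn \<beta> by (simp add: algebra_simps)
  finally show "inner_D y y \<le> (2 + 2 * \<beta> + \<beta>\<^sup>2) * inner_D (w, p) (w, p)"
    by (simp add: inner_D_def)
qed

end

section \<open>Flat measures\<close>

definition orthonormal :: "'a::euclidean_space set \<Rightarrow> bool" where
  "orthonormal B \<longleftrightarrow> pairwise orthogonal B \<and> (\<forall>b\<in>B. norm b = 1)"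

lemma orthonormal_inner: "\<lbrakk>orthonormal B; b \<in> B; c \<in> B\<rbrakk> \<Longrightarrow> b \<bullet> c = (if b = c then 1 else 0)"
  by (auto simp: orthonormal_def pairwise_def orthogonal_def norm_eq_1)

lemma orthonormal_independent: "orthonormal B \<Longrightarrow> independent B"
  by (rule pairwise_orthogonal_independent) (auto simp: orthonormal_def)

lemma orthonormal_finite: "orthonormal B \<Longrightarrow> finite B"
  using orthonormal_independent independent_imp_finite by auto

lemma orthonormal_subset: "\<lbrakk>orthonormal B; C \<subseteq> B\<rbrakk> \<Longrightarrow> orthonormal C"
  by (auto simp: orthonormal_def pairwise_def)

lemma orthonormal_sum_inner:
  assumes "orthonormal B" "b \<in> B"
  shows "(\<Sum>e\<in>B. c e *\<^sub>R e) \<bullet> b = c b"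
proof -
  have "(\<Sum>e\<in>B. c e *\<^sub>R e) \<bullet> b = (\<Sum>e\<in>B. if e = b then c e else 0)"
    unfolding inner_sum_left using assms by (intro sum.cong) (auto simp: orthonormal_inner)
  then show ?thesis using assms(2) orthonormal_finite[OF assms(1)] by simp
qed

lemma orthonormal_expand:
  assumes "orthonormal B" "x \<in> span B"
  shows "x = (\<Sum>e\<in>B. (x \<bullet> e) *\<^sub>R e)"
proof -
  obtain c where "x = (\<Sum>e\<in>B. c e *\<^sub>R e)"
    using assms orthonormal_finite span_finite[of B] by auto
  then show ?thesis using orthonormal_sum_inner[OF assms(1), of _ c] by simp
qed

lemma orthonormal_norm:
  assumes "orthonormal B"
  shows "(norm (\<Sum>e\<in>B. c e *\<^sub>R e))\<^sup>2 = (\<Sum>e\<in>B. (c e)\<^sup>2)"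
  unfolding power2_norm_eq_inner
  by (subst inner_sum_right) (simp add: orthonormal_sum_inner[OF assms] power2_eq_square)

lemma onb:
  assumes "subspace V"
  shows "onb V \<subseteq> V" "orthonormal (onb V)" "span (onb V) = V" "card (onb V) = dim V"
proof -
  have "\<exists>B. B \<subseteq> V \<and> pairwise orthogonal B \<and> (\<forall>b\<in>B. norm b = 1) \<and> independent B \<and> span B = V"
    using orthonormal_basis_subspace[OF assms] by metis
  from someI_ex[OF this, folded onb_def]
  show "onb V \<subseteq> V" "orthonormal (onb V)" "span (onb V) = V" "card (onb V) = dim V"
    using assms by (auto simp: orthonormal_def) (metis dim_eq_card_independent dim_span)
qed

text \<open>\<open>flat_measure\<close> fixes basis and origin by a choice. Here both are
  parameters, so that each computation can use the frame that suits it once independence of the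
  choice is shown.\<close>

definition coords :: "'a::euclidean_space set \<Rightarrow> ('a \<Rightarrow> real) measure" where
  "coords B = (\<Pi>\<^sub>M b\<in>B. lborel)"

definition frame_map :: "'a::euclidean_space set \<Rightarrow> 'a \<Rightarrow> ('a \<Rightarrow> real) \<Rightarrow> 'a" where
  "frame_map B o' c = o' + (\<Sum>b\<in>B. c b *\<^sub>R b)"

definition frame_measure :: "'a::euclidean_space set \<Rightarrow> 'a \<Rightarrow> 'a measure" where
  "frame_measure B o' = distr (coords B) borel (frame_map B o')"

interpretation lb: product_sigma_finite "\<lambda>_::'b. lborel :: real measure"
  by standard

lemma sets_coords: "sets (coords B) = sets (\<Pi>\<^sub>M b\<in>B. borel)"
  unfolding coords_def by (rule sets_PiM_cong) auto

lemma space_coords: "space (coords B) = PiE B (\<lambda>_. UNIV)"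
  by (simp add: coords_def space_PiM)

lemma measurable_frame_map [measurable]: "frame_map B o' \<in> borel_measurable (coords B)"
  unfolding frame_map_def[abs_def] measurable_cong_sets[OF sets_coords refl] by measurable

lemma sets_frame_measure [simp, measurable_cong]: "sets (frame_measure B o') = sets borel"
  by (simp add: frame_measure_def)

lemma space_frame_measure [simp]: "space (frame_measure B o') = UNIV"
  by (simp add: frame_measure_def)

lemma emeasure_frame:
  "A \<in> sets borel \<Longrightarrow> emeasure (frame_measure B o') A = emeasure (coords B) (frame_map B o' -` A \<inter> space (coords B))"
  by (simp add: frame_measure_def emeasure_distr)

lemma emeasure_frame_nn:
  "A \<in> sets borel \<Longrightarrow> emeasure (frame_measure B o') A = (\<integral>\<^sup>+c. indicator A (frame_map B o' c) \<partial>coords B)"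
  by (simp add: frame_measure_def nn_integral_distr flip: nn_integral_indicator)

lemma sigma_finite_coords: "finite B \<Longrightarrow> sigma_finite_measure (coords B)"
  unfolding coords_def by (rule lb.sigma_finite)

lemma measurable_affine_coords:
  "(\<lambda>f. \<lambda>i\<in>B. t i + c * f i) \<in> measurable (coords B) (coords B)"
proof -
  have "(\<lambda>f. \<lambda>i\<in>B. t i + c * f i) \<in> measurable (\<Pi>\<^sub>M b\<in>B. borel) (\<Pi>\<^sub>M b\<in>B. borel::real measure)"
    by measurable
  then show ?thesis using measurable_cong_sets[OF sets_coords[of B] sets_coords[of B]] by simp
qed

text \<open>By uniqueness of the product measure it suffices to compare boxes, where each factor is
  the one-dimensional scaling rule \<open>lborel_real_affine\<close>.\<close>

lemma coords_affine:
  assumes B: "finite B" and c: "c \<noteq> 0" and X: "X \<in> sets (coords B)"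
  shows "emeasure (coords B) X
    = ennreal (\<bar>c\<bar> ^ card B) * emeasure (coords B) ((\<lambda>f. \<lambda>i\<in>B. t i + c * f i) -` X \<inter> space (coords B))"
proof -
  let ?\<phi> = "\<lambda>f. \<lambda>i\<in>B. t i + c * f i"
  let ?P = "density (distr (coords B) (coords B) ?\<phi>) (\<lambda>_. ennreal (\<bar>c\<bar> ^ card B))"
  have em: "emeasure ?P Y = ennreal (\<bar>c\<bar> ^ card B) * emeasure (coords B) (?\<phi> -` Y \<inter> space (coords B))"
    if "Y \<in> sets (coords B)" for Y
    using that by (simp add: emeasure_density_const emeasure_distr[OF measurable_affine_coords])
  have "?P = (\<Pi>\<^sub>M b\<in>B. lborel)"
  proof (rule lb.PiM_eqI[OF B])
    show "sets ?P = sets (\<Pi>\<^sub>M b\<in>B. lborel)" by (simp add: coords_def)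
    fix A :: "'a \<Rightarrow> real set" assume A: "\<And>i. i \<in> B \<Longrightarrow> A i \<in> sets lborel"
    have 1: "?\<phi> -` (PiE B A) \<inter> space (coords B) = PiE B (\<lambda>i. (\<lambda>x. t i + c * x) -` A i)"
      by (auto simp: space_coords PiE_iff)
    have 2: "emeasure lborel (A i) = ennreal \<bar>c\<bar> * emeasure lborel ((\<lambda>x. t i + c * x) -` A i)"
      if "i \<in> B" for i
      using A[OF that]
      by (subst lborel_real_affine[OF c, of "t i"]) (simp add: emeasure_density_const emeasure_distr)
    have "emeasure ?P (PiE B A) = ennreal (\<bar>c\<bar> ^ card B) * (\<Prod>i\<in>B. emeasure lborel ((\<lambda>x. t i + c * x) -` A i))"
    proof (subst em)
      show "PiE B A \<in> sets (coords B)" using A B by (auto simp: coords_def intro!: sets_PiM_I_finite)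
      have "(\<lambda>x. t i + c * x) -` A i \<in> sets lborel" if "i \<in> B" for i
        using A[OF that] measurable_sets_borel[of "\<lambda>x. t i + c * x" borel "A i"] by simp
      then show "ennreal (\<bar>c\<bar> ^ card B) * emeasure (coords B) (?\<phi> -` (PiE B A) \<inter> space (coords B)) =
          ennreal (\<bar>c\<bar> ^ card B) * (\<Prod>i\<in>B. emeasure lborel ((\<lambda>x. t i + c * x) -` A i))"
        unfolding 1 unfolding coords_def by (subst lb.emeasure_PiM[OF B]) auto
    qed
    also have "\<dots> = (\<Prod>i\<in>B. emeasure lborel (A i))"
      by (simp add: 2 prod.distrib ennreal_power)
    finally show "emeasure ?P (PiE B A) = (\<Prod>i\<in>B. emeasure lborel (A i))" .
  qed
  then have "emeasure (coords B) X = emeasure ?P X" by (simp add: coords_def)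
  with em[OF X] show ?thesis by simp
qed

text \<open>In coordinates the map multiplies by c and shifts by the coefficients of v, so
  \<open>coords_affine\<close> applies. Translations, dilations and the reflection c = -1 are all
  instances.\<close>

lemma frame_measure_affine:
  assumes B: "orthonormal B" and c: "c \<noteq> 0" and v: "v \<in> span B" and A: "A \<in> sets borel"
  shows "emeasure (frame_measure B o') A
    = ennreal (\<bar>c\<bar> ^ card B) * emeasure (frame_measure B o') ((\<lambda>x. o' + v + c *\<^sub>R (x - o')) -` A)"
proof -
  have fin: "finite B" using B by (rule orthonormal_finite)
  let ?\<phi> = "\<lambda>f. \<lambda>i\<in>B. (v \<bullet> i) + c * f i"
  have eq: "frame_map B o' (?\<phi> f) = o' + v + c *\<^sub>R (frame_map B o' f - o')" for f
    by (subst (2) orthonormal_expand[OF B v])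
      (simp add: frame_map_def scaleR_add_left sum.distrib scaleR_sum_right)
  have m: "(\<lambda>x. o' + v + c *\<^sub>R (x - o')) -` A \<in> sets borel"
    using A by (intro measurable_sets_borel[of _ borel]) auto
  have mA: "frame_map B o' -` A \<inter> space (coords B) \<in> sets (coords B)"
    using A by (intro measurable_sets[OF measurable_frame_map])
  have "?\<phi> -` (frame_map B o' -` A \<inter> space (coords B)) \<inter> space (coords B)
    = frame_map B o' -` ((\<lambda>x. o' + v + c *\<^sub>R (x - o')) -` A) \<inter> space (coords B)"
    by (auto simp: eq space_coords)
  then show ?thesis
    unfolding emeasure_frame[OF A] emeasure_frame[OF m] by (subst coords_affine[OF fin c mA, of "\<lambda>i. v \<bullet> i"]) simp
qed

lemma frame_measure_translate:
  assumes "orthonormal B" "v \<in> span B" "A \<in> sets borel"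
  shows "emeasure (frame_measure B o') ((\<lambda>x. v + x) -` A) = emeasure (frame_measure B o') A"
proof -
  have "(\<lambda>x. o' + v + 1 *\<^sub>R (x - o')) = (\<lambda>x. v + x)" by (auto simp: algebra_simps)
  then show ?thesis using frame_measure_affine[OF assms(1) _ assms(2,3), of 1 o'] by simp
qed

lemma frame_measure_origin:
  assumes B: "orthonormal B" and v: "o1 - o2 \<in> span B"
  shows "frame_measure B o1 = frame_measure B o2"
proof (rule measure_eqI)
  fix A assume "A \<in> sets (frame_measure B o1)"
  then have A: "A \<in> sets borel" by simp
  have m: "(\<lambda>x. (o1 - o2) + x) -` A \<in> sets borel"
    using A by (intro measurable_sets_borel[of _ borel]) auto
  have "frame_map B o1 -` A = frame_map B o2 -` ((\<lambda>x. (o1 - o2) + x) -` A)"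
    by (auto simp: frame_map_def algebra_simps)
  then show "emeasure (frame_measure B o1) A = emeasure (frame_measure B o2) A"
    using frame_measure_translate[OF B v A, of o2] by (simp add: emeasure_frame A m)
qed simp

text \<open>Together with positivity, shown next, this allows the mass of the unit ball to be
  cancelled when two frames are compared.\<close>

lemma frame_measure_ball_finite:
  assumes B: "orthonormal B"
  shows "emeasure (frame_measure B 0) (ball 0 1) < \<infinity>"
proof -
  have fin: "finite B" using B by (rule orthonormal_finite)
  have "frame_map B 0 -` ball 0 1 \<inter> space (coords B) \<subseteq> PiE B (\<lambda>_. {-1..1})"
  proof (clarsimp simp: space_coords PiE_iff)
    fix c i assume c: "norm (frame_map B 0 c) < 1" and i: "i \<in> B"
    have "\<bar>c i\<bar> = \<bar>frame_map B 0 c \<bullet> i\<bar>" using orthonormal_sum_inner[OF B i] by (simp add: frame_map_def)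
    also have "\<dots> \<le> norm (frame_map B 0 c) * norm i" by (rule Cauchy_Schwarz_ineq2)
    also have "norm i = 1" using B i by (simp add: orthonormal_def)
    finally show "- 1 \<le> c i \<and> c i \<le> 1" using c by linarith
  qed
  then have "emeasure (coords B) (frame_map B 0 -` ball 0 1 \<inter> space (coords B))
    \<le> emeasure (coords B) (PiE B (\<lambda>_. {-1..1}))"
    using fin by (intro emeasure_mono) (auto simp: coords_def intro!: sets_PiM_I_finite)
  also have "\<dots> < \<infinity>"
    unfolding coords_def by (subst lb.emeasure_PiM[OF fin]) (auto simp: ennreal_power[symmetric] power_less_top_ennreal)
  finally show ?thesis by (simp add: emeasure_frame)
qed

lemma frame_measure_ball_pos:
  assumes B: "orthonormal B"
  shows "0 < emeasure (frame_measure B 0) (ball 0 1)"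
proof -
  have fin: "finite B" using B by (rule orthonormal_finite)
  \<comment> \<open>Half the side of a cube inside the unit ball: the norm of a point of the cube is
    at most \<open>card B * e\<close>, which is below 1. The summand 1 also covers the empty basis
    of a point.\<close>
  define e where "e = 1 / (real (card B) + 1)"
  have e: "0 < e" "card B * e < 1" by (auto simp: e_def field_simps)
  have "PiE B (\<lambda>_. {-e..e}) \<subseteq> frame_map B 0 -` ball 0 1 \<inter> space (coords B)"
  proof
    fix c assume "c \<in> PiE B (\<lambda>_. {-e..e})"
    then have c: "\<forall>i\<in>B. - e \<le> c i \<and> c i \<le> e" "c \<in> space (coords B)"
      by (auto simp: space_coords PiE_iff)
    have "norm (frame_map B 0 c) \<le> (\<Sum>i\<in>B. norm (c i *\<^sub>R i))" by (simp only: frame_map_def add_0_left norm_sum)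
    also have "\<dots> \<le> (\<Sum>i\<in>B. e)"
    proof (rule sum_mono)
      fix i assume i: "i \<in> B"
      then have "norm i = 1" "\<bar>c i\<bar> \<le> e" using B c(1) by (auto simp: orthonormal_def abs_le_iff minus_le_iff)
      then show "norm (c i *\<^sub>R i) \<le> e" by simp
    qed
    finally show "c \<in> frame_map B 0 -` ball 0 1 \<inter> space (coords B)" using e c by simp
  qed
  then have "emeasure (coords B) (PiE B (\<lambda>_. {-e..e})) \<le> emeasure (coords B) (frame_map B 0 -` ball 0 1 \<inter> space (coords B))"
    by (rule emeasure_mono) (rule measurable_sets[OF measurable_frame_map], simp)
  moreover have "0 < emeasure (coords B) (PiE B (\<lambda>_. {-e..e}))"
  proof -
    have "emeasure (coords B) (PiE B (\<lambda>_. {-e..e})) = (\<Prod>i\<in>B. emeasure lborel {-e..e})"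
      unfolding coords_def by (rule lb.emeasure_PiM[OF fin]) simp
    also have "\<dots> = ennreal ((2 * e) ^ card B)"
      using e(1) by (simp add: ennreal_power)
    finally show ?thesis using e(1) by simp
  qed
  ultimately show ?thesis by (simp add: emeasure_frame)
qed


text \<open>Both measures are invariant under translations along the common span and under the reflection, so
  Fubini's theorem gives \<open>\<mu> A * \<mu>' X = \<mu> X * \<mu>' A\<close> for all \<open>A\<close> and \<open>X\<close>; take the unit ball for \<open>X\<close>.\<close>

lemma frame_measure_basis:
  assumes B: "orthonormal B" and B': "orthonormal B'" and sp: "span B = span B'"
  shows "frame_measure B o' = frame_measure B' o'"
proof -
  have fin: "finite B" "finite B'" using B B' by (auto simp: orthonormal_finite)
  interpret b: sigma_finite_measure "coords B" using fin by (intro sigma_finite_coords)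
  interpret b': sigma_finite_measure "coords B'" using fin by (intro sigma_finite_coords)
  interpret bb: pair_sigma_finite "coords B" "coords B'" by standard
  let ?E = "frame_map B 0" and ?E' = "frame_map B' 0"
  let ?m = "frame_measure B 0" and ?m' = "frame_measure B' 0"
  have in_span: "?E c \<in> span B" "?E' c \<in> span B" for c
    unfolding frame_map_def by (simp_all add: span_sum span_scale span_base) (simp add: sp span_sum span_scale span_base)
  have neg: "emeasure ?m' (uminus -` X) = emeasure ?m' X" if "X \<in> sets borel" for X
    using frame_measure_affine[OF B' _ span_zero that, of "-1" 0] by (simp add: vimage_def)
  have key: "emeasure ?m A * emeasure ?m' X = emeasure ?m X * emeasure ?m' A"
    if A: "A \<in> sets borel" and X: "X \<in> sets borel" for A X
  proof -
    have [measurable]: "A \<in> sets borel" "X \<in> sets borel" by fact+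
    have "emeasure ?m A * emeasure ?m' X
      = (\<integral>\<^sup>+c. indicator A (?E c) * emeasure ?m' X \<partial>coords B)"
      by (simp add: nn_integral_multc emeasure_frame_nn[OF A])
    also have "\<dots> = (\<integral>\<^sup>+c. \<integral>\<^sup>+c'. indicator A (?E c) * indicator X (?E c + ?E' c') \<partial>coords B' \<partial>coords B)"
    proof (rule nn_integral_cong)
      fix c
      have m: "(\<lambda>x. ?E c + x) -` X \<in> sets borel" by (intro measurable_sets_borel[of _ borel] X) auto
      have "emeasure ?m' X = emeasure ?m' ((\<lambda>x. ?E c + x) -` X)"
        using frame_measure_translate[OF B' _ X, of "?E c"] in_span sp by simp
      also have "\<dots> = (\<integral>\<^sup>+c'. indicator X (?E c + ?E' c') \<partial>coords B')"
        unfolding emeasure_frame_nn[OF m] by (intro nn_integral_cong) (simp add: indicator_def)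
      finally show "indicator A (?E c) * emeasure ?m' X
        = (\<integral>\<^sup>+c'. indicator A (?E c) * indicator X (?E c + ?E' c') \<partial>coords B')"
        by (simp add: nn_integral_cmult)
    qed
    also have "\<dots> = (\<integral>\<^sup>+c'. \<integral>\<^sup>+c. indicator A (?E c) * indicator X (?E c + ?E' c') \<partial>coords B \<partial>coords B')"
      by (rule bb.Fubini'[symmetric]) measurable
    also have "\<dots> = (\<integral>\<^sup>+c'. \<integral>\<^sup>+c. indicator A (?E c - ?E' c') * indicator X (?E c) \<partial>coords B \<partial>coords B')"
    proof (rule nn_integral_cong)
      fix c'
      let ?Y = "A \<inter> (\<lambda>x. x + ?E' c') -` X"
      have m1: "(\<lambda>x. x + ?E' c') -` X \<in> sets borel" by (intro measurable_sets_borel[of _ borel] X) auto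
      then have m: "?Y \<in> sets borel" using A by auto
      have m2: "(\<lambda>x. - ?E' c' + x) -` ?Y \<in> sets borel" by (intro measurable_sets_borel[of _ borel] m) auto
      have "(\<integral>\<^sup>+c. indicator A (?E c) * indicator X (?E c + ?E' c') \<partial>coords B) = emeasure ?m ?Y"
        unfolding emeasure_frame_nn[OF m] by (intro nn_integral_cong) (simp add: indicator_def)
      also have "\<dots> = emeasure ?m ((\<lambda>x. - ?E' c' + x) -` ?Y)"
        using frame_measure_translate[OF B _ m, of "- ?E' c'"] in_span by (simp add: span_neg)
      also have "\<dots> = (\<integral>\<^sup>+c. indicator A (?E c - ?E' c') * indicator X (?E c) \<partial>coords B)"
        unfolding emeasure_frame_nn[OF m2] by (intro nn_integral_cong) (simp add: indicator_def)
      finally show "(\<integral>\<^sup>+c. indicator A (?E c) * indicator X (?E c + ?E' c') \<partial>coords B)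
        = (\<integral>\<^sup>+c. indicator A (?E c - ?E' c') * indicator X (?E c) \<partial>coords B)" .
    qed
    also have "\<dots> = (\<integral>\<^sup>+c. \<integral>\<^sup>+c'. indicator A (?E c - ?E' c') * indicator X (?E c) \<partial>coords B' \<partial>coords B)"
      by (rule bb.Fubini') measurable
    also have "\<dots> = (\<integral>\<^sup>+c. indicator X (?E c) * emeasure ?m' A \<partial>coords B)"
    proof (rule nn_integral_cong)
      fix c
      have m1: "(\<lambda>x. ?E c + x) -` A \<in> sets borel" by (intro measurable_sets_borel[of _ borel] A) auto
      have m2: "uminus -` ((\<lambda>x. ?E c + x) -` A) \<in> sets borel" by (intro measurable_sets_borel[of _ borel] m1) auto
      have "emeasure ?m' A = emeasure ?m' ((\<lambda>x. ?E c + x) -` A)"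
        using frame_measure_translate[OF B' _ A, of "?E c"] in_span sp by simp
      also have "\<dots> = emeasure ?m' (uminus -` ((\<lambda>x. ?E c + x) -` A))"
        using neg[OF m1] by simp
      also have "\<dots> = (\<integral>\<^sup>+c'. indicator A (?E c - ?E' c') \<partial>coords B')"
        unfolding emeasure_frame_nn[OF m2] by (intro nn_integral_cong) (simp add: indicator_def)
      finally show "(\<integral>\<^sup>+c'. indicator A (?E c - ?E' c') * indicator X (?E c) \<partial>coords B')
        = indicator X (?E c) * emeasure ?m' A"
        by (simp add: nn_integral_multc) (simp add: mult.commute)
    qed
    also have "\<dots> = emeasure ?m X * emeasure ?m' A"
      by (simp add: nn_integral_multc emeasure_frame_nn[OF X])
    finally show ?thesis .
  qed
  have card: "card B = card B'"
    using sp B B' by (metis dim_eq_card_independent dim_span orthonormal_independent)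
  then obtain h where h: "bij_betw h B B'" using fin by (metis bij_betw_iff_card)
  \<comment> \<open>Invariance determines the measure only up to a factor. The factor is 1, because
    relabelling the coordinates along a bijection h of the two bases preserves the product measure
    and, by Pythagoras, the norm.\<close>
  have ball: "emeasure ?m' (ball 0 1) = emeasure ?m (ball 0 1)"
  proof -
    have mo: "(\<lambda>\<omega>. \<lambda>n\<in>B. \<omega> (h n)) \<in> measurable (coords B') (coords B)"
    proof -
      have "(\<lambda>\<omega>. \<lambda>n\<in>B. \<omega> (h n)) \<in> measurable (\<Pi>\<^sub>M b\<in>B'. borel) (\<Pi>\<^sub>M b\<in>B. borel)"
        using h by (intro measurable_restrict) (auto simp: bij_betw_def)
      then show ?thesis using measurable_cong_sets[OF sets_coords[of B'] sets_coords[of B]] by simp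
    qed
    have d: "coords B = distr (coords B') (coords B) (\<lambda>\<omega>. \<lambda>n\<in>B. \<omega> (h n))"
    proof -
      have "distr (coords B') (coords B) (\<lambda>\<omega>. \<lambda>n\<in>B. \<omega> (h n)) = (\<Pi>\<^sub>M b\<in>B. lborel)"
      proof (rule lb.PiM_eqI[OF fin(1)])
        show "sets (distr (coords B') (coords B) (\<lambda>\<omega>. \<lambda>n\<in>B. \<omega> (h n))) = sets (\<Pi>\<^sub>M b\<in>B. lborel)"
          by (simp add: coords_def)
        fix A :: "'a \<Rightarrow> real set" assume A: "\<And>i. i \<in> B \<Longrightarrow> A i \<in> sets lborel"
        let ?g = "inv_into B h"
        have g: "?g y \<in> B" "h (?g y) = y" if "y \<in> B'" for y
          using that h by (auto simp: bij_betw_def inv_into_into f_inv_into_f)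
        have hg: "?g (h x) = x" "h x \<in> B'" if "x \<in> B" for x
          using that h by (auto simp: bij_betw_def)
        have pre: "(\<lambda>\<omega>. \<lambda>n\<in>B. \<omega> (h n)) -` (PiE B A) \<inter> space (coords B') = PiE B' (\<lambda>y. A (?g y))"
        proof (rule set_eqI)
          fix \<omega> :: "'a \<Rightarrow> real"
          have *: "(\<forall>n\<in>B. \<omega> (h n) \<in> A n) \<longleftrightarrow> (\<forall>y\<in>B'. \<omega> y \<in> A (?g y))"
          proof safe
            fix y assume "\<forall>n\<in>B. \<omega> (h n) \<in> A n" "y \<in> B'"
            with g[of y] show "\<omega> y \<in> A (?g y)" by (metis (no_types))
          next
            fix n assume "\<forall>y\<in>B'. \<omega> y \<in> A (?g y)" "n \<in> B"
            with hg[of n] show "\<omega> (h n) \<in> A n" by (metis (no_types))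
          qed
          have "\<omega> \<in> (\<lambda>\<omega>. \<lambda>n\<in>B. \<omega> (h n)) -` (PiE B A) \<inter> space (coords B') \<longleftrightarrow>
              (\<forall>n\<in>B. \<omega> (h n) \<in> A n) \<and> \<omega> \<in> extensional B'"
            by (simp add: space_coords PiE_iff)
          then show "\<omega> \<in> (\<lambda>\<omega>. \<lambda>n\<in>B. \<omega> (h n)) -` (PiE B A) \<inter> space (coords B') \<longleftrightarrow>
              \<omega> \<in> PiE B' (\<lambda>y. A (?g y))"
            by (simp only: * PiE_iff)
        qed
        have "PiE B A \<in> sets (coords B)" 
          unfolding coords_def by (rule sets_PiM_I_finite[OF fin(1)]) (rule A)
        then have "emeasure (distr (coords B') (coords B) (\<lambda>\<omega>. \<lambda>n\<in>B. \<omega> (h n))) (PiE B A)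
          = emeasure (coords B') (PiE B' (\<lambda>y. A (?g y)))"
          by (simp add: emeasure_distr[OF mo] pre)
        also have "\<dots> = (\<Prod>y\<in>B'. emeasure lborel (A (?g y)))"
          unfolding coords_def by (rule lb.emeasure_PiM[OF fin(2)]) (rule A, rule g)
        also have "\<dots> = (\<Prod>x\<in>B. emeasure lborel (A x))"
          using prod.reindex_bij_betw[OF h, of "\<lambda>y. emeasure lborel (A (?g y))"] hg by simp
        finally show "emeasure (distr (coords B') (coords B) (\<lambda>\<omega>. \<lambda>n\<in>B. \<omega> (h n))) (PiE B A)
          = (\<Prod>i\<in>B. emeasure lborel (A i))" .
      qed
      then show ?thesis by (simp add: coords_def)
    qed
    have nrm: "(norm (?E (\<lambda>n\<in>B. \<omega> (h n))))\<^sup>2 = (norm (?E' \<omega>))\<^sup>2" for \<omega>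
      using sum.reindex_bij_betw[OF h, of "\<lambda>y. (\<omega> y)\<^sup>2"]
      by (simp add: frame_map_def orthonormal_norm[OF B] orthonormal_norm[OF B'])
    have nrm': "norm (?E (\<lambda>n\<in>B. \<omega> (h n))) = norm (?E' \<omega>)" for \<omega>
      using nrm[of \<omega>] by (simp add: power2_eq_iff_nonneg)
    have "emeasure ?m (ball 0 1)
      = emeasure (coords B') ((\<lambda>\<omega>. \<lambda>n\<in>B. \<omega> (h n)) -` (?E -` ball 0 1 \<inter> space (coords B)) \<inter> space (coords B'))"
      by (subst emeasure_frame, simp, subst d, subst emeasure_distr[OF mo])
        (auto intro!: measurable_sets[OF measurable_frame_map])
    also have "(\<lambda>\<omega>. \<lambda>n\<in>B. \<omega> (h n)) -` (?E -` ball 0 1 \<inter> space (coords B)) \<inter> space (coords B')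
      = ?E' -` ball 0 1 \<inter> space (coords B')"
      using nrm' by (auto simp: space_coords)
    finally show ?thesis by (simp add: emeasure_frame)
  qed
  have "?m = ?m'"
  proof (rule measure_eqI)
    fix A assume "A \<in> sets ?m"
    then have A: "A \<in> sets borel" by simp
    have "emeasure ?m (ball 0 1) * emeasure ?m A = emeasure ?m (ball 0 1) * emeasure ?m' A"
      using key[OF A, of "ball 0 1"] ball by (simp add: mult.commute)
    then show "emeasure ?m A = emeasure ?m' A"
      using frame_measure_ball_finite[OF B] frame_measure_ball_pos[OF B]
      by (auto simp: ennreal_mult_cancel_left)
  qed simp
  moreover have "frame_measure C o' = distr (frame_measure C 0) borel (\<lambda>x. o' + x)" for C
  proof -
    have "(\<lambda>x. o' + x) \<circ> frame_map C 0 = frame_map C o'" by (auto simp: frame_map_def)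
    then show ?thesis unfolding frame_measure_def by (subst distr_distr) simp_all
  qed
  ultimately show ?thesis by simp
qed

section \<open>Tangent spaces, and the flat measure in an arbitrary frame\<close>

lemma subspace_tangent: "subspace (tangent S)"
  by (simp add: tangent_def)

lemma tangentI: "\<lbrakk>x \<in> S; y \<in> S\<rbrakk> \<Longrightarrow> x - y \<in> tangent S"
  unfolding tangent_def by (intro span_base) auto

lemma tangent_eq_span:
  assumes "a \<in> S"
  shows "tangent S = span ((\<lambda>x. x - a) ` S)"
proof (rule subset_antisym)
  have "x - y \<in> span ((\<lambda>x. x - a) ` S)" if "x \<in> S" "y \<in> S" for x y
  proof -
    have "(x - a) - (y - a) \<in> span ((\<lambda>x. x - a) ` S)" using that by (intro span_diff span_base) auto
    then show ?thesis by simp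
  qed
  then show "tangent S \<subseteq> span ((\<lambda>x. x - a) ` S)"
    unfolding tangent_def by (intro span_minimal) auto
  show "span ((\<lambda>x. x - a) ` S) \<subseteq> tangent S"
    using assms unfolding tangent_def by (intro span_mono) auto
qed

lemma affine_hull_eq_tangent:
  assumes "a \<in> S"
  shows "affine hull S = (\<lambda>v. a + v) ` tangent S"
proof -
  have "(\<lambda>x. - a + x) ` (S - {a}) = (\<lambda>x. x - a) ` S - {0}" by auto
  then show ?thesis
    using affine_hull_span2[OF assms] tangent_eq_span[OF assms] by (simp add: span_delete_0)
qed

lemma tangent_affine_hull [simp]: "tangent (affine hull S) = tangent S"
proof (cases "S = {}")
  case False
  then obtain a where a: "a \<in> S" by auto
  then have "(\<lambda>x. x - a) ` (affine hull S) = tangent S"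
    by (simp add: affine_hull_eq_tangent image_image)
  then show ?thesis
    using tangent_eq_span[of a "affine hull S"] a hull_subset[of S affine] subspace_tangent[of S]
    by (auto simp: subset_iff span_eq_iff)
qed simp

lemma mem_affine_hull_iff:
  assumes "a \<in> affine hull S"
  shows "x \<in> affine hull S \<longleftrightarrow> x - a \<in> tangent S"
proof -
  have "affine hull S = (\<lambda>v. a + v) ` tangent S"
    using affine_hull_eq_tangent[OF assms] by (simp add: hull_hull)
  then show ?thesis by (auto simp: image_iff intro: bexI[of _ "x - a"])
qed

lemma affine_hull_diff: "\<lbrakk>x \<in> affine hull S; y \<in> affine hull S\<rbrakk> \<Longrightarrow> x - y \<in> tangent S"
  using mem_affine_hull_iff by blast

lemma dim_tangent:
  assumes "S \<noteq> {}"
  shows "int (dim (tangent S)) = aff_dim S"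
proof -
  obtain a where a: "a \<in> S" using assms by auto
  have "(+) (- a) ` S = (\<lambda>x. x - a) ` S" by auto
  then show ?thesis
    using aff_dim_eq_dim[of a S] hull_inc[OF a, of affine] tangent_eq_span[OF a] by (simp add: dim_span)
qed

lemma tangent_mono: "affine hull S \<subseteq> affine hull S' \<Longrightarrow> tangent S \<subseteq> tangent S'"
proof -
  assume "affine hull S \<subseteq> affine hull S'"
  then have "tangent (affine hull S) \<subseteq> tangent (affine hull S')"
    unfolding tangent_def by (intro span_mono) blast
  then show ?thesis by simp
qed

lemma tangent_mono_subset: "S \<subseteq> S' \<Longrightarrow> tangent S \<subseteq> tangent S'"
  by (intro tangent_mono hull_mono)

lemma flat_measure_eq_frame:
  assumes B: "orthonormal B" "span B = tangent S" and p: "p \<in> affine hull S"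
  shows "flat_measure S = frame_measure B p"
proof -
  note o = onb[OF subspace_tangent[of S]]
  let ?p = "SOME x. x \<in> affine hull S"
  have p': "?p \<in> affine hull S" using p by (rule someI)
  have "flat_measure S = frame_measure (onb (tangent S)) ?p"
    by (simp add: flat_measure_def frame_measure_def coords_def frame_map_def[abs_def])
  also have "\<dots> = frame_measure B ?p"
    using o B by (intro frame_measure_basis) auto
  also have "\<dots> = frame_measure B p"
    using B p p' by (intro frame_measure_origin) (auto intro: affine_hull_diff)
  finally show ?thesis .
qed

lemma sets_flat_measure [simp, measurable_cong]: "sets (flat_measure S) = sets borel"
  by (simp add: flat_measure_def)

lemma space_flat_measure [simp]: "space (flat_measure S) = UNIV"
  by (simp add: flat_measure_def)

lemma flat_measure_cong: "affine hull S = affine hull S' \<Longrightarrow> flat_measure S = flat_measure S'"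
proof -
  assume eq: "affine hull S = affine hull S'"
  then have "tangent S = tangent S'"
    using tangent_affine_hull[of S] tangent_affine_hull[of S'] by simp
  with eq show ?thesis by (simp add: flat_measure_def)
qed

lemma flat_measure_eq_onb:
  assumes "p \<in> affine hull S"
  shows "flat_measure S = frame_measure (onb (tangent S)) p"
  using onb[OF subspace_tangent[of S]] assms by (intro flat_measure_eq_frame) auto

lemma card_onb_tangent: "S \<noteq> {} \<Longrightarrow> card (onb (tangent S)) = nat (aff_dim S)"
  using dim_tangent[of S] onb(4)[OF subspace_tangent[of S]] by simp

lemma flat_measure_affine:
  assumes p: "p \<in> affine hull S" and q: "q \<in> affine hull S" and c: "c \<noteq> 0" and A: "A \<in> sets borel"
  shows "emeasure (flat_measure S) A
    = ennreal (\<bar>c\<bar> ^ nat (aff_dim S)) * emeasure (flat_measure S) ((\<lambda>x. q + c *\<^sub>R (x - p)) -` A)"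
proof -
  note o = onb[OF subspace_tangent[of S]]
  have ne: "S \<noteq> {}" using p by auto
  have v: "q - p \<in> span (onb (tangent S))" using affine_hull_diff[OF q p] o by simp
  show ?thesis
    using frame_measure_affine[OF o(2) c v A, of p] ne
    by (simp add: flat_measure_eq_onb[OF p] card_onb_tangent)
qed

text \<open>K is the volume of the unit ball of the tangent space. It stays abstract, as it cancels
  wherever the volumes of two balls are compared.\<close>

lemma flat_measure_ball:
  assumes "S \<noteq> {}"
  obtains K where "0 < K"
    "\<And>p r. \<lbrakk>p \<in> affine hull S; 0 < r\<rbrakk> \<Longrightarrow>
       emeasure (flat_measure S) (ball p r) = ennreal (K * r ^ nat (aff_dim S))"
proof -
  note o = onb[OF subspace_tangent[of S]]
  let ?B = "onb (tangent S)"
  define K where "K = enn2real (emeasure (frame_measure ?B 0) (ball 0 1))"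
  have K: "emeasure (frame_measure ?B 0) (ball 0 1) = ennreal K" "0 < K"
    using frame_measure_ball_finite[OF o(2)] frame_measure_ball_pos[OF o(2)]
    by (auto simp: K_def enn2real_positive_iff less_top)
  have "emeasure (flat_measure S) (ball p r) = ennreal (K * r ^ nat (aff_dim S))"
    if p: "p \<in> affine hull S" and r: "0 < r" for p r
  proof -
    have 1: "(\<lambda>x. p + r *\<^sub>R (x - p)) -` ball p r = ball p 1"
      using r by (auto simp: dist_norm norm_minus_commute)
    have 2: "frame_map ?B p -` ball p 1 = frame_map ?B 0 -` ball 0 1"
      by (auto simp: frame_map_def dist_norm)
    have "emeasure (flat_measure S) (ball p 1) = ennreal K"
      unfolding K(1)[symmetric] flat_measure_eq_onb[OF p] by (simp add: emeasure_frame 2)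
    then show ?thesis
      using flat_measure_affine[OF p p, of r "ball p r"] r K
      by (simp add: 1 ennreal_mult' mult.commute)
  qed
  with K(2) show thesis using that by blast
qed

lemma flat_measure_bounded_finite:
  assumes S: "S \<noteq> {}" and A: "bounded A"
  shows "emeasure (flat_measure S) A < \<infinity>"
proof -
  obtain K where K: "\<And>p r. \<lbrakk>p \<in> affine hull S; 0 < r\<rbrakk> \<Longrightarrow>
       emeasure (flat_measure S) (ball p r) = ennreal (K * r ^ nat (aff_dim S))"
    using flat_measure_ball[OF S] by metis
  obtain p where p: "p \<in> affine hull S" using S hull_inc by fastforce
  obtain r where r: "0 < r" "A \<subseteq> ball p r" using bounded_subset_ballD[OF A] by metis
  have "emeasure (flat_measure S) A \<le> emeasure (flat_measure S) (ball p r)"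
    using r by (intro emeasure_mono) auto
  then show ?thesis using K[OF p r(1)] by (simp add: le_less_trans)
qed

lemma flat_measure_affine_hull_compl:
  assumes "S \<noteq> {}"
  shows "emeasure (flat_measure S) (- (affine hull S)) = 0"
proof -
  obtain p where p: "p \<in> affine hull S" using assms hull_inc by fastforce
  note o = onb[OF subspace_tangent[of S]]
  have "frame_map (onb (tangent S)) p c \<in> affine hull S" for c
  proof -
    have "(\<Sum>b\<in>onb (tangent S). c b *\<^sub>R b) \<in> tangent S"
      using o subspace_tangent by (intro subspace_sum subspace_scale) auto
    then show ?thesis by (simp add: frame_map_def mem_affine_hull_iff[OF p])
  qed
  then have "frame_map (onb (tangent S)) p -` (- (affine hull S)) = {}" by (simp add: vimage_def)
  moreover have "- (affine hull S) \<in> sets borel"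
    by (intro borel_comp borel_closed closed_affine_hull)
  ultimately show ?thesis by (simp add: flat_measure_eq_onb[OF p] emeasure_frame)
qed

text \<open>A basis adapted to the direction e, so that the coordinate along e can be separated from
  the others in a product measure.\<close>

lemma onb_extend:
  assumes V: "subspace V" and e: "e \<in> V" "norm e = 1"
  obtains B where "orthonormal (insert e B)" "e \<notin> B" "span (insert e B) = V" "span B = {v \<in> V. e \<bullet> v = 0}"
proof -
  have V0: "subspace {v \<in> V. e \<bullet> v = 0}"
    using V by (auto simp: subspace_def inner_simps)
  note o = onb[OF V0]
  let ?B = "onb {v \<in> V. e \<bullet> v = 0}"
  have n: "e \<notin> ?B" using o(1) e(2) by (auto simp: norm_eq_1)
  have on: "orthonormal (insert e ?B)"
    using o(1,2) e(2) n by (auto simp: orthonormal_def pairwise_def orthogonal_def inner_commute)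
  have "span (insert e ?B) = V"
  proof (rule subset_antisym)
    show "span (insert e ?B) \<subseteq> V" using V e o(1) by (intro span_minimal) auto
    show "V \<subseteq> span (insert e ?B)"
    proof
      fix v assume v: "v \<in> V"
      have "v - (e \<bullet> v) *\<^sub>R e \<in> {v \<in> V. e \<bullet> v = 0}"
        using v e V by (auto simp: inner_simps norm_eq_1 intro: subspace_diff subspace_scale)
      then show "v \<in> span (insert e ?B)" unfolding span_breakdown_eq using o(3) by blast
    qed
  qed
  with on n o(3) show thesis using that by blast
qed

text \<open>The measure lives on the affine hull of S. There L has a unit normal e in the tangent
  space; in a frame that contains e and has its origin on L, the points of L have e-coordinate 0, so
  they lie in a box with one factor of measure zero.\<close>

lemma flat_measure_null_affine:
  fixes L :: "'a::euclidean_space set"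
  assumes S: "S \<noteq> {}" and L: "affine L" "aff_dim L < aff_dim S"
  shows "L \<in> null_sets (flat_measure S)"
proof -
  have Lb: "L \<in> sets borel" using closed_affine_hull[of L] hull_same[of affine, OF L(1)] by (simp add: borel_closed)
  let ?L = "L \<inter> affine hull S"
  have L'b: "?L \<in> sets borel" using Lb by (auto simp: closed_affine_hull borel_closed)
  have "emeasure (flat_measure S) ?L = 0"
  proof (cases "?L = {}")
    case False
    then obtain p where p: "p \<in> ?L" by auto
    then have pS: "p \<in> affine hull S" by auto
    have "aff_dim ?L \<le> aff_dim L" by (intro aff_dim_subset) auto
    then have "dim (tangent ?L) < dim (tangent S)"
      using L(2) dim_tangent[OF False] dim_tangent[OF S] by simp
    moreover have "tangent ?L \<subseteq> tangent S"
      by (intro tangent_mono) (metis hull_hull hull_mono inf_le2)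
    ultimately have "span (tangent ?L) \<subset> span (tangent S)"
      by (metis (no_types) dim_span less_irrefl psubsetI span_mono)
    then obtain y where y: "y \<noteq> 0" "y \<in> span (tangent S)" "\<And>x. x \<in> span (tangent ?L) \<Longrightarrow> orthogonal y x"
      using orthogonal_to_subspace_exists_gen by metis
    define e where "e = y /\<^sub>R norm y"
    have e: "norm e = 1" "e \<in> tangent S" "\<And>x. x \<in> tangent ?L \<Longrightarrow> e \<bullet> x = 0"
      using y span_eq_iff[THEN iffD2, OF subspace_tangent[of S]]
      by (auto simp: e_def orthogonal_def intro!: subspace_scale subspace_tangent intro: span_base)
    obtain B where B: "orthonormal (insert e B)" "e \<notin> B" "span (insert e B) = tangent S"
      using onb_extend[OF subspace_tangent e(2,1)] by metis
    have fin: "finite (insert e B)" using B(1) by (rule orthonormal_finite)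
    have "frame_map (insert e B) p -` ?L \<inter> space (coords (insert e B))
      \<subseteq> PiE (insert e B) (\<lambda>b. if b = e then {0} else UNIV)"
    proof
      fix c assume c: "c \<in> frame_map (insert e B) p -` ?L \<inter> space (coords (insert e B))"
      have "frame_map (insert e B) p c - p \<in> tangent ?L"
        using c p by (intro tangentI) auto
      then have "c e = 0"
        using e(3)[of "frame_map (insert e B) p c - p"] orthonormal_sum_inner[OF B(1), of e c]
        by (simp add: frame_map_def inner_commute)
      then show "c \<in> PiE (insert e B) (\<lambda>b. if b = e then {0} else UNIV)"
        using c by (auto simp: space_coords PiE_iff)
    qed
    then have "emeasure (coords (insert e B)) (frame_map (insert e B) p -` ?L \<inter> space (coords (insert e B)))
       \<le> emeasure (coords (insert e B)) (PiE (insert e B) (\<lambda>b. if b = e then {0} else UNIV))"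
      using fin by (intro emeasure_mono) (auto simp: coords_def intro!: sets_PiM_I_finite)
    also have "\<dots> = (\<Prod>b\<in>insert e B. emeasure lborel (if b = e then {0::real} else UNIV))"
      unfolding coords_def using fin by (subst lb.emeasure_PiM) auto
    also have "\<dots> = 0" using fin by (intro prod_zero) auto
    finally show ?thesis
      using L'b by (simp add: flat_measure_eq_frame[OF B(1,3) pS] emeasure_frame)
  qed simp
  moreover have "emeasure (flat_measure S) L \<le> emeasure (flat_measure S) ?L + emeasure (flat_measure S) (- (affine hull S))"
    using Lb L'b by (intro order_trans[OF emeasure_mono emeasure_subadditive])
      (auto simp: closed_affine_hull borel_closed)
  ultimately show ?thesis
    using Lb flat_measure_affine_hull_compl[OF S] by (auto intro!: null_setsI)
qed

section \<open>The volume of a pyramid\<close>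

lemma nn_integral_cone:
  assumes h: "0 < h"
  shows "(\<integral>\<^sup>+t. ennreal ((1 - t / h) ^ k) * indicator {0..h} t \<partial>lborel) = ennreal (h / (real k + 1))"
proof -
  let ?F = "\<lambda>t. - (h / (real k + 1)) * (1 - t / h) ^ Suc k"
  have "(\<integral>\<^sup>+t. ennreal ((1 - t / h) ^ k) * indicator {0..h} t \<partial>lborel) = ennreal (?F h - ?F 0)"
  proof (rule nn_integral_FTC_Icc[where F = ?F])
    fix x assume x: "x \<in> {0..h}"
    show "(?F has_real_derivative (1 - x / h) ^ k) (at x)"
    proof -
      have "((\<lambda>t. 1 - t / h) has_real_derivative (- 1 / h)) (at x)"
        using h by (auto intro!: derivative_eq_intros)
      from DERIV_cmult[OF DERIV_power_Suc[OF this, of k], of "- (h / (real k + 1))"]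
      have D: "(?F has_real_derivative - (h / (real k + 1)) * ((1 + real k) * (- 1 / h * (1 - x / h) ^ k))) (at x)" .
      have E: "- (h / (real k + 1)) * ((1 + real k) * (- 1 / h * y)) = y" for y
      proof -
        have "h \<noteq> 0" "1 + real k \<noteq> 0" using h by auto
        then have "h / (real k + 1) * ((1 + real k) * (1 / h * y)) = y" by (simp add: add.commute)
        then show ?thesis by simp
      qed
      show ?thesis using D unfolding E .
    qed
    show "0 \<le> (1 - x / h) ^ k" using x h by simp
  qed (use h in auto)
  then show ?thesis using h by simp
qed

text \<open>Fubini along the direction e from the base to the apex: the slice at height t is a
  translate of the base scaled by 1 - t / h, and \<open>nn_integral_cone\<close> adds up the
  slices.\<close>

lemma flat_measure_pyramid:
  fixes f :: "'a::euclidean_space set"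
  assumes f: "convex f" "f \<noteq> {}" "compact f"
    and e: "norm e = 1" "\<And>v. v \<in> tangent f \<Longrightarrow> e \<bullet> v = 0"
    and a: "\<And>y. y \<in> f \<Longrightarrow> e \<bullet> (a - y) = h" and h: "0 < h" and m: "m = nat (aff_dim f) + 1"
    and T: "T = convex hull (insert a f)" and eT: "e \<in> tangent T"
  shows "real m * measure (flat_measure T) T = h * measure (flat_measure f) f"
proof -
  obtain p where p: "p \<in> f" using f by auto
  have fT: "f \<subseteq> T" and aT: "a \<in> T" unfolding T using hull_subset[of "insert a f" convex] by auto
  have Tc: "compact T" unfolding T using f by (intro compact_convex_hull) auto
  have pT: "p \<in> affine hull T" and pf: "p \<in> affine hull f" using p fT by (auto intro: hull_inc)
  have tT: "tangent T = span (insert (a - p) (tangent f))"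
  proof -
    have "tangent T = tangent (insert a f)"
      unfolding T by (metis affine_hull_convex_hull tangent_affine_hull)
    also have "\<dots> = span ((\<lambda>x. x - p) ` insert a f)" using p by (intro tangent_eq_span) auto
    also have "\<dots> = span (insert (a - p) (tangent f))"
      by (simp add: tangent_eq_span[OF p] span_insert span_span)
    finally show ?thesis .
  qed
  have ev: "v \<in> tangent f" if v: "v \<in> tangent T" "e \<bullet> v = 0" for v
  proof -
    obtain k where k: "v - k *\<^sub>R (a - p) \<in> tangent f"
      using v(1) unfolding tT span_breakdown_eq span_eq_iff[THEN iffD2, OF subspace_tangent] by auto
    then have "e \<bullet> (v - k *\<^sub>R (a - p)) = 0" by (rule e(2))
    then have "k = 0" using v(2) a[OF p] h by (simp add: inner_simps)
    then show ?thesis using k by simp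
  qed
  have sub: "tangent f \<subseteq> tangent T" using fT by (rule tangent_mono_subset)
  obtain B where B: "orthonormal (insert e B)" "e \<notin> B" "span (insert e B) = tangent T"
    "span B = {v \<in> tangent T. e \<bullet> v = 0}"
    using onb_extend[OF subspace_tangent eT e(1)] by metis
  have Bf: "span B = tangent f" using B(4) ev e(2) sub by auto
  have oB: "orthonormal B" using B(1) by (rule orthonormal_subset) auto
  have fin: "finite B" using oB by (rule orthonormal_finite)
  have eqT: "flat_measure T = frame_measure (insert e B) p" and eqf: "flat_measure f = frame_measure B p"
    using flat_measure_eq_frame[OF B(1,3) pT] flat_measure_eq_frame[OF oB Bf pf] by auto
  have cardB: "card B = m - 1"
    using m f(2) dim_tangent[of f] Bf oB by (metis add_diff_cancel_right' dim_eq_card_independent dim_span nat_int orthonormal_independent)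
  have fb: "f \<in> sets borel" "T \<in> sets borel" using f Tc by (auto intro: borel_compact)
  have eB: "e \<bullet> b = 0" if "b \<in> B" for b
    using that B(4) span_base by auto
  have e_map: "e \<bullet> (frame_map B p c + t *\<^sub>R e - p) = t" for c t
    using e(1) eB by (simp add: frame_map_def inner_simps inner_sum_right norm_eq_1)
  have upd: "frame_map (insert e B) p (c(e := t)) = frame_map B p c + t *\<^sub>R e" for c t
  proof -
    have "(\<Sum>b\<in>B. (c(e := t)) b *\<^sub>R b) = (\<Sum>b\<in>B. c b *\<^sub>R b)"
      using B(2) by (intro sum.cong) auto
    then show ?thesis using B(2) fin by (simp add: frame_map_def)
  qed
  have T_iff: "x \<in> T \<longleftrightarrow> (\<exists>s\<in>{0..1}. \<exists>y\<in>f. x = (1 - s) *\<^sub>R y + s *\<^sub>R a)" for x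
  proof -
    have "x \<in> T \<longleftrightarrow> (\<exists>u\<ge>0. \<exists>v\<ge>0. \<exists>y. u + v = 1 \<and> y \<in> f \<and> x = u *\<^sub>R a + v *\<^sub>R y)"
      unfolding T convex_hull_insert[OF f(2)] hull_same[of convex, OF f(1)] by simp
    also have "\<dots> \<longleftrightarrow> (\<exists>s\<in>{0..1}. \<exists>y\<in>f. x = (1 - s) *\<^sub>R y + s *\<^sub>R a)"
    proof safe
      fix u v :: real and y assume *: "0 \<le> u" "0 \<le> v" "u + v = 1" "y \<in> f"
      then have "v = 1 - u" by simp
      with * show "\<exists>s\<in>{0..1}. \<exists>y'\<in>f. u *\<^sub>R a + v *\<^sub>R y = (1 - s) *\<^sub>R y' + s *\<^sub>R a"
        by (intro bexI[of _ u] bexI[of _ y]) (auto simp: add.commute)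
    next
      fix s :: real and y assume *: "s \<in> {0..1}" "y \<in> f"
      then show "\<exists>u\<ge>0. \<exists>v\<ge>0. \<exists>y'. u + v = 1 \<and> y' \<in> f \<and> (1 - s) *\<^sub>R y + s *\<^sub>R a = u *\<^sub>R a + v *\<^sub>R y'"
        by (intro exI[of _ s] conjI exI[of _ "1 - s"] exI[of _ y]) (auto simp: add.commute)
    qed
    finally show ?thesis .
  qed
  \<comment> \<open>The height t determines the weight t / h of the apex. What remains is that the
    projection from the apex to the base lies in f; as a map of the base hyperplane it is a
    dilation, whose centre moves towards \<open>a - h *\<^sub>R e\<close>, the foot of the
    apex.\<close>
  have slice: "frame_map B p c + t *\<^sub>R e \<in> T \<longleftrightarrow> 
      frame_map B p c \<in> (\<lambda>x. p + (1 / (1 - t/h)) *\<^sub>R (x - (p + (t/h) *\<^sub>R (a - h *\<^sub>R e - p)))) -` f"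
    if t: "0 \<le> t" "t < h" for c t
  proof -
    let ?x = "frame_map B p c + t *\<^sub>R e"
    have th: "0 < 1 - t/h" using t h by simp
    have s: "s = t / h" if "?x = (1 - s) *\<^sub>R y + s *\<^sub>R a" "y \<in> f" for s y
    proof -
      have "e \<bullet> (p - y) = 0" using e(2) tangentI[OF p that(2)] by simp
      moreover have "?x - p = (y - p) + s *\<^sub>R (a - y)" using that(1) by (simp add: algebra_simps)
      then have "e \<bullet> (?x - p) = - (e \<bullet> (p - y)) + s * (e \<bullet> (a - y))" by (simp only: inner_simps)
      ultimately have "t = s * h" using e_map a[OF that(2)] by simp
      then show ?thesis using h by simp
    qed
    have "?x \<in> T \<longleftrightarrow> (\<exists>y\<in>f. ?x = (1 - t/h) *\<^sub>R y + (t/h) *\<^sub>R a)"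
      unfolding T_iff using s t h by (metis atLeastAtMost_iff divide_le_eq_1_pos divide_nonneg_pos less_imp_le)
    also have "\<dots> \<longleftrightarrow> (\<exists>y\<in>f. y = (1 / (1 - t/h)) *\<^sub>R (?x - (t/h) *\<^sub>R a))"
    proof (intro bex_cong refl)
      fix y
      have "y = (1 / (1 - t/h)) *\<^sub>R (?x - (t/h) *\<^sub>R a) \<longleftrightarrow> (1 - t/h) *\<^sub>R y = (1 - t/h) *\<^sub>R ((1 / (1 - t/h)) *\<^sub>R (?x - (t/h) *\<^sub>R a))"
        using th t by (subst scaleR_cancel_left) auto
      also have "\<dots> \<longleftrightarrow> (1 - t/h) *\<^sub>R y = ?x - (t/h) *\<^sub>R a" using th t by auto
      finally show "?x = (1 - t/h) *\<^sub>R y + (t/h) *\<^sub>R a \<longleftrightarrow> y = (1 / (1 - t/h)) *\<^sub>R (?x - (t/h) *\<^sub>R a)"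
        by (auto simp: algebra_simps)
    qed
    also have "(1 / (1 - t/h)) *\<^sub>R (?x - (t/h) *\<^sub>R a) = p + (1 / (1 - t/h)) *\<^sub>R (frame_map B p c - (p + (t/h) *\<^sub>R (a - h *\<^sub>R e - p)))"
    proof -
      have "p = (1 / (1 - t/h)) *\<^sub>R ((1 - t/h) *\<^sub>R p)" using th t by auto
      then have "p + (1 / (1 - t/h)) *\<^sub>R (frame_map B p c - (p + (t/h) *\<^sub>R (a - h *\<^sub>R e - p)))
        = (1 / (1 - t/h)) *\<^sub>R ((1 - t/h) *\<^sub>R p + (frame_map B p c - (p + (t/h) *\<^sub>R (a - h *\<^sub>R e - p))))"
        by (metis scaleR_add_right)
      also have "(1 - t/h) *\<^sub>R p + (frame_map B p c - (p + (t/h) *\<^sub>R (a - h *\<^sub>R e - p))) = ?x - (t/h) *\<^sub>R a"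
        using h by (simp add: algebra_simps)
      finally show ?thesis by simp
    qed
    finally show ?thesis by simp
  qed
  have out: "frame_map B p c + t *\<^sub>R e \<notin> T" if t: "t < 0 \<or> h < t" for c t
  proof
    assume "frame_map B p c + t *\<^sub>R e \<in> T"
    then obtain s y where s: "s \<in> {0..1}" "y \<in> f" "frame_map B p c + t *\<^sub>R e = (1 - s) *\<^sub>R y + s *\<^sub>R a"
      unfolding T_iff by auto
    have "e \<bullet> (p - y) = 0" using e(2) tangentI[OF p s(2)] by simp
    moreover have "frame_map B p c + t *\<^sub>R e - p = (y - p) + s *\<^sub>R (a - y)" using s(3) by (simp add: algebra_simps)
    then have "e \<bullet> (frame_map B p c + t *\<^sub>R e - p) = - (e \<bullet> (p - y)) + s * (e \<bullet> (a - y))"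
      by (simp only: inner_simps)
    ultimately have "t = s * h" using e_map a[OF s(2)] by simp
    moreover have "0 \<le> s * h" "s * h \<le> h" using s(1) h by (auto simp: mult_left_le_one_le)
    ultimately show False using t by linarith
  qed
  have q: "p + (t/h) *\<^sub>R (a - h *\<^sub>R e - p) \<in> affine hull f" for t
  proof -
    have "a - h *\<^sub>R e - p \<in> tangent f"
    proof (rule ev)
      show "a - h *\<^sub>R e - p \<in> tangent T"
      proof -
        have "(a - p) - h *\<^sub>R e \<in> tangent T"
          using p fT eT by (intro subspace_diff subspace_scale subspace_tangent tangentI[OF aT]) auto
        then show ?thesis by (simp add: algebra_simps)
      qed
      show "e \<bullet> (a - h *\<^sub>R e - p) = 0"
        using a[OF p] e(1) by (simp add: inner_simps norm_eq_1)
    qed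
    then show ?thesis by (simp add: mem_affine_hull_iff[OF pf] subspace_scale subspace_tangent)
  qed
  \<comment> \<open>The height t = h, at which the dilation degenerates, is left out; a single
    height is a null set for the outer integral.\<close>
  have slice_measure: "(\<integral>\<^sup>+c. indicator T (frame_map B p c + t *\<^sub>R e) \<partial>coords B)
      = ennreal ((1 - t/h) ^ (m - 1)) * indicator {0..h} t * emeasure (flat_measure f) f" if th: "t \<noteq> h" for t
  proof (cases "0 \<le> t \<and> t < h")
    case True
    let ?k = "1 / (1 - t/h)"
    let ?q = "p + (t/h) *\<^sub>R (a - h *\<^sub>R e - p)"
    let ?Y = "(\<lambda>x. p + ?k *\<^sub>R (x - ?q)) -` f"
    have k: "?k \<noteq> 0" "0 < 1 - t/h" using True h by auto
    have Yb: "?Y \<in> sets borel" by (intro measurable_sets_borel[of _ borel] fb) auto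
    have "(\<integral>\<^sup>+c. indicator T (frame_map B p c + t *\<^sub>R e) \<partial>coords B) = emeasure (flat_measure f) ?Y"
      unfolding eqf emeasure_frame_nn[OF Yb]
      using True by (intro nn_integral_cong) (simp add: indicator_def slice)
    moreover have "emeasure (flat_measure f) f = ennreal (\<bar>?k\<bar> ^ (m - 1)) * emeasure (flat_measure f) ?Y"
      using flat_measure_affine[OF q[of t] pf k(1) fb(1)] by (simp add: m)
    then have "ennreal ((1 - t/h) ^ (m - 1)) * emeasure (flat_measure f) f
        = (ennreal ((1 - t/h) ^ (m - 1)) * ennreal (\<bar>?k\<bar> ^ (m - 1))) * emeasure (flat_measure f) ?Y"
      by (simp only: mult.assoc)
    moreover have "ennreal ((1 - t/h) ^ (m - 1)) * ennreal (\<bar>?k\<bar> ^ (m - 1)) = 1"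
      using k th by (simp add: ennreal_mult[symmetric] power_mult_distrib[symmetric] del: ennreal_mult)
    ultimately show ?thesis using True by simp
  next
    case False
    then have "t < 0 \<or> h < t" using th by auto
    then show ?thesis using out by (auto simp: indicator_def)
  qed
  have "emeasure (flat_measure T) T = (\<integral>\<^sup>+c. indicator T (frame_map (insert e B) p c) \<partial>coords (insert e B))"
    unfolding eqT by (rule emeasure_frame_nn[OF fb(2)])
  also have "\<dots> = (\<integral>\<^sup>+t. \<integral>\<^sup>+c. indicator T (frame_map (insert e B) p (c(e := t))) \<partial>coords B \<partial>lborel)"
    unfolding coords_def
  proof (rule lb.product_nn_integral_insert_rev[OF fin B(2)])
    have "frame_map (insert e B) p \<in> borel_measurable (coords (insert e B))" by simp
    then show "(\<lambda>c. indicator T (frame_map (insert e B) p c)) \<in> borel_measurable (\<Pi>\<^sub>M b\<in>insert e B. lborel)"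
      using fb(2) unfolding coords_def by measurable
  qed
  also have "\<dots> = (\<integral>\<^sup>+t. ennreal ((1 - t/h) ^ (m - 1)) * indicator {0..h} t * emeasure (flat_measure f) f \<partial>lborel)"
  proof (rule nn_integral_cong_AE)
    have "AE t in lborel. t \<noteq> h" by (rule AE_lborel_singleton)
    then show "AE t in lborel. (\<integral>\<^sup>+c. indicator T (frame_map (insert e B) p (c(e := t))) \<partial>coords B)
        = ennreal ((1 - t/h) ^ (m - 1)) * indicator {0..h} t * emeasure (flat_measure f) f"
      by eventually_elim (simp add: upd slice_measure)
  qed
  also have "\<dots> = ennreal (h / real m) * emeasure (flat_measure f) f"
    using nn_integral_cone[OF h, of "m - 1"] m by (subst nn_integral_multc) (auto simp: add.commute)
  finally have "emeasure (flat_measure T) T = ennreal (h / real m) * emeasure (flat_measure f) f" .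
  then have "measure (flat_measure T) T = (h / real m) * measure (flat_measure f) f"
    using h by (simp add: measure_def enn2real_mult)
  then show ?thesis using m h by simp
qed

section \<open>Simplices and the lowest-order Raviart--Thomas space\<close>

definition apex :: "'a::euclidean_space set \<Rightarrow> 'a set \<Rightarrow> 'a" where
  "apex T f = (THE a. a extreme_point_of T \<and> a \<notin> f)"

definition height :: "'a::euclidean_space set \<Rightarrow> 'a set \<Rightarrow> real" where
  "height T f = outer_normal T f \<bullet> ((SOME p. p \<in> f) - apex T f)"

text \<open>The barycentric coordinate of the vertex opposite to f, as a quotient of distances from
  the hyperplane of f. Being an affine function on the whole space, it is also available outside the
  cell.\<close>

definition bary :: "'a::euclidean_space set \<Rightarrow> 'a set \<Rightarrow> 'a \<Rightarrow> real" where
  "bary T f x = (outer_normal T f \<bullet> ((SOME p. p \<in> f) - x)) / height T f"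

text \<open>Points are kept apart: a zero-dimensional simplex has no facets and carries no
  flux.\<close>

locale cell =
  fixes T :: "'a::euclidean_space set"
  assumes simplex: "aff_dim T simplex T" and dim: "1 \<le> aff_dim T"
begin

definition vertices :: "'a set" where "vertices = {v. v extreme_point_of T}"

lemma vertices:
  shows T_eq: "T = convex hull vertices" and vertices_indep: "\<not> affine_dependent vertices"
    and card_vertices: "int (card vertices) = aff_dim T + 1"
proof -
  obtain C where C: "\<not> affine_dependent C" "int (card C) = aff_dim T + 1" "T = convex hull C"
    using simplex unfolding simplex_def by auto
  have "vertices = C"
    unfolding vertices_def by (subst C(3)) (simp add: extreme_point_of_convex_hull_affine_independent[OF C(1)])
  with C show "T = convex hull vertices" "\<not> affine_dependent vertices" "int (card vertices) = aff_dim T + 1"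
    by auto
qed

lemma finite_vertices: "finite vertices"
  using vertices_indep by (rule aff_independent_finite)

lemma vertex_notin:
  assumes "v \<in> vertices" shows "v \<notin> affine hull (vertices - {v})"
  using vertices_indep assms by (auto simp: affine_dependent_def)

lemma facet_iff: "f facet_of T \<longleftrightarrow> (\<exists>v\<in>vertices. f = convex hull (vertices - {v}))"
proof -
  have "2 \<le> card vertices" using card_vertices dim by linarith
  then show ?thesis
    by (subst T_eq) (auto simp: facet_of_convex_hull_affine_independent_alt[OF vertices_indep])
qed

lemma apex_facet:
  assumes v: "v \<in> vertices"
  shows "apex T (convex hull (vertices - {v})) = v"
  unfolding apex_def
proof (rule the_equality)
  have "v \<notin> convex hull (vertices - {v})"
    using vertex_notin[OF v] convex_hull_subset_affine_hull by blast
  then show "v extreme_point_of T \<and> v \<notin> convex hull (vertices - {v})"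
    using v by (simp add: vertices_def)
  show "a = v" if "a extreme_point_of T \<and> a \<notin> convex hull (vertices - {v})" for a
    using that hull_inc[of a "vertices - {v}" convex] by (auto simp: vertices_def)
qed


lemma facet_inj: "inj_on (\<lambda>v. convex hull (vertices - {v})) vertices"
  by (rule inj_on_inverseI[where g = "apex T"]) (rule apex_facet)

lemma facet_bij: "bij_betw (\<lambda>v. convex hull (vertices - {v})) vertices {f. f facet_of T}"
  using facet_inj by (auto simp: bij_betw_def facet_iff)

lemma finite_facets [simp]: "finite {f. f facet_of T}"
  using facet_bij finite_vertices bij_betw_finite by blast

lemma card_facets: "int (card {f. f facet_of T}) = aff_dim T + 1"
  using bij_betw_same_card[OF facet_bij] card_vertices by simp

lemma T_props: "convex T" "compact T" "T \<noteq> {}" "bounded T" "closed T"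
proof -
  show c: "compact T"
    by (subst T_eq) (use finite_vertices in \<open>simp add: compact_convex_hull finite_imp_compact\<close>)
  then show "bounded T" "closed T" by (auto simp: compact_imp_bounded compact_imp_closed)
  show "convex T" by (subst T_eq) simp
  show "T \<noteq> {}" using dim by auto
qed

lemma facet_props:
  assumes f: "f facet_of T"
  shows "convex f" "compact f" "f \<noteq> {}" "f \<subseteq> T" "aff_dim f = aff_dim T - 1"
    and "apex T f \<in> T" "apex T f \<in> vertices" "T = convex hull (insert (apex T f) f)"
    and "apex T f \<notin> affine hull f" "f = convex hull (vertices - {apex T f})"
    and "\<And>p. p \<in> f \<Longrightarrow> tangent T = span (insert (apex T f - p) (tangent f))"
proof -
  obtain v where v: "v \<in> vertices" "f = convex hull (vertices - {v})" using f facet_iff by auto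
  then have av: "apex T f = v" by (simp add: apex_facet)
  show "convex f" by (simp add: v)
  show "compact f" using finite_vertices by (simp add: v compact_convex_hull finite_imp_compact)
  show "f \<noteq> {}" "f \<subseteq> T" "aff_dim f = aff_dim T - 1"
    using f by (auto simp: facet_of_def face_of_imp_subset)
  show "apex T f \<in> vertices" unfolding av by (rule v(1))
  show "apex T f \<in> T" unfolding av using v(1) by (simp add: vertices_def extreme_point_of_def)
  have "convex hull (insert v f) = convex hull (insert v (vertices - {v}))"
    unfolding v(2) by (metis hull_insert)
  also have "\<dots> = T" using T_eq v(1) by (simp add: insert_absorb)
  finally show T: "T = convex hull (insert (apex T f) f)" by (simp add: av)
  show "apex T f \<notin> affine hull f"
    unfolding av unfolding v(2) affine_hull_convex_hull by (rule vertex_notin[OF v(1)])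
  show "f = convex hull (vertices - {apex T f})" unfolding av by (rule v(2))
  show "tangent T = span (insert (apex T f - p) (tangent f))" if p: "p \<in> f" for p
  proof -
    have "affine hull T = affine hull (insert (apex T f) f)"
      by (subst T) (rule affine_hull_convex_hull)
    then have "tangent T = tangent (insert (apex T f) f)"
      using tangent_affine_hull[of T] tangent_affine_hull[of "insert (apex T f) f"] by simp
    also have "\<dots> = span ((\<lambda>x. x - p) ` insert (apex T f) f)" using p by (intro tangent_eq_span) auto
    also have "\<dots> = span (insert (apex T f - p) (tangent f))"
      by (simp add: tangent_eq_span[OF p] span_insert span_span)
    finally show ?thesis .
  qed
qed

text \<open>The facet directions and the direction to the apex span the tangent space, so a tangent
  vector orthogonal to the facet is determined by its product with the apex direction; unit length
  leaves the sign.\<close>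

lemma facet_normal_unique:
  assumes f: "f facet_of T" and e: "e \<in> tangent T" "norm e = 1" "\<And>v. v \<in> tangent f \<Longrightarrow> e \<bullet> v = 0"
    and e': "e' \<in> tangent T" "norm e' = 1" "\<And>v. v \<in> tangent f \<Longrightarrow> e' \<bullet> v = 0"
  shows "e' = e \<or> e' = - e"
proof -
  obtain p where p: "p \<in> f" using facet_props(3)[OF f] by auto
  let ?w = "apex T f - p"
  note tT = facet_props(11)[OF f p]
  have key: "u = 0" if u: "u \<in> tangent T" "\<And>v. v \<in> tangent f \<Longrightarrow> u \<bullet> v = 0" "u \<bullet> ?w = 0" for u
  proof -
    have "tangent T \<subseteq> {x. u \<bullet> x = 0}"
      unfolding tT using u by (intro span_minimal) (auto simp: subspace_def inner_simps)
    then show ?thesis using u(1) by auto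
  qed
  have ew: "e \<bullet> ?w \<noteq> 0" using key[OF e(1,3)] e(2) by auto
  define k where "k = (e' \<bullet> ?w) / (e \<bullet> ?w)"
  have "e' - k *\<^sub>R e = 0"
  proof (rule key)
    show "e' - k *\<^sub>R e \<in> tangent T"
      using e(1) e'(1) by (intro subspace_diff subspace_scale subspace_tangent)
    show "(e' - k *\<^sub>R e) \<bullet> v = 0" if "v \<in> tangent f" for v
      using e(3) e'(3) that by (simp add: inner_simps)
    show "(e' - k *\<^sub>R e) \<bullet> ?w = 0" unfolding k_def inner_diff_left inner_scaleR_left using ew by simp
  qed
  then have k: "e' = k *\<^sub>R e" by simp
  then have "\<bar>k\<bar> = 1" using e(2) e'(2) by simp
  then show ?thesis using k by (auto simp: abs_if split: if_splits) 
qed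

text \<open>The normal is the normalised component of p - apex orthogonal to the facet; the length z
  of that component is the height. It is nonzero because the apex is off the affine hull of the
  facet.\<close>

lemma outer_normal_ex:
  assumes f: "f facet_of T"
  shows "\<exists>\<nu> h. 0 < h \<and> \<nu> \<in> tangent T \<and> norm \<nu> = 1 \<and> (\<forall>v\<in>tangent f. \<nu> \<bullet> v = 0) \<and>
    (\<forall>y\<in>f. \<nu> \<bullet> (y - apex T f) = h) \<and> (\<forall>x\<in>T. \<forall>y\<in>f. \<nu> \<bullet> (x - y) \<le> 0)"
proof -
  note fp = facet_props[OF f]
  obtain p where p: "p \<in> f" using fp(3) by auto
  let ?w = "p - apex T f"
  obtain y z where yz: "y \<in> span (tangent f)" "\<And>v. v \<in> span (tangent f) \<Longrightarrow> orthogonal z v" "?w = y + z"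
    using orthogonal_subspace_decomp_exists[of "tangent f" ?w] by metis
  have sp: "span (tangent f) = tangent f" using subspace_tangent by (simp add: span_eq_iff)
  have z0: "z \<noteq> 0"
  proof
    assume "z = 0"
    then have "- ?w \<in> tangent f" using yz sp subspace_tangent[of f] by (simp add: subspace_neg)
    then have "apex T f \<in> affine hull f"
      by (subst mem_affine_hull_iff[OF hull_inc[OF p]]) simp
    with fp(9) show False by simp
  qed
  define \<nu> where "\<nu> = z /\<^sub>R norm z"
  have orth: "\<nu> \<bullet> v = 0" if "v \<in> tangent f" for v
    using yz(2) that sp by (simp add: \<nu>_def orthogonal_def)
  have "\<nu> \<bullet> ?w = \<nu> \<bullet> z" using orth yz(1,3) sp by (simp add: inner_simps)
  also have "\<dots> = norm z" using z0 by (simp add: \<nu>_def dot_square_norm power2_eq_square)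
  finally have nw: "\<nu> \<bullet> ?w = norm z" .
  have h: "\<nu> \<bullet> (y - apex T f) = norm z" if "y \<in> f" for y
    using orth[OF tangentI[OF that p]] nw by (simp add: inner_simps)
  have zw: "z = ?w - y" using yz(3) by simp
  have "z \<in> tangent T"
    unfolding zw
  proof (rule subspace_diff[OF subspace_tangent])
    show "?w \<in> tangent T" using p fp(4,6) by (intro tangentI) auto
    show "y \<in> tangent T" using yz(1) sp tangent_mono_subset[OF fp(4)] by auto
  qed
  then have nT: "\<nu> \<in> tangent T" unfolding \<nu>_def by (intro subspace_scale subspace_tangent)
  have le: "\<nu> \<bullet> (x - y) \<le> 0" if "x \<in> T" "y \<in> f" for x y
  proof -
    have "T \<subseteq> {x. \<nu> \<bullet> x \<le> \<nu> \<bullet> y}"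
    proof (subst fp(8), rule hull_minimal)
      have "\<nu> \<bullet> x = \<nu> \<bullet> y" if "x \<in> f" for x
        using orth[OF tangentI[OF that \<open>y \<in> f\<close>]] by (simp add: inner_simps)
      moreover have "\<nu> \<bullet> apex T f \<le> \<nu> \<bullet> y"
        using h[OF \<open>y \<in> f\<close>] norm_ge_zero[of z] unfolding inner_diff_right by linarith
      ultimately show "insert (apex T f) f \<subseteq> {x. \<nu> \<bullet> x \<le> \<nu> \<bullet> y}" by auto
      show "convex {x. \<nu> \<bullet> x \<le> \<nu> \<bullet> y}" by (rule convex_halfspace_le)
    qed
    then show ?thesis using that by (auto simp: inner_simps)
  qed
  have "norm \<nu> = 1" using z0 by (simp add: \<nu>_def)
  with z0 nT orth h le show ?thesis by (intro exI[of _ \<nu>] exI[of _ "norm z"]) auto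
qed

lemma outer_normal_props:
  assumes f: "f facet_of T"
  defines "\<nu> \<equiv> outer_normal T f"
  shows "0 < height T f" "\<nu> \<in> tangent T" "norm \<nu> = 1" "\<And>v. v \<in> tangent f \<Longrightarrow> \<nu> \<bullet> v = 0"
    "\<And>y. y \<in> f \<Longrightarrow> \<nu> \<bullet> (y - apex T f) = height T f"
    "\<And>x y. \<lbrakk>x \<in> T; y \<in> f\<rbrakk> \<Longrightarrow> \<nu> \<bullet> (x - y) \<le> 0"
proof -
  obtain e h where e: "0 < h" "e \<in> tangent T" "norm e = 1" "\<And>v. v \<in> tangent f \<Longrightarrow> e \<bullet> v = 0"
    "\<And>y. y \<in> f \<Longrightarrow> e \<bullet> (y - apex T f) = h" "\<And>x y. \<lbrakk>x \<in> T; y \<in> f\<rbrakk> \<Longrightarrow> e \<bullet> (x - y) \<le> 0"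
    using outer_normal_ex[OF f] by blast
  note fp = facet_props[OF f]
  have "outer_normal T f = e"
    unfolding outer_normal_def
  proof (rule the_equality)
    show "e \<in> tangent T \<and> norm e = 1 \<and> (\<forall>x\<in>T. \<forall>y\<in>f. e \<bullet> (x - y) \<le> 0)" using e by blast
    fix e' assume e': "e' \<in> tangent T \<and> norm e' = 1 \<and> (\<forall>x\<in>T. \<forall>y\<in>f. e' \<bullet> (x - y) \<le> 0)"
    obtain p where p: "p \<in> f" using fp(3) by auto
    \<comment> \<open>The one-sided condition in \<open>outer_normal\<close> holds for two points of
      f in both orders, which forces orthogonality to f. The apex then decides the sign.\<close>
    have "tangent f \<subseteq> {x. e' \<bullet> x = 0}"
      unfolding tangent_def
    proof (rule span_minimal)
      have "e' \<bullet> (x - y) = 0" if "x \<in> f" "y \<in> f" for x y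
      proof -
        have "e' \<bullet> (x - y) \<le> 0" "e' \<bullet> (y - x) \<le> 0" using e' that fp(4) by blast+
        then show ?thesis by (simp add: inner_diff_right)
      qed
      then show "{x - y |x y. x \<in> f \<and> y \<in> f} \<subseteq> {x. e' \<bullet> x = 0}" by blast
      show "subspace {x. e' \<bullet> x = 0}" by (rule subspace_hyperplane)
    qed
    then have "e' = e \<or> e' = - e"
      using facet_normal_unique[OF f e(2,3,4)] e' by blast
    moreover have "e' \<bullet> (p - apex T f) \<ge> 0"
    proof -
      have "e' \<bullet> (apex T f - p) \<le> 0" using e' p fp(6) by blast
      then show ?thesis by (simp add: inner_diff_right)
    qed
    ultimately show "e' = e" using e(1) e(5)[OF p] by auto
  qed
  then have n: "\<nu> = e" by (simp add: \<nu>_def)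
  have "(SOME p. p \<in> f) \<in> f" using fp(3) by (simp add: some_in_eq)
  then have "height T f = h" using e(5) n by (simp add: height_def \<nu>_def)
  with n e show "0 < height T f" "\<nu> \<in> tangent T" "norm \<nu> = 1" "\<And>v. v \<in> tangent f \<Longrightarrow> \<nu> \<bullet> v = 0"
    "\<And>y. y \<in> f \<Longrightarrow> \<nu> \<bullet> (y - apex T f) = height T f"
    "\<And>x y. \<lbrakk>x \<in> T; y \<in> f\<rbrakk> \<Longrightarrow> \<nu> \<bullet> (x - y) \<le> 0"
    by auto
qed

lemma normal_const_on_facet:
  "\<lbrakk>f facet_of T; x \<in> f; y \<in> f\<rbrakk> \<Longrightarrow> outer_normal T f \<bullet> x = outer_normal T f \<bullet> y"
  using outer_normal_props(4)[OF _ tangentI, of f x y] by (simp add: inner_simps)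

lemma bary_eq: "\<lbrakk>f facet_of T; p \<in> f\<rbrakk> \<Longrightarrow> bary T f x = (outer_normal T f \<bullet> (p - x)) / height T f"
  using normal_const_on_facet[of f "SOME p. p \<in> f" p] someI[of "\<lambda>p. p \<in> f" p]
  by (simp add: bary_def inner_simps)

lemma bary_facet: "\<lbrakk>f facet_of T; p \<in> f\<rbrakk> \<Longrightarrow> bary T f p = 0"
  by (simp add: bary_eq)

lemma bary_apex: assumes f: "f facet_of T" shows "bary T f (apex T f) = 1"
proof -
  obtain p where p: "p \<in> f" using facet_props(3)[OF f] by auto
  show ?thesis using outer_normal_props(1,5)[OF f] p by (simp add: bary_eq[OF f p])
qed

lemma bary_nonneg: assumes f: "f facet_of T" and x: "x \<in> T" shows "0 \<le> bary T f x"
proof -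
  obtain p where p: "p \<in> f" using facet_props(3)[OF f] by auto
  show ?thesis using outer_normal_props(1,6)[OF f] x p
    by (simp add: bary_eq[OF f p] inner_diff_right)
qed

text \<open>\<open>bary T f\<close> is affine, equal to 1 at the opposite vertex and to 0 at the
  other vertices, so it returns the affine coordinate of the opposite vertex.\<close>

lemma bary_sum:
  assumes x: "x \<in> affine hull T"
  shows "(\<Sum>f | f facet_of T. bary T f x) = 1" "(\<Sum>f | f facet_of T. bary T f x *\<^sub>R apex T f) = x"
proof -
  let ?C = vertices
  have "x \<in> affine hull ?C" using x T_eq affine_hull_convex_hull by metis
  then obtain u where u: "sum u ?C = 1" "(\<Sum>v\<in>?C. u v *\<^sub>R v) = x"
    unfolding affine_hull_finite[OF finite_vertices] by auto
  have b: "bary T f x = u (apex T f)" if f: "f facet_of T" for f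
  proof -
    note fp = facet_props[OF f]
    obtain p where p: "p \<in> f" using fp(3) by auto
    have "bary T f x = (\<Sum>v\<in>?C. u v * bary T f v)"
    proof -
      have "outer_normal T f \<bullet> (p - x) = (\<Sum>v\<in>?C. u v * (outer_normal T f \<bullet> (p - v)))"
        unfolding u(2)[symmetric] inner_diff_right inner_sum_right right_diff_distrib sum_subtractf
        by (simp add: sum_distrib_right[symmetric] u(1))
      then show ?thesis by (simp add: bary_eq[OF f p] sum_divide_distrib)
    qed
    also have "\<dots> = (\<Sum>v\<in>?C. if v = apex T f then u v else 0)"
    proof (rule sum.cong[OF refl])
      fix v assume v: "v \<in> ?C"
      show "u v * bary T f v = (if v = apex T f then u v else 0)"
      proof (cases "v = apex T f")
        case False
        then have "v \<in> f" using v by (subst fp(10)) (auto intro: hull_inc)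
        then show ?thesis using False bary_facet[OF f] by simp
      qed (simp add: bary_apex[OF f])
    qed
    also have "\<dots> = u (apex T f)" using fp(7) finite_vertices by simp
    finally show ?thesis .
  qed
  have r: "(\<Sum>f | f facet_of T. g (apex T f)) = (\<Sum>v\<in>?C. g v)" for g :: "'a \<Rightarrow> 'b::real_vector"
    using sum.reindex_bij_betw[OF facet_bij, of "\<lambda>f. g (apex T f)"] by (simp add: apex_facet)
  show "(\<Sum>f | f facet_of T. bary T f x) = 1"
    using r[of u] u(1) by (simp add: b)
  show "(\<Sum>f | f facet_of T. bary T f x *\<^sub>R apex T f) = x"
    using r[of "\<lambda>v. u v *\<^sub>R v"] u(2) by (simp add: b)
qed

text \<open>The closed form of \<open>RT0_basis\<close>: a field radial from the opposite vertex,
  hence tangential to every facet through that vertex, and scaled by the height to have unit normal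
  component on f.\<close>

definition shape :: "'a set \<Rightarrow> 'a \<Rightarrow> 'a" where
  "shape f x = (1 / height T f) *\<^sub>R (x - apex T f)"

lemma RT0_iff: "v \<in> RT0 T \<longleftrightarrow> (\<exists>a b. v = (\<lambda>x. a + b *\<^sub>R x)) \<and> (\<forall>x\<in>T. v x \<in> tangent T)"
  by (auto simp: RT0_def fun_eq_iff)

lemma RT0I: "\<lbrakk>\<And>x. v x = a + b *\<^sub>R x; \<And>x. x \<in> T \<Longrightarrow> v x \<in> tangent T\<rbrakk> \<Longrightarrow> v \<in> RT0 T"
  unfolding RT0_def by blast

lemma RT0E:
  assumes "v \<in> RT0 T"
  obtains a b where "\<And>x. v x = a + b *\<^sub>R x" "\<And>x. x \<in> T \<Longrightarrow> v x \<in> tangent T"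
  using assms unfolding RT0_def by blast

lemma RT0_subspace: "subspace (RT0 T)"
proof (rule subspaceI)
  show "0 \<in> RT0 T" by (rule RT0I[of _ 0 0]) (auto simp: subspace_0 subspace_tangent)
  show "v + w \<in> RT0 T" if vw: "v \<in> RT0 T" "w \<in> RT0 T" for v w
  proof -
    obtain a b where v: "\<And>x. v x = a + b *\<^sub>R x" "\<And>x. x \<in> T \<Longrightarrow> v x \<in> tangent T"
      using vw(1) by (rule RT0E) blast
    obtain a' b' where w: "\<And>x. w x = a' + b' *\<^sub>R x" "\<And>x. x \<in> T \<Longrightarrow> w x \<in> tangent T"
      using vw(2) by (rule RT0E) blast
    show ?thesis
    proof (rule RT0I)
      show "(v + w) x = (a + a') + (b + b') *\<^sub>R x" for x by (simp add: v(1) w(1) algebra_simps)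
      show "(v + w) x \<in> tangent T" if "x \<in> T" for x
        using v(2)[OF that] w(2)[OF that] by (simp add: subspace_add subspace_tangent)
    qed
  qed
  show "c *\<^sub>R v \<in> RT0 T" if vw: "v \<in> RT0 T" for v c
  proof -
    obtain a b where v: "\<And>x. v x = a + b *\<^sub>R x" "\<And>x. x \<in> T \<Longrightarrow> v x \<in> tangent T"
      using vw by (rule RT0E) blast
    show ?thesis
    proof (rule RT0I)
      show "(c *\<^sub>R v) x = c *\<^sub>R a + (c * b) *\<^sub>R x" for x
        by (simp add: v(1) scaleR_fun_def algebra_simps)
      show "(c *\<^sub>R v) x \<in> tangent T" if "x \<in> T" for x
        using v(2)[OF that] by (simp add: scaleR_fun_def subspace_scale subspace_tangent)
    qed
  qed
qed

lemma two_points: obtains x y where "x \<in> T" "y \<in> T" "x \<noteq> y"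
proof -
  have "\<not> (\<exists>a. T \<subseteq> {a})" using dim aff_dim_subset[of T "{_}"] by fastforce
  then show thesis using that T_props(3) by blast
qed

text \<open>Elements of \<open>RT0 T\<close> are maps of the ambient space; two distinct points of
  the cell already recover both coefficients of a + b x.\<close>

lemma RT0_eqI:
  assumes "v \<in> RT0 T" "w \<in> RT0 T" and eq: "\<And>x. x \<in> T \<Longrightarrow> v x = w x"
  shows "v = w"
proof -
  obtain a b a' b' where v: "\<And>x. v x = a + b *\<^sub>R x" and w: "\<And>x. w x = a' + b' *\<^sub>R x"
    using assms by (auto simp: RT0_def)
  obtain x y where xy: "x \<in> T" "y \<in> T" "x \<noteq> y" by (rule two_points)
  have e: "a + b *\<^sub>R x = a' + b' *\<^sub>R x" "a + b *\<^sub>R y = a' + b' *\<^sub>R y"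
    using eq xy v w by auto
  then have "(a + b *\<^sub>R x) - (a + b *\<^sub>R y) = (a' + b' *\<^sub>R x) - (a' + b' *\<^sub>R y)" by simp
  then have "(b - b') *\<^sub>R (x - y) = 0" by (simp add: algebra_simps)
  then have "b = b'" using xy by simp
  with e have "a = a'" by simp
  with \<open>b = b'\<close> show ?thesis by (auto simp: v w)
qed

lemma normal_comp_eq:
  assumes v: "v \<in> RT0 T" and f: "f facet_of T" and x: "x \<in> f"
  shows "normal_comp T f v = v x \<bullet> outer_normal T f"
proof -
  obtain a b where ab: "\<And>x. v x = a + b *\<^sub>R x" using v by (auto simp: RT0_def)
  have "v y \<bullet> outer_normal T f = v x \<bullet> outer_normal T f" if "y \<in> f" for y
    using normal_const_on_facet[OF f that x] by (simp add: ab inner_simps inner_commute)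
  then show ?thesis unfolding normal_comp_def
    by (intro the_equality) (blast, metis x)
qed

lemma normal_comp_linear:
  assumes f: "f facet_of T"
  shows "\<lbrakk>v \<in> RT0 T; w \<in> RT0 T\<rbrakk> \<Longrightarrow> normal_comp T f (v + w) = normal_comp T f v + normal_comp T f w"
    and "v \<in> RT0 T \<Longrightarrow> normal_comp T f (c *\<^sub>R v) = c * normal_comp T f v"
    and "normal_comp T f 0 = 0"
proof -
  obtain x where x: "x \<in> f" using facet_props(3)[OF f] by auto
  note n = normal_comp_eq[OF _ f x]
  show "\<lbrakk>v \<in> RT0 T; w \<in> RT0 T\<rbrakk> \<Longrightarrow> normal_comp T f (v + w) = normal_comp T f v + normal_comp T f w"
    using n subspace_add[OF RT0_subspace] by (simp add: inner_simps)
  show "v \<in> RT0 T \<Longrightarrow> normal_comp T f (c *\<^sub>R v) = c * normal_comp T f v"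
    using n subspace_scale[OF RT0_subspace] by (simp add: scaleR_fun_def)
  show "normal_comp T f 0 = 0" using n subspace_0[OF RT0_subspace] by simp
qed

lemma shape_combination:
  "(\<lambda>x. \<Sum>f | f facet_of T. k f *\<^sub>R shape f x)
    = (\<lambda>x. (- (\<Sum>f | f facet_of T. (k f / height T f) *\<^sub>R apex T f)) + (\<Sum>f | f facet_of T. k f / height T f) *\<^sub>R x)"
  by (rule ext) (simp add: shape_def scaleR_diff_right sum_subtractf scaleR_sum_left)

lemma shape_combination_RT0: "(\<lambda>x. \<Sum>f | f facet_of T. k f *\<^sub>R shape f x) \<in> RT0 T"
  unfolding RT0_iff
proof (intro conjI ballI)
  show "\<exists>a b. (\<lambda>x. \<Sum>f | f facet_of T. k f *\<^sub>R shape f x) = (\<lambda>x. a + b *\<^sub>R x)"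
    by (intro exI) (rule shape_combination)
  fix x assume "x \<in> T"
  then show "(\<Sum>f | f facet_of T. k f *\<^sub>R shape f x) \<in> tangent T"
    unfolding shape_def
    by (intro subspace_sum subspace_scale subspace_tangent tangentI) (auto simp: facet_props(6))
qed

text \<open>The normal component on f is that of v x plus b times the distance of x from f. The
  first part sums to v x; the second sums to b (x - x) by the barycentric expansion of x.\<close>

lemma RT0_expand:
  assumes v: "v \<in> RT0 T"
  shows "v = (\<lambda>x. \<Sum>f | f facet_of T. normal_comp T f v *\<^sub>R shape f x)"
proof (rule RT0_eqI[OF v shape_combination_RT0])
  fix x assume x: "x \<in> T"
  then have xa: "x \<in> affine hull T" by (rule hull_inc)
  obtain a b where ab: "\<And>x. v x = a + b *\<^sub>R x" using v by (auto simp: RT0_def)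
  let ?F = "{f. f facet_of T}"
  have vt: "v x \<in> tangent T" using v x by (auto simp: RT0_def)
  have n: "normal_comp T f v / height T f = (v x \<bullet> outer_normal T f) / height T f + b * bary T f x"
    if f: "f facet_of T" for f
  proof -
    obtain p where p: "p \<in> f" using facet_props(3)[OF f] by auto
    have "normal_comp T f v = v x \<bullet> outer_normal T f + b * (outer_normal T f \<bullet> (p - x))"
      unfolding normal_comp_eq[OF v f p] by (simp add: ab inner_simps inner_commute algebra_simps)
    then show ?thesis by (simp add: bary_eq[OF f p] add_divide_distrib)
  qed
  \<comment> \<open>the derivative of the barycentric expansion of the identity in the direction \<open>v x\<close>\<close>
  have d: "(\<Sum>f\<in>?F. (v x \<bullet> outer_normal T f / height T f) *\<^sub>R (x - apex T f)) = v x"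
  proof -
    have xv: "x + v x \<in> affine hull T" using vt by (simp add: mem_affine_hull_iff[OF xa])
    have bd: "bary T f x - bary T f (x + v x) = v x \<bullet> outer_normal T f / height T f" for f
      by (simp add: bary_def inner_simps diff_divide_distrib[symmetric] inner_commute)
    have "(\<Sum>f\<in>?F. (v x \<bullet> outer_normal T f / height T f) *\<^sub>R (x - apex T f))
      = (\<Sum>f\<in>?F. bary T f x - bary T f (x + v x)) *\<^sub>R x
        - (\<Sum>f\<in>?F. (bary T f x - bary T f (x + v x)) *\<^sub>R apex T f)"
      by (simp add: bd scaleR_diff_right sum_subtractf scaleR_sum_left)
    also have "\<dots> = v x"
      using bary_sum[OF xa] bary_sum[OF xv] by (simp add: sum_subtractf scaleR_diff_left)
    finally show ?thesis .
  qed
  have "(\<Sum>f\<in>?F. normal_comp T f v *\<^sub>R shape f x)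
    = (\<Sum>f\<in>?F. (normal_comp T f v / height T f) *\<^sub>R (x - apex T f))"
    by (simp add: shape_def)
  also have "\<dots> = (\<Sum>f\<in>?F. (v x \<bullet> outer_normal T f / height T f + b * bary T f x) *\<^sub>R (x - apex T f))"
    by (intro sum.cong) (auto simp: n)
  also have "\<dots> = v x + b *\<^sub>R ((\<Sum>f\<in>?F. bary T f x) *\<^sub>R x - (\<Sum>f\<in>?F. bary T f x *\<^sub>R apex T f))"
    unfolding scaleR_add_left sum.distrib d
    by (simp add: scaleR_diff_right sum_subtractf scaleR_sum_left scaleR_sum_right)
  also have "\<dots> = v x" using bary_sum[OF xa] by simp
  finally show "v x = (\<Sum>f\<in>?F. normal_comp T f v *\<^sub>R shape f x)" by simp
qed

lemma shape_normal:
  assumes f: "f facet_of T" and g: "g facet_of T" and x: "x \<in> g"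
  shows "shape f x \<bullet> outer_normal T g = (if f = g then 1 else 0)"
proof (cases "f = g")
  case True
  then show ?thesis using outer_normal_props(1,5)[OF g] x by (simp add: shape_def inner_commute)
next
  case False
  have "apex T f \<noteq> apex T g"
  proof
    assume eq: "apex T f = apex T g"
    have "f = g" by (rule trans[OF facet_props(10)[OF f, unfolded eq] facet_props(10)[OF g, symmetric]])
    with False show False by simp
  qed
  then have "apex T f \<in> g"
    using facet_props(7)[OF f] by (subst facet_props(10)[OF g]) (intro hull_inc, simp)
  then show ?thesis using False normal_const_on_facet[OF g x]
    by (simp add: shape_def inner_simps inner_commute)
qed

lemma shape_combination_normal:
  assumes g: "g facet_of T"
  shows "normal_comp T g (\<lambda>x. \<Sum>f | f facet_of T. k f *\<^sub>R shape f x) = k g"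
proof -
  obtain x where x: "x \<in> g" using facet_props(3)[OF g] by auto
  have "(\<Sum>f | f facet_of T. k f *\<^sub>R shape f x) \<bullet> outer_normal T g = (\<Sum>f | f facet_of T. if f = g then k f else 0)"
    unfolding inner_sum_left by (intro sum.cong) (auto simp: shape_normal[OF _ g x])
  also have "\<dots> = k g" using g by simp
  finally show ?thesis using normal_comp_eq[OF shape_combination_RT0 g x] by simp
qed

lemma RT0_normal_eqI:
  assumes "v \<in> RT0 T" "w \<in> RT0 T" "\<And>f. f facet_of T \<Longrightarrow> normal_comp T f v = normal_comp T f w"
  shows "v = w"
  by (subst RT0_expand[OF assms(1)], subst RT0_expand[OF assms(2)]) (simp add: assms(3))

lemma RT0_basis_eq:
  assumes f: "f facet_of T" shows "RT0_basis T f = shape f"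
proof -
  have s: "shape f = (\<lambda>x. \<Sum>g | g facet_of T. (if g = f then 1 else 0) *\<^sub>R shape g x)"
    using f by (intro ext) (simp add: if_distrib[of "\<lambda>c. c *\<^sub>R _"] cong: if_cong)
  have R: "shape f \<in> RT0 T" by (subst s) (rule shape_combination_RT0)
  have n: "normal_comp T g (shape f) = (if g = f then 1 else 0)" if "g facet_of T" for g
    by (subst s) (rule shape_combination_normal[OF that])
  show ?thesis unfolding RT0_basis_def
  proof (rule the_equality)
    show "shape f \<in> RT0 T \<and> (\<forall>g. g facet_of T \<longrightarrow> normal_comp T g (shape f) = (if g = f then 1 else 0))"
      using R n by blast
    fix v assume v: "v \<in> RT0 T \<and> (\<forall>g. g facet_of T \<longrightarrow> normal_comp T g v = (if g = f then 1 else 0))"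
    show "v = shape f"
    proof (rule RT0_normal_eqI[OF conjunct1[OF v] R])
      show "normal_comp T g v = normal_comp T g (shape f)" if "g facet_of T" for g
        using conjunct2[OF v, rule_format, OF that] n[OF that] by simp
    qed
  qed
qed

lemma tangential_div_RT0:
  assumes v: "v \<in> RT0 T"
  shows "tangential_div T v x = of_int (aff_dim T) * (\<Sum>f | f facet_of T. normal_comp T f v / height T f)"
proof -
  let ?b = "\<Sum>f | f facet_of T. normal_comp T f v / height T f"
  obtain a where ab: "v = (\<lambda>x. a + ?b *\<^sub>R x)"
    using trans[OF RT0_expand[OF v] shape_combination] by (rule that)
  have "vector_derivative (\<lambda>t. v (x + t *\<^sub>R e)) (at 0) = ?b *\<^sub>R e" for e
  proof (rule vector_derivative_at)
    have "((\<lambda>t. a + ?b *\<^sub>R (x + t *\<^sub>R e)) has_vector_derivative (0 + ?b *\<^sub>R (0 + 1 *\<^sub>R e))) (at 0)"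
      by (auto intro!: derivative_eq_intros simp del: scaleR_one)
    then show "((\<lambda>t. v (x + t *\<^sub>R e)) has_vector_derivative ?b *\<^sub>R e) (at 0)"
      by (subst ab) simp
  qed
  then have "tangential_div T v x = (\<Sum>e\<in>onb (tangent T). ?b * (e \<bullet> e))"
    unfolding tangential_div_def by simp
  also have "\<dots> = (\<Sum>e\<in>onb (tangent T). ?b)"
    using onb(2)[OF subspace_tangent[of T]] by (intro sum.cong) (auto simp: orthonormal_inner)
  also have "\<dots> = of_int (aff_dim T) * ?b"
    using dim card_onb_tangent[OF T_props(3)] by simp
  finally show ?thesis .
qed

lemma facet_measure:
  assumes f: "f facet_of T"
  shows "of_int (aff_dim T) * measure (flat_measure T) T = height T f * measure (flat_measure f) f"
proof -
  note fp = facet_props[OF f] and np = outer_normal_props[OF f]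
  have "real (nat (aff_dim T)) * measure (flat_measure T) T = height T f * measure (flat_measure f) f"
  proof (rule flat_measure_pyramid[OF fp(1,3,2) _ _ _ np(1) _ fp(8)])
    show "norm (- outer_normal T f) = 1" using np(3) by simp
    show "- outer_normal T f \<bullet> v = 0" if "v \<in> tangent f" for v using np(4)[OF that] by simp
    show "- outer_normal T f \<bullet> (apex T f - y) = height T f" if "y \<in> f" for y
      using np(5)[OF that] by (simp add: inner_simps)
    show "nat (aff_dim T) = nat (aff_dim f) + 1" using fp(5) dim by linarith
    show "- outer_normal T f \<in> tangent T" using np(2) by (simp add: subspace_neg subspace_tangent)
  qed
  then show ?thesis using dim by simp
qed

text \<open>The divergence theorem on a simplex. In the explicit basis it splits into one pyramid
  formula per facet, \<open>facet_measure\<close>.\<close>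

lemma integral_div_RT0:
  assumes v: "v \<in> RT0 T"
  shows "measure (flat_measure T) T * tangential_div T v x
    = (\<Sum>f | f facet_of T. measure (flat_measure f) f * normal_comp T f v)"
proof -
  have "measure (flat_measure T) T * tangential_div T v x
    = (\<Sum>f | f facet_of T. (of_int (aff_dim T) * measure (flat_measure T) T) / height T f * normal_comp T f v)"
    unfolding tangential_div_RT0[OF v] by (simp add: sum_distrib_left algebra_simps)
  also have "\<dots> = (\<Sum>f | f facet_of T. measure (flat_measure f) f * normal_comp T f v)"
  proof (rule sum.cong[OF refl])
    fix f assume "f \<in> {f. f facet_of T}"
    then have f: "f facet_of T" by simp
    show "(of_int (aff_dim T) * measure (flat_measure T) T) / height T f * normal_comp T f v
      = measure (flat_measure f) f * normal_comp T f v"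
      unfolding facet_measure[OF f] using outer_normal_props(1)[OF f] by simp
  qed
  finally show ?thesis .
qed

end

section \<open>Null boundaries, positivity and integrability for flat measures\<close>

lemma flat_measure_frontier_null:
  assumes T: "polyhedron T" "T \<noteq> {}"
  shows "T - rel_interior T \<in> null_sets (flat_measure T)"
proof -
  have "affine hull f \<in> null_sets (flat_measure T)" if "f facet_of T" for f
    using that by (intro flat_measure_null_affine[OF T(2)]) (auto simp: facet_of_def)
  moreover have "finite {f. f facet_of T}" using T(1) by (rule finite_polyhedron_facets)
  ultimately have 1: "(\<Union>f\<in>{f. f facet_of T}. affine hull f) \<in> null_sets (flat_measure T)"
    by (intro null_sets_UN') (auto intro: countable_finite)
  have 2: "T - rel_interior T \<subseteq> (\<Union>f\<in>{f. f facet_of T}. affine hull f)"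
    unfolding rel_boundary_of_polyhedron[OF T(1)] by (auto intro: hull_inc)
  have "T - rel_interior T \<in> sets (flat_measure T)"
  proof -
    have "closed (T - rel_interior T)"
      unfolding rel_boundary_of_polyhedron[OF T(1)] using finite_polyhedron_facets[OF T(1)] T(1)
      by (intro closed_Union) (auto simp: facet_of_imp_face_of face_of_polyhedron_polyhedron polyhedron_imp_closed)
    then show ?thesis by (simp add: borel_closed)
  qed
  then show ?thesis using null_sets_subset[OF 1 _ 2] by simp
qed

lemma rel_interior_borel [measurable]: "rel_interior S \<in> sets borel" for S :: "'a::euclidean_space set"
proof -
  obtain U where U: "open U" "rel_interior S = affine hull S \<inter> U"
    using openin_rel_interior[of S] unfolding openin_open by auto
  show ?thesis unfolding U(2)
    by (rule sets.Int) (rule borel_closed[OF closed_affine_hull], rule borel_open[OF U(1)])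
qed

lemma flat_measure_inter_affine_hull:
  assumes S: "S \<noteq> {}" and A: "A \<in> sets borel"
  shows "emeasure (flat_measure S) (A \<inter> affine hull S) = emeasure (flat_measure S) A"
proof (rule emeasure_eq_AE)
  have "- (affine hull S) \<in> null_sets (flat_measure S)"
    using flat_measure_affine_hull_compl[OF S] by (auto intro!: null_setsI borel_comp borel_closed closed_affine_hull)
  then show "AE x in flat_measure S. (x \<in> A \<inter> affine hull S) = (x \<in> A)"
    by (rule AE_I') auto
qed (use A in \<open>auto intro: borel_closed closed_affine_hull\<close>)

lemma flat_measure_rel_interior_pos:
  assumes T: "rel_interior T \<noteq> {}"
  shows "0 < emeasure (flat_measure T) (rel_interior T)"
proof -
  obtain z where z: "z \<in> rel_interior T" using T by auto
  then obtain e where e: "0 < e" "ball z e \<inter> affine hull T \<subseteq> T" by (auto simp: mem_rel_interior_ball)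
  have "ball z e \<inter> affine hull T \<subseteq> rel_interior T"
    using e(2) by (subst Int_commute, intro rel_interior_maximal openin_open_Int) (auto simp: Int_commute)
  then have le: "emeasure (flat_measure T) (ball z e \<inter> affine hull T) \<le> emeasure (flat_measure T) (rel_interior T)"
    by (rule emeasure_mono) simp
  have ne: "T \<noteq> {}" using T by auto
  obtain K where K: "0 < K" "\<And>p r. \<lbrakk>p \<in> affine hull T; 0 < r\<rbrakk> \<Longrightarrow>
       emeasure (flat_measure T) (ball p r) = ennreal (K * r ^ nat (aff_dim T))"
    by (rule flat_measure_ball[OF ne]) (rule that)
  have "z \<in> affine hull T" using z subsetD[OF rel_interior_subset z] by (intro hull_inc)
  then have "emeasure (flat_measure T) (ball z e \<inter> affine hull T) = ennreal (K * e ^ nat (aff_dim T))"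
    using flat_measure_inter_affine_hull[OF ne, of "ball z e"] K(2)[of z e] e(1) by simp
  moreover have "0 < K * e ^ nat (aff_dim T)" using K(1) e(1) by simp
  ultimately show ?thesis using le by (simp add: less_le_trans[of 0 "ennreal (K * e ^ nat (aff_dim T))"])
qed

lemma measure_rel_interior:
  assumes T: "polyhedron T" "T \<noteq> {}"
  shows "measure (flat_measure T) (rel_interior T) = measure (flat_measure T) T"
proof -
  have "emeasure (flat_measure T) (rel_interior T) = emeasure (flat_measure T) T"
  proof (rule emeasure_eq_AE)
    show "AE x in flat_measure T. (x \<in> rel_interior T) = (x \<in> T)"
      using flat_measure_frontier_null[OF T] by (rule AE_I') (use rel_interior_subset in auto)
  qed (use T in \<open>auto intro: borel_closed polyhedron_imp_closed\<close>)
  then show ?thesis by (simp add: measure_def)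
qed

lemma set_integrable_flat:
  fixes g :: "'a::euclidean_space \<Rightarrow> real"
  assumes A: "bounded A" "A \<in> sets borel" and S: "S \<noteq> {}" and g: "continuous_on UNIV g"
  shows "set_integrable (flat_measure S) A g"
proof -
  have "bounded (g ` closure A)"
    using A g by (intro compact_imp_bounded compact_continuous_image continuous_on_subset[OF g])
      (auto simp: compact_closure)
  then obtain B where B: "\<And>x. x \<in> A \<Longrightarrow> norm (g x) \<le> B"
    unfolding bounded_iff using closure_subset by (metis image_eqI subsetD)
  show ?thesis
    unfolding set_integrable_def
  proof (rule integrableI_bounded_set_indicator)
    show "g \<in> borel_measurable (flat_measure S)"
      using borel_measurable_continuous_onI[OF g] by simp
    show "emeasure (flat_measure S) A < \<infinity>" using flat_measure_bounded_finite[OF S A(1)] .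
  qed (use A B in auto)
qed

section \<open>Inverse permeability\<close>

lemma Cauchy_Schwarz_spd:
  assumes V: "subspace V" and k: "spd_tensor V k" and x: "x \<in> V" and y: "y \<in> V"
  shows "(k x \<bullet> y)\<^sup>2 \<le> (k x \<bullet> x) * (k y \<bullet> y)"
proof -
  have "linear k" using k by (simp add: spd_tensor_def)
  interpret spd_form V "\<lambda>x y. k x \<bullet> y"
  proof
    show "\<exists>F. finite F \<and> V \<subseteq> span F"
      using onb[OF V] orthonormal_finite by (intro exI[of _ "onb V"]) auto
    show "k x \<bullet> y = k y \<bullet> x" if "x \<in> V" "y \<in> V" for x y
      using k that unfolding spd_tensor_def by (metis inner_commute)
    show "0 < k x \<bullet> x" if "x \<in> V" "x \<noteq> 0" for x
      using k that unfolding spd_tensor_def by blast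
  qed (use \<open>linear k\<close> V in \<open>simp_all add: linear_add linear_scale inner_add_left\<close>)
  show ?thesis using Cauchy_Schwarz[OF x y] .
qed

text \<open>\<open>inv_into V k\<close> is meaningful only on V. Expansion in an orthonormal basis
  of V extends it to a linear map of the whole space, which supplies the continuity that
  integrability asks for.\<close>

lemma spd_inverse:
  assumes V: "subspace V" and k: "spd_tensor V k"
  obtains G where "linear G" "\<And>x. x \<in> V \<Longrightarrow> inv_into V k x = G x" "\<And>x. x \<in> V \<Longrightarrow> G x \<in> V"
    "\<And>x. x \<in> V \<Longrightarrow> k (G x) = x"
proof -
  have lin: "linear k" and sub: "k ` V \<subseteq> V" using k by (auto simp: spd_tensor_def)
  have inj: "inj_on k V"
  proof (subst linear_inj_on_iff_eq_0[OF lin V], intro ballI impI)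
    fix x assume "x \<in> V" "k x = 0"
    then show "x = 0" using k by (force simp: spd_tensor_def)
  qed
  have "dim (k ` V) = dim V"
    by (intro dim_image_eq[OF lin]) (unfold span_eq_iff[THEN iffD2, OF V], rule inj)
  then have im: "k ` V = V"
    using sub V lin by (intro subspace_dim_equal) (auto simp: linear_subspace_image)
  let ?i = "inv_into V k"
  have i: "?i x \<in> V" "k (?i x) = x" if "x \<in> V" for x
    using that im by (auto simp: inv_into_into f_inv_into_f)
  have i_eq: "?i y = x" if "x \<in> V" "k x = y" for x y
    using that inj by auto
  have iadd: "?i (x + y) = ?i x + ?i y" if "x \<in> V" "y \<in> V" for x y
    using that i V lin by (intro i_eq) (auto simp: subspace_add linear_add)
  have iscale: "?i (c *\<^sub>R x) = c *\<^sub>R ?i x" if "x \<in> V" for c x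
    using that i V lin by (intro i_eq) (auto simp: subspace_scale linear_scale)
  note o = onb[OF V]
  define G where "G x = (\<Sum>e\<in>onb V. (x \<bullet> e) *\<^sub>R ?i e)" for x
  have sum: "?i (\<Sum>e\<in>E. c e *\<^sub>R e) = (\<Sum>e\<in>E. c e *\<^sub>R ?i e)" if "finite E" "E \<subseteq> V" for E c
    using that
  proof (induction E rule: finite_induct)
    case empty
    then show ?case using iscale[of 0 0] V by (simp add: subspace_0)
  next
    case (insert e E)
    then show ?case using V
      by (simp add: iadd iscale subspace_sum subspace_scale subset_iff)
  qed
  have "linear G"
    unfolding G_def by (intro linearI) (simp_all add: inner_simps scaleR_add_left sum.distrib scaleR_sum_right)
  moreover have "?i x = G x" if "x \<in> V" for x
    using sum[OF orthonormal_finite[OF o(2)] o(1), of "\<lambda>e. x \<bullet> e"] orthonormal_expand[OF o(2), of x] that o(3)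
    by (simp add: G_def)
  ultimately show thesis using that i by metis
qed


text \<open>The upper bound compares l |G y|^2 with |G y| |y|. The lower bound is Cauchy--Schwarz in
  the form of k for G y and y, which yields |y|^4 \<le> (G y . y) (k y . y).\<close>

lemma spd_inverse_form:
  assumes V: "subspace V" and k: "spd_tensor V k"
    and G: "\<And>x. x \<in> V \<Longrightarrow> G x \<in> V" "\<And>x. x \<in> V \<Longrightarrow> k (G x) = x"
  shows "\<lbrakk>x \<in> V; y \<in> V\<rbrakk> \<Longrightarrow> G x \<bullet> y = x \<bullet> G y"
    and "\<lbrakk>x \<in> V; x \<noteq> 0\<rbrakk> \<Longrightarrow> 0 < G x \<bullet> x"
    and "\<lbrakk>0 < l; \<And>x. x \<in> V \<Longrightarrow> l * (norm x)\<^sup>2 \<le> k x \<bullet> x; y \<in> V\<rbrakk> \<Longrightarrow> G y \<bullet> y \<le> (norm y)\<^sup>2 / l"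
    and "\<lbrakk>0 < u; \<And>x. x \<in> V \<Longrightarrow> k x \<bullet> x \<le> u * (norm x)\<^sup>2; y \<in> V\<rbrakk> \<Longrightarrow> (norm y)\<^sup>2 / u \<le> G y \<bullet> y"
proof -
  have ks: "k x \<bullet> y = x \<bullet> k y" if "x \<in> V" "y \<in> V" for x y
    using k that by (simp add: spd_tensor_def)
  have kp: "0 < k x \<bullet> x" if "x \<in> V" "x \<noteq> 0" for x
      using k that unfolding spd_tensor_def by blast
  show sym: "G x \<bullet> y = x \<bullet> G y" if "x \<in> V" "y \<in> V" for x y
    using ks[OF G(1)[OF that(1)] G(1)[OF that(2)]] G(2)[OF that(1)] G(2)[OF that(2)] by simp
  have eq: "G x \<bullet> x = k (G x) \<bullet> G x" if "x \<in> V" for x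
    using G(2)[OF that] by (simp add: inner_commute)
  have k0: "k 0 = 0" using k by (simp add: spd_tensor_def linear_0)
  have G0: "G x \<noteq> 0" if "x \<in> V" "x \<noteq> 0" for x
    using G(2)[OF that(1)] that(2) k0 by auto
  show "0 < G x \<bullet> x" if "x \<in> V" "x \<noteq> 0" for x
    unfolding eq[OF that(1)] by (rule kp[OF G(1)[OF that(1)] G0[OF that]])
  show "G y \<bullet> y \<le> (norm y)\<^sup>2 / l"
    if l: "0 < l" "\<And>x. x \<in> V \<Longrightarrow> l * (norm x)\<^sup>2 \<le> k x \<bullet> x" and y: "y \<in> V" for l y
  proof -
    let ?x = "G y"
    have "l * (norm ?x)\<^sup>2 \<le> norm ?x * norm y"
      using l(2)[OF G(1)[OF y]] norm_cauchy_schwarz[of ?x y] unfolding eq[OF y, symmetric] by linarith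
    then have "norm ?x * (l * norm ?x) \<le> norm ?x * norm y" by (simp add: power2_eq_square mult_ac)
    then have "l * norm ?x \<le> norm y" by (cases "norm ?x = 0") auto
    then have "norm ?x \<le> norm y / l" using l(1) by (simp add: field_simps)
    then have "norm ?x * norm y \<le> norm y / l * norm y" by (intro mult_right_mono) auto
    then show ?thesis using norm_cauchy_schwarz[of ?x y] by (simp add: power2_eq_square)
  qed
  show "(norm y)\<^sup>2 / u \<le> G y \<bullet> y"
    if u: "0 < u" "\<And>x. x \<in> V \<Longrightarrow> k x \<bullet> x \<le> u * (norm x)\<^sup>2" and y: "y \<in> V" for u y
  proof (cases "y = 0")
    case False
    have p: "0 < (norm y)\<^sup>2" using False by simp
    have nn: "0 \<le> G y \<bullet> y" unfolding eq[OF y] using kp[OF G(1)[OF y] G0[OF y False]] by simp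
    have "(norm y)\<^sup>2 * (norm y)\<^sup>2 = (k (G y) \<bullet> y)\<^sup>2"
      by (simp only: G(2)[OF y] power2_norm_eq_inner power2_eq_square[of "y \<bullet> y"])
    also have "\<dots> \<le> (k (G y) \<bullet> G y) * (k y \<bullet> y)"
      by (rule Cauchy_Schwarz_spd[OF V k G(1)[OF y] y])
    also have "\<dots> \<le> (G y \<bullet> y) * (u * (norm y)\<^sup>2)"
      unfolding eq[OF y, symmetric] using u(2)[OF y] nn by (rule mult_left_mono)
    finally have "(norm y)\<^sup>2 * (norm y)\<^sup>2 \<le> (u * (G y \<bullet> y)) * (norm y)\<^sup>2" by (simp add: mult_ac)
    then have "(norm y)\<^sup>2 \<le> u * (G y \<bullet> y)" using p by (simp only: mult_le_cancel_right_pos)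
    then show ?thesis using u(1) by (simp add: field_simps)
  qed simp
qed

section \<open>Estimates on a shape-regular simplex\<close>

lemma RT0_continuous: "v \<in> RT0 T \<Longrightarrow> continuous_on UNIV v"
  unfolding RT0_def by (auto intro!: continuous_intros simp: fun_eq_iff[symmetric] cong: continuous_on_cong)

context cell
begin

lemma polyhedron_T: "polyhedron T"
  using simplex by (rule simplex_imp_polyhedron)

lemma unit_tangent: obtains e where "e \<in> tangent T" "norm e = 1"
proof -
  note o = onb[OF subspace_tangent[of T]]
  have "onb (tangent T) \<noteq> {}"
    using card_onb_tangent[OF T_props(3)] dim by (metis card.empty not_one_le_zero zero_less_nat_eq zle_iff_zadd int_one_le_iff_zero_less less_irrefl)
  then obtain e where e: "e \<in> onb (tangent T)" by auto
  then show thesis using that[of e] o(1,2) by (auto simp: orthonormal_def)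
qed

text \<open>A step of length r against the outer normal from z stays in the cell. There the distance
  from the hyperplane of f is at most the height, since a barycentric coordinate is at most
  1.\<close>

lemma height_ge:
  assumes f: "f facet_of T" and z: "z \<in> T" "0 \<le> r" "cball z r \<inter> affine hull T \<subseteq> T"
  shows "r \<le> height T f"
proof -
  let ?\<nu> = "outer_normal T f"
  note n = outer_normal_props[OF f]
  obtain p where p: "p \<in> f" using facet_props(3)[OF f] by auto
  have za: "z \<in> affine hull T" using z(1) by (rule hull_inc)
  have "z - r *\<^sub>R ?\<nu> \<in> affine hull T"
    using n(2) by (subst mem_affine_hull_iff[OF za]) (simp add: subspace_neg subspace_scale subspace_tangent)
  then have w: "z - r *\<^sub>R ?\<nu> \<in> T" using z n(3) by (auto simp: dist_norm subset_iff)
  have "bary T f (z - r *\<^sub>R ?\<nu>) \<le> (\<Sum>f | f facet_of T. bary T f (z - r *\<^sub>R ?\<nu>))"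
    using f w bary_nonneg by (intro member_le_sum) auto
  also have "\<dots> = 1" using w by (intro bary_sum hull_inc)
  finally have "?\<nu> \<bullet> (p - (z - r *\<^sub>R ?\<nu>)) \<le> height T f"
    using n(1) by (simp add: bary_eq[OF f p])
  moreover have "?\<nu> \<bullet> (z - p) \<le> 0" using n(6)[OF z(1) p] .
  ultimately show ?thesis using n(3) by (simp add: inner_simps norm_eq_1)
qed

text \<open>If \<open>v x = c + b (x - z)\<close> on a cell that contains a ball of radius \<open>r\<close> about \<open>z\<close>, then
  \<open>|v| \<ge> |c| + |b| r / 4\<close> on the ball of radius \<open>r / 4\<close> whose center is at distance \<open>r / 2\<close> from \<open>z\<close>
  in the direction of \<open>\<plusminus> c\<close>.\<close>

lemma RT0_normal_comp_bound:
  assumes v: "v \<in> RT0 T" and f: "f facet_of T"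
    and z: "z \<in> T" "0 < r" "cball z r \<inter> affine hull T \<subseteq> T" and s: "1 \<le> s" "diameter T \<le> s * r"
  shows "(normal_comp T f v)\<^sup>2 * measure (flat_measure T) T
    \<le> (4 * s)\<^sup>2 * (8 * s) ^ nat (aff_dim T) * (LINT x:T|flat_measure T. (norm (v x))\<^sup>2)"
proof -
  let ?m = "nat (aff_dim T)" and ?M = "flat_measure T"
  obtain K where K: "0 < K" "\<And>p r. \<lbrakk>p \<in> affine hull T; 0 < r\<rbrakk> \<Longrightarrow> emeasure ?M (ball p r) = ennreal (K * r ^ ?m)"
    by (rule flat_measure_ball[OF T_props(3)]) (rule that)
  obtain a b where ab: "\<And>x. v x = a + b *\<^sub>R x" using v by (auto simp: RT0_def)
  define c where "c = v z"
  have vc: "v x = c + b *\<^sub>R (x - z)" for x by (simp add: c_def ab algebra_simps)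
  have cT: "c \<in> tangent T" using v z(1) by (auto simp: RT0_def c_def)
  obtain e where e: "e \<in> tangent T" "norm e = 1" "c \<bullet> e = norm c"
  proof (cases "c = 0")
    case True
    then show ?thesis using unit_tangent that by auto
  next
    case False
    then show ?thesis using that[of "c /\<^sub>R norm c"] cT
      by (simp add: subspace_scale subspace_tangent dot_square_norm power2_eq_square)
  qed
  \<comment> \<open>With this sign b (x - z) has a component of at least |b| r / 4 along e on the
    shifted ball, so it cannot cancel c.\<close>
  define sg :: real where "sg = (if b < 0 then -1 else 1)"
  have sg: "\<bar>sg\<bar> = 1" "b * sg = \<bar>b\<bar>" by (auto simp: sg_def)
  define z' where "z' = z + (sg * (r / 2)) *\<^sub>R e"
  have za: "z \<in> affine hull T" using z(1) by (rule hull_inc)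
  have z'a: "z' \<in> affine hull T"
    using e(1) by (subst mem_affine_hull_iff[OF za]) (simp add: z'_def subspace_scale subspace_tangent)
  define \<beta> where "\<beta> = norm c + \<bar>b\<bar> * (r / 4)"
  have \<beta>0: "0 \<le> \<beta>" using z(2) by (simp add: \<beta>_def)
  let ?B = "ball z' (r / 4) \<inter> affine hull T"
  have BT: "?B \<subseteq> T"
  proof
    fix x assume x: "x \<in> ?B"
    have "dist z x \<le> dist z z' + dist z' x" by (rule dist_triangle)
    also have "dist z z' = r / 2" using e(2) sg(1) z(2) by (simp add: z'_def dist_norm abs_mult)
    finally have "dist z x \<le> r" using x z(2) by simp
    then show "x \<in> T" using x z(3) by auto
  qed
  have low: "\<beta>\<^sup>2 \<le> (norm (v x))\<^sup>2" if x: "x \<in> ?B" for x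
  proof -
    have "\<bar>(x - z') \<bullet> e\<bar> \<le> norm (x - z')" using Cauchy_Schwarz_ineq2[of "x - z'" e] e(2) by simp
    also have "\<dots> \<le> r / 4" using x by (simp add: dist_norm norm_minus_commute)
    finally have 1: "\<bar>(x - z') \<bullet> e\<bar> \<le> r / 4" .
    have "(x - z) \<bullet> e = sg * (r / 2) + (x - z') \<bullet> e"
      using e(2) by (simp add: z'_def inner_simps norm_eq_1)
    then have "b * ((x - z) \<bullet> e) = \<bar>b\<bar> * (r / 2) + b * ((x - z') \<bullet> e)"
      by (simp add: distrib_left mult.assoc[symmetric] sg(2))
    moreover have "\<bar>b * ((x - z') \<bullet> e)\<bar> \<le> \<bar>b\<bar> * (r / 4)"
      unfolding abs_mult by (rule mult_left_mono[OF 1]) simp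
    ultimately have "\<bar>b\<bar> * (r / 4) \<le> b * ((x - z) \<bullet> e)" by linarith
    then have "\<beta> \<le> v x \<bullet> e" unfolding \<beta>_def vc using e(3) by (simp add: inner_simps)
    also have "\<dots> \<le> norm (v x)" using norm_cauchy_schwarz[of "v x" e] e(2) by simp
    finally show ?thesis using \<beta>0 by (intro power_mono)
  qed
  have Bm: "measure ?M ?B = K * (r / 4) ^ ?m"
    using flat_measure_inter_affine_hull[OF T_props(3), of "ball z' (r/4)"] K(2)[OF z'a, of "r/4"] z(2) K(1)
    by (simp add: measure_def)
  have Bb: "?B \<in> sets borel" by (auto intro!: sets.Int borel_closed closed_affine_hull)
  have BI: "integrable ?M (\<lambda>x. \<beta>\<^sup>2 * indicator ?B x)"
    using Bb flat_measure_bounded_finite[OF T_props(3) bounded_subset[OF T_props(4) BT]] by simp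
  have cont: "continuous_on UNIV (\<lambda>x. (norm (v x))\<^sup>2)"
    by (intro continuous_intros RT0_continuous[OF v])
  have VI: "integrable ?M (\<lambda>x. indicator T x *\<^sub>R (norm (v x))\<^sup>2)"
    using set_integrable_flat[OF T_props(4) _ T_props(3) cont] T_props(5)
    by (simp add: set_integrable_def borel_closed)
  have "\<beta>\<^sup>2 * measure ?M ?B = (LINT x|?M. \<beta>\<^sup>2 * indicator ?B x)" using Bb by simp
  also have "\<dots> \<le> (LINT x|?M. indicator T x *\<^sub>R (norm (v x))\<^sup>2)"
    using BI VI
  proof (rule integral_mono)
    fix x
    show "\<beta>\<^sup>2 * indicator ?B x \<le> indicator T x *\<^sub>R (norm (v x))\<^sup>2"
      using low[of x] BT by (cases "x \<in> ?B") (auto simp: indicator_def)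
  qed
  finally have lower: "\<beta>\<^sup>2 * (K * (r / 4) ^ ?m) \<le> (LINT x:T|?M. (norm (v x))\<^sup>2)"
    unfolding Bm by (simp add: set_lebesgue_integral_def)
  have dist_z: "dist z x \<le> s * r" if "x \<in> T" for x
    using diameter_bounded_bound[OF T_props(4) z(1) that] s(2) by simp
  \<comment> \<open>The cell lies within distance s r of z; the factor 2 allows for the open ball.
    Compared with the ball of radius r / 4 this gives 8 s per dimension.\<close>
  have "emeasure ?M T \<le> emeasure ?M (ball z (2 * s * r))"
  proof (rule emeasure_mono)
    have "0 < s * r" using z(2) s(1) by simp
    then show "T \<subseteq> ball z (2 * s * r)" using dist_z by force
  qed simp
  also have "\<dots> = ennreal (K * (2 * s * r) ^ ?m)" using z(2) s(1) by (intro K(2) za) simp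
  finally have "measure ?M T \<le> K * (2 * s * r) ^ ?m"
    using K(1) z(2) s(1) by (simp add: measure_def enn2real_leI)
  also have "\<dots> = (8 * s) ^ ?m * (K * (r / 4) ^ ?m)"
  proof -
    have "2 * s * r = (8 * s) * (r / 4)" by simp
    then show ?thesis by (simp only: power_mult_distrib) (simp only: mult_ac)
  qed
  finally have meas: "measure ?M T \<le> (8 * s) ^ ?m * (K * (r / 4) ^ ?m)" .
  obtain y where y: "y \<in> f" using facet_props(3)[OF f] by auto
  have "\<bar>normal_comp T f v\<bar> \<le> norm (v y)"
    unfolding normal_comp_eq[OF v f y] using Cauchy_Schwarz_ineq2[of "v y" "outer_normal T f"] outer_normal_props(3)[OF f] by simp
  also have "\<dots> \<le> norm c + \<bar>b\<bar> * norm (y - z)"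
    unfolding vc by (metis norm_scaleR norm_triangle_ineq)
  also have "\<dots> \<le> norm c + \<bar>b\<bar> * (s * r)"
    using dist_z[of y] y facet_props(4)[OF f] by (intro add_left_mono mult_left_mono) (auto simp: dist_norm norm_minus_commute)
  \<comment> \<open>The bound on the cell has s r in place of the r / 4 in \<open>\<beta>\<close>,
    whence 4 s.\<close>
  also have "\<dots> \<le> 4 * s * \<beta>"
    using s(1) mult_right_mono[of 1 "4 * s" "norm c"] by (simp add: \<beta>_def algebra_simps)
  finally have "\<bar>normal_comp T f v\<bar>\<^sup>2 \<le> (4 * s * \<beta>)\<^sup>2" by (intro power_mono) auto
  then have "(normal_comp T f v)\<^sup>2 * measure ?M T \<le> (4 * s * \<beta>)\<^sup>2 * ((8 * s) ^ ?m * (K * (r / 4) ^ ?m))"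
    using meas by (intro mult_mono) auto
  also have "\<dots> = (4 * s)\<^sup>2 * (8 * s) ^ ?m * (\<beta>\<^sup>2 * (K * (r / 4) ^ ?m))"
    by (simp add: power_mult_distrib mult_ac)
  also have "\<dots> \<le> (4 * s)\<^sup>2 * (8 * s) ^ ?m * (LINT x:T|?M. (norm (v x))\<^sup>2)"
    using lower s(1) by (intro mult_left_mono) auto
  finally show ?thesis .
qed

end


section \<open>The permeability-weighted form on one cell and its diagonal\<close>

definition cell_form :: "'a::euclidean_space set \<Rightarrow> ('a \<Rightarrow> 'a) \<Rightarrow> ('a \<Rightarrow> 'a) \<Rightarrow> ('a \<Rightarrow> 'a) \<Rightarrow> real" where
  "cell_form T k u v = (LINT x:T|flat_measure T. k (u x) \<bullet> v x)"

text \<open>k plays the role of \<open>inv_perm\<close>, which is specified on the tangent space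
  only; hence linearity is stated as agreement there with a linear map. The numbers lo and hi
  enclose its spectrum.\<close>

locale cell_tensor = cell +
  fixes k :: "'a \<Rightarrow> 'a" and lo hi :: real
  assumes k_linear: "\<exists>G. linear G \<and> (\<forall>x\<in>tangent T. k x = G x)"
    and k_sym: "\<lbrakk>x \<in> tangent T; y \<in> tangent T\<rbrakk> \<Longrightarrow> k x \<bullet> y = x \<bullet> k y"
    and k_lower: "x \<in> tangent T \<Longrightarrow> lo * (norm x)\<^sup>2 \<le> k x \<bullet> x"
    and k_upper: "x \<in> tangent T \<Longrightarrow> k x \<bullet> x \<le> hi * (norm x)\<^sup>2"
    and lo: "0 < lo" and hi: "0 < hi"
begin

definition G :: "'a \<Rightarrow> 'a" where "G = (SOME G. linear G \<and> (\<forall>x\<in>tangent T. k x = G x))"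

lemma G: "linear G" "x \<in> tangent T \<Longrightarrow> k x = G x"
  using someI_ex[OF k_linear, folded G_def] by auto

lemma RT0_tangent: "\<lbrakk>v \<in> RT0 T; x \<in> T\<rbrakk> \<Longrightarrow> v x \<in> tangent T"
  by (auto simp: RT0_def)

lemma k_integrand: "\<lbrakk>u \<in> RT0 T; x \<in> T\<rbrakk> \<Longrightarrow> k (u x) = G (u x)"
  by (simp add: G(2) RT0_tangent)

lemma cell_form_G:
  "u \<in> RT0 T \<Longrightarrow> cell_form T k u v = (LINT x:T|flat_measure T. G (u x) \<bullet> v x)"
  unfolding cell_form_def using T_props(5)
  by (intro set_lebesgue_integral_cong) (auto simp: k_integrand borel_closed)

lemma cell_form_integrable:
  assumes "u \<in> RT0 T" "v \<in> RT0 T"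
  shows "set_integrable (flat_measure T) T (\<lambda>x. G (u x) \<bullet> v x)"
  using T_props
  by (intro set_integrable_flat continuous_intros linear_continuous_on_compose[OF RT0_continuous[OF assms(1)] G(1)]
      RT0_continuous[OF assms(2)]) (auto simp: borel_closed)

lemma cell_form_add:
  assumes "u \<in> RT0 T" "w \<in> RT0 T" "v \<in> RT0 T"
  shows "cell_form T k (u + w) v = cell_form T k u v + cell_form T k w v"
proof -
  have "cell_form T k (u + w) v = (LINT x:T|flat_measure T. G (u x) \<bullet> v x + G (w x) \<bullet> v x)"
    using assms subspace_add[OF RT0_subspace] by (simp add: cell_form_G linear_add[OF G(1)] inner_simps)
  then show ?thesis using assms by (simp add: cell_form_G set_integral_add cell_form_integrable)
qed

lemma cell_form_scale: "u \<in> RT0 T \<Longrightarrow> cell_form T k (c *\<^sub>R u) v = c * cell_form T k u v"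
  using subspace_scale[OF RT0_subspace]
  by (simp add: cell_form_G scaleR_fun_def linear_scale[OF G(1)])

lemma cell_form_sym:
  assumes "u \<in> RT0 T" "v \<in> RT0 T"
  shows "cell_form T k u v = cell_form T k v u"
proof -
  have "k (u x) \<bullet> v x = k (v x) \<bullet> u x" if "x \<in> T" for x
    using k_sym[OF RT0_tangent[OF assms(1) that] RT0_tangent[OF assms(2) that]] by (simp add: inner_commute)
  then show ?thesis
    unfolding cell_form_def using T_props(5)
    by (intro set_lebesgue_integral_cong) (simp_all add: borel_closed)
qed

lemma cell_form_mono:
  assumes "u \<in> RT0 T" "continuous_on UNIV g" "\<And>x. x \<in> T \<Longrightarrow> g x \<le> k (u x) \<bullet> u x"
  shows "(LINT x:T|flat_measure T. g x) \<le> cell_form T k u u"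
  unfolding cell_form_G[OF assms(1)]
proof (rule set_integral_mono)
  show "set_integrable (flat_measure T) T g"
    using assms T_props by (intro set_integrable_flat) (auto simp: borel_closed)
qed (use assms cell_form_integrable k_integrand in auto)

lemma cell_form_nonneg: "u \<in> RT0 T \<Longrightarrow> 0 \<le> cell_form T k u u"
proof -
  assume u: "u \<in> RT0 T"
  have "0 \<le> k (u x) \<bullet> u x" if "x \<in> T" for x
    using k_lower[OF RT0_tangent[OF u that]] lo by (meson mult_nonneg_nonneg order_trans less_imp_le zero_le_power2)
  then show ?thesis using cell_form_mono[OF u, of "\<lambda>_. 0"] by (simp add: set_lebesgue_integral_def)
qed

lemma shape_RT0: "f facet_of T \<Longrightarrow> shape f \<in> RT0 T"
proof -
  assume f: "f facet_of T"
  have "shape f = (\<lambda>x. \<Sum>g | g facet_of T. (if g = f then 1 else 0) *\<^sub>R shape g x)"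
    using f by (intro ext) (simp add: if_distrib[of "\<lambda>c. c *\<^sub>R _"] cong: if_cong)
  then show ?thesis by (rule ssubst) (rule shape_combination_RT0)
qed

text \<open>The quadratic form of a sum of \<open>N\<close> vectors is at most \<open>N\<close> times the sum of the quadratic
  forms; this bound is independent of the tensor.\<close>

lemma cell_form_le_diag:
  assumes v: "v \<in> RT0 T"
  shows "cell_form T k v v \<le> (of_int (aff_dim T) + 1) *
    (\<Sum>f | f facet_of T. (normal_comp T f v)\<^sup>2 * cell_form T k (shape f) (shape f))"
proof -
  let ?F = "{f. f facet_of T}"
  let ?w = "\<lambda>f. normal_comp T f v *\<^sub>R shape f"
  have wR: "?w f \<in> RT0 T" if "f \<in> ?F" for f
    using that by (intro subspace_scale RT0_subspace shape_RT0) simp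
  have pt: "G (\<Sum>f\<in>?F. a f) \<bullet> (\<Sum>f\<in>?F. a f) \<le> real (card ?F) * (\<Sum>f\<in>?F. G (a f) \<bullet> a f)"
    if a: "\<And>f. f \<in> ?F \<Longrightarrow> a f \<in> tangent T" for a :: "'a set \<Rightarrow> 'a"
  proof -
    have "G (\<Sum>f\<in>?F. a f) \<bullet> (\<Sum>f\<in>?F. a f) = (\<Sum>f\<in>?F. \<Sum>g\<in>?F. G (a f) \<bullet> a g)"
      unfolding linear_sum[OF G(1)] inner_sum_left inner_sum_right by (rule sum.swap)
    also have "\<dots> \<le> (\<Sum>f\<in>?F. \<Sum>g\<in>?F. (G (a f) \<bullet> a f + G (a g) \<bullet> a g) / 2)"
    proof (intro sum_mono)
      fix f g assume fg: "f \<in> ?F" "g \<in> ?F"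
      have d: "a f - a g \<in> tangent T" using a fg by (simp add: subspace_diff subspace_tangent)
      have "0 \<le> G (a f - a g) \<bullet> (a f - a g)"
        using k_lower[OF d] lo G(2)[OF d] by (metis mult_nonneg_nonneg order_trans less_imp_le zero_le_power2)
      also have "\<dots> = G (a f) \<bullet> a f + G (a g) \<bullet> a g - 2 * (G (a f) \<bullet> a g)"
        using k_sym[OF a[OF fg(1)] a[OF fg(2)]] G(2)[OF a[OF fg(1)]] G(2)[OF a[OF fg(2)]]
        by (simp add: linear_diff[OF G(1)] inner_diff_left inner_diff_right inner_commute)
      finally show "G (a f) \<bullet> a g \<le> (G (a f) \<bullet> a f + G (a g) \<bullet> a g) / 2" by simp
    qed
    also have "\<dots> = real (card ?F) * (\<Sum>f\<in>?F. G (a f) \<bullet> a f)"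
      by (simp add: add_divide_distrib sum.distrib sum_divide_distrib[symmetric] sum_distrib_left[symmetric])
    finally show ?thesis .
  qed
  have int: "set_integrable (flat_measure T) T (\<lambda>x. \<Sum>f\<in>?F. G (?w f x) \<bullet> ?w f x)"
    using cell_form_integrable[OF wR wR] unfolding set_integrable_def scaleR_sum_right
    by (intro Bochner_Integration.integrable_sum) auto
  have "cell_form T k v v = (LINT x:T|flat_measure T. G (v x) \<bullet> v x)"
    by (rule cell_form_G[OF v])
  also have "\<dots> \<le> (LINT x:T|flat_measure T. real (card ?F) * (\<Sum>f\<in>?F. G (?w f x) \<bullet> ?w f x))"
  proof (rule set_integral_mono)
    fix x assume x: "x \<in> T"
    have "v x = (\<Sum>f\<in>?F. ?w f x)"
      by (subst RT0_expand[OF v]) (simp add: scaleR_fun_def)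
    then show "G (v x) \<bullet> v x \<le> real (card ?F) * (\<Sum>f\<in>?F. G (?w f x) \<bullet> ?w f x)"
      using pt[of "\<lambda>f. ?w f x"] RT0_tangent[OF wR x] by simp
  qed (use v int cell_form_integrable in auto)
  also have "\<dots> = real (card ?F) * (\<Sum>f\<in>?F. cell_form T k (?w f) (?w f))"
  proof -
    have "(LINT x:T|flat_measure T. \<Sum>f\<in>?F. G (?w f x) \<bullet> ?w f x) = (\<Sum>f\<in>?F. cell_form T k (?w f) (?w f))"
      using cell_form_integrable[OF wR wR] wR
      unfolding set_integrable_def set_lebesgue_integral_def scaleR_sum_right
      by (subst Bochner_Integration.integral_sum) (auto simp: cell_form_G set_lebesgue_integral_def)
    then show ?thesis by simp
  qed
  also have "(\<Sum>f\<in>?F. cell_form T k (?w f) (?w f))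
    = (\<Sum>f\<in>?F. (normal_comp T f v)\<^sup>2 * cell_form T k (shape f) (shape f))"
  proof (rule sum.cong[OF refl])
    fix f assume "f \<in> ?F"
    then have f: "shape f \<in> RT0 T" "?w f \<in> RT0 T" using shape_RT0 wR by auto
    show "cell_form T k (?w f) (?w f) = (normal_comp T f v)\<^sup>2 * cell_form T k (shape f) (shape f)"
      unfolding cell_form_scale[OF f(1)] cell_form_sym[OF f] by (simp add: power2_eq_square)
  qed
  also have "real (card ?F) = of_int (aff_dim T) + 1"
    using card_facets by (metis of_int_1 of_int_add of_int_of_nat_eq)
  finally show ?thesis .
qed

context
  fixes z :: 'a and r s :: real
  assumes z: "z \<in> T" "0 < r" "cball z r \<inter> affine hull T \<subseteq> T" and s: "1 \<le> s" "diameter T \<le> s * r"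
begin

lemma normal_comp_le_cell_form:
  assumes v: "v \<in> RT0 T" and f: "f facet_of T"
  shows "(normal_comp T f v)\<^sup>2 * measure (flat_measure T) T
    \<le> (4 * s)\<^sup>2 * (8 * s) ^ nat (aff_dim T) / lo * cell_form T k v v"
proof -
  have c: "continuous_on UNIV (\<lambda>x. lo * (norm (v x))\<^sup>2)"
    by (intro continuous_intros RT0_continuous[OF v])
  have "(LINT x:T|flat_measure T. lo * (norm (v x))\<^sup>2) \<le> cell_form T k v v"
    using k_lower[OF RT0_tangent[OF v]] by (intro cell_form_mono v c)
  then have "(LINT x:T|flat_measure T. (norm (v x))\<^sup>2) \<le> cell_form T k v v / lo"
    using lo by (simp add: field_simps)
  then have "(4 * s)\<^sup>2 * (8 * s) ^ nat (aff_dim T) * (LINT x:T|flat_measure T. (norm (v x))\<^sup>2)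
     \<le> (4 * s)\<^sup>2 * (8 * s) ^ nat (aff_dim T) * (cell_form T k v v / lo)"
    using s by (intro mult_left_mono) auto
  with RT0_normal_comp_bound[OF v f z s] show ?thesis by simp
qed

lemma measure_T_pos: "0 < measure (flat_measure T) T"
proof -
  have "rel_interior T \<noteq> {}" using T_props by (simp add: rel_interior_eq_empty)
  then have "0 < emeasure (flat_measure T) (rel_interior T)" by (rule flat_measure_rel_interior_pos)
  also have "\<dots> \<le> emeasure (flat_measure T) T"
    using rel_interior_subset T_props(5) by (intro emeasure_mono) (auto simp: borel_closed)
  finally show ?thesis
    using flat_measure_bounded_finite[OF T_props(3,4)] by (simp add: measure_def enn2real_positive_iff less_top)
qed

text \<open>Definiteness comes out of the quantitative bound: a nonzero field has a nonzero facet
  component, and the form controls it.\<close>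

lemma cell_form_pos:
  assumes v: "v \<in> RT0 T" "v \<noteq> 0" shows "0 < cell_form T k v v"
proof -
  obtain f where f: "f facet_of T" "normal_comp T f v \<noteq> 0"
    using RT0_normal_eqI[OF v(1) subspace_0[OF RT0_subspace]] v(2) normal_comp_linear(3) by metis
  have "0 < (normal_comp T f v)\<^sup>2 * measure (flat_measure T) T" using f(2) measure_T_pos by simp
  with normal_comp_le_cell_form[OF v(1) f(1)]
  have "0 < (4 * s)\<^sup>2 * (8 * s) ^ nat (aff_dim T) / lo * cell_form T k v v" by linarith
  moreover have "0 < (4 * s)\<^sup>2 * (8 * s) ^ nat (aff_dim T) / lo" using s lo by simp
  ultimately show ?thesis by (simp only: zero_less_mult_pos)
qed

text \<open>The length is at most the diameter over the height, and the height is at least the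
  inradius r.\<close>

lemma shape_norm_le: assumes f: "f facet_of T" and x: "x \<in> T" shows "norm (shape f x) \<le> s"
proof -
  have "norm (x - apex T f) \<le> diameter T"
    using diameter_bounded_bound[OF T_props(4) x facet_props(6)[OF f]] by (simp add: dist_norm)
  also have "\<dots> \<le> s * height T f"
    using s(2) mult_left_mono[OF height_ge[OF f z(1) less_imp_le[OF z(2)] z(3)], of s] s(1) by linarith
  finally show ?thesis
    using outer_normal_props(1)[OF f] by (simp add: shape_def divide_le_eq)
qed

text \<open>A basis function costs at most hi s^2 times the volume of the cell, and a squared facet
  component times that volume is bounded by the form at the price of 1 / lo. Thus the volume cancels
  and the tensor enters through hi / lo; the number of facets is the leading factor.\<close>

lemma diag_le_cell_form:
  assumes v: "v \<in> RT0 T"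
  shows "(\<Sum>f | f facet_of T. (normal_comp T f v)\<^sup>2 * cell_form T k (shape f) (shape f))
    \<le> (of_int (aff_dim T) + 1) * (hi / lo * s\<^sup>2 * ((4 * s)\<^sup>2 * (8 * s) ^ nat (aff_dim T))) * cell_form T k v v"
proof -
  let ?F = "{f. f facet_of T}" and ?C = "(4 * s)\<^sup>2 * (8 * s) ^ nat (aff_dim T)"
  have "(normal_comp T f v)\<^sup>2 * cell_form T k (shape f) (shape f) \<le> hi / lo * s\<^sup>2 * ?C * cell_form T k v v"
    if "f \<in> ?F" for f
  proof -
    have f: "f facet_of T" using that by simp
    have "cell_form T k (shape f) (shape f) \<le> (LINT x:T|flat_measure T. hi * s\<^sup>2)"
      unfolding cell_form_G[OF shape_RT0[OF f]]
    proof (rule set_integral_mono)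
      fix x assume x: "x \<in> T"
      have "G (shape f x) \<bullet> shape f x \<le> hi * (norm (shape f x))\<^sup>2"
        using k_upper[OF RT0_tangent[OF shape_RT0[OF f] x]] k_integrand[OF shape_RT0[OF f] x] by simp
      also have "\<dots> \<le> hi * s\<^sup>2"
        using hi shape_norm_le[OF f x] by (intro mult_left_mono power_mono) auto
      finally show "G (shape f x) \<bullet> shape f x \<le> hi * s\<^sup>2" .
    qed (use T_props f in \<open>auto intro!: set_integrable_flat cell_form_integrable shape_RT0 simp: borel_closed\<close>)
    also have "\<dots> = hi * s\<^sup>2 * measure (flat_measure T) T"
      using flat_measure_bounded_finite[OF T_props(3,4)] T_props(5)
      by (simp add: set_integral_const borel_closed less_top)
    finally have "(normal_comp T f v)\<^sup>2 * cell_form T k (shape f) (shape f)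
      \<le> (normal_comp T f v)\<^sup>2 * (hi * s\<^sup>2 * measure (flat_measure T) T)"
      by (intro mult_left_mono) auto
    also have "\<dots> = hi * s\<^sup>2 * ((normal_comp T f v)\<^sup>2 * measure (flat_measure T) T)" by simp
    also have "\<dots> \<le> hi * s\<^sup>2 * (?C / lo * cell_form T k v v)"
      using hi by (intro mult_left_mono normal_comp_le_cell_form v f) auto
    finally show ?thesis by simp
  qed
  then have "(\<Sum>f\<in>?F. (normal_comp T f v)\<^sup>2 * cell_form T k (shape f) (shape f))
    \<le> real (card ?F) * (hi / lo * s\<^sup>2 * ?C * cell_form T k v v)"
    by (rule sum_bounded_above)
  also have "real (card ?F) = of_int (aff_dim T) + 1"
    using card_facets by (metis of_int_1 of_int_add of_int_of_nat_eq)
  finally show ?thesis by (simp only: mult.assoc)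
qed

end

end

section \<open>Faces and sides of simplices\<close>

lemma face_inter_rel_interior:
  fixes T :: "'a::euclidean_space set"
  assumes T: "convex T" and e: "e face_of T" "e \<inter> rel_interior T \<noteq> {}"
  shows "e = T"
  using e face_of_disjoint_rel_interior[of e T] by blast

lemma polyhedron_in_facet:
  assumes "polyhedron T" "x \<in> T" "x \<notin> rel_interior T"
  obtains f where "f facet_of T" "x \<in> f"
  using assms rel_boundary_of_polyhedron[of T] by blast

context cell
begin

lemma bary_pos_imp_T:
  assumes x: "x \<in> affine hull T" "\<And>f. f facet_of T \<Longrightarrow> 0 \<le> bary T f x"
  shows "x \<in> T"
proof -
  have "(\<Sum>f | f facet_of T. bary T f x *\<^sub>R apex T f) \<in> T"
    using T_props(1) x bary_sum(1)[OF x(1)] facet_props(6) by (intro convex_sum) auto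
  then show ?thesis by (simp add: bary_sum(2)[OF x(1)])
qed

lemma bary_pos_imp_rel_interior:
  assumes x: "x \<in> affine hull T" "\<And>f. f facet_of T \<Longrightarrow> 0 < bary T f x"
  shows "x \<in> rel_interior T"
proof (rule ccontr)
  assume "x \<notin> rel_interior T"
  moreover have "x \<in> T" using x by (intro bary_pos_imp_T) (auto intro: less_imp_le)
  ultimately obtain f where "f facet_of T" "x \<in> f" using polyhedron_in_facet[OF polyhedron_T] by metis
  then show False using x(2)[of f] bary_facet[of f x] by simp
qed

lemma bary_zero_imp_facet:
  assumes x: "x \<in> T" and f: "f facet_of T" "bary T f x = 0"
  shows "x \<in> f"
proof -
  have xa: "x \<in> affine hull T" using x by (rule hull_inc)
  let ?F = "{g. g facet_of T}"
  have "x = (\<Sum>g\<in>?F - {f}. bary T g x *\<^sub>R apex T g)"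
    using bary_sum(2)[OF xa] f by (simp add: sum.remove[of ?F f])
  also have "\<dots> \<in> f"
  proof (rule convex_sum)
    show "convex f" using facet_props(1)[OF f(1)] .
    show "(\<Sum>g\<in>?F - {f}. bary T g x) = 1"
      using bary_sum(1)[OF xa] f by (simp add: sum.remove[of ?F f])
    fix g assume g: "g \<in> ?F - {f}"
    show "0 \<le> bary T g x" using g x by (intro bary_nonneg) auto
    obtain p where p: "p \<in> f" using facet_props(3)[OF f(1)] by auto
    have "apex T g \<noteq> apex T f"
    proof
      assume eq: "apex T g = apex T f"
      have gf: "g facet_of T" using g by simp
      have "g = f" by (rule trans[OF facet_props(10)[OF gf, unfolded eq] facet_props(10)[OF f(1), symmetric]])
      with g show False by simp
    qed
    then show "apex T g \<in> f"
      using facet_props(7)[of g] g by (subst facet_props(10)[OF f(1)]) (intro hull_inc, simp)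
  qed simp
  finally show ?thesis .
qed

lemma facet_rel_interior_unique:
  assumes f: "f facet_of T" "g facet_of T" and p: "p \<in> rel_interior f" "p \<in> g"
  shows "f = g"
proof -
  have pf: "p \<in> f" using p(1) rel_interior_subset by auto
  have "f \<inter> g face_of T" using f by (intro face_of_Int) (auto simp: facet_of_imp_face_of)
  then have "f \<inter> g face_of f" using f(1) by (meson face_of_subset facet_of_imp_subset inf_le1)
  then have "f \<inter> g = f" using facet_props(1)[OF f(1)] p pf by (intro face_inter_rel_interior) auto
  then have sub: "f \<subseteq> g" by auto
  have "f face_of g"
    using f sub by (meson face_of_subset facet_of_imp_face_of facet_of_imp_subset)
  then show ?thesis
    using face_of_aff_dim_lt[OF facet_props(1)[OF f(2)], of f] facet_props(5)[OF f(1)] facet_props(5)[OF f(2)] by auto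
qed

text \<open>Along the inward normal the barycentric coordinate that vanishes on f grows linearly
  from 0. The others start positive, since a relative interior point of f lies on no other facet,
  and they stay positive for a short while.\<close>

lemma inward_normal:
  assumes f: "f facet_of T" and p: "p \<in> rel_interior f"
  shows "\<forall>\<^sub>F t in at_right 0. p - t *\<^sub>R outer_normal T f \<in> rel_interior T"
proof -
  let ?\<nu> = "outer_normal T f"
  note n = outer_normal_props[OF f]
  have pf: "p \<in> f" using p rel_interior_subset by auto
  then have pT: "p \<in> T" using facet_props(4)[OF f] by auto
  then have pa: "p \<in> affine hull T" by (rule hull_inc)
  have ev: "\<forall>\<^sub>F t in at_right 0. 0 < bary T g (p - t *\<^sub>R ?\<nu>)" if g: "g facet_of T" for g
  proof -
    obtain y where y: "y \<in> g" using facet_props(3)[OF g] by auto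
    have b: "bary T g (p - t *\<^sub>R ?\<nu>) = bary T g p + t * ((outer_normal T g \<bullet> ?\<nu>) / height T g)" for t
      by (simp add: bary_eq[OF g y] inner_simps add_divide_distrib diff_divide_distrib)
    show ?thesis
    proof (cases "g = f")
      case True
      have "bary T g (p - t *\<^sub>R ?\<nu>) = t / height T f" for t
        unfolding b using n(3) bary_facet[OF f pf] by (simp add: True norm_eq_1)
      then show ?thesis using n(1)
        by (auto simp: eventually_at_right_field intro!: exI[of _ 1])
    next
      case False
      have "bary T g p \<noteq> 0"
        using bary_zero_imp_facet[OF pT g] facet_rel_interior_unique[OF f g p] False by auto
      then have pos: "0 < bary T g p" using bary_nonneg[OF g pT] by simp
      have "((\<lambda>t. bary T g (p - t *\<^sub>R ?\<nu>)) \<longlongrightarrow> bary T g p + 0 * ((outer_normal T g \<bullet> ?\<nu>) / height T g)) (at_right 0)"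
        unfolding b by (intro tendsto_intros)
      then show ?thesis using pos by (simp add: order_tendsto_iff)
    qed
  qed
  have "\<forall>\<^sub>F t in at_right 0. \<forall>g\<in>{g. g facet_of T}. 0 < bary T g (p - t *\<^sub>R ?\<nu>)"
    using ev by (intro eventually_ball_finite) auto
  then show ?thesis
  proof eventually_elim
    fix t assume "\<forall>g\<in>{g. g facet_of T}. 0 < bary T g (p - t *\<^sub>R ?\<nu>)"
    moreover have "p - t *\<^sub>R ?\<nu> \<in> affine hull T"
      using n(2) by (subst mem_affine_hull_iff[OF pa]) (simp add: subspace_neg subspace_scale subspace_tangent)
    ultimately show "p - t *\<^sub>R ?\<nu> \<in> rel_interior T" by (intro bary_pos_imp_rel_interior) auto
  qed
qed

end

lemma facet_affine_hull:
  assumes "rel_interior f \<subseteq> S" "convex f" "aff_dim f = aff_dim S"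
  shows "affine hull f = affine hull S"
proof -
  have "aff_dim (rel_interior f) = aff_dim S" using assms by (simp add: rel_interior_aff_dim)
  then have "affine hull (rel_interior f) = affine hull S"
    using aff_dim_eq_full_gen[OF assms(1)] by simp
  then show ?thesis by (simp add: rel_interior_same_affine_hull[OF assms(2)])
qed

section \<open>Simplicial meshes\<close>

lemma simplex_rel_interior_nonempty: "\<lbrakk>n simplex T; 0 \<le> n\<rbrakk> \<Longrightarrow> T \<noteq> {} \<and> rel_interior T \<noteq> {}"
  using aff_dim_simplex[of n T] convex_simplex[of n T] rel_interior_eq_empty[of T] by auto

locale smesh =
  fixes S :: "'a::euclidean_space set" and C :: "'a set set"
  assumes mesh: "simplicial_mesh S C" and S_ne: "S \<noteq> {}"
begin

lemma finite_C: "finite C" and Union_C: "\<Union>C = closure S"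
  and rel_interior_sub: "T \<in> C \<Longrightarrow> rel_interior T \<subseteq> S"
  and C_simplex: "T \<in> C \<Longrightarrow> aff_dim S simplex T"
  and C_match: "\<lbrakk>T \<in> C; T' \<in> C; x \<in> T; x \<in> T'; x \<in> S\<rbrakk> \<Longrightarrow> T \<inter> T' face_of T \<and> T \<inter> T' face_of T'"
  using mesh unfolding simplicial_mesh_def by blast+

lemma S_dim: "0 \<le> aff_dim S"
  using S_ne aff_dim_negative_iff[of S] by linarith

lemma C_props:
  assumes T: "T \<in> C"
  shows "aff_dim T = aff_dim S" "T \<noteq> {}" "rel_interior T \<noteq> {}" "convex T" "polyhedron T" "compact T" "polytope T"
    "affine hull T = affine hull S" "tangent T = tangent S" "flat_measure T = flat_measure S" "T \<subseteq> closure S"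
    "aff_dim T simplex T"
proof -
  note s = C_simplex[OF T]
  show ad: "aff_dim T = aff_dim S" using s by (rule aff_dim_simplex)
  show "T \<noteq> {}" "rel_interior T \<noteq> {}" using simplex_rel_interior_nonempty[OF s S_dim] by auto
  show "convex T" using s by (rule convex_simplex)
  show pt: "polytope T" using s by (rule simplex_imp_polytope)
  then show "polyhedron T" "compact T" by (auto simp: polytope_imp_polyhedron polytope_imp_compact)
  show sub: "T \<subseteq> closure S" using Union_C T by auto
  have "closure S \<subseteq> affine hull S"
    by (intro closure_minimal hull_subset closed_affine_hull)
  then have "affine hull T = affine hull (affine hull S)"
    using aff_dim_eq_full_gen[of T "affine hull S"] sub ad by auto
  then show ah: "affine hull T = affine hull S" by (simp add: hull_hull)
  then show "tangent T = tangent S" using tangent_affine_hull[of T] tangent_affine_hull[of S] by simp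
  show "flat_measure T = flat_measure S" using ah by (rule flat_measure_cong)
  show "aff_dim T simplex T" using s ad by simp
qed

text \<open>The relative interior of a cell lies in S, where cells have to match. The intersection
  is then a face of T through an interior point, hence T itself, and T cannot be a proper face of a
  simplex of the same dimension.\<close>

lemma C_unique:
  assumes T: "T \<in> C" "T' \<in> C" and x: "x \<in> rel_interior T" "x \<in> T'"
  shows "T = T'"
proof -
  have xT: "x \<in> T" "x \<in> S" using x rel_interior_subset rel_interior_sub[OF T(1)] by auto
  then have face: "T \<inter> T' face_of T" "T \<inter> T' face_of T'" using C_match[OF T xT(1) x(2) xT(2)] by auto
  then have "T \<inter> T' = T" using C_props(4)[OF T(1)] x xT by (intro face_inter_rel_interior) auto
  then have "T face_of T'" using face(2) by simp
  then show ?thesis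
    using face_of_aff_dim_lt[OF C_props(4)[OF T(2)], of T] C_props(1)[OF T(1)] C_props(1)[OF T(2)] by auto
qed

lemma cell_C: "\<lbrakk>T \<in> C; 1 \<le> aff_dim S\<rbrakk> \<Longrightarrow> cell T"
  using C_props by (simp add: cell_def)

text \<open>Both cells contain the points p - t \<nu> in their relative interiors for small t. The
  facets are allowed to differ, because meshes on a common side are compared without assuming that
  they match along a slit.\<close>

lemma same_side:
  assumes d: "1 \<le> aff_dim S" and T: "T \<in> C" "T' \<in> C" and f: "f facet_of T" "f' facet_of T'"
    and p: "p \<in> rel_interior f" "p \<in> rel_interior f'"
    and n: "outer_normal T f = outer_normal T' f'"
  shows "T = T' \<and> f = f'"
proof -
  interpret c: cell T using T(1) d by (rule cell_C)
  interpret c': cell T' using T(2) d by (rule cell_C)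
  have "\<forall>\<^sub>F t in at_right 0. p - t *\<^sub>R outer_normal T f \<in> rel_interior T \<and> p - t *\<^sub>R outer_normal T f \<in> rel_interior T'"
    using c.inward_normal[OF f(1) p(1)] c'.inward_normal[OF f(2) p(2)] n by (simp add: eventually_conj)
  then obtain t where "p - t *\<^sub>R outer_normal T f \<in> rel_interior T" "p - t *\<^sub>R outer_normal T f \<in> rel_interior T'"
    using eventually_happens[of _ "at_right (0::real)"] by (auto simp: trivial_limit_at_right_real)
  then have "T = T'" using C_unique[OF T] rel_interior_subset by blast
  moreover have "p \<in> f'" using p(2) rel_interior_subset by auto
  ultimately show ?thesis using c.facet_rel_interior_unique[OF f(1), of f' p] f(2) p(1) by auto
qed

lemma normals_opposite:
  assumes d: "1 \<le> aff_dim S" and T: "T \<in> C" "T' \<in> C" and f: "f facet_of T" "f' facet_of T'"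
    and t: "tangent f = tangent f'"
  shows "outer_normal T' f' = outer_normal T f \<or> outer_normal T' f' = - outer_normal T f"
proof -
  interpret c: cell T using T(1) d by (rule cell_C)
  interpret c': cell T' using T(2) d by (rule cell_C)
  show ?thesis
    using c.facet_normal_unique[OF f(1) c.outer_normal_props(2,3,4)[OF f(1)], of "outer_normal T' f'"]
      c'.outer_normal_props(2,3,4)[OF f(2)] t C_props(9)[OF T(1)] C_props(9)[OF T(2)] by simp
qed

text \<open>Within the tangent space of S a facet has two unit normals, and by
  \<open>same_side\<close> each of them belongs to at most one cell.\<close>

lemma shared_facet_two_cells:
  assumes d: "1 \<le> aff_dim S" and T: "T \<in> C" "T' \<in> C" "T'' \<in> C" "T \<noteq> T'"
    and f: "f facet_of T" "f facet_of T'" "f facet_of T''"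
  shows "T'' = T \<or> T'' = T'"
proof -
  have "rel_interior f \<noteq> {}"
    using f(1) C_props(4)[OF T(1)] face_of_imp_convex[of f T] rel_interior_eq_empty[of f] by (auto simp: facet_of_def)
  then obtain p where p: "p \<in> rel_interior f" by auto
  note side = same_side[OF d _ _ _ _ p p]
  have "outer_normal T' f = - outer_normal T f"
    using normals_opposite[OF d T(1,2) f(1,2) refl] side[OF T(1,2) f(1,2)] T(4) by auto
  moreover have "outer_normal T'' f = outer_normal T f \<or> outer_normal T'' f = - outer_normal T f"
    using normals_opposite[OF d T(1,3) f(1,3) refl] .
  ultimately show ?thesis using side[OF T(3,1) f(3,1)] side[OF T(3,2) f(3,2)] by auto
qed

end

section \<open>Piecewise constant functions without jumps\<close>

text \<open>By measure: a nonempty relatively open subset of H contains a ball of positive flat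
  measure, while finitely many affine sets of smaller dimension are null.\<close>

lemma avoid_affine_sets:
  fixes H :: "'a::euclidean_space set"
  assumes H: "affine H" and U: "openin (top_of_set H) U" "U \<noteq> {}"
    and N: "finite N" "\<And>L. L \<in> N \<Longrightarrow> affine L \<and> aff_dim L < aff_dim H"
  shows "\<exists>y\<in>U. y \<notin> \<Union>N"
proof (rule ccontr)
  assume "\<not> ?thesis"
  then have sub: "U \<subseteq> \<Union>N" by auto
  obtain x where x: "x \<in> U" using U(2) by auto
  then obtain e where e: "0 < e" "ball x e \<inter> H \<subseteq> U" using U(1) by (meson openin_contains_ball)
  have xH: "x \<in> affine hull H" using x U(1) H by (metis hull_inc openin_imp_subset subsetD)
  then have ne: "H \<noteq> {}" by auto
  have hH: "affine hull H = H" using H by (rule hull_same)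
  obtain K where K: "0 < K" "\<And>p r. \<lbrakk>p \<in> affine hull H; 0 < r\<rbrakk> \<Longrightarrow>
       emeasure (flat_measure H) (ball p r) = ennreal (K * r ^ nat (aff_dim H))"
    by (rule flat_measure_ball[OF ne]) (rule that)
  have "(\<Union>L\<in>N. L) \<in> null_sets (flat_measure H)"
    using N flat_measure_null_affine[OF ne] by (intro null_sets_UN') (auto intro: countable_finite)
  then have "emeasure (flat_measure H) (\<Union>N) = 0" "\<Union>N \<in> sets (flat_measure H)" by auto
  moreover have "emeasure (flat_measure H) (ball x e \<inter> affine hull H) \<le> emeasure (flat_measure H) (\<Union>N)"
  proof (rule emeasure_mono)
    show "ball x e \<inter> affine hull H \<subseteq> \<Union>N" unfolding hH using e(2) sub by blast
  qed (rule calculation(2))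
  ultimately have "ennreal (K * e ^ nat (aff_dim H)) = 0"
    using K(2)[OF xH e(1)] flat_measure_inter_affine_hull[OF ne, of "ball x e"] by simp
  moreover have "0 < K * e ^ nat (aff_dim H)" using K(1) e(1) by simp
  ultimately show False by (simp add: ennreal_eq_0_iff)
qed

text \<open>Two cells that meet inside \<open>X\<close> can be joined by a segment in \<open>X\<close> that avoids the sets of
  codimension two, hence it only crosses facets.\<close>

lemma constant_on_connected_mesh:
  fixes X H :: "'a::euclidean_space set" and q :: "'a set \<Rightarrow> real"
  assumes X: "connected X" "openin (top_of_set H) X" "affine H"
    and C: "finite C" "\<And>T. T \<in> C \<Longrightarrow> closed T \<and> convex T \<and> affine hull T = H \<and> T \<inter> X \<noteq> {}" "X \<subseteq> \<Union>C"
    and N: "finite N" "\<And>L. L \<in> N \<Longrightarrow> affine L \<and> aff_dim L \<le> aff_dim H - 2"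
    and step: "\<And>T T' z. \<lbrakk>T \<in> C; T' \<in> C; z \<in> X; z \<in> T; z \<in> T'; z \<notin> \<Union>N\<rbrakk> \<Longrightarrow> q T = q T'"
    and T: "T1 \<in> C" "T2 \<in> C"
  shows "q T1 = q T2"
proof (rule ccontr)
  assume ne: "q T1 \<noteq> q T2"
  define A where "A = \<Union>{T \<in> C. q T = q T1}"
  define B where "B = \<Union>{T \<in> C. q T \<noteq> q T1}"
  have cl: "closed A" "closed B" using C by (auto simp: A_def B_def intro!: closed_Union)
  have cov: "X \<subseteq> A \<union> B" using C(3) by (auto simp: A_def B_def)
  have "A \<inter> X \<noteq> {}" "B \<inter> X \<noteq> {}"
    using C(2)[OF T(1)] C(2)[OF T(2)] T ne by (fastforce simp: A_def B_def)+
  \<comment> \<open>Connectedness makes the cells with the value of T1 meet the others at a point of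
    X. This point may lie in the exceptional set, so it is only the centre of a ball in which a
    generic segment is sought.\<close>
  then have "A \<inter> B \<inter> X \<noteq> {}" using X(1) cl cov unfolding connected_closed by blast
  then obtain x Ta Tb where x: "x \<in> X" "x \<in> Ta" "x \<in> Tb" and Tab: "Ta \<in> C" "Tb \<in> C" "q Ta = q T1" "q Tb \<noteq> q T1"
    by (auto simp: A_def B_def)
  obtain e where e: "0 < e" "ball x e \<inter> H \<subseteq> X" using X(2) x(1) by (meson openin_contains_ball)
  have opn: "openin (top_of_set H) (rel_interior T \<inter> ball x e)" "rel_interior T \<inter> ball x e \<noteq> {}"
    if "T \<in> C" "x \<in> T" for T
  proof -
    have T: "convex T" "closed T" "affine hull T = H" using C(2)[OF that(1)] by auto
    show "openin (top_of_set H) (rel_interior T \<inter> ball x e)"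
      using openin_rel_interior[of T] T(3) by (simp add: openin_Int_open)
    have "x \<in> closure (rel_interior T)" using T that(2) by (simp add: convex_closure_rel_interior)
    then show "rel_interior T \<inter> ball x e \<noteq> {}"
      using e(1) by (metis closure_approachable disjoint_iff dist_commute mem_ball)
  qed
  have "\<exists>y\<in>rel_interior Ta \<inter> ball x e. y \<notin> \<Union>N"
    using N by (intro avoid_affine_sets[OF X(3) opn[OF Tab(1) x(2)]]) force+
  then obtain y1 where y1: "y1 \<in> rel_interior Ta" "y1 \<in> ball x e" "y1 \<notin> \<Union>N" by auto
  have y1N: "y1 \<notin> L" if "L \<in> N" for L using that y1(3) by auto
  \<comment> \<open>The cones over the exceptional sets with vertex y1. They still have codimension
    one, and a segment from y1 that met an exceptional set would end in such a cone.\<close>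
  define N' where "N' = (\<lambda>L. affine hull (insert y1 L)) ` N"
  have "\<exists>y\<in>rel_interior Tb \<inter> ball x e. y \<notin> \<Union>N'"
  proof (rule avoid_affine_sets[OF X(3) opn[OF Tab(2) x(3)]])
    show "finite N'" using N(1) by (simp add: N'_def)
    fix L' assume "L' \<in> N'"
    then obtain L where L: "L \<in> N" "L' = affine hull (insert y1 L)" by (auto simp: N'_def)
    have "aff_dim (insert y1 L) \<le> aff_dim L + 1" by (simp add: aff_dim_insert)
    then show "affine L' \<and> aff_dim L' < aff_dim H" using N(2)[OF L(1)] L(2) by auto
  qed
  then obtain y2 where y2: "y2 \<in> rel_interior Tb" "y2 \<in> ball x e" "y2 \<notin> \<Union>N'" by auto
  let ?I = "closed_segment y1 y2"
  have yT: "y1 \<in> Ta" "y2 \<in> Tb" using y1 y2 rel_interior_subset by auto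
  then have "y1 \<in> affine hull Ta" "y2 \<in> affine hull Tb" by (auto intro: hull_inc)
  then have yH: "y1 \<in> H" "y2 \<in> H" using C(2)[OF Tab(1)] C(2)[OF Tab(2)] by auto
  have "?I \<subseteq> ball x e \<inter> H"
    using y1(2) y2(2) yH by (intro closed_segment_subset convex_Int) (auto simp: affine_imp_convex X(3))
  then have IX: "?I \<subseteq> X" using e(2) by auto
  have "A \<inter> ?I \<noteq> {}" "B \<inter> ?I \<noteq> {}"
    using yT Tab by (auto simp: A_def B_def)
  moreover have "?I \<subseteq> A \<union> B" using IX cov by auto
  ultimately have "A \<inter> B \<inter> ?I \<noteq> {}"
    using connected_segment(1)[of y1 y2] cl unfolding connected_closed by blast
  then obtain z T T' where z: "z \<in> ?I" "z \<in> T" "z \<in> T'" "T \<in> C" "T' \<in> C" "q T = q T1" "q T' \<noteq> q T1"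
    by (auto simp: A_def B_def)
  have "z \<notin> L" if L: "L \<in> N" for L
  proof
    assume zL: "z \<in> L"
    then have zy: "z \<noteq> y1" using y1N[OF L] by auto
    obtain u where u: "0 \<le> u" "u \<le> 1" "z = (1 - u) *\<^sub>R y1 + u *\<^sub>R y2"
      using z(1) by (auto simp: in_segment)
    then have u0: "u \<noteq> 0" using zy by auto
    have "y2 = (1 - 1 / u) *\<^sub>R y1 + (1 / u) *\<^sub>R z"
      using u0 by (simp add: u(3) algebra_simps)
    moreover have "(1 - 1 / u) *\<^sub>R y1 + (1 / u) *\<^sub>R z \<in> affine hull (insert y1 L)"
      using zL by (intro mem_affine affine_affine_hull hull_inc) auto
    ultimately show False using y2(3) L by (auto simp: N'_def)
  qed
  then have "q T = q T'" using z IX by (intro step) auto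
  with z show False by simp
qed

lemma flat_measure_null_Union:
  assumes "S \<noteq> {}" "finite N" "\<And>L. L \<in> N \<Longrightarrow> affine L \<and> aff_dim L < aff_dim S"
  shows "\<Union>N \<in> null_sets (flat_measure S)"
proof -
  have "(\<Union>L\<in>N. L) \<in> null_sets (flat_measure S)"
  proof (rule null_sets_UN')
    show "countable N" using assms(2) by (rule countable_finite)
    show "L \<in> null_sets (flat_measure S)" if "L \<in> N" for L
      using assms(3)[OF that] by (intro flat_measure_null_affine[OF assms(1)]) auto
  qed
  then show ?thesis by simp
qed

text \<open>Affine hulls instead of the faces themselves, so that the exceptional sets are affine,
  as \<open>avoid_affine_sets\<close> and the null set lemma require.\<close>

definition face_hulls :: "'a::euclidean_space set set \<Rightarrow> int \<Rightarrow> 'a set set" where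
  "face_hulls C d = (\<lambda>e. affine hull e) ` (\<Union>T\<in>C. {e. e face_of T \<and> aff_dim e \<le> d})"

lemma face_hulls:
  shows "\<lbrakk>finite C; \<And>T. T \<in> C \<Longrightarrow> polytope T\<rbrakk> \<Longrightarrow> finite (face_hulls C d)"
    and "L \<in> face_hulls C d \<Longrightarrow> affine L \<and> aff_dim L \<le> d"
    and "\<lbrakk>T \<in> C; e face_of T; aff_dim e \<le> d; x \<in> e\<rbrakk> \<Longrightarrow> x \<in> \<Union>(face_hulls C d)"
proof -
  show "finite (face_hulls C d)" if "finite C" "\<And>T. T \<in> C \<Longrightarrow> polytope T"
    unfolding face_hulls_def
  proof (intro finite_imageI finite_UN_I that(1))
    fix T assume "T \<in> C"
    then have "finite {e. e face_of T}" by (intro finite_polytope_faces that(2))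
    then show "finite {e. e face_of T \<and> aff_dim e \<le> d}" by (rule rev_finite_subset) auto
  qed
  show "L \<in> face_hulls C d \<Longrightarrow> affine L \<and> aff_dim L \<le> d" by (auto simp: face_hulls_def)
  show "x \<in> \<Union>(face_hulls C d)" if *: "T \<in> C" "e face_of T" "aff_dim e \<le> d" "x \<in> e"
  proof (rule UnionI)
    show "affine hull e \<in> face_hulls C d" using * unfolding face_hulls_def by blast
    show "x \<in> affine hull e" using *(4) by (rule hull_inc)
  qed
qed

section \<open>The meshed medium\<close>

locale meshed_medium =
  fixes \<Omega> :: "'a::euclidean_space medium" and M :: "'a mesh" and \<sigma> :: real
  assumes medium: "fractured_medium \<Omega>" and medium_mesh: "medium_mesh \<Omega> \<sigma> M"
begin

abbreviation "SD \<equiv> subdoms \<Omega>"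

lemma medium_props:
  shows region: "open (region \<Omega>)" "connected (region \<Omega>)" "bounded (region \<Omega>)" "region \<Omega> \<noteq> {}"
    and finite_SD: "finite SD" and SD_region: "\<Union>SD \<subseteq> region \<Omega>"
    and top_SD: "{S \<in> SD. aff_dim S = int DIM('a)} = components (region \<Omega> - (\<Union>S\<in>lower_subdoms \<Omega>. closure S))"
    and lower_iface: "\<forall>S\<in>lower_subdoms \<Omega>. \<exists>U \<nu>. (S, U, \<nu>) \<in> ifaces \<Omega>"
    and boundary: "dirichlet \<Omega> \<union> neumann \<Omega> = outer_boundary \<Omega>" "dirichlet \<Omega> \<inter> neumann \<Omega> = {}"
    and dirichlet_pos: "\<exists>H. affine H \<and> aff_dim H = int DIM('a) - 1 \<and> 0 < emeasure (flat_measure H) (dirichlet \<Omega> \<inter> H)"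
  using medium unfolding fractured_medium_def by - (elim conjE, assumption)+

lemma SD_all: "\<forall>S\<in>SD. S \<noteq> {} \<and> connected S \<and> openin (top_of_set (affine hull S)) S"
  and SD_closures: "\<forall>S\<in>SD. \<forall>U\<in>SD. S \<noteq> U \<and> aff_dim U \<le> aff_dim S \<longrightarrow> S \<inter> closure U = {}"
  using medium unfolding fractured_medium_def by - (elim conjE, assumption)+

lemma SD_props:
  assumes S: "S \<in> SD"
  shows "S \<noteq> {}" "connected S" "openin (top_of_set (affine hull S)) S" "bounded S" "S \<in> sets borel" "0 \<le> aff_dim S"
proof -
  show ne: "S \<noteq> {}" and "connected S" and op: "openin (top_of_set (affine hull S)) S"
    using SD_all S by auto
  show "bounded S" using region(3) SD_region S by (meson Union_upper bounded_subset order_trans)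
  obtain O' where O': "open O'" "S = affine hull S \<inter> O'" using op unfolding openin_open by auto
  show "S \<in> sets borel"
    by (subst O'(2), rule sets.Int) (rule borel_closed[OF closed_affine_hull], rule borel_open[OF O'(1)])
  show "0 \<le> aff_dim S" using ne aff_dim_negative_iff[of S] by linarith
qed

lemma SD_closure_disjoint: "\<lbrakk>S \<in> SD; U \<in> SD; S \<noteq> U; aff_dim U \<le> aff_dim S\<rbrakk> \<Longrightarrow> S \<inter> closure U = {}"
  using SD_closures by blast

lemma SD_disjoint: "\<lbrakk>S \<in> SD; U \<in> SD; x \<in> S; x \<in> U\<rbrakk> \<Longrightarrow> S = U"
  using SD_closure_disjoint[of S U] SD_closure_disjoint[of U S] closure_subset[of S] closure_subset[of U]
  by (metis IntI empty_iff linorder_le_cases subsetD)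

lemma boundary_disjoint: "\<lbrakk>S \<in> SD; x \<in> S\<rbrakk> \<Longrightarrow> x \<notin> dirichlet \<Omega> \<and> x \<notin> neumann \<Omega>"
  using boundary(1) unfolding outer_boundary_def by blast

lemma cells_smesh: "S \<in> SD \<Longrightarrow> smesh S (cells M S)"
  using medium_mesh SD_props(1) unfolding medium_mesh_def smesh_def by blast

lemma mortar_smesh: "g \<in> ifaces \<Omega> \<Longrightarrow> smesh (fst g) (mortar_cells M g)"
  using medium_mesh SD_props(1) unfolding medium_mesh_def smesh_def
  by (cases g) (fastforce simp: ifaces_def)

lemma cells_shape_regular: "\<lbrakk>S \<in> SD; T \<in> cells M S\<rbrakk> \<Longrightarrow> shape_regular \<sigma> T"
  using medium_mesh unfolding medium_mesh_def by blast

lemma facet_resolves: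
  assumes "S \<in> SD" "T \<in> cells M S" "f facet_of T" "A \<in> SD \<union> {dirichlet \<Omega>, neumann \<Omega>}"
    and x: "x \<in> rel_interior f" "x \<in> A"
  shows "rel_interior f \<subseteq> A"
proof -
  have "rel_interior f \<subseteq> A \<or> rel_interior f \<inter> A = {}"
    using medium_mesh assms(1-4) unfolding medium_mesh_def by blast
  with x show ?thesis by blast
qed

text \<open>A relative interior point of a cell lies in the subdomain that it meshes. This allows
  fluxes and pressures of all subdomains to be indexed by cells alone.\<close>

lemma cell_unique_SD:
  assumes "S \<in> SD" "T \<in> cells M S" "S' \<in> SD" "T \<in> cells M S'"
  shows "S = S'"
proof -
  interpret s: smesh S "cells M S" using assms(1) by (rule cells_smesh)
  interpret s': smesh S' "cells M S'" using assms(3) by (rule cells_smesh)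
  obtain x where "x \<in> rel_interior T" using s.C_props(3)[OF assms(2)] by auto
  then show ?thesis
    using s.rel_interior_sub[OF assms(2)] s'.rel_interior_sub[OF assms(4)] SD_disjoint assms by blast
qed

lemma ifaceD:
  assumes "(S, U, \<nu>) \<in> ifaces \<Omega>"
  shows "S \<in> SD" "U \<in> SD" "aff_dim U = aff_dim S + 1" "\<nu> \<in> tangent U" "norm \<nu> = 1"
    "\<And>\<tau>. \<tau> \<in> tangent S \<Longrightarrow> \<nu> \<bullet> \<tau> = 0" "\<And>x. x \<in> S \<Longrightarrow> \<forall>\<^sub>F t in at_right 0. x - t *\<^sub>R \<nu> \<in> U"
  using assms unfolding ifaces_def by auto

text \<open>The pigeonhole principle: finitely many closed cells cover \<open>U\<close>, so one of them contains points
  \<open>x - t \<nu>\<close> for arbitrarily small \<open>t\<close>.\<close>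

lemma iface_adjacent_cell:
  assumes g: "(S, U, \<nu>) \<in> ifaces \<Omega>" and x: "x \<in> S"
  obtains T where "T \<in> cells M U" "x \<in> T" "\<exists>\<^sub>F t in at_right 0. x - t *\<^sub>R \<nu> \<in> T"
proof -
  note gD = ifaceD[OF g]
  interpret u: smesh U "cells M U" using gD(2) by (rule cells_smesh)
  have "\<exists>T\<in>cells M U. \<exists>\<^sub>F t in at_right 0. x - t *\<^sub>R \<nu> \<in> T"
  proof (rule ccontr)
    assume "\<not> ?thesis"
    then have "\<forall>T\<in>cells M U. \<forall>\<^sub>F t in at_right 0. x - t *\<^sub>R \<nu> \<notin> T" by (simp add: not_frequently)
    then have "\<forall>\<^sub>F t in at_right 0. \<forall>T\<in>cells M U. x - t *\<^sub>R \<nu> \<notin> T"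
      using u.finite_C by (intro eventually_ball_finite) auto
    then have "\<forall>\<^sub>F t in at_right (0::real). False"
      using gD(7)[OF x]
    proof eventually_elim
      fix t :: real assume *: "\<forall>T\<in>cells M U. x - t *\<^sub>R \<nu> \<notin> T" "x - t *\<^sub>R \<nu> \<in> U"
      then have "x - t *\<^sub>R \<nu> \<in> \<Union>(cells M U)" using u.Union_C closure_subset by blast
      with * show False by auto
    qed
    then show False by (simp add: trivial_limit_at_right_real)
  qed
  then obtain T where T: "T \<in> cells M U" "\<exists>\<^sub>F t in at_right 0. x - t *\<^sub>R \<nu> \<in> T" by auto
  have "x \<in> T"
  proof (rule ccontr)
    assume "x \<notin> T"
    moreover have "closed T" using u.C_props(6)[OF T(1)] by (rule compact_imp_closed)
    ultimately have "open (- T)" "x \<in> - T" by auto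
    moreover have "((\<lambda>t. x - t *\<^sub>R \<nu>) \<longlongrightarrow> x - 0 *\<^sub>R \<nu>) (at_right 0)" by (intro tendsto_intros)
    ultimately have "\<forall>\<^sub>F t in at_right 0. x - t *\<^sub>R \<nu> \<in> - T"
      by (intro topological_tendstoD) auto
    then show False using T(2) by (simp add: frequently_def)
  qed
  with T that show thesis by blast
qed

text \<open>\<open>ifaces\<close> only requires points close to S along the normal to lie in U. The
  inclusion follows since every point of S belongs to a closed cell of U.\<close>

lemma iface_subset_hull:
  assumes g: "(S, U, \<nu>) \<in> ifaces \<Omega>"
  shows "affine hull S \<subseteq> affine hull U" "tangent S \<subseteq> tangent U"
proof -
  interpret u: smesh U "cells M U" using ifaceD(2)[OF g] by (rule cells_smesh)
  have "S \<subseteq> affine hull U"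
  proof
    fix x assume "x \<in> S"
    then obtain T where T: "T \<in> cells M U" "x \<in> T" using iface_adjacent_cell[OF g] by metis
    then show "x \<in> affine hull U" using u.C_props(8)[OF T(1)] hull_inc[of x T affine] by auto
  qed
  then show 1: "affine hull S \<subseteq> affine hull U" by (simp add: hull_minimal)
  show "tangent S \<subseteq> tangent U" using 1 by (rule tangent_mono)
qed

lemma iface_facet_hull:
  assumes g: "(S, U, \<nu>) \<in> ifaces \<Omega>" and T: "T \<in> cells M U" and f: "f facet_of T" "rel_interior f \<subseteq> S"
  shows "affine hull f = affine hull S" "tangent f = tangent S" "flat_measure f = flat_measure S"
proof -
  note gD = ifaceD[OF g]
  interpret u: smesh U "cells M U" using gD(2) by (rule cells_smesh)
  have "convex f" using f(1) u.C_props(4)[OF T] by (meson face_of_imp_convex facet_of_imp_face_of)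
  moreover have "aff_dim f = aff_dim S" using f(1) u.C_props(1)[OF T] gD(3) by (simp add: facet_of_def)
  ultimately show "affine hull f = affine hull S" using f(2) by (intro facet_affine_hull)
  then show "tangent f = tangent S" "flat_measure f = flat_measure S"
    using tangent_affine_hull[of f] tangent_affine_hull[of S] flat_measure_cong by auto
qed

lemma normal_is_iface_normal:
  assumes g: "(S, U, \<nu>) \<in> ifaces \<Omega>" and T: "T \<in> cells M U" and f: "f facet_of T" "tangent f = tangent S"
  shows "\<nu> = outer_normal T f \<or> \<nu> = - outer_normal T f"
proof -
  note gD = ifaceD[OF g]
  interpret u: smesh U "cells M U" using gD(2) by (rule cells_smesh)
  have "1 \<le> aff_dim U" using gD(3) SD_props(6)[OF gD(1)] by simp
  then interpret c: cell T using u.cell_C[OF T] by simp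
  show ?thesis
    using c.facet_normal_unique[OF f(1) c.outer_normal_props(2,3,4)[OF f(1)], of \<nu>] gD(4,5,6) f(2) u.C_props(9)[OF T]
    by simp
qed

text \<open>All sums over interfaces depend on this. A normal other than \<nu> and - \<nu> would
  have a component w orthogonal to \<nu>, and an orthonormal basis of the tangent space of S
  extended by both would exceed the dimension of U, which is one more than that of S.\<close>

lemma finite_ifaces: "finite (ifaces \<Omega>)"
proof -
  have "finite {\<nu>. (S, U, \<nu>) \<in> ifaces \<Omega>}" for S U
  proof (cases "\<exists>\<nu>. (S, U, \<nu>) \<in> ifaces \<Omega>")
    case True
    then obtain \<nu> where g: "(S, U, \<nu>) \<in> ifaces \<Omega>" by auto
    note gD = ifaceD[OF g]
    have "\<nu>' = \<nu> \<or> \<nu>' = - \<nu>" if g': "(S, U, \<nu>') \<in> ifaces \<Omega>" for \<nu>'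
    proof -
      note gD' = ifaceD[OF g']
      define w where "w = \<nu>' - (\<nu> \<bullet> \<nu>') *\<^sub>R \<nu>"
      have "w = 0"
      proof (rule ccontr)
        assume w0: "w \<noteq> 0"
        have wT: "w \<in> tangent U" using gD(4) gD'(4) unfolding w_def by (intro subspace_diff subspace_scale subspace_tangent)
        have wn: "\<nu> \<bullet> w = 0" using gD(5) by (simp add: w_def inner_simps norm_eq_1)
        have wS: "w \<bullet> \<tau> = 0" if "\<tau> \<in> tangent S" for \<tau> using gD(6)[OF that] gD'(6)[OF that] by (simp add: w_def inner_simps)
        let ?B = "insert (w /\<^sub>R norm w) (insert \<nu> (onb (tangent S)))"
        note o = onb[OF subspace_tangent[of S]]
        have n1: "\<nu> \<notin> onb (tangent S)" using gD(6)[of \<nu>] gD(5) o(1) by (auto simp: norm_eq_1)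
        have n2: "w /\<^sub>R norm w \<notin> onb (tangent S)"
          using wS[of "w /\<^sub>R norm w"] w0 o(1) by auto
        have n3: "w /\<^sub>R norm w \<noteq> \<nu>" 
        proof
          assume eq: "w /\<^sub>R norm w = \<nu>"
          have "\<nu> \<bullet> (w /\<^sub>R norm w) = 0" using wn by simp
          then show False using gD(5) unfolding eq by (simp add: norm_eq_1)
        qed
        have orth: "orthonormal ?B"
          unfolding orthonormal_def
        proof (intro conjI ballI)
          show "norm b = 1" if "b \<in> ?B" for b
            using that w0 gD(5) o(2) by (auto simp: orthonormal_def)
          have a: "orthogonal \<nu> b \<and> orthogonal (w /\<^sub>R norm w) b" if "b \<in> onb (tangent S)" for b
            using that o(1) gD(6) wS by (auto simp: orthogonal_def)
          have b: "orthogonal \<nu> (w /\<^sub>R norm w)" using wn by (simp add: orthogonal_def)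
          show "pairwise orthogonal ?B"
            using o(2) a b by (auto simp: pairwise_insert orthonormal_def orthogonal_commute)
        qed
        have "card ?B = Suc (Suc (card (onb (tangent S))))"
          using n1 n2 n3 orthonormal_finite[OF o(2)] by simp
        moreover have "?B \<subseteq> tangent U"
          using wT gD(4) o(1) iface_subset_hull(2)[OF g] by (auto intro: subspace_scale subspace_tangent)
        then have "card ?B \<le> dim (tangent U)"
          using orthonormal_independent[OF orth] by (intro independent_card_le_dim)
        ultimately have "dim (tangent S) + 2 \<le> dim (tangent U)" using o(4) by simp
        then show False
          using gD(3) dim_tangent[OF SD_props(1)[OF gD(1)]] dim_tangent[OF SD_props(1)[OF gD(2)]] by linarith
      qed
      then have e: "\<nu>' = (\<nu> \<bullet> \<nu>') *\<^sub>R \<nu>" by (simp add: w_def)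
      then have "norm \<nu>' = \<bar>\<nu> \<bullet> \<nu>'\<bar> * norm \<nu>" by (metis norm_scaleR)
      then have "\<bar>\<nu> \<bullet> \<nu>'\<bar> = 1" using gD(5) gD'(5) by simp
      then have "\<nu> \<bullet> \<nu>' = 1 \<or> \<nu> \<bullet> \<nu>' = - 1" by linarith
      then show ?thesis using e by auto
    qed
    then have "{\<nu>'. (S, U, \<nu>') \<in> ifaces \<Omega>} \<subseteq> {\<nu>, - \<nu>}" by auto
    then show ?thesis by (rule finite_subset) simp
  qed simp
  then have "finite (SIGMA S:SD. SIGMA U:SD. {\<nu>. (S, U, \<nu>) \<in> ifaces \<Omega>})"
    using finite_SD by (intro finite_SigmaI)
  moreover have "ifaces \<Omega> \<subseteq> (SIGMA S:SD. SIGMA U:SD. {\<nu>. (S, U, \<nu>) \<in> ifaces \<Omega>})"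
    using ifaceD(1,2) by auto
  ultimately show ?thesis by (rule finite_subset[rotated])
qed

text \<open>Pairs of a cell and a facet: where U is slit, the same facet as a set can belong to
  cells on both sides, and the outer normal relative to the cell tells the sides apart.\<close>

definition iface_facets :: "'a iface \<Rightarrow> ('a set \<times> 'a set) set" where
  "iface_facets g = {(T, f). T \<in> cells M (fst (snd g)) \<and> f facet_of T \<and> lies_on (fst (snd g)) T f g}"

lemma iface_facetsD:
  assumes "(T, f) \<in> iface_facets (S, U, \<nu>)"
  shows "T \<in> cells M U" "f facet_of T" "\<nu> = outer_normal T f" "rel_interior f \<subseteq> S"
  using assms by (auto simp: iface_facets_def lies_on_def)

lemma iface_facetsI:
  "\<lbrakk>T \<in> cells M U; f facet_of T; \<nu> = outer_normal T f; rel_interior f \<subseteq> S\<rbrakk> \<Longrightarrow> (T, f) \<in> iface_facets (S, U, \<nu>)"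
  by (auto simp: iface_facets_def lies_on_def)

lemma finite_iface_facets:
  assumes "g \<in> ifaces \<Omega>" shows "finite (iface_facets g)"
proof -
  obtain S U \<nu> where g: "g = (S, U, \<nu>)" by (cases g)
  have U: "U \<in> SD" using assms ifaceD(2) unfolding g by blast
  interpret u: smesh U "cells M U" using U by (rule cells_smesh)
  have "finite (SIGMA T:cells M U. {f. f facet_of T})"
    using u.finite_C u.C_props(5) by (intro finite_SigmaI) (auto intro: finite_polyhedron_facets)
  then show ?thesis by (rule finite_subset[rotated]) (auto simp: g iface_facets_def)
qed

lemma iface_facets_disjoint:
  assumes g: "(S, U, \<nu>) \<in> ifaces \<Omega>" and "(T, f) \<in> iface_facets (S, U, \<nu>)" "(T', f') \<in> iface_facets (S, U, \<nu>)"
    and "p \<in> rel_interior f" "p \<in> rel_interior f'"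
  shows "T = T' \<and> f = f'"
proof -
  interpret u: smesh U "cells M U" using ifaceD(2)[OF g] by (rule cells_smesh)
  have "1 \<le> aff_dim U" using ifaceD(1,3)[OF g] SD_props(6) by force
  then show ?thesis using iface_facetsD[OF assms(2)] iface_facetsD[OF assms(3)] assms(4,5) by (intro u.same_side) auto
qed

text \<open>Away from the hulls of faces of smaller dimension than S, a point x of S is in the
  relative interior of a facet of an adjacent cell, and this facet lies in S because the mesh
  resolves the subdomains. Since the cell contains points x - t \<nu> with t > 0, its outer normal
  there is \<nu> and not - \<nu>.\<close>

lemma iface_covered:
  assumes g: "(S, U, \<nu>) \<in> ifaces \<Omega>"
  shows "S - (\<Union>(T, f)\<in>iface_facets (S, U, \<nu>). rel_interior f) \<in> null_sets (flat_measure S)"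
proof -
  note gD = ifaceD[OF g]
  interpret u: smesh U "cells M U" using gD(2) by (rule cells_smesh)
  have dU: "1 \<le> aff_dim U" using gD(3) SD_props(6)[OF gD(1)] by simp
  have S_ne: "S \<noteq> {}" using SD_props(1)[OF gD(1)] .
  define N where "N = face_hulls (cells M U) (aff_dim S - 1)"
  have null: "\<Union>N \<in> null_sets (flat_measure S)"
    unfolding N_def using face_hulls(2)[of _ "cells M U" "aff_dim S - 1"]
    by (intro flat_measure_null_Union[OF S_ne] face_hulls(1)[OF u.finite_C] u.C_props(7)) force+
  have "S - (\<Union>(T, f)\<in>iface_facets (S, U, \<nu>). rel_interior f) \<subseteq> \<Union>N"
  proof
    fix x assume x: "x \<in> S - (\<Union>(T, f)\<in>iface_facets (S, U, \<nu>). rel_interior f)"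
    then have xS: "x \<in> S" by simp
    obtain T where T: "T \<in> cells M U" "x \<in> T" "\<exists>\<^sub>F t in at_right 0. x - t *\<^sub>R \<nu> \<in> T"
      by (rule iface_adjacent_cell[OF g xS]) (rule that)
    interpret c: cell T using T(1) dU by (rule u.cell_C)
    have "S \<noteq> U" using gD(3) by auto
    then have "x \<notin> rel_interior T"
      using u.rel_interior_sub[OF T(1)] xS SD_disjoint[OF gD(1,2)] by blast
    then obtain f where f: "f facet_of T" "x \<in> f" by (rule polyhedron_in_facet[OF c.polyhedron_T T(2)]) (rule that)
    note fp = c.facet_props[OF f(1)]
    show "x \<in> \<Union>N"
    proof (cases "x \<in> rel_interior f")
      case True
      then have fS: "rel_interior f \<subseteq> S" using facet_resolves[OF gD(2) T(1) f(1), of S x] gD(1) xS by simp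
      have tf: "tangent f = tangent S" using iface_facet_hull[OF g T(1) f(1) fS] by simp
      have "\<nu> \<noteq> - outer_normal T f"
      proof
        assume eq: "\<nu> = - outer_normal T f"
        obtain t :: real where t: "x - t *\<^sub>R \<nu> \<in> T" "0 < t"
          using frequently_ex[OF frequently_eventually_conj[OF T(3) eventually_at_right_less]] by auto
        have "outer_normal T f \<bullet> ((x - t *\<^sub>R \<nu>) - x) \<le> 0"
          using c.outer_normal_props(6)[OF f(1) t(1) f(2)] .
        then show False using t(2) c.outer_normal_props(3)[OF f(1)] unfolding eq by (simp add: norm_eq_1)
      qed
      then have "\<nu> = outer_normal T f" using normal_is_iface_normal[OF g T(1) f(1) tf] by simp
      then have "(T, f) \<in> iface_facets (S, U, \<nu>)" using T f fS by (intro iface_facetsI)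
      then show ?thesis using x True by auto
    next
      case False
      have "polyhedron f" using c.polyhedron_T f(1) by (meson face_of_polyhedron_polyhedron facet_of_imp_face_of)
      then obtain e where e: "e facet_of f" "x \<in> e" by (rule polyhedron_in_facet[OF _ f(2) False]) (rule that)
      have "e face_of T" using e(1) f(1) by (meson face_of_trans facet_of_imp_face_of)
      moreover have "aff_dim e \<le> aff_dim S - 1"
        using e(1) fp(5) u.C_props(1)[OF T(1)] gD(3) by (simp add: facet_of_def)
      ultimately show ?thesis unfolding N_def using T(1) e(2) by (intro face_hulls(3))
    qed
  qed
  moreover have "S - (\<Union>(T, f)\<in>iface_facets (S, U, \<nu>). rel_interior f) \<in> sets (flat_measure S)"
  proof -
    have "(\<Union>(T, f)\<in>iface_facets (S, U, \<nu>). rel_interior f) \<in> sets borel"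
      using finite_iface_facets[OF g] by (intro sets.finite_UN) auto
    then show ?thesis using SD_props(5)[OF gD(1)] by simp
  qed
  ultimately show ?thesis using null_sets_subset[OF null] by blast
qed

end

section \<open>Pressures without jumps vanish\<close>

lemma closure_Union_finite: "finite A \<Longrightarrow> closure (\<Union>A) = (\<Union>S\<in>A. closure S)"
  by (induction A rule: finite_induct) (auto simp: closure_Un)

context meshed_medium
begin

lemma polyhedron_facet: "\<lbrakk>polyhedron T; f facet_of T\<rbrakk> \<Longrightarrow> polyhedron f"
  by (meson face_of_polyhedron_polyhedron facet_of_imp_face_of)

lemma face_rel_interior_or_lower:
  assumes e: "polyhedron e" "e face_of T" "aff_dim e = d + 1" "x \<in> e" and T: "T \<in> C" and x: "x \<notin> \<Union>(face_hulls C d)"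
  shows "x \<in> rel_interior e"
proof (rule ccontr)
  assume ni: "x \<notin> rel_interior e"
  obtain e' where e': "e' facet_of e" "x \<in> e'"
    by (rule polyhedron_in_facet[OF e(1,4) ni]) (rule that)
  have "e' face_of T" using e'(1) e(2) by (meson face_of_trans facet_of_imp_face_of)
  moreover have "aff_dim e' \<le> d" using e'(1) e(3) by (simp add: facet_of_def)
  ultimately show False using face_hulls(3)[OF T _ _ e'(2)] x by blast
qed

text \<open>A point subdomain has just one cell. Otherwise, at a point outside the hulls of the
  faces of codimension two, two distinct cells can only meet in a common facet, where the hypothesis
  applies.\<close>

lemma constant_on_subdomain:
  assumes S: "S \<in> SD" and T: "T \<in> cells M S" "T' \<in> cells M S"
    and q: "\<And>T T' f. \<lbrakk>1 \<le> aff_dim S; T \<in> cells M S; T' \<in> cells M S; T \<noteq> T'; f facet_of T; f facet_of T'; rel_interior f \<subseteq> S\<rbrakk>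
        \<Longrightarrow> q T = q T'"
  shows "(q T :: real) = q T'"
proof (cases "aff_dim S = 0")
  case True
  then obtain a where a: "S = {a}" using aff_dim_eq_0 by auto
  interpret s: smesh S "cells M S" using S by (rule cells_smesh)
  have "rel_interior T = {a}" "rel_interior T' = {a}"
    using s.C_props(3) s.rel_interior_sub T a by blast+
  then have "T = T'" using s.C_unique[OF T, of a] rel_interior_subset[of T'] by auto
  then show ?thesis by simp
next
  case False
  then have d: "1 \<le> aff_dim S" using SD_props(6)[OF S] by linarith
  interpret s: smesh S "cells M S" using S by (rule cells_smesh)
  let ?N = "face_hulls (cells M S) (aff_dim S - 2)"
  show ?thesis
  proof (rule constant_on_connected_mesh[where X = S and H = "affine hull S" and C = "cells M S" and N = "?N"])
    show "connected S" "openin (top_of_set (affine hull S)) S" using SD_props[OF S] by auto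
    show "finite (cells M S)" by (rule s.finite_C)
    show "closed T \<and> convex T \<and> affine hull T = affine hull S \<and> T \<inter> S \<noteq> {}" if "T \<in> cells M S" for T
      using s.C_props(3,4,6,8)[OF that] s.rel_interior_sub[OF that] rel_interior_subset[of T]
      by (auto simp: compact_imp_closed)
    show "S \<subseteq> \<Union>(cells M S)" using s.Union_C closure_subset by auto
    show "finite ?N" by (intro face_hulls(1) s.finite_C s.C_props(7))
    show "affine L \<and> aff_dim L \<le> aff_dim (affine hull S) - 2" if "L \<in> ?N" for L
      using face_hulls(2)[OF that] by simp
    show "T \<in> cells M S" "T' \<in> cells M S" by fact+
    fix T T' z assume A: "T \<in> cells M S" "T' \<in> cells M S" "z \<in> S" "z \<in> T" "z \<in> T'" and z: "z \<notin> \<Union>?N"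
    show "q T = q T'"
    proof (cases "T = T'")
      case False
      let ?e = "T \<inter> T'"
      have e: "?e face_of T" "?e face_of T'" using s.C_match[OF A(1,2,4,5,3)] by auto
      have "?e \<noteq> T"
      proof
        assume "?e = T"
        then have "T face_of T'" using e(2) by simp
        then show False
          using face_of_aff_dim_lt[OF s.C_props(4)[OF A(2)], of T] False s.C_props(1)[OF A(1)] s.C_props(1)[OF A(2)] by simp
      qed
      then have "aff_dim ?e < aff_dim S"
        using face_of_aff_dim_lt[OF s.C_props(4)[OF A(1)] e(1)] s.C_props(1)[OF A(1)] by simp
      moreover have "\<not> aff_dim ?e \<le> aff_dim S - 2"
        using face_hulls(3)[OF A(1) e(1), of "aff_dim S - 2" z] z A by auto
      ultimately have ad: "aff_dim ?e = aff_dim S - 2 + 1" by linarith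
      have ef: "?e facet_of T" "?e facet_of T'"
        using e ad A s.C_props(1)[OF A(1)] s.C_props(1)[OF A(2)] unfolding facet_of_def by auto
      have "z \<in> rel_interior ?e"
        using face_rel_interior_or_lower[OF polyhedron_facet[OF s.C_props(5)[OF A(1)] ef(1)] e(1) ad _ A(1) z] A by simp
      then have "rel_interior ?e \<subseteq> S"
        using facet_resolves[OF S A(1) ef(1), of S z] S A(3) by simp
      then show ?thesis using q[OF d A(1,2) False ef] by simp
    qed simp
  qed auto
qed

section \<open>Full-dimensional subdomains and the interfaces between them\<close>

lemma lower_SD: "S \<in> lower_subdoms \<Omega> \<longleftrightarrow> S \<in> SD \<and> aff_dim S < int DIM('a)"
  by (simp add: lower_subdoms_def)

lemma top_component:
  assumes "D \<noteq> {}" "connected D" "D \<subseteq> region \<Omega>" "\<And>S. S \<in> lower_subdoms \<Omega> \<Longrightarrow> D \<inter> closure S = {}"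
  shows "\<exists>U\<in>SD. aff_dim U = int DIM('a) \<and> D \<subseteq> U"
proof -
  let ?R = "region \<Omega> - (\<Union>S\<in>lower_subdoms \<Omega>. closure S)"
  have "D \<subseteq> ?R" using assms(3,4) by blast
  then obtain c where "c \<in> components ?R" "D \<subseteq> c" using exists_component_superset[OF _ _ assms(2), of ?R] assms(1) by blast
  then show ?thesis using top_SD by blast
qed

text \<open>The lower-dimensional subdomains with their closures lie in finitely many proper affine
  subspaces, so points off these subspaces are dense in the region.\<close>

lemma region_subset_closure_top:
  "region \<Omega> \<subseteq> (\<Union>U\<in>{U \<in> SD. aff_dim U = int DIM('a)}. closure U)"
proof
  fix x assume x: "x \<in> region \<Omega>"
  let ?top = "{U \<in> SD. aff_dim U = int DIM('a)}"
  have fin: "finite ?top" using finite_SD by simp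
  have "x \<in> closure (\<Union>?top)"
    unfolding closure_approachable
  proof (intro allI impI)
    fix e :: real assume e: "0 < e"
    have "\<exists>y\<in>ball x e \<inter> region \<Omega>. y \<notin> \<Union>((\<lambda>S. affine hull S) ` lower_subdoms \<Omega>)"
    proof (rule avoid_affine_sets[of UNIV])
      show "openin (top_of_set UNIV) (ball x e \<inter> region \<Omega>)" using region(1) by (simp add: open_Int)
      show "ball x e \<inter> region \<Omega> \<noteq> {}" using x e centre_in_ball by blast
      show "finite ((\<lambda>S. affine hull S) ` lower_subdoms \<Omega>)" using finite_SD by (simp add: lower_subdoms_def)
    qed (auto simp: lower_SD)
    then obtain y where y: "y \<in> ball x e" "y \<in> region \<Omega>" "\<And>S. S \<in> lower_subdoms \<Omega> \<Longrightarrow> y \<notin> affine hull S" by auto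
    have "closure S \<subseteq> affine hull S" for S :: "'a set"
      by (intro closure_minimal hull_subset closed_affine_hull)
    then have "{y} \<inter> closure S = {}" if "S \<in> lower_subdoms \<Omega>" for S using y(3)[OF that] by blast
    then obtain U where "U \<in> ?top" "y \<in> U" using top_component[of "{y}"] y(2) by auto
    then show "\<exists>y\<in>\<Union>?top. dist y x < e" using y(1) by (intro bexI[of _ y]) (auto simp: dist_commute)
  qed
  also have "closure (\<Union>?top) = (\<Union>U\<in>?top. closure U)"
    using fin by (simp add: closure_Union_finite)
  finally show "x \<in> (\<Union>U\<in>?top. closure U)" .
qed

text \<open>Near a point of a subdomain \<open>S\<close> of codimension one, the side \<open>{y - t \<nu>}\<close> of \<open>S\<close> is convex and
  does not meet the fractures, hence it is contained in one subdomain; by connectedness of \<open>S\<close> this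
  subdomain is the same along \<open>S\<close>.\<close>

lemma iface_of_side:
  assumes S: "S \<in> SD" "aff_dim S = int DIM('a) - 1" and U: "U \<in> SD" "aff_dim U = int DIM('a)"
    and \<nu>: "norm \<nu> = 1" "\<And>\<tau>. \<tau> \<in> tangent S \<Longrightarrow> \<nu> \<bullet> \<tau> = 0"
    and z: "z \<in> S" "\<forall>\<^sub>F t in at_right 0. z - t *\<^sub>R \<nu> \<in> U"
  shows "(S, U, \<nu>) \<in> ifaces \<Omega>"
proof -
  define side where "side W = {x \<in> S. \<forall>\<^sub>F t in at_right 0. x - t *\<^sub>R \<nu> \<in> W}" for W
  have Sl: "S \<in> lower_subdoms \<Omega>" using S by (simp add: lower_SD)
  have local: "\<exists>W\<in>SD. \<exists>\<epsilon>>0. S \<inter> ball x \<epsilon> \<subseteq> side W" if x: "x \<in> S" for x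
  proof -
    have "open (region \<Omega> - (\<Union>S'\<in>lower_subdoms \<Omega> - {S}. closure S'))"
      using region(1) finite_SD by (intro open_Diff closed_UN) (auto simp: lower_subdoms_def)
    moreover have "x \<in> region \<Omega> - (\<Union>S'\<in>lower_subdoms \<Omega> - {S}. closure S')"
    proof -
      have "x \<in> region \<Omega>" using x S(1) SD_region by blast
      moreover have "x \<notin> closure S'" if "S' \<in> lower_subdoms \<Omega> - {S}" for S'
      proof -
        have "S \<inter> closure S' = {}"
          using that S(2) by (intro SD_closure_disjoint[OF S(1)]) (auto simp: lower_SD)
        then show ?thesis using x by blast
      qed
      ultimately show ?thesis by blast
    qed
    ultimately obtain e1 where e1: "0 < e1" "ball x e1 \<subseteq> region \<Omega> - (\<Union>S'\<in>lower_subdoms \<Omega> - {S}. closure S')"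
      by (meson open_contains_ball)
    obtain e2 where e2: "0 < e2" "ball x e2 \<inter> affine hull S \<subseteq> S"
      using SD_props(3)[OF S(1)] x by (meson openin_contains_ball)
    \<comment> \<open>Halving e1 leaves room for two displacements from x, one along S and one along
      the normal, each shorter than \<epsilon>.\<close>
    define \<epsilon> where "\<epsilon> = min (e1 / 2) e2"
    have \<epsilon>: "0 < \<epsilon>" "2 * \<epsilon> \<le> e1" "\<epsilon> \<le> e2" using e1 e2 by (auto simp: \<epsilon>_def)
    define D where "D = (\<lambda>(y, t). y - t *\<^sub>R \<nu>) ` ((ball x \<epsilon> \<inter> affine hull S) \<times> {0<..<\<epsilon>})"
    have xa: "x \<in> affine hull S" using x by (rule hull_inc)
    have "connected D"
      unfolding D_def
      by (intro connected_continuous_image connected_Times convex_connected convex_Int)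
        (auto intro!: continuous_intros simp: case_prod_unfold affine_imp_convex)
    moreover have "(x, \<epsilon> / 2) \<in> (ball x \<epsilon> \<inter> affine hull S) \<times> {0<..<\<epsilon>}" using xa \<epsilon>(1) by simp
    then have "D \<noteq> {}" unfolding D_def by blast
    moreover have Db: "D \<subseteq> ball x e1"
    proof
      fix w assume "w \<in> D"
      then obtain y t where w: "w = y - t *\<^sub>R \<nu>" "dist x y < \<epsilon>" "0 < t" "t < \<epsilon>" by (auto simp: D_def)
      have "dist y w = t" using w \<nu>(1) by (simp add: dist_norm)
      then show "w \<in> ball x e1" using dist_triangle[of x w y] w \<epsilon> by simp
    qed
    moreover have "D \<inter> closure S' = {}" if S': "S' \<in> lower_subdoms \<Omega>" for S'
    proof (cases "S' = S")
      case True
      have "w \<notin> affine hull S" if wD: "w \<in> D" for w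
      proof
        assume wS: "w \<in> affine hull S"
        obtain y t where w: "w = y - t *\<^sub>R \<nu>" "y \<in> affine hull S" "0 < t" using wD by (auto simp: D_def)
        have "\<nu> \<bullet> (w - y) = 0" using \<nu>(2) affine_hull_diff[OF wS w(2)] by simp
        then show False using w \<nu>(1) by (simp add: norm_eq_1)
      qed
      moreover have "closure S \<subseteq> affine hull S"
        by (intro closure_minimal hull_subset closed_affine_hull)
      ultimately show ?thesis using True by blast
    next
      case False
      then show ?thesis using Db e1(2) S' by blast
    qed
    ultimately obtain W where W: "W \<in> SD" "D \<subseteq> W"
      using top_component[of D] e1(2) by blast
    have "S \<inter> ball x \<epsilon> \<subseteq> side W"
    proof
      fix y assume y: "y \<in> S \<inter> ball x \<epsilon>"
      then have ya: "y \<in> affine hull S" by (auto intro: hull_inc)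
      have "\<forall>\<^sub>F t in at_right 0. t \<in> {0<..<\<epsilon>}" using \<epsilon>(1) by (rule eventually_at_right_real)
      then have "\<forall>\<^sub>F t in at_right 0. y - t *\<^sub>R \<nu> \<in> W"
      proof eventually_elim
        fix t assume "t \<in> {0<..<\<epsilon>}"
        then have "y - t *\<^sub>R \<nu> \<in> D" using y ya unfolding D_def by (intro image_eqI[of _ _ "(y, t)"]) auto
        then show "y - t *\<^sub>R \<nu> \<in> W" using W(2) by auto
      qed
      then show "y \<in> side W" using y by (simp add: side_def)
    qed
    then show ?thesis using W(1) \<epsilon>(1) by blast
  qed
  have uniq: "W = W'" if "W \<in> SD" "W' \<in> SD" "x \<in> side W" "x \<in> side W'" for x W W'
  proof -
    have "\<forall>\<^sub>F t in at_right 0. x - t *\<^sub>R \<nu> \<in> W \<and> x - t *\<^sub>R \<nu> \<in> W'"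
      using that(3,4) by (simp add: side_def eventually_conj)
    then obtain t where "x - t *\<^sub>R \<nu> \<in> W" "x - t *\<^sub>R \<nu> \<in> W'"
      using eventually_happens[of _ "at_right (0::real)"] by (auto simp: trivial_limit_at_right_real)
    then show ?thesis using SD_disjoint[OF that(1,2)] by blast
  qed
  have opn: "openin (top_of_set S) (side W)" if "W \<in> SD" for W
    unfolding openin_contains_ball
  proof (intro conjI ballI)
    show "side W \<subseteq> S" by (auto simp: side_def)
    fix x assume xW: "x \<in> side W"
    then have x: "x \<in> S" by (simp add: side_def)
    obtain W' \<epsilon> where W': "W' \<in> SD" "0 < \<epsilon>" "S \<inter> ball x \<epsilon> \<subseteq> side W'" using local[OF x] by blast
    have "x \<in> side W'" using W'(2,3) x by auto
    then have "W' = W" using uniq[OF W'(1) that _ xW] by blast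
    then show "\<exists>e>0. ball x e \<inter> S \<subseteq> side W" using W'(2,3) by (auto simp: Int_commute)
  qed
  have "openin (top_of_set S) (\<Union>W\<in>SD - {U}. side W)"
    using opn by (intro openin_Union) auto
  moreover have "S \<subseteq> side U \<union> (\<Union>W\<in>SD - {U}. side W)"
  proof
    fix x assume x: "x \<in> S"
    obtain W' \<epsilon> where W': "W' \<in> SD" "0 < \<epsilon>" "S \<inter> ball x \<epsilon> \<subseteq> side W'" using local[OF x] by blast
    have "x \<in> side W'" using W'(2,3) x by auto
    then show "x \<in> side U \<union> (\<Union>W\<in>SD - {U}. side W)" using W'(1) by blast
  qed
  moreover have "side U \<inter> (\<Union>W\<in>SD - {U}. side W) = {}" using uniq U(1) by blast
  moreover have "side U \<noteq> {}" using z by (auto simp: side_def)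
  ultimately have "(\<Union>W\<in>SD - {U}. side W) = {}"
    using SD_props(2)[OF S(1)] opn[OF U(1)] unfolding connected_openin by blast
  then have "S \<subseteq> side U" using \<open>S \<subseteq> side U \<union> (\<Union>W\<in>SD - {U}. side W)\<close> by blast
  moreover have "tangent U = UNIV"
    using dim_tangent[OF SD_props(1)[OF U(1)]] U(2) subspace_tangent[of U]
    by (metis dim_eq_full of_nat_eq_iff span_eq_iff)
  ultimately show ?thesis using S U \<nu> unfolding ifaces_def by (auto simp: side_def)
qed

text \<open>A generic point of S in a cell of U lies in the relative interior of a facet, which the
  resolution of subdomains places in S. At that point the outer normal exhibits U as one side of S,
  and \<open>iface_of_side\<close> propagates this along S.\<close>

lemma top_crossing:
  assumes U: "U \<in> SD" "aff_dim U = int DIM('a)" "T \<in> cells M U" and S: "S \<in> SD" "aff_dim S = int DIM('a) - 1"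
    and z: "z \<in> S" "z \<in> T" "z \<notin> \<Union>(face_hulls (cells M U) (int DIM('a) - 2))"
  shows "\<exists>\<nu>. (S, U, \<nu>) \<in> ifaces \<Omega>"
proof -
  interpret u: smesh U "cells M U" using U(1) by (rule cells_smesh)
  have "1 \<le> aff_dim U" using U(2) DIM_positive[where 'a = 'a] by linarith
  then interpret c: cell T using u.cell_C[OF U(3)] by simp
  have "S \<noteq> U" using S U by auto
  then have ni: "z \<notin> rel_interior T"
    using u.rel_interior_sub[OF U(3)] z(1) SD_disjoint[OF S(1) U(1)] by blast
  obtain f where f: "f facet_of T" "z \<in> f" by (rule polyhedron_in_facet[OF c.polyhedron_T z(2) ni]) (rule that)
  have ad: "aff_dim f = int DIM('a) - 2 + 1" using f(1) u.C_props(1)[OF U(3)] U(2) by (simp add: facet_of_def)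
  have zf: "z \<in> rel_interior f"
    using face_rel_interior_or_lower[OF polyhedron_facet[OF c.polyhedron_T f(1)] facet_of_imp_face_of[OF f(1)] ad f(2) U(3) z(3)] .
  then have fS: "rel_interior f \<subseteq> S" using facet_resolves[OF U(1,3) f(1), of S z] S(1) z(1) by simp
  have "affine hull f = affine hull S"
    using ad S(2) by (intro facet_affine_hull[OF fS] c.facet_props(1)[OF f(1)]) simp
  then have tf: "tangent f = tangent S" using tangent_affine_hull[of f] tangent_affine_hull[of S] by simp
  note n = c.outer_normal_props[OF f(1)]
  have "\<forall>\<^sub>F t in at_right 0. z - t *\<^sub>R outer_normal T f \<in> U"
    using c.inward_normal[OF f(1) zf] by eventually_elim (use u.rel_interior_sub[OF U(3)] in blast)
  then have "(S, U, outer_normal T f) \<in> ifaces \<Omega>"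
    using n(3,4) tf z(1) by (intro iface_of_side S U) auto
  then show ?thesis by blast
qed

text \<open>The segment argument is applied to the whole region. A generic passage from V to another
  subdomain V' of full dimension takes place at a point of some S of codimension one, and both are
  sides of S, so c V = c S = c V'.\<close>

lemma top_constant:
  assumes c: "\<And>S U \<nu>. (S, U, \<nu>) \<in> ifaces \<Omega> \<Longrightarrow> c S = c U"
    and UU': "U \<in> SD" "aff_dim U = int DIM('a)" "U' \<in> SD" "aff_dim U' = int DIM('a)"
  shows "(c U :: real) = c U'"
proof -
  let ?n = "int DIM('a)"
  let ?top = "{U \<in> SD. aff_dim U = ?n}"
  define C where "C = (\<Union>U\<in>?top. cells M U)"
  define N where "N = face_hulls (\<Union>S\<in>SD. cells M S) (?n - 2)"
  define q where "q T = c (THE S. S \<in> SD \<and> T \<in> cells M S)" for T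
  have q: "q T = c S" if "S \<in> SD" "T \<in> cells M S" for S T
  proof -
    have "(THE S. S \<in> SD \<and> T \<in> cells M S) = S"
      using that cell_unique_SD by (intro the_equality) auto
    then show ?thesis by (simp add: q_def)
  qed
  have NU: "z \<notin> \<Union>(face_hulls (cells M S) (?n - 2))" if "z \<notin> \<Union>N" "S \<in> SD" for z S
    using that unfolding N_def face_hulls_def by blast
  have fullT: "closed T \<and> convex T \<and> affine hull T = UNIV \<and> T \<inter> region \<Omega> \<noteq> {}" if T: "T \<in> C" for T
  proof -
    obtain V where V: "V \<in> SD" "aff_dim V = ?n" "T \<in> cells M V" using T by (auto simp: C_def)
    interpret v: smesh V "cells M V" using V(1) by (rule cells_smesh)
    have "affine hull V = UNIV" using V(2) aff_dim_eq_full by blast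
    moreover have "rel_interior T \<subseteq> region \<Omega>" using v.rel_interior_sub[OF V(3)] V(1) SD_region by blast
    ultimately show ?thesis
      using v.C_props(3,4,6,8)[OF V(3)] rel_interior_subset[of T] by (auto simp: compact_imp_closed)
  qed
  have "q T = q T'" if "T \<in> C" "T' \<in> C" for T T'
  proof (rule constant_on_connected_mesh[where X = "region \<Omega>" and H = UNIV and C = C and N = N])
    show "connected (region \<Omega>)" "openin (top_of_set UNIV) (region \<Omega>)" using region by auto
    show "finite C" unfolding C_def
      using finite_SD smesh.finite_C[OF cells_smesh] by (intro finite_UN_I) auto
    show "closed T \<and> convex T \<and> affine hull T = UNIV \<and> T \<inter> region \<Omega> \<noteq> {}" if "T \<in> C" for T
      using fullT[OF that] .
    show "region \<Omega> \<subseteq> \<Union>C"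
    proof -
      have "closure V \<subseteq> \<Union>C" if "V \<in> ?top" for V
        using smesh.Union_C[OF cells_smesh, of V] that unfolding C_def by blast
      then show ?thesis using region_subset_closure_top by blast
    qed
    show "finite N" unfolding N_def
    proof (rule face_hulls(1))
      show "finite (\<Union>S\<in>SD. cells M S)"
        using finite_SD smesh.finite_C[OF cells_smesh] by (intro finite_UN_I) auto
      show "polytope T" if "T \<in> (\<Union>S\<in>SD. cells M S)" for T
        using that smesh.C_props(7)[OF cells_smesh] by blast
    qed
    show "affine L \<and> aff_dim L \<le> aff_dim (UNIV::'a set) - 2" if "L \<in> N" for L
      using face_hulls(2)[of L] that by (simp add: N_def)
    show "T \<in> C" "T' \<in> C" by fact+
    fix T T' z assume A: "T \<in> C" "T' \<in> C" "z \<in> region \<Omega>" "z \<in> T" "z \<in> T'" and z: "z \<notin> \<Union>N"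
    obtain V where V: "V \<in> SD" "aff_dim V = ?n" "T \<in> cells M V" using A(1) by (auto simp: C_def)
    obtain V' where V': "V' \<in> SD" "aff_dim V' = ?n" "T' \<in> cells M V'" using A(2) by (auto simp: C_def)
    have "c V = c V'"
    proof (cases "V = V'")
      case False
      have zc: "z \<in> closure V" "z \<in> closure V'"
        using A(4,5) smesh.C_props(11)[OF cells_smesh[OF V(1)] V(3)] smesh.C_props(11)[OF cells_smesh[OF V'(1)] V'(3)] by auto
      have notin: "z \<notin> W" if W: "W \<in> ?top" for W
      proof
        assume zW: "z \<in> W"
        have "W = V" using SD_closure_disjoint[of W V] W V zc(1) zW by auto
        moreover have "W = V'" using SD_closure_disjoint[of W V'] W V' zc(2) zW by auto
        ultimately show False using False by simp
      qed
      \<comment> \<open>Otherwise z would lie in a full-dimensional W, and membership in the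
        closures of V and V' would force V = W = V'.\<close>
      have "\<exists>S\<in>lower_subdoms \<Omega>. z \<in> closure S"
      proof (rule ccontr)
        assume "\<not> ?thesis"
        then obtain W where "W \<in> SD" "aff_dim W = ?n" "{z} \<subseteq> W" using top_component[of "{z}"] A(3) by auto
        then show False using notin by auto
      qed
      then obtain S where S: "S \<in> SD" "aff_dim S < ?n" "z \<in> closure S" by (auto simp: lower_SD)
      interpret s: smesh S "cells M S" using S(1) by (rule cells_smesh)
      obtain E where E: "E \<in> cells M S" "z \<in> E" using S(3) s.Union_C by blast
      \<comment> \<open>A cell is a face of itself, so genericity of z excludes cells of codimension
        two or more; only fractures of codimension one can contain z.\<close>
      have "\<not> aff_dim E \<le> ?n - 2"
        using face_hulls(3)[OF E(1) face_of_refl[OF s.C_props(4)[OF E(1)]] _ E(2), of "?n - 2"] NU[OF z S(1)] by blast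
      then have dS: "aff_dim S = ?n - 1" using s.C_props(1)[OF E(1)] S(2) by linarith
      have "z \<in> rel_interior E"
        using s.C_props(1)[OF E(1)] dS
        by (intro face_rel_interior_or_lower[OF s.C_props(5)[OF E(1)] face_of_refl[OF s.C_props(4)[OF E(1)]] _ E(2) E(1) NU[OF z S(1)]]) simp
      then have zS: "z \<in> S" using s.rel_interior_sub[OF E(1)] by auto
      have "c S = c V" using top_crossing[OF V S(1) dS zS A(4) NU[OF z V(1)]] c by blast
      moreover have "c S = c V'" using top_crossing[OF V' S(1) dS zS A(5) NU[OF z V'(1)]] c by blast
      ultimately show ?thesis by simp
    qed simp
    then show "q T = q T'" using q[OF V(1,3)] q[OF V'(1,3)] by simp
  qed auto
  moreover have "\<exists>T. T \<in> cells M V" if "V \<in> SD" for V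
    using smesh.Union_C[OF cells_smesh[OF that]] SD_props(1)[OF that]
    by (metis Union_empty closure_eq_empty equals0I)
  then obtain T T' where T: "T \<in> cells M U" "T' \<in> cells M U'" using UU' by blast
  ultimately have "q T = q T'" using UU' by (auto simp: C_def)
  then show ?thesis using q[OF UU'(1) T(1)] q[OF UU'(3) T(2)] by simp
qed

text \<open>Every lower-dimensional subdomain has an interface to a subdomain of the next dimension,
  so induction on the codimension climbs to full dimension.\<close>

lemma all_constant:
  assumes c: "\<And>S U \<nu>. (S, U, \<nu>) \<in> ifaces \<Omega> \<Longrightarrow> c S = c U"
    and V: "V \<in> SD" "aff_dim V = int DIM('a)" and S: "S \<in> SD"
  shows "(c S :: real) = c V"
  using S
proof (induction "nat (int DIM('a) - aff_dim S)" arbitrary: S rule: less_induct)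
  case less
  show ?case
  proof (cases "aff_dim S = int DIM('a)")
    case True
    with c show ?thesis by (rule top_constant[OF _ less.prems _ V])
  next
    case False
    then have lt: "aff_dim S < int DIM('a)" using aff_dim_le_DIM[of S] by simp
    then have "S \<in> lower_subdoms \<Omega>" using less.prems by (simp add: lower_SD)
    then obtain U \<nu> where g: "(S, U, \<nu>) \<in> ifaces \<Omega>" using lower_iface by blast
    have "c U = c V" using ifaceD(2,3)[OF g] lt by (intro less.hyps) auto
    then show ?thesis using c[OF g] by simp
  qed
qed

text \<open>Positive measure on a hyperplane yields a Dirichlet point off all faces of dimension at
  most n - 2. Such a point is covered by a closed cell but lies in no subdomain, so it is interior
  to a facet of dimension n - 1; resolution of the boundary puts the whole facet into the Dirichlet
  part.\<close>

lemma dirichlet_facet: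
  obtains S T f where "S \<in> SD" "aff_dim S = int DIM('a)" "T \<in> cells M S" "f facet_of T" "rel_interior f \<subseteq> dirichlet \<Omega>"
proof -
  let ?n = "int DIM('a)"
  obtain H where H: "affine H" "aff_dim H = ?n - 1" "0 < emeasure (flat_measure H) (dirichlet \<Omega> \<inter> H)"
    using dirichlet_pos by blast
  define N where "N = face_hulls (\<Union>S\<in>SD. cells M S) (?n - 2)"
  have H_ne: "H \<noteq> {}" using H(3) by auto
  have Nn: "\<Union>N \<in> null_sets (flat_measure H)"
  proof (rule flat_measure_null_Union[OF H_ne])
    show "finite N" unfolding N_def
    proof (rule face_hulls(1))
      show "finite (\<Union>S\<in>SD. cells M S)"
        using finite_SD smesh.finite_C[OF cells_smesh] by (intro finite_UN_I) auto
      show "polytope T" if "T \<in> (\<Union>S\<in>SD. cells M S)" for T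
        using that smesh.C_props(7)[OF cells_smesh] by blast
    qed
    show "affine L \<and> aff_dim L < aff_dim H" if "L \<in> N" for L
      using face_hulls(2)[of L] that H(2) by (force simp: N_def)
  qed
  have "\<not> dirichlet \<Omega> \<inter> H \<subseteq> \<Union>N"
  proof
    assume "dirichlet \<Omega> \<inter> H \<subseteq> \<Union>N"
    then have "emeasure (flat_measure H) (dirichlet \<Omega> \<inter> H) \<le> emeasure (flat_measure H) (\<Union>N)"
      using Nn by (intro emeasure_mono) auto
    then show False using H(3) Nn by (simp add: null_sets_def)
  qed
  then obtain x where x: "x \<in> dirichlet \<Omega>" "x \<notin> \<Union>N" by blast
  have "x \<in> closure (\<Union>SD)" "x \<notin> \<Union>SD" using x(1) boundary(1) unfolding outer_boundary_def by blast+
  then have "x \<in> (\<Union>S\<in>SD. closure S)" using finite_SD by (simp add: closure_Union_finite)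
  then obtain S where S: "S \<in> SD" "x \<in> closure S" by blast
  interpret s: smesh S "cells M S" using S(1) by (rule cells_smesh)
  obtain T where T: "T \<in> cells M S" "x \<in> T" using S(2) s.Union_C by blast
  have NS: "x \<notin> \<Union>(face_hulls (cells M S) (?n - 2))"
    using x(2) S(1) unfolding N_def face_hulls_def by blast
  have "x \<notin> rel_interior T" using s.rel_interior_sub[OF T(1)] \<open>x \<notin> \<Union>SD\<close> S(1) by blast
  then obtain f where f: "f facet_of T" "x \<in> f"
    using polyhedron_in_facet[OF s.C_props(5)[OF T(1)] T(2)] by blast
  have adf: "aff_dim f = aff_dim S - 1" using f(1) s.C_props(1)[OF T(1)] by (simp add: facet_of_def)
  have "\<not> aff_dim f \<le> ?n - 2"
    using face_hulls(3)[OF T(1) facet_of_imp_face_of[OF f(1)] _ f(2), of "?n - 2"] NS by blast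
  then have top: "aff_dim S = ?n" using adf aff_dim_le_DIM[of S] by linarith
  have "x \<in> rel_interior f"
    using adf top
    by (intro face_rel_interior_or_lower[OF polyhedron_facet[OF s.C_props(5)[OF T(1)] f(1)] facet_of_imp_face_of[OF f(1)] _ f(2) T(1) NS]) simp
  then have "rel_interior f \<subseteq> dirichlet \<Omega>" using facet_resolves[OF S(1) T(1) f(1), of "dirichlet \<Omega>" x] x(1) by simp
  then show thesis using that S(1) top T(1) f(1) by blast
qed

end

section \<open>The discrete extension\<close>

lemma set_integral_lincomb:
  fixes c :: "'i \<Rightarrow> real"
  assumes I: "finite I" and S: "S \<in> sets borel" "bounded S" "S \<noteq> {}"
    and A: "\<And>i. i \<in> I \<Longrightarrow> A i \<in> sets borel \<and> A i \<subseteq> S"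
  shows "set_integrable (flat_measure S) S (\<lambda>x. \<Sum>i\<in>I. c i * indicat_real (A i) x)"
    and "(LINT x:S|flat_measure S. \<Sum>i\<in>I. c i * indicat_real (A i) x) = (\<Sum>i\<in>I. c i * measure (flat_measure S) (A i))"
proof -
  have eq: "indicat_real S x *\<^sub>R (\<Sum>i\<in>I. c i * indicat_real (A i) x) = (\<Sum>i\<in>I. c i * indicat_real (A i) x)" for x
  proof (cases "x \<in> S")
    case False
    then have "indicat_real (A i) x = 0" if "i \<in> I" for i using A[OF that] by (auto simp: indicator_def)
    then show ?thesis using False by simp
  qed simp
  have int: "integrable (flat_measure S) (\<lambda>x. c i * indicat_real (A i) x)" if "i \<in> I" for i
  proof -
    have "bounded (A i)" using A[OF that] S(2) bounded_subset by blast
    then have "emeasure (flat_measure S) (A i) < \<infinity>" using flat_measure_bounded_finite[OF S(3)] by blast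
    then show ?thesis using A[OF that] by simp
  qed
  show "set_integrable (flat_measure S) S (\<lambda>x. \<Sum>i\<in>I. c i * indicat_real (A i) x)"
    unfolding set_integrable_def eq using int by (intro Bochner_Integration.integrable_sum)
  show "(LINT x:S|flat_measure S. \<Sum>i\<in>I. c i * indicat_real (A i) x) = (\<Sum>i\<in>I. c i * measure (flat_measure S) (A i))"
    unfolding set_lebesgue_integral_def eq using int A
    by (subst Bochner_Integration.integral_sum) auto
qed

lemma sum_indicator_product:
  fixes a b :: "'i \<Rightarrow> real"
  assumes "finite I" "\<And>i j. \<lbrakk>i \<in> I; j \<in> I; x \<in> A i; x \<in> A j\<rbrakk> \<Longrightarrow> i = j"
  shows "(\<Sum>i\<in>I. a i * indicat_real (A i) x) * (\<Sum>i\<in>I. b i * indicat_real (A i) x)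
    = (\<Sum>i\<in>I. a i * b i * indicat_real (A i) x)"
proof (cases "\<exists>i\<in>I. x \<in> A i")
  case True
  then obtain i where i: "i \<in> I" "x \<in> A i" by auto
  have "(\<Sum>j\<in>I. h j * indicat_real (A j) x) = h i" for h :: "'i \<Rightarrow> real"
  proof -
    have "(\<Sum>j\<in>I. h j * indicat_real (A j) x) = (\<Sum>j\<in>I. if j = i then h j else 0)"
      using assms(2) i by (intro sum.cong) (auto simp: indicator_def)
    then show ?thesis using assms(1) i by simp
  qed
  then show ?thesis by simp
next
  case False
  then have "(\<Sum>j\<in>I. h j * indicat_real (A j) x) = 0" for h :: "'i \<Rightarrow> real"
    by (intro sum.neutral) (auto simp: indicator_def)
  then show ?thesis by simp
qed

lemma measure_pos_rel_interior:
  assumes "T \<noteq> {}" "convex T" "bounded T"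
  shows "0 < measure (flat_measure T) (rel_interior T)"
proof -
  have "rel_interior T \<noteq> {}" using assms by (simp add: rel_interior_eq_empty)
  moreover have "bounded (rel_interior T)" using assms(3) rel_interior_subset bounded_subset by blast
  ultimately show ?thesis
    using flat_measure_rel_interior_pos[of T] flat_measure_bounded_finite[OF assms(1), of "rel_interior T"]
    by (simp add: measure_def enn2real_positive_iff less_top)
qed

context meshed_medium
begin

definition flux_cells :: "'a set set" where
  "flux_cells = {T. \<exists>S\<in>SD. 1 \<le> aff_dim S \<and> T \<in> cells M S}"

definition ncomp :: "'a set \<Rightarrow> 'a set \<Rightarrow> 'a flux \<Rightarrow> real" where
  "ncomp T f v = normal_comp T f (v T)"

definition overlap :: "'a iface \<Rightarrow> 'a set \<Rightarrow> 'a set \<Rightarrow> real" where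
  "overlap g f E = measure (flat_measure (fst g)) (rel_interior f \<inter> rel_interior E)"

text \<open>The mean of the mortar function over the facet, written with overlaps because mortar
  cells and facets need not match. It is the value on f of the L2 projection onto facetwise
  constants.\<close>

definition facet_mean :: "'a mortar \<Rightarrow> 'a iface \<Rightarrow> 'a set \<Rightarrow> real" where
  "facet_mean \<mu> g f = (\<Sum>E\<in>mortar_cells M g. \<mu> g E * overlap g f E) / measure (flat_measure (fst g)) (rel_interior f)"

text \<open>By \<open>iface_unique\<close> the sum has at most one term. Writing it as a sum
  provides the value 0 on facets off the interfaces and keeps linearity in the mortar
  evident.\<close>

definition lift_coef :: "'a mortar \<Rightarrow> 'a set \<Rightarrow> 'a set \<Rightarrow> real" where
  "lift_coef \<mu> T f = (\<Sum>g | g \<in> ifaces \<Omega> \<and> (T, f) \<in> iface_facets g. facet_mean \<mu> g f)"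

text \<open>The closed form of R_h, identified with \<open>extension\<close> below. The facet
  components are prescribed and the radial basis fields carry them into the cell.\<close>

definition mortar_lift :: "'a mortar \<Rightarrow> 'a flux" where
  "mortar_lift \<mu> T = (if T \<in> flux_cells then (\<lambda>x. \<Sum>f | f facet_of T. lift_coef \<mu> T f *\<^sub>R cell.shape T f x) else 0)"

lemma flux_cell: "T \<in> flux_cells \<Longrightarrow> cell T"
  using smesh.cell_C[OF cells_smesh] by (auto simp: flux_cells_def)

lemma iface_dim: "g \<in> ifaces \<Omega> \<Longrightarrow> 1 \<le> aff_dim (fst (snd g)) \<and> fst g \<in> SD \<and> fst (snd g) \<in> SD"
proof -
  assume g: "g \<in> ifaces \<Omega>"
  obtain S U \<nu> where e: "g = (S, U, \<nu>)" by (cases g)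
  show ?thesis using ifaceD(1,2,3)[of S U \<nu>] SD_props(6)[of S] g unfolding e by simp
qed

lemma iface_facet_props:
  assumes g: "g \<in> ifaces \<Omega>" and f: "(T, f) \<in> iface_facets g"
  shows "T \<in> flux_cells" "f facet_of T" "rel_interior f \<subseteq> fst g" "0 < measure (flat_measure (fst g)) (rel_interior f)"
    "flat_measure f = flat_measure (fst g)" "rel_interior f \<noteq> {}"
proof -
  obtain S U \<nu> where e: "g = (S, U, \<nu>)" by (cases g)
  note D = iface_facetsD[OF f[unfolded e]]
  note gD = ifaceD[OF g[unfolded e]]
  show T: "T \<in> flux_cells" using D(1) iface_dim[OF g] by (auto simp: flux_cells_def e)
  then interpret c: cell T by (rule flux_cell)
  note fp = c.facet_props[OF D(2)]
  show fm: "flat_measure f = flat_measure (fst g)"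
    using iface_facet_hull(3)[OF g[unfolded e] D(1,2,4)] by (simp add: e)
  show "0 < measure (flat_measure (fst g)) (rel_interior f)"
    unfolding fm[symmetric] using fp(1,2,3) by (intro measure_pos_rel_interior) (auto simp: compact_imp_bounded)
  show "f facet_of T" "rel_interior f \<subseteq> fst g" using D by (auto simp: e)
  show "rel_interior f \<noteq> {}" using fp(1,3) by (simp add: rel_interior_eq_empty)
qed

lemma iface_unique:
  assumes g: "g \<in> ifaces \<Omega>" "(T, f) \<in> iface_facets g" and g': "g' \<in> ifaces \<Omega>" "(T, f) \<in> iface_facets g'"
  shows "g = g'"
proof -
  obtain S U \<nu> where e: "g = (S, U, \<nu>)" by (cases g)
  obtain S' U' \<nu>' where e': "g' = (S', U', \<nu>')" by (cases g')
  note D = iface_facetsD[OF g(2)[unfolded e]] and D' = iface_facetsD[OF g'(2)[unfolded e']]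
  have SD: "S \<in> SD" "U \<in> SD" "S' \<in> SD" "U' \<in> SD" using iface_dim[OF g(1)] iface_dim[OF g'(1)] by (auto simp: e e')
  have "U = U'" using cell_unique_SD[OF SD(2) D(1) SD(4) D'(1)] .
  moreover obtain x where "x \<in> rel_interior f" using iface_facet_props(6)[OF g] by auto
  then have "S = S'" using SD_disjoint[OF SD(1,3)] D(4) D'(4) by blast
  ultimately show ?thesis using D(3) D'(3) by (simp add: e e')
qed

lemma lift_coef_eq:
  assumes "g \<in> ifaces \<Omega>" "(T, f) \<in> iface_facets g"
  shows "lift_coef \<mu> T f = facet_mean \<mu> g f"
proof -
  have "{g. g \<in> ifaces \<Omega> \<and> (T, f) \<in> iface_facets g} = {g}" using iface_unique[OF assms] assms by blast
  then show ?thesis by (simp add: lift_coef_def)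
qed

lemma lift_coef_zero: "\<not> (\<exists>g\<in>ifaces \<Omega>. (T, f) \<in> iface_facets g) \<Longrightarrow> lift_coef \<mu> T f = 0"
  unfolding lift_coef_def by (intro sum.neutral) blast

lemma lies_on_iff:
  assumes "S \<in> SD" "T \<in> cells M S" "f facet_of T"
  shows "(\<exists>g\<in>ifaces \<Omega>. lies_on S T f g) \<longleftrightarrow> (\<exists>g\<in>ifaces \<Omega>. (T, f) \<in> iface_facets g)"
proof
  assume "\<exists>g\<in>ifaces \<Omega>. lies_on S T f g"
  then obtain g where g: "g \<in> ifaces \<Omega>" "lies_on S T f g" by auto
  then have "fst (snd g) = S" by (auto simp: lies_on_def)
  with g assms have "(T, f) \<in> iface_facets g" by (simp add: iface_facets_def)
  with g(1) show "\<exists>g\<in>ifaces \<Omega>. (T, f) \<in> iface_facets g" by blast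
next
  assume "\<exists>g\<in>ifaces \<Omega>. (T, f) \<in> iface_facets g"
  then obtain g where g: "g \<in> ifaces \<Omega>" "(T, f) \<in> iface_facets g" by auto
  then have "T \<in> cells M (fst (snd g))" "lies_on (fst (snd g)) T f g" by (auto simp: iface_facets_def)
  moreover have "fst (snd g) = S"
    using cell_unique_SD[OF _ _ assms(1,2)] iface_dim[OF g(1)] calculation(1) by blast
  ultimately show "\<exists>g\<in>ifaces \<Omega>. lies_on S T f g" using g(1) by auto
qed

lemma iface_facet_not_boundary:
  assumes g: "g \<in> ifaces \<Omega>" "(T, f) \<in> iface_facets g"
  shows "\<not> rel_interior f \<subseteq> neumann \<Omega>" "\<lbrakk>S \<in> SD; T \<in> cells M S\<rbrakk> \<Longrightarrow> \<not> rel_interior f \<subseteq> S"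
proof -
  obtain x where x: "x \<in> rel_interior f" using iface_facet_props(6)[OF g] by auto
  then have xS: "x \<in> fst g" using iface_facet_props(3)[OF g] by auto
  show "\<not> rel_interior f \<subseteq> neumann \<Omega>" using boundary_disjoint[of "fst g" x] x xS iface_dim[OF g(1)] by blast
  show "\<not> rel_interior f \<subseteq> S" if S: "S \<in> SD" "T \<in> cells M S"
  proof
    assume "rel_interior f \<subseteq> S"
    then have "fst g = S" using SD_disjoint[of "fst g" S x] x xS iface_dim[OF g(1)] S(1) by blast
    moreover have "T \<in> cells M (fst (snd g))" using g(2) by (auto simp: iface_facets_def)
    then have "fst (snd g) = S" using cell_unique_SD[OF _ _ S] iface_dim[OF g(1)] by blast
    moreover have "aff_dim (fst (snd g)) = aff_dim (fst g) + 1" using ifaceD(3) g(1) by (metis prod.collapse)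
    ultimately show False by simp
  qed
qed

lemma flux_space_iff:
  "v \<in> flux_space \<Omega> M \<longleftrightarrow> (\<forall>T. T \<notin> flux_cells \<longrightarrow> v T = 0) \<and> (\<forall>T\<in>flux_cells. v T \<in> RT0 T) \<and>
     (\<forall>T\<in>flux_cells. \<forall>f. f facet_of T \<and> rel_interior f \<subseteq> neumann \<Omega> \<longrightarrow> ncomp T f v = 0) \<and>
     (\<forall>S\<in>SD. 1 \<le> aff_dim S \<longrightarrow> (\<forall>T\<in>cells M S. \<forall>T'\<in>cells M S. \<forall>f.
           T \<noteq> T' \<and> f facet_of T \<and> f facet_of T' \<and> rel_interior f \<subseteq> S \<longrightarrow> ncomp T f v + ncomp T' f v = 0))"
proof -
  have n: "T \<notin> flux_cells \<longleftrightarrow> (\<forall>S\<in>SD. 1 \<le> aff_dim S \<longrightarrow> T \<notin> cells M S)" for T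
    by (auto simp: flux_cells_def)
  have b: "(\<forall>T\<in>flux_cells. Q T) \<longleftrightarrow> (\<forall>S\<in>SD. 1 \<le> aff_dim S \<longrightarrow> (\<forall>T\<in>cells M S. Q T))" for Q
    by (auto simp: flux_cells_def)
  show ?thesis
    unfolding flux_space_def mem_Collect_eq n b ncomp_def
    by (simp only: ball_conj_distrib imp_conjR conj_assoc)
qed

lemma flux_spaceD:
  assumes "v \<in> flux_space \<Omega> M"
  shows flux_zero: "T \<notin> flux_cells \<Longrightarrow> v T = 0"
    and flux_RT0: "T \<in> flux_cells \<Longrightarrow> v T \<in> RT0 T"
    and flux_neumann: "\<lbrakk>T \<in> flux_cells; f facet_of T; rel_interior f \<subseteq> neumann \<Omega>\<rbrakk> \<Longrightarrow> ncomp T f v = 0"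
    and flux_continuous: "\<lbrakk>S \<in> SD; 1 \<le> aff_dim S; T \<in> cells M S; T' \<in> cells M S; T \<noteq> T'; f facet_of T; f facet_of T'; rel_interior f \<subseteq> S\<rbrakk>
      \<Longrightarrow> ncomp T f v + ncomp T' f v = 0"
proof -
  note 1 = assms[unfolded flux_space_iff]
  note 2 = conjunct2[OF 1] note 3 = conjunct2[OF 2]
  show "T \<notin> flux_cells \<Longrightarrow> v T = 0" using conjunct1[OF 1] by simp
  show "T \<in> flux_cells \<Longrightarrow> v T \<in> RT0 T" using conjunct1[OF 2] by simp
  show "\<lbrakk>T \<in> flux_cells; f facet_of T; rel_interior f \<subseteq> neumann \<Omega>\<rbrakk> \<Longrightarrow> ncomp T f v = 0"
    using conjunct1[OF 3] by simp
  show "\<lbrakk>S \<in> SD; 1 \<le> aff_dim S; T \<in> cells M S; T' \<in> cells M S; T \<noteq> T'; f facet_of T; f facet_of T'; rel_interior f \<subseteq> S\<rbrakk>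
      \<Longrightarrow> ncomp T f v + ncomp T' f v = 0"
    using conjunct2[OF 3] by simp
qed

lemma ncomp_linear:
  assumes "T \<in> flux_cells" "f facet_of T" "v \<in> flux_space \<Omega> M"
  shows "w \<in> flux_space \<Omega> M \<Longrightarrow> ncomp T f (v + w) = ncomp T f v + ncomp T f w"
    and "ncomp T f (c *\<^sub>R v) = c * ncomp T f v"
proof -
  interpret c: cell T using assms(1) by (rule flux_cell)
  show "w \<in> flux_space \<Omega> M \<Longrightarrow> ncomp T f (v + w) = ncomp T f v + ncomp T f w"
    using c.normal_comp_linear(1)[OF assms(2)] flux_RT0 assms by (simp add: ncomp_def)
  show "ncomp T f (c *\<^sub>R v) = c * ncomp T f v"
    using c.normal_comp_linear(2)[OF assms(2)] flux_RT0 assms by (simp add: ncomp_def scaleR_fun_def)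
qed

lemma ncomp_zero: "\<lbrakk>T \<in> flux_cells; f facet_of T\<rbrakk> \<Longrightarrow> ncomp T f 0 = 0"
  using cell.normal_comp_linear(3)[OF flux_cell] by (simp add: ncomp_def)

lemma cells_flux: "\<lbrakk>S \<in> SD; 1 \<le> aff_dim S; T \<in> cells M S\<rbrakk> \<Longrightarrow> T \<in> flux_cells"
  by (auto simp: flux_cells_def)

lemma flux_space_subspace: "subspace (flux_space \<Omega> M)"
proof (rule subspaceI)
  show "0 \<in> flux_space \<Omega> M"
    unfolding flux_space_iff using cell.RT0_subspace[OF flux_cell] cells_flux
    by (auto simp: subspace_0 ncomp_zero)
  fix v assume v: "v \<in> flux_space \<Omega> M"
  show "v + w \<in> flux_space \<Omega> M" if w: "w \<in> flux_space \<Omega> M" for w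
    unfolding flux_space_iff
  proof (intro conjI ballI allI impI)
    show "(v + w) T = 0" if "T \<notin> flux_cells" for T using flux_zero[OF v that] flux_zero[OF w that] by simp
    show "(v + w) T \<in> RT0 T" if "T \<in> flux_cells" for T
      using flux_RT0[OF v that] flux_RT0[OF w that] cell.RT0_subspace[OF flux_cell[OF that]] by (simp add: subspace_add)
    show "ncomp T f (v + w) = 0" if "T \<in> flux_cells" "f facet_of T \<and> rel_interior f \<subseteq> neumann \<Omega>" for T f
      using flux_neumann[OF v that(1)] flux_neumann[OF w that(1)] ncomp_linear(1)[OF that(1) _ v w] that(2) by simp
    show "ncomp T f (v + w) + ncomp T' f (v + w) = 0" if *: "S \<in> SD" "1 \<le> aff_dim S" "T \<in> cells M S" "T' \<in> cells M S"
      "T \<noteq> T' \<and> f facet_of T \<and> f facet_of T' \<and> rel_interior f \<subseteq> S" for S T T' f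
    proof -
      have "ncomp T f v + ncomp T' f v = 0" "ncomp T f w + ncomp T' f w = 0"
        using flux_continuous[OF v *(1-4)] flux_continuous[OF w *(1-4)] *(5) by simp_all
      then show ?thesis
        using ncomp_linear(1)[OF cells_flux[OF *(1,2,3)] _ v w] ncomp_linear(1)[OF cells_flux[OF *(1,2,4)] _ v w] *(5) by simp
    qed
  qed
  show "c *\<^sub>R v \<in> flux_space \<Omega> M" for c
    unfolding flux_space_iff
  proof (intro conjI ballI allI impI)
    show "(c *\<^sub>R v) T = 0" if "T \<notin> flux_cells" for T using flux_zero[OF v that] by (simp add: scaleR_fun_def fun_eq_iff)
    show "(c *\<^sub>R v) T \<in> RT0 T" if "T \<in> flux_cells" for T
      using flux_RT0[OF v that] subspace_scale[OF cell.RT0_subspace[OF flux_cell[OF that]]] by (simp add: scaleR_fun_def[of c v])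
    show "ncomp T f (c *\<^sub>R v) = 0" if "T \<in> flux_cells" "f facet_of T \<and> rel_interior f \<subseteq> neumann \<Omega>" for T f
      using flux_neumann[OF v that(1)] ncomp_linear(2)[OF that(1) _ v] that(2) by simp
    show "ncomp T f (c *\<^sub>R v) + ncomp T' f (c *\<^sub>R v) = 0" if *: "S \<in> SD" "1 \<le> aff_dim S" "T \<in> cells M S" "T' \<in> cells M S"
      "T \<noteq> T' \<and> f facet_of T \<and> f facet_of T' \<and> rel_interior f \<subseteq> S" for S T T' f
    proof -
      have "ncomp T f v + ncomp T' f v = 0" using flux_continuous[OF v *(1-4)] *(5) by simp
      then show ?thesis
        using ncomp_linear(2)[OF cells_flux[OF *(1,2,3)] _ v] ncomp_linear(2)[OF cells_flux[OF *(1,2,4)] _ v] *(5)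
        by (simp add: distrib_left[symmetric])
    qed
  qed
qed

lemma flux_eqI:
  assumes v: "v \<in> flux_space \<Omega> M" and w: "w \<in> flux_space \<Omega> M"
    and eq: "\<And>T f. \<lbrakk>T \<in> flux_cells; f facet_of T\<rbrakk> \<Longrightarrow> ncomp T f v = ncomp T f w"
  shows "v = w"
proof
  fix T
  show "v T = w T"
  proof (cases "T \<in> flux_cells")
    case True
    then interpret c: cell T by (rule flux_cell)
    show ?thesis using eq[OF True] unfolding ncomp_def
      by (intro c.RT0_normal_eqI flux_RT0[OF v True] flux_RT0[OF w True])
  qed (simp add: flux_zero[OF v] flux_zero[OF w])
qed

text \<open>On a cell the facet components can be prescribed freely, so the Neumann condition and
  continuity are the only constraints. The lift and the flux test functions are built this
  way.\<close>

lemma flux_of_coefs: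
  assumes "\<And>T f. \<lbrakk>T \<in> flux_cells; f facet_of T; rel_interior f \<subseteq> neumann \<Omega>\<rbrakk> \<Longrightarrow> k T f = 0"
    and "\<And>S T T' f. \<lbrakk>S \<in> SD; T \<in> cells M S; T' \<in> cells M S; T \<noteq> T'; f facet_of T; f facet_of T'; rel_interior f \<subseteq> S\<rbrakk>
      \<Longrightarrow> k T f + k T' f = 0"
  defines "v \<equiv> \<lambda>T. if T \<in> flux_cells then (\<lambda>x. \<Sum>f | f facet_of T. k T f *\<^sub>R cell.shape T f x) else 0"
  shows "v \<in> flux_space \<Omega> M" "\<And>T f. \<lbrakk>T \<in> flux_cells; f facet_of T\<rbrakk> \<Longrightarrow> ncomp T f v = k T f"
proof -
  show n: "ncomp T f v = k T f" if "T \<in> flux_cells" "f facet_of T" for T f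
    using cell.shape_combination_normal[OF flux_cell[OF that(1)] that(2)] that(1) by (simp add: ncomp_def v_def)
  show "v \<in> flux_space \<Omega> M"
    unfolding flux_space_iff
  proof (intro conjI ballI allI impI)
    show "v T = 0" if "T \<notin> flux_cells" for T using that by (simp add: v_def)
    show "v T \<in> RT0 T" if "T \<in> flux_cells" for T
      using cell.shape_combination_RT0[OF flux_cell[OF that]] that by (simp add: v_def)
    show "ncomp T f v = 0" if "T \<in> flux_cells" "f facet_of T \<and> rel_interior f \<subseteq> neumann \<Omega>" for T f
      using that assms(1) n by simp
    show "ncomp T f v + ncomp T' f v = 0" if *: "S \<in> SD" "1 \<le> aff_dim S" "T \<in> cells M S" "T' \<in> cells M S"
      "T \<noteq> T' \<and> f facet_of T \<and> f facet_of T' \<and> rel_interior f \<subseteq> S" for S T T' f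
      using n[OF cells_flux[OF *(1,2,3)]] n[OF cells_flux[OF *(1,2,4)]] assms(2)[OF *(1,3,4)] *(5) by simp
  qed
qed

text \<open>An interface facet lies in a subdomain of smaller dimension, hence neither on the
  Neumann boundary nor inside the subdomain of its cell. So the constraints of
  \<open>flux_space\<close> concern facets on which the coefficients vanish.\<close>

lemma mortar_lift_flux: "mortar_lift \<mu> \<in> flux_space \<Omega> M"
  and ncomp_lift: "\<lbrakk>T \<in> flux_cells; f facet_of T\<rbrakk> \<Longrightarrow> ncomp T f (mortar_lift \<mu>) = lift_coef \<mu> T f"
proof -
  have *: "lift_coef \<mu> T f = 0" if "T \<in> flux_cells" "f facet_of T" "rel_interior f \<subseteq> neumann \<Omega>" for T f
    using that iface_facet_not_boundary(1) by (intro lift_coef_zero) blast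
  have **: "lift_coef \<mu> T f + lift_coef \<mu> T' f = 0"
    if "S \<in> SD" "T \<in> cells M S" "T' \<in> cells M S" "T \<noteq> T'" "f facet_of T" "f facet_of T'" "rel_interior f \<subseteq> S" for S T T' f
  proof -
    have "lift_coef \<mu> T f = 0" "lift_coef \<mu> T' f = 0"
      using that iface_facet_not_boundary(2) by (blast intro: lift_coef_zero)+
    then show ?thesis by simp
  qed
  have e: "mortar_lift \<mu> = (\<lambda>T. if T \<in> flux_cells then (\<lambda>x. \<Sum>f | f facet_of T. lift_coef \<mu> T f *\<^sub>R cell.shape T f x) else 0)"
    by (simp add: mortar_lift_def fun_eq_iff)
  show "mortar_lift \<mu> \<in> flux_space \<Omega> M" unfolding e by (rule flux_of_coefs(1)[OF * **])
  show "ncomp T f (mortar_lift \<mu>) = lift_coef \<mu> T f" if "T \<in> flux_cells" "f facet_of T"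
    unfolding e by (rule flux_of_coefs(2)[OF * ** that])
qed

lemma facet_mean_linear:
  "facet_mean (\<mu> + \<mu>') g f = facet_mean \<mu> g f + facet_mean \<mu>' g f"
  "facet_mean (c *\<^sub>R \<mu>) g f = c * facet_mean \<mu> g f"
  by (simp_all add: facet_mean_def scaleR_fun_def distrib_right sum.distrib add_divide_distrib sum_distrib_left mult.assoc)

lemma mortar_lift_linear: "mortar_lift (\<mu> + \<mu>') = mortar_lift \<mu> + mortar_lift \<mu>'" "mortar_lift (c *\<^sub>R \<mu>) = c *\<^sub>R mortar_lift \<mu>"
proof -
  note s = flux_space_subspace
  show "mortar_lift (\<mu> + \<mu>') = mortar_lift \<mu> + mortar_lift \<mu>'"
    by (rule flux_eqI) (simp_all add: mortar_lift_flux subspace_add s ncomp_lift ncomp_linear lift_coef_def facet_mean_linear sum.distrib)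
  show "mortar_lift (c *\<^sub>R \<mu>) = c *\<^sub>R mortar_lift \<mu>"
    by (rule flux_eqI) (simp_all add: mortar_lift_flux subspace_scale s ncomp_lift ncomp_linear lift_coef_def facet_mean_linear sum_distrib_left)
qed

lemma normal_trace_eq:
  assumes g: "g \<in> ifaces \<Omega>"
  shows "normal_trace \<Omega> M v g x = (\<Sum>(T, f)\<in>iface_facets g. ncomp T f v * indicat_real (rel_interior f) x)"
proof -
  let ?U = "fst (snd g)"
  interpret u: smesh ?U "cells M ?U" using iface_dim[OF g] cells_smesh by blast
  have "normal_trace \<Omega> M v g x = (\<Sum>T\<in>cells M ?U. \<Sum>f | f facet_of T \<and> lies_on ?U T f g. ncomp T f v * indicat_real (rel_interior f) x)"
    using g by (simp add: normal_trace_def ncomp_def)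
  also have "\<dots> = (\<Sum>(T, f)\<in>(SIGMA T:cells M ?U. {f. f facet_of T \<and> lies_on ?U T f g}). ncomp T f v * indicat_real (rel_interior f) x)"
    using u.finite_C u.C_props(5) finite_polyhedron_facets by (intro sum.Sigma) (auto intro: rev_finite_subset)
  also have "(SIGMA T:cells M ?U. {f. f facet_of T \<and> lies_on ?U T f g}) = iface_facets g"
    by (auto simp: iface_facets_def)
  finally show ?thesis .
qed

lemma facets_disjoint:
  assumes "g \<in> ifaces \<Omega>" "i \<in> iface_facets g" "j \<in> iface_facets g" "x \<in> rel_interior (snd i)" "x \<in> rel_interior (snd j)"
  shows "i = j"
proof -
  obtain S U \<nu> where g: "g = (S, U, \<nu>)" by (cases g)
  show ?thesis
    using iface_facets_disjoint[of S U \<nu> "fst i" "snd i" "fst j" "snd j" x] assms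
    unfolding g by (simp add: prod_eq_iff)
qed

lemma normal_trace_at:
  assumes g: "g \<in> ifaces \<Omega>" and f: "(T, f) \<in> iface_facets g" and x: "x \<in> rel_interior f"
  shows "normal_trace \<Omega> M v g x = ncomp T f v"
proof -
  have "normal_trace \<Omega> M v g x = (\<Sum>i\<in>iface_facets g. if i = (T, f) then ncomp T f v else 0)"
    unfolding normal_trace_eq[OF g]
  proof (rule sum.cong[OF refl])
    fix i assume i: "i \<in> iface_facets g"
    show "(case i of (T, f) \<Rightarrow> ncomp T f v * indicat_real (rel_interior f) x) = (if i = (T, f) then ncomp T f v else 0)"
    proof (cases "x \<in> rel_interior (snd i)")
      case True
      then have "i = (T, f)" using facets_disjoint[OF g i f True] x by simp
      then show ?thesis using x by simp
    next
      case False
      then have "i \<noteq> (T, f)" using x by auto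
      then show ?thesis using False by (simp add: case_prod_unfold)
    qed
  qed
  then show ?thesis using f finite_iface_facets[OF g] by simp
qed

lemma mortar_cell_props:
  assumes g: "g \<in> ifaces \<Omega>" and E: "E \<in> mortar_cells M g"
  shows "rel_interior E \<subseteq> fst g" "0 < measure (flat_measure (fst g)) (rel_interior E)"
proof -
  interpret m: smesh "fst g" "mortar_cells M g" using g by (rule mortar_smesh)
  show "rel_interior E \<subseteq> fst g" using m.rel_interior_sub[OF E] .
  show "0 < measure (flat_measure (fst g)) (rel_interior E)"
    unfolding m.C_props(10)[OF E, symmetric] using m.C_props(2,4,6)[OF E]
    by (intro measure_pos_rel_interior) (auto simp: compact_imp_bounded)
qed

lemma finite_mortar: "g \<in> ifaces \<Omega> \<Longrightarrow> finite (mortar_cells M g)"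
  using smesh.finite_C[OF mortar_smesh] by blast

text \<open>A trace is constant on each facet, so testing sees nothing of the mortar but its facet
  means, and the normal equations of the projection become diagonal.\<close>

lemma trace_residual:
  assumes g: "g \<in> ifaces \<Omega>"
  shows "(LINT x:fst g|flat_measure (fst g). (normal_trace \<Omega> M w g x - mortar_fun M \<mu> g x) * normal_trace \<Omega> M v g x)
    = (\<Sum>(T, f)\<in>iface_facets g. (ncomp T f w - facet_mean \<mu> g f) * measure (flat_measure (fst g)) (rel_interior f) * ncomp T f v)"
proof -
  let ?S = "fst g" and ?F = "iface_facets g" and ?C = "mortar_cells M g"
  let ?m = "measure (flat_measure ?S)"
  have SD: "?S \<in> SD" using iface_dim[OF g] by blast
  note Sp = SD_props(5,4,1)[OF SD]
  have fin: "finite ?F" "finite ?C" using finite_iface_facets[OF g] finite_mortar[OF g] by auto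
  have fS: "rel_interior (snd i) \<subseteq> ?S" if "i \<in> ?F" for i
    using iface_facet_props(3)[OF g, of "fst i" "snd i"] that by simp
  have tr: "normal_trace \<Omega> M u g x = (\<Sum>i\<in>?F. ncomp (fst i) (snd i) u * indicat_real (rel_interior (snd i)) x)" for u x
    unfolding normal_trace_eq[OF g] by (simp add: case_prod_unfold)
  define A where "A = (\<lambda>x. \<Sum>i\<in>?F. (ncomp (fst i) (snd i) w * ncomp (fst i) (snd i) v) * indicat_real (rel_interior (snd i)) x)"
  define B where "B = (\<lambda>x. \<Sum>j\<in>?F \<times> ?C. (ncomp (fst (fst j)) (snd (fst j)) v * \<mu> g (snd j))
        * indicat_real (rel_interior (snd (fst j)) \<inter> rel_interior (snd j)) x)"
  have AB: "(normal_trace \<Omega> M w g x - mortar_fun M \<mu> g x) * normal_trace \<Omega> M v g x = A x - B x" for x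
  proof -
    have "normal_trace \<Omega> M w g x * normal_trace \<Omega> M v g x = A x"
      unfolding tr A_def using fin(1) facets_disjoint[OF g] by (intro sum_indicator_product) blast+
    moreover have "mortar_fun M \<mu> g x * normal_trace \<Omega> M v g x = B x"
      unfolding tr B_def mortar_fun_def piecewise_const_def sum_product
      by (subst sum.swap) (simp add: sum.cartesian_product case_prod_unfold indicator_inter_arith mult_ac)
    ultimately show ?thesis by (simp add: left_diff_distrib)
  qed
  have iA: "set_integrable (flat_measure ?S) ?S A"
    "(LINT x:?S|flat_measure ?S. A x) = (\<Sum>i\<in>?F. (ncomp (fst i) (snd i) w * ncomp (fst i) (snd i) v) * ?m (rel_interior (snd i)))"
    unfolding A_def using fS fin by (intro set_integral_lincomb Sp; simp)+
  have iB: "set_integrable (flat_measure ?S) ?S B"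
    "(LINT x:?S|flat_measure ?S. B x) = (\<Sum>j\<in>?F \<times> ?C. (ncomp (fst (fst j)) (snd (fst j)) v * \<mu> g (snd j)) * ?m (rel_interior (snd (fst j)) \<inter> rel_interior (snd j)))"
    unfolding B_def using fS fin by (intro set_integral_lincomb Sp; force)+
  have "(LINT x:?S|flat_measure ?S. (normal_trace \<Omega> M w g x - mortar_fun M \<mu> g x) * normal_trace \<Omega> M v g x)
    = (LINT x:?S|flat_measure ?S. A x) - (LINT x:?S|flat_measure ?S. B x)"
    unfolding AB using iA(1) iB(1) by (rule set_integral_diff)
  also have "\<dots> = (\<Sum>i\<in>?F. (ncomp (fst i) (snd i) w - facet_mean \<mu> g (snd i)) * ?m (rel_interior (snd i)) * ncomp (fst i) (snd i) v)"
  proof -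
    have "(LINT x:?S|flat_measure ?S. B x) = (\<Sum>i\<in>?F. \<Sum>E\<in>?C. ncomp (fst i) (snd i) v * (\<mu> g E * overlap g (snd i) E))"
      unfolding iB(2) overlap_def by (simp add: sum.cartesian_product case_prod_unfold mult_ac)
    also have "\<dots> = (\<Sum>i\<in>?F. facet_mean \<mu> g (snd i) * ?m (rel_interior (snd i)) * ncomp (fst i) (snd i) v)"
    proof (rule sum.cong[OF refl])
      fix i assume "i \<in> ?F"
      then have p: "0 < ?m (rel_interior (snd i))" using iface_facet_props(4)[OF g, of "fst i" "snd i"] by simp
      show "(\<Sum>E\<in>?C. ncomp (fst i) (snd i) v * (\<mu> g E * overlap g (snd i) E))
        = facet_mean \<mu> g (snd i) * ?m (rel_interior (snd i)) * ncomp (fst i) (snd i) v"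
        using p by (simp add: facet_mean_def sum_distrib_left[symmetric])
    qed
    finally show ?thesis unfolding iA(2) by (simp add: sum_subtractf[symmetric] algebra_simps)
  qed
  finally show ?thesis by (simp add: case_prod_unfold)
qed

lemma L2_residual:
  "L2_ifaces \<Omega> (\<lambda>g x. normal_trace \<Omega> M w g x - mortar_fun M \<mu> g x) (normal_trace \<Omega> M v)
    = (\<Sum>g\<in>ifaces \<Omega>. \<Sum>(T, f)\<in>iface_facets g.
        (ncomp T f w - facet_mean \<mu> g f) * measure (flat_measure (fst g)) (rel_interior f) * ncomp T f v)"
  unfolding L2_ifaces_def by (intro sum.cong refl trace_residual)

text \<open>For uniqueness, the test flux is the difference of a candidate and the lift:
  orthogonality then says that a sum of squares with positive facet areas as weights vanishes, so
  the candidate has the facet means as its coefficients.\<close>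

lemma mortar_proj_eq: "mortar_proj \<Omega> M \<mu> = normal_trace \<Omega> M (mortar_lift \<mu>)"
  unfolding mortar_proj_def
proof (rule the_equality)
  have c: "ncomp T f (mortar_lift \<mu>) = facet_mean \<mu> g f" if "g \<in> ifaces \<Omega>" "(T, f) \<in> iface_facets g" for g T f
    using iface_facet_props(1,2)[OF that] lift_coef_eq[OF that] by (simp add: ncomp_lift)
  have res: "L2_ifaces \<Omega> (\<lambda>g x. normal_trace \<Omega> M (mortar_lift \<mu>) g x - mortar_fun M \<mu> g x) (normal_trace \<Omega> M v) = 0" for v
    unfolding L2_residual using c by (intro sum.neutral ballI) auto
  show "normal_trace \<Omega> M (mortar_lift \<mu>) \<in> normal_trace \<Omega> M ` flux_space \<Omega> M \<and>
     (\<forall>v\<in>flux_space \<Omega> M. L2_ifaces \<Omega> (\<lambda>g x. normal_trace \<Omega> M (mortar_lift \<mu>) g x - mortar_fun M \<mu> g x) (normal_trace \<Omega> M v) = 0)"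
    using res mortar_lift_flux by blast
  fix t assume t: "t \<in> normal_trace \<Omega> M ` flux_space \<Omega> M \<and>
     (\<forall>v\<in>flux_space \<Omega> M. L2_ifaces \<Omega> (\<lambda>g x. t g x - mortar_fun M \<mu> g x) (normal_trace \<Omega> M v) = 0)"
  then obtain w where w: "w \<in> flux_space \<Omega> M" "t = normal_trace \<Omega> M w" by blast
  define v where "v = w + (-1) *\<^sub>R mortar_lift \<mu>"
  have v: "v \<in> flux_space \<Omega> M"
    unfolding v_def using w(1) mortar_lift_flux flux_space_subspace by (intro subspace_add subspace_scale)
  have nv: "ncomp T f v = ncomp T f w - facet_mean \<mu> g f" if "g \<in> ifaces \<Omega>" "(T, f) \<in> iface_facets g" for g T f
  proof -
    note p = iface_facet_props(1,2)[OF that]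
    show ?thesis
      unfolding v_def ncomp_linear(1)[OF p w(1) subspace_scale[OF flux_space_subspace mortar_lift_flux]]
        ncomp_linear(2)[OF p mortar_lift_flux] c[OF that] by simp
  qed
  let ?h = "\<lambda>g i. (ncomp (fst i) (snd i) w - facet_mean \<mu> g (snd i)) * measure (flat_measure (fst g)) (rel_interior (snd i)) * ncomp (fst i) (snd i) v"
  have zero: "(\<Sum>g\<in>ifaces \<Omega>. \<Sum>i\<in>iface_facets g. ?h g i) = 0"
    using t v L2_residual[of w \<mu> v] unfolding w(2) by (simp add: case_prod_unfold)
  have nn: "0 \<le> ?h g i" if "g \<in> ifaces \<Omega>" "i \<in> iface_facets g" for g i
    using nv[of g "fst i" "snd i"] that by (simp add: mult.assoc mult.left_commute)
  have "?h g i = 0" if g: "g \<in> ifaces \<Omega>" and i: "i \<in> iface_facets g" for g i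
  proof -
    have "(\<Sum>i\<in>iface_facets g. ?h g i) = 0"
      using zero finite_ifaces nn g by (subst (asm) sum_nonneg_eq_0_iff) (auto intro!: sum_nonneg)
    then show ?thesis using finite_iface_facets[OF g] nn[OF g] i by (subst (asm) sum_nonneg_eq_0_iff) auto
  qed
  then have "ncomp T f w = ncomp T f (mortar_lift \<mu>)" if "g \<in> ifaces \<Omega>" "(T, f) \<in> iface_facets g" for g T f
    using nv[OF that] c[OF that] iface_facet_props(4)[OF that] that by fastforce
  note eqc = this
  have "normal_trace \<Omega> M w g x = normal_trace \<Omega> M (mortar_lift \<mu>) g x" if g: "g \<in> ifaces \<Omega>" for g x
    unfolding normal_trace_eq[OF g]
  proof (rule sum.cong[OF refl])
    fix i assume "i \<in> iface_facets g"
    then show "(case i of (T, f) \<Rightarrow> ncomp T f w * indicat_real (rel_interior f) x)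
        = (case i of (T, f) \<Rightarrow> ncomp T f (mortar_lift \<mu>) * indicat_real (rel_interior f) x)"
      by (cases i) (simp add: eqc[OF g])
  qed
  moreover have "normal_trace \<Omega> M w g x = normal_trace \<Omega> M (mortar_lift \<mu>) g x" if "g \<notin> ifaces \<Omega>" for g x
    using that by (simp add: normal_trace_def)
  ultimately show "t = normal_trace \<Omega> M (mortar_lift \<mu>)" unfolding w(2) by (intro ext) blast
qed

text \<open>A flux is determined by its facet components. On interface facets they are read off the
  trace at a relative interior point, elsewhere they are prescribed to be zero; zero-dimensional
  cells have no facets.\<close>

lemma extension_eq: "extension \<Omega> M \<mu> = mortar_lift \<mu>"
  unfolding extension_def mortar_proj_eq
proof (rule the_equality)
  have z: "ncomp T f (mortar_lift \<mu>) = 0"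
    if "S \<in> SD" "T \<in> cells M S" "f facet_of T" "\<not> (\<exists>g\<in>ifaces \<Omega>. lies_on S T f g)" for S T f
  proof (cases "T \<in> flux_cells")
    case True
    then show ?thesis using that lies_on_iff[OF that(1-3)] by (simp add: ncomp_lift lift_coef_zero)
  next
    case False
    then have "aff_dim T = 0"
      using that(1,2) smesh.C_props(1)[OF cells_smesh[OF that(1)] that(2)] SD_props(6)[OF that(1)]
      unfolding flux_cells_def by force
    then show ?thesis using that(3) aff_dim_negative_iff[of f] by (simp add: facet_of_def)
  qed
  show "mortar_lift \<mu> \<in> flux_space \<Omega> M \<and> normal_trace \<Omega> M (mortar_lift \<mu>) = normal_trace \<Omega> M (mortar_lift \<mu>) \<and>
     (\<forall>S\<in>SD. \<forall>T\<in>cells M S. \<forall>f. f facet_of T \<longrightarrow>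
       \<not> (\<exists>g\<in>ifaces \<Omega>. lies_on S T f g) \<longrightarrow> normal_comp T f (mortar_lift \<mu> T) = 0)"
    using z mortar_lift_flux unfolding ncomp_def by blast
  fix v assume v: "v \<in> flux_space \<Omega> M \<and> normal_trace \<Omega> M v = normal_trace \<Omega> M (mortar_lift \<mu>) \<and>
     (\<forall>S\<in>SD. \<forall>T\<in>cells M S. \<forall>f. f facet_of T \<longrightarrow>
       \<not> (\<exists>g\<in>ifaces \<Omega>. lies_on S T f g) \<longrightarrow> normal_comp T f (v T) = 0)"
  show "v = mortar_lift \<mu>"
  proof (rule flux_eqI)
    show "v \<in> flux_space \<Omega> M" "mortar_lift \<mu> \<in> flux_space \<Omega> M" using v mortar_lift_flux by auto
    fix T f assume T: "T \<in> flux_cells" and f: "f facet_of T"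
    obtain S where S: "S \<in> SD" "T \<in> cells M S" using T by (auto simp: flux_cells_def)
    show "ncomp T f v = ncomp T f (mortar_lift \<mu>)"
    proof (cases "\<exists>g\<in>ifaces \<Omega>. lies_on S T f g")
      case True
      then obtain g where g: "g \<in> ifaces \<Omega>" "(T, f) \<in> iface_facets g" using lies_on_iff[OF S f] by blast
      obtain x where x: "x \<in> rel_interior f" using iface_facet_props(6)[OF g] by auto
      show ?thesis using normal_trace_at[OF g x] v by metis
    next
      case False
      then show ?thesis using z[OF S f False] v S f unfolding ncomp_def by metis
    qed
  qed
qed

end

section \<open>The divergence form and its kernel\<close>

context meshed_medium
begin

text \<open>By the divergence theorem for \<open>RT0\<close>, the integral of the divergence over
  the cell.\<close>

definition outflow :: "'a set \<Rightarrow> 'a flux \<Rightarrow> real" where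
  "outflow T v = (\<Sum>f | f facet_of T. measure (flat_measure f) f * ncomp T f v)"

lemma cell_meas:
  assumes S: "S \<in> SD" "T \<in> cells M S"
  shows "0 < measure (flat_measure S) (rel_interior T)"
    "measure (flat_measure T) T = measure (flat_measure S) (rel_interior T)"
proof -
  interpret s: smesh S "cells M S" using S(1) by (rule cells_smesh)
  note p = s.C_props[OF S(2)]
  show "0 < measure (flat_measure S) (rel_interior T)"
    unfolding p(10)[symmetric] using p(2,4,6) by (intro measure_pos_rel_interior) (auto simp: compact_imp_bounded)
  show "measure (flat_measure T) T = measure (flat_measure S) (rel_interior T)"
    using measure_rel_interior[OF p(5,2)] by (simp add: p(10))
qed

lemma not_flux_cell: "\<lbrakk>S \<in> SD; T \<in> cells M S; T \<notin> flux_cells\<rbrakk> \<Longrightarrow> aff_dim T = 0 \<and> {f. f facet_of T} = {}"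
proof -
  assume S: "S \<in> SD" "T \<in> cells M S" "T \<notin> flux_cells"
  then have "aff_dim T = 0"
    using smesh.C_props(1)[OF cells_smesh[OF S(1)] S(2)] SD_props(6)[OF S(1)]
    unfolding flux_cells_def by force
  moreover have "\<not> f facet_of T" for f
  proof
    assume "f facet_of T"
    then have "f \<noteq> {}" "aff_dim f < 0" using \<open>aff_dim T = 0\<close> by (simp_all add: facet_of_def)
    then show False by (simp only: aff_dim_negative_iff)
  qed
  ultimately show ?thesis by simp
qed

lemma tangential_div_flux:
  assumes v: "v \<in> flux_space \<Omega> M" and S: "S \<in> SD" "T \<in> cells M S"
  shows "tangential_div T (v T) x = outflow T v / measure (flat_measure S) (rel_interior T)"
proof (cases "T \<in> flux_cells")
  case True
  have "measure (flat_measure S) (rel_interior T) * tangential_div T (v T) x = outflow T v"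
    using cell.integral_div_RT0[OF flux_cell[OF True] flux_RT0[OF v True]] cell_meas(2)[OF S]
    by (simp add: outflow_def ncomp_def)
  then show ?thesis using cell_meas(1)[OF S] by (simp add: field_simps)
next
  case False
  have "tangential_div T (v T) x = 0"
    unfolding flux_zero[OF v False] tangential_div_def by (simp add: vector_derivative_const_at)
  moreover have "outflow T v = 0" using not_flux_cell[OF S False] by (simp add: outflow_def)
  ultimately show ?thesis by simp
qed

text \<open>The integral over the cell T of all mortars on interfaces at S, that is, of minus the
  jump.\<close>

definition mortar_load :: "'a mortar \<Rightarrow> 'a set \<Rightarrow> 'a set \<Rightarrow> real" where
  "mortar_load \<mu> S T = (\<Sum>g | g \<in> ifaces \<Omega> \<and> fst g = S. \<Sum>E\<in>mortar_cells M g. \<mu> g E * overlap g T E)"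

text \<open>All factors are constant on relative interiors of cells or mortar cells, so the
  integrand is a combination of indicators and the cell areas in \<open>tangential_div_flux\<close>
  cancel.\<close>

lemma integral_mixed_div:
  assumes v: "v \<in> flux_space \<Omega> M" and S: "S \<in> SD"
  shows "(LINT x:S|flat_measure S. piecewise_const (cells M S) q x * mixed_div \<Omega> M (v, \<mu>) S x)
    = (\<Sum>T\<in>cells M S. q T * (outflow T v - mortar_load \<mu> S T))"
proof -
  interpret s: smesh S "cells M S" using S by (rule cells_smesh)
  note Sp = SD_props(5,4,1)[OF S]
  let ?C = "cells M S" and ?m = "measure (flat_measure S)"
  let ?G = "{g. g \<in> ifaces \<Omega> \<and> fst g = S}"
  let ?J = "SIGMA g:?G. mortar_cells M g"
  let ?d = "\<lambda>T. outflow T v / ?m (rel_interior T)"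
  have finG: "finite ?G" using finite_ifaces by simp
  have finJ: "finite ?J" using finG finite_mortar by (intro finite_SigmaI) auto
  have dj: "T = T'" if "T \<in> ?C" "T' \<in> ?C" "x \<in> rel_interior T" "x \<in> rel_interior T'" for x T T'
    using s.C_unique[OF that(1,2,3)] that(4) rel_interior_subset by blast
  define A where "A = (\<lambda>x. \<Sum>T\<in>?C. (q T * ?d T) * indicat_real (rel_interior T) x)"
  define B where "B = (\<lambda>x. \<Sum>j\<in>?C \<times> ?J. (q (fst j) * \<mu> (fst (snd j)) (snd (snd j)))
      * indicat_real (rel_interior (fst j) \<inter> rel_interior (snd (snd j))) x)"
  have AB: "piecewise_const ?C q x * mixed_div \<Omega> M (v, \<mu>) S x = A x - B x" for x
  proof -
    have fd: "flux_div M v S x = (\<Sum>T\<in>?C. ?d T * indicat_real (rel_interior T) x)"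
      unfolding flux_div_def by (intro sum.cong refl) (simp add: tangential_div_flux[OF v S])
    have "piecewise_const ?C q x * flux_div M v S x = A x"
      unfolding fd piecewise_const_def A_def using s.finite_C dj by (intro sum_indicator_product) blast+
    moreover have "jump \<Omega> M \<mu> S x = - (\<Sum>j\<in>?J. \<mu> (fst j) (snd j) * indicat_real (rel_interior (snd j)) x)"
      unfolding jump_def mortar_fun_def piecewise_const_def using finG finite_mortar
      by (subst sum.Sigma) (auto simp: case_prod_unfold)
    then have "piecewise_const ?C q x * jump \<Omega> M \<mu> S x = - B x"
      unfolding piecewise_const_def B_def
      by (simp add: sum_product sum.cartesian_product case_prod_unfold indicator_inter_arith mult_ac)
    ultimately show ?thesis by (simp add: mixed_div_def distrib_left)
  qed
  have TS: "rel_interior T \<subseteq> S" if "T \<in> ?C" for T using s.rel_interior_sub[OF that] .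
  have iA: "set_integrable (flat_measure S) S A"
    "(LINT x:S|flat_measure S. A x) = (\<Sum>T\<in>?C. (q T * ?d T) * ?m (rel_interior T))"
    unfolding A_def using TS s.finite_C by (intro set_integral_lincomb Sp; simp)+
  have iB: "set_integrable (flat_measure S) S B"
    "(LINT x:S|flat_measure S. B x) = (\<Sum>j\<in>?C \<times> ?J. (q (fst j) * \<mu> (fst (snd j)) (snd (snd j))) * ?m (rel_interior (fst j) \<inter> rel_interior (snd (snd j))))"
    unfolding B_def using TS s.finite_C finJ by (intro set_integral_lincomb Sp; force)+
  have "(LINT x:S|flat_measure S. B x) = (\<Sum>T\<in>?C. \<Sum>j\<in>?J. q T * (\<mu> (fst j) (snd j) * overlap (fst j) T (snd j)))"
  proof -
    have "(\<Sum>T\<in>?C. \<Sum>j\<in>?J. q T * (\<mu> (fst j) (snd j) * overlap (fst j) T (snd j)))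
      = (\<Sum>j\<in>?C \<times> ?J. q (fst j) * (\<mu> (fst (snd j)) (snd (snd j)) * overlap (fst (snd j)) (fst j) (snd (snd j))))"
      by (simp add: sum.cartesian_product case_prod_unfold)
    also have "\<dots> = (LINT x:S|flat_measure S. B x)"
      unfolding iB(2) by (intro sum.cong refl) (auto simp: overlap_def)
    finally show ?thesis by simp
  qed
  also have "\<dots> = (\<Sum>T\<in>?C. q T * mortar_load \<mu> S T)"
  proof (rule sum.cong[OF refl])
    fix T
    have "mortar_load \<mu> S T = (\<Sum>j\<in>?J. \<mu> (fst j) (snd j) * overlap (fst j) T (snd j))"
      unfolding mortar_load_def using finG finite_mortar by (subst sum.Sigma) (auto simp: case_prod_unfold)
    then show "(\<Sum>j\<in>?J. q T * (\<mu> (fst j) (snd j) * overlap (fst j) T (snd j))) = q T * mortar_load \<mu> S T"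
      by (simp add: sum_distrib_left)
  qed
  finally have B: "(LINT x:S|flat_measure S. B x) = (\<Sum>T\<in>?C. q T * mortar_load \<mu> S T)" .
  have A: "(LINT x:S|flat_measure S. A x) = (\<Sum>T\<in>?C. q T * outflow T v)"
    unfolding iA(2)
  proof (rule sum.cong[OF refl])
    fix T assume "T \<in> ?C"
    then show "q T * ?d T * ?m (rel_interior T) = q T * outflow T v" using cell_meas(1)[OF S, of T] by simp
  qed
  have "(LINT x:S|flat_measure S. piecewise_const ?C q x * mixed_div \<Omega> M (v, \<mu>) S x)
    = (LINT x:S|flat_measure S. A x) - (LINT x:S|flat_measure S. B x)"
    unfolding AB using iA(1) iB(1) by (rule set_integral_diff)
  then show ?thesis unfolding A B by (simp add: sum_subtractf[symmetric] right_diff_distrib)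
qed

lemma flux_add_lift: "v \<in> flux_space \<Omega> M \<Longrightarrow> v + mortar_lift \<mu> \<in> flux_space \<Omega> M"
  using flux_space_subspace mortar_lift_flux by (intro subspace_add)

lemma form_b_eq:
  assumes v: "v \<in> flux_space \<Omega> M"
  shows "form_b \<Omega> M (v, \<mu>) q = - (\<Sum>S\<in>SD. \<Sum>T\<in>cells M S. q T * (outflow T (v + mortar_lift \<mu>) - mortar_load \<mu> S T))"
  unfolding form_b_def extension_eq
  using integral_mixed_div[OF flux_add_lift[OF v]] by simp

lemma outflow_linear:
  assumes S: "S \<in> SD" "T \<in> cells M S" and v: "v \<in> flux_space \<Omega> M"
  shows "w \<in> flux_space \<Omega> M \<Longrightarrow> outflow T (v + w) = outflow T v + outflow T w"
    and "outflow T (c *\<^sub>R v) = c * outflow T v"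
proof -
  have 1: "outflow T (v + w) = outflow T v + outflow T w" if w: "w \<in> flux_space \<Omega> M" "T \<in> flux_cells"
    using ncomp_linear(1)[OF w(2) _ v w(1)] by (simp add: outflow_def distrib_left sum.distrib)
  have 2: "outflow T (c *\<^sub>R v) = c * outflow T v" if "T \<in> flux_cells"
    using ncomp_linear(2)[OF that _ v] by (simp add: outflow_def sum_distrib_left mult.left_commute)
  show "w \<in> flux_space \<Omega> M \<Longrightarrow> outflow T (v + w) = outflow T v + outflow T w"
    using 1 not_flux_cell[OF S] by (cases "T \<in> flux_cells") (auto simp: outflow_def)
  show "outflow T (c *\<^sub>R v) = c * outflow T v"
    using 2 not_flux_cell[OF S] by (cases "T \<in> flux_cells") (auto simp: outflow_def)
qed

lemma mortar_load_linear:
  "mortar_load (\<mu> + \<mu>') S T = mortar_load \<mu> S T + mortar_load \<mu>' S T"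
  "mortar_load (c *\<^sub>R \<mu>) S T = c * mortar_load \<mu> S T"
  by (simp_all add: mortar_load_def scaleR_fun_def distrib_right sum.distrib sum_distrib_left mult.assoc)

lemma form_b_linear:
  assumes v: "v \<in> flux_space \<Omega> M"
  shows "w \<in> flux_space \<Omega> M \<Longrightarrow> form_b \<Omega> M ((v, \<mu>) + (w, \<mu>')) q = form_b \<Omega> M (v, \<mu>) q + form_b \<Omega> M (w, \<mu>') q"
    and "form_b \<Omega> M (c *\<^sub>R (v, \<mu>)) q = c * form_b \<Omega> M (v, \<mu>) q"
    and "form_b \<Omega> M (v, \<mu>) (p + q) = form_b \<Omega> M (v, \<mu>) p + form_b \<Omega> M (v, \<mu>) q"
    and "form_b \<Omega> M (v, \<mu>) (c *\<^sub>R q) = c * form_b \<Omega> M (v, \<mu>) q"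
proof -
  note sub = flux_space_subspace
  show "form_b \<Omega> M ((v, \<mu>) + (w, \<mu>')) q = form_b \<Omega> M (v, \<mu>) q + form_b \<Omega> M (w, \<mu>') q"
    if w: "w \<in> flux_space \<Omega> M"
  proof -
    have e: "v + w + mortar_lift (\<mu> + \<mu>') = (v + mortar_lift \<mu>) + (w + mortar_lift \<mu>')" by (simp add: mortar_lift_linear)
    have "form_b \<Omega> M (v + w, \<mu> + \<mu>') q = - (\<Sum>S\<in>SD. \<Sum>T\<in>cells M S.
        q T * (outflow T (v + mortar_lift \<mu>) - mortar_load \<mu> S T) + q T * (outflow T (w + mortar_lift \<mu>') - mortar_load \<mu>' S T))"
      unfolding form_b_eq[OF subspace_add[OF sub v w]] e
    proof (intro arg_cong[where f = uminus] sum.cong refl)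
      fix S T assume "S \<in> SD" "T \<in> cells M S"
      note o = outflow_linear(1)[OF this flux_add_lift[OF v] flux_add_lift[OF w]]
      show "q T * (outflow T ((v + mortar_lift \<mu>) + (w + mortar_lift \<mu>')) - mortar_load (\<mu> + \<mu>') S T)
        = q T * (outflow T (v + mortar_lift \<mu>) - mortar_load \<mu> S T) + q T * (outflow T (w + mortar_lift \<mu>') - mortar_load \<mu>' S T)"
        unfolding o mortar_load_linear by (simp add: algebra_simps)
    qed
    then show ?thesis by (simp add: form_b_eq[OF v] form_b_eq[OF w] sum.distrib)
  qed
  show "form_b \<Omega> M (c *\<^sub>R (v, \<mu>)) q = c * form_b \<Omega> M (v, \<mu>) q"
  proof -
    have e: "c *\<^sub>R v + mortar_lift (c *\<^sub>R \<mu>) = c *\<^sub>R (v + mortar_lift \<mu>)" by (simp add: mortar_lift_linear scaleR_add_right)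
    have "form_b \<Omega> M (c *\<^sub>R v, c *\<^sub>R \<mu>) q = - (\<Sum>S\<in>SD. \<Sum>T\<in>cells M S.
        c * (q T * (outflow T (v + mortar_lift \<mu>) - mortar_load \<mu> S T)))"
      unfolding form_b_eq[OF subspace_scale[OF sub v]] e
    proof (intro arg_cong[where f = uminus] sum.cong refl)
      fix S T assume "S \<in> SD" "T \<in> cells M S"
      note o = outflow_linear(2)[OF this flux_add_lift[OF v]]
      show "q T * (outflow T (c *\<^sub>R (v + mortar_lift \<mu>)) - mortar_load (c *\<^sub>R \<mu>) S T)
        = c * (q T * (outflow T (v + mortar_lift \<mu>) - mortar_load \<mu> S T))"
        unfolding o mortar_load_linear by (simp add: algebra_simps)
    qed
    then show ?thesis by (simp add: form_b_eq[OF v] sum_distrib_left)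
  qed
  show "form_b \<Omega> M (v, \<mu>) (p + q) = form_b \<Omega> M (v, \<mu>) p + form_b \<Omega> M (v, \<mu>) q"
    by (simp add: form_b_eq[OF v] distrib_right sum.distrib)
  show "form_b \<Omega> M (v, \<mu>) (c *\<^sub>R q) = c * form_b \<Omega> M (v, \<mu>) q"
    by (simp add: form_b_eq[OF v] scaleR_fun_def sum_distrib_left mult.assoc)
qed

lemma flux_space0_iff:
  "v \<in> flux_space0 \<Omega> M \<longleftrightarrow> v \<in> flux_space \<Omega> M \<and>
    (\<forall>g\<in>ifaces \<Omega>. \<forall>(T, f)\<in>iface_facets g. ncomp T f v = 0)"
proof (rule iffI)
  assume v: "v \<in> flux_space0 \<Omega> M"
  have "ncomp T f v = 0" if g: "g \<in> ifaces \<Omega>" "(T, f) \<in> iface_facets g" for g T f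
  proof -
    obtain S where S: "S \<in> SD" "T \<in> cells M S" using iface_facet_props(1)[OF g] by (auto simp: flux_cells_def)
    note f = iface_facet_props(2)[OF g]
    have "\<exists>g\<in>ifaces \<Omega>. lies_on S T f g" using lies_on_iff[OF S f] g by blast
    then show ?thesis using v S f unfolding flux_space0_def ncomp_def by simp
  qed
  then show "v \<in> flux_space \<Omega> M \<and> (\<forall>g\<in>ifaces \<Omega>. \<forall>(T, f)\<in>iface_facets g. ncomp T f v = 0)"
    using v by (auto simp: flux_space0_def)
next
  assume v: "v \<in> flux_space \<Omega> M \<and> (\<forall>g\<in>ifaces \<Omega>. \<forall>(T, f)\<in>iface_facets g. ncomp T f v = 0)"
  have "normal_comp T f (v T) = 0"
    if S: "S \<in> SD" "T \<in> cells M S" "f facet_of T" and l: "\<exists>g\<in>ifaces \<Omega>. lies_on S T f g" for S T f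
  proof -
    obtain g where "g \<in> ifaces \<Omega>" "(T, f) \<in> iface_facets g" using lies_on_iff[OF S] l by blast
    then show ?thesis using v unfolding ncomp_def by fastforce
  qed
  then show "v \<in> flux_space0 \<Omega> M" using v unfolding flux_space0_def by simp
qed

lemma flux_space0_subspace: "subspace (flux_space0 \<Omega> M)"
proof (rule subspaceI)
  note p = iface_facet_props(1,2) and sub = flux_space_subspace
  show "0 \<in> flux_space0 \<Omega> M"
    unfolding flux_space0_iff using subspace_0[OF sub] p by (auto simp: ncomp_zero)
  fix v assume "v \<in> flux_space0 \<Omega> M"
  then have v: "v \<in> flux_space \<Omega> M" "\<And>g T f. \<lbrakk>g \<in> ifaces \<Omega>; (T, f) \<in> iface_facets g\<rbrakk> \<Longrightarrow> ncomp T f v = 0"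
    unfolding flux_space0_iff by auto
  show "v + w \<in> flux_space0 \<Omega> M" if "w \<in> flux_space0 \<Omega> M" for w
  proof -
    have w: "w \<in> flux_space \<Omega> M" "\<And>g T f. \<lbrakk>g \<in> ifaces \<Omega>; (T, f) \<in> iface_facets g\<rbrakk> \<Longrightarrow> ncomp T f w = 0"
      using that unfolding flux_space0_iff by auto
    have "ncomp T f (v + w) = 0" if "g \<in> ifaces \<Omega>" "(T, f) \<in> iface_facets g" for g T f
      using ncomp_linear(1)[OF p[OF that] v(1) w(1)] v(2)[OF that] w(2)[OF that] by simp
    then show ?thesis unfolding flux_space0_iff using subspace_add[OF sub v(1) w(1)] by auto
  qed
  show "c *\<^sub>R v \<in> flux_space0 \<Omega> M" for c
  proof -
    have "ncomp T f (c *\<^sub>R v) = 0" if "g \<in> ifaces \<Omega>" "(T, f) \<in> iface_facets g" for g T f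
      using ncomp_linear(2)[OF p[OF that] v(1)] v(2)[OF that] by simp
    then show ?thesis unfolding flux_space0_iff using subspace_scale[OF sub v(1)] by auto
  qed
qed

lemma mortar_space_subspace: "subspace (mortar_space \<Omega> M)"
  unfolding mortar_space_def by (rule subspaceI) (auto simp: scaleR_fun_def)

lemma pressure_space_subspace: "subspace (pressure_space \<Omega> M)"
  unfolding pressure_space_def by (rule subspaceI) (auto simp: scaleR_fun_def)

lemma W_space_subspace: "subspace (W_space \<Omega> M)"
  unfolding W_space_def by (intro subspace_Times flux_space0_subspace mortar_space_subspace)

lemma flux0_flux: "v \<in> flux_space0 \<Omega> M \<Longrightarrow> v \<in> flux_space \<Omega> M"
  by (simp add: flux_space0_iff)

lemma mortar_lift_zero: "mortar_lift 0 = 0"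
  using mortar_lift_linear(2)[of 0 0] by simp

lemma mortar_load_zero: "mortar_load 0 S T = 0"
  by (simp add: mortar_load_def)

lemma facet_meas_pos:
  assumes "T \<in> flux_cells" "f facet_of T" shows "0 < measure (flat_measure f) f"
proof -
  interpret c: cell T using assms(1) by (rule flux_cell)
  note fp = c.facet_props[OF assms(2)]
  have "polyhedron f" using c.polyhedron_T assms(2) by (rule polyhedron_facet)
  then have "measure (flat_measure f) (rel_interior f) = measure (flat_measure f) f" using fp(3) by (rule measure_rel_interior)
  moreover have "0 < measure (flat_measure f) (rel_interior f)"
    using fp(1,2,3) by (intro measure_pos_rel_interior) (auto simp: compact_imp_bounded)
  ultimately show ?thesis by simp
qed

section \<open>Test functions that detect the jumps of a pressure\<close>

lemma sum_cells_single:
  assumes S: "S \<in> SD" "T \<in> cells M S" and z: "\<And>S' T'. \<lbrakk>S' \<in> SD; T' \<in> cells M S'; T' \<noteq> T\<rbrakk> \<Longrightarrow> h S' T' = 0"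
  shows "(\<Sum>S\<in>SD. \<Sum>T\<in>cells M S. h S T) = (h S T :: real)"
proof -
  have fin: "finite (cells M S)" using smesh.finite_C[OF cells_smesh[OF S(1)]] .
  have "(\<Sum>S\<in>SD. \<Sum>T\<in>cells M S. h S T) = (\<Sum>S'\<in>SD. if S' = S then h S T else 0)"
  proof (rule sum.cong[OF refl])
    fix S' assume S': "S' \<in> SD"
    show "(\<Sum>T\<in>cells M S'. h S' T) = (if S' = S then h S T else 0)"
    proof (cases "S' = S")
      case True
      have "(\<Sum>T'\<in>cells M S. h S T') = (\<Sum>T'\<in>cells M S. if T' = T then h S T else 0)"
        using z[OF S(1)] by (intro sum.cong) auto
      then show ?thesis using True S(2) fin by simp
    next
      case False
      have "T' \<noteq> T" if "T' \<in> cells M S'" for T' using cell_unique_SD[OF S' _ S(1)] S(2) that False by blast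
      then show ?thesis using False z[OF S'] by (simp add: sum.neutral)
    qed
  qed
  then show ?thesis using S(1) finite_SD by simp
qed

text \<open>The test flux leaves T through f, enters T' and vanishes on all other facets, so b
  reduces to the jump of q across f times the area of f.\<close>

lemma test_interior:
  assumes q: "\<And>v. v \<in> flux_space0 \<Omega> M \<Longrightarrow> form_b \<Omega> M (v, 0) q = 0"
    and S: "S \<in> SD" "1 \<le> aff_dim S" and T: "T \<in> cells M S" "T' \<in> cells M S" "T \<noteq> T'"
    and f: "f facet_of T" "f facet_of T'" "rel_interior f \<subseteq> S"
  shows "q T = q T'"
proof -
  interpret s: smesh S "cells M S" using S(1) by (rule cells_smesh)
  have Tf: "T \<in> flux_cells" "T' \<in> flux_cells" using cells_flux[OF S] T by auto
  interpret c: cell T using Tf(1) by (rule flux_cell)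
  obtain x where x: "x \<in> rel_interior f"
    using c.facet_props(1,3)[OF f(1)] by (metis all_not_in_conv rel_interior_eq_empty)
  define k :: "'a set \<Rightarrow> 'a set \<Rightarrow> real" where
    "k T1 f1 = (if f1 = f then (if T1 = T then 1 else if T1 = T' then - 1 else 0) else 0)" for T1 f1
  define v where "v = (\<lambda>T. if T \<in> flux_cells then (\<lambda>x. \<Sum>f | f facet_of T. k T f *\<^sub>R cell.shape T f x) else 0)"
  have k1: "k T1 f1 = 0" if "rel_interior f1 \<subseteq> neumann \<Omega>" for T1 f1
    using that x f(3) boundary_disjoint[OF S(1)] by (auto simp: k_def)
  \<comment> \<open>Continuity across f needs that no third cell has f as a facet:
    \<open>shared_facet_two_cells\<close>.\<close>
  have k2: "k T1 f1 + k T2 f1 = 0"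
    if A: "S1 \<in> SD" "T1 \<in> cells M S1" "T2 \<in> cells M S1" "T1 \<noteq> T2" "f1 facet_of T1" "f1 facet_of T2" "rel_interior f1 \<subseteq> S1" for S1 T1 T2 f1
  proof (cases "f1 = f \<and> (T1 \<in> {T, T'} \<or> T2 \<in> {T, T'})")
    case True
    then have "S1 = S" using cell_unique_SD[OF A(1) _ S(1)] A(2,3) T(1,2) by blast
    then have "T1 = T \<or> T1 = T'" "T2 = T \<or> T2 = T'"
      using s.shared_facet_two_cells[OF S(2) T(1,2) _ T(3) f(1,2)] A True by blast+
    then show ?thesis using A(4) T(3) True by (auto simp: k_def)
  qed (auto simp: k_def)
  have v: "v \<in> flux_space \<Omega> M" unfolding v_def by (rule flux_of_coefs(1)) (use k1 k2 in blast)+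
  have nv: "ncomp T1 f1 v = k T1 f1" if "T1 \<in> flux_cells" "f1 facet_of T1" for T1 f1
    unfolding v_def by (rule flux_of_coefs(2)) (use k1 k2 that in blast)+
  have v0: "v \<in> flux_space0 \<Omega> M"
    unfolding flux_space0_iff
  proof (intro conjI v ballI, clarify)
    fix S1 U \<nu> T1 f1 assume g: "(S1, U, \<nu>) \<in> ifaces \<Omega>" "(T1, f1) \<in> iface_facets (S1, U, \<nu>)"
    have "k T1 f1 = 0"
      using iface_facet_not_boundary(2)[OF g] f(3) S(1) T by (auto simp: k_def)
    then show "ncomp T1 f1 v = 0" using nv iface_facet_props(1,2)[OF g] by simp
  qed
  let ?f = "measure (flat_measure f) f"
  have out: "outflow T1 v = (if T1 = T then ?f else 0) - (if T1 = T' then ?f else 0)"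
    if "S1 \<in> SD" "T1 \<in> cells M S1" for S1 T1
  proof (cases "T1 \<in> flux_cells")
    case True
    have "outflow T1 v = (\<Sum>f1 | f1 facet_of T1. if f1 = f then ?f * k T1 f else 0)"
      unfolding outflow_def using nv[OF True] by (intro sum.cong) (auto simp: k_def)
    also have "\<dots> = (if f facet_of T1 then ?f * k T1 f else 0)"
      using cell.finite_facets[OF flux_cell[OF True]] by simp
    also have "\<dots> = (if T1 = T then ?f else 0) - (if T1 = T' then ?f else 0)"
      using f T(3) by (auto simp: k_def)
    finally show ?thesis .
  next
    case False
    then show ?thesis using not_flux_cell[OF that] Tf by (auto simp: outflow_def)
  qed
  have "0 = (\<Sum>S\<in>SD. \<Sum>T\<in>cells M S. q T * outflow T v)"
    using q[OF v0] by (simp add: form_b_eq[OF v] mortar_lift_zero mortar_load_zero)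
  also have "\<dots> = (\<Sum>S1\<in>SD. \<Sum>T1\<in>cells M S1. (if T1 = T then q T1 * ?f else 0)) - (\<Sum>S1\<in>SD. \<Sum>T1\<in>cells M S1. (if T1 = T' then q T1 * ?f else 0))"
    unfolding sum_subtractf[symmetric] by (intro sum.cong refl) (simp add: out right_diff_distrib)
  also have "\<dots> = q T * ?f - q T' * ?f"
    using sum_cells_single[OF S(1) T(1), of "\<lambda>_ T1. if T1 = T then q T1 * ?f else 0"]
      sum_cells_single[OF S(1) T(2), of "\<lambda>_ T1. if T1 = T' then q T1 * ?f else 0"] by simp
  finally show ?thesis using facet_meas_pos[OF Tf(1) f(1)] by simp
qed

text \<open>A flux that leaves T through f alone is admissible, because a Dirichlet facet is neither
  on the Neumann boundary nor inside a subdomain.\<close>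

lemma test_dirichlet:
  assumes q: "\<And>v. v \<in> flux_space0 \<Omega> M \<Longrightarrow> form_b \<Omega> M (v, 0) q = 0"
    and S: "S \<in> SD" "1 \<le> aff_dim S" and T: "T \<in> cells M S" and f: "f facet_of T" "rel_interior f \<subseteq> dirichlet \<Omega>"
  shows "q T = 0"
proof -
  have Tf: "T \<in> flux_cells" using cells_flux[OF S] T by auto
  interpret c: cell T using Tf(1) by (rule flux_cell)
  obtain x where x: "x \<in> rel_interior f"
    using c.facet_props(1,3)[OF f(1)] by (metis all_not_in_conv rel_interior_eq_empty)
  define k :: "'a set \<Rightarrow> 'a set \<Rightarrow> real" where "k T1 f1 = (if f1 = f \<and> T1 = T then 1 else 0)" for T1 f1
  define v where "v = (\<lambda>T. if T \<in> flux_cells then (\<lambda>x. \<Sum>f | f facet_of T. k T f *\<^sub>R cell.shape T f x) else 0)"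
  have k1: "k T1 f1 = 0" if "rel_interior f1 \<subseteq> neumann \<Omega>" for T1 f1
    using that x f(2) boundary(2) by (auto simp: k_def)
  have k0: "k T1 f1 = 0" if "rel_interior f1 \<subseteq> S1" "S1 \<in> SD" for T1 f1 S1
    using that x f(2) boundary_disjoint[OF that(2), of x] by (auto simp: k_def)
  have k2: "k T1 f1 + k T2 f1 = 0" if "rel_interior f1 \<subseteq> S1" "S1 \<in> SD" for T1 f1 S1 T2
    using k0[OF that] by simp
  have v: "v \<in> flux_space \<Omega> M" unfolding v_def by (rule flux_of_coefs(1)) (use k1 k2 in blast)+
  have nv: "ncomp T1 f1 v = k T1 f1" if "T1 \<in> flux_cells" "f1 facet_of T1" for T1 f1
    unfolding v_def by (rule flux_of_coefs(2)) (use k1 k2 that in blast)+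
  have v0: "v \<in> flux_space0 \<Omega> M"
    unfolding flux_space0_iff
  proof (intro conjI v ballI, clarify)
    fix S1 U \<nu> T1 f1 assume g: "(S1, U, \<nu>) \<in> ifaces \<Omega>" "(T1, f1) \<in> iface_facets (S1, U, \<nu>)"
    have "k T1 f1 = 0" using iface_facet_props(3)[OF g] iface_dim[OF g(1)] by (intro k0[of f1 S1]) auto
    then show "ncomp T1 f1 v = 0" using nv iface_facet_props(1,2)[OF g] by simp
  qed
  let ?f = "measure (flat_measure f) f"
  have out: "outflow T1 v = (if T1 = T then ?f else 0)"
    if "S1 \<in> SD" "T1 \<in> cells M S1" for S1 T1
  proof (cases "T1 \<in> flux_cells")
    case True
    have "outflow T1 v = (\<Sum>f1 | f1 facet_of T1. if f1 = f then ?f * k T1 f else 0)"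
      unfolding outflow_def using nv[OF True] by (intro sum.cong) (auto simp: k_def)
    also have "\<dots> = (if f facet_of T1 then ?f * k T1 f else 0)"
      using cell.finite_facets[OF flux_cell[OF True]] by simp
    also have "\<dots> = (if T1 = T then ?f else 0)"
      using f by (auto simp: k_def)
    finally show ?thesis .
  next
    case False
    then show ?thesis using not_flux_cell[OF that] Tf by (auto simp: outflow_def)
  qed
  have "0 = (\<Sum>S\<in>SD. \<Sum>T\<in>cells M S. q T * outflow T v)"
    using q[OF v0] by (simp add: form_b_eq[OF v] mortar_lift_zero mortar_load_zero)
  also have "\<dots> = q T * outflow T v"
    by (rule sum_cells_single[OF S(1) T]) (simp add: out)
  finally show ?thesis using facet_meas_pos[OF Tf(1) f(1)] out[OF S(1) T] by simp
qed

lemma measure_partition: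
  assumes S: "S \<noteq> {}" and I: "finite I" "\<And>i. i \<in> I \<Longrightarrow> A i \<in> sets borel"
    and dj: "\<And>i j x. \<lbrakk>i \<in> I; j \<in> I; x \<in> A i; x \<in> A j\<rbrakk> \<Longrightarrow> i = j"
    and R: "R \<in> sets borel" "bounded R" and null: "R - (\<Union>i\<in>I. A i) \<subseteq> N" "N \<in> null_sets (flat_measure S)"
  shows "(\<Sum>i\<in>I. measure (flat_measure S) (A i \<inter> R)) = measure (flat_measure S) R"
proof -
  let ?M = "flat_measure S"
  have "measure ?M (\<Union>i\<in>I. A i \<inter> R) = (\<Sum>i\<in>I. measure ?M (A i \<inter> R))"
  proof (rule measure_finite_Union[OF I(1)])
    show "(\<lambda>i. A i \<inter> R) ` I \<subseteq> sets ?M" using I(2) R(1) by auto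
    show "disjoint_family_on (\<lambda>i. A i \<inter> R) I" using dj unfolding disjoint_family_on_def by blast
    show "emeasure ?M (A i \<inter> R) \<noteq> \<infinity>" if "i \<in> I" for i
      using flat_measure_bounded_finite[OF S, of "A i \<inter> R"] bounded_subset[OF R(2), of "A i \<inter> R"] by auto
  qed
  moreover have "emeasure ?M (\<Union>i\<in>I. A i \<inter> R) = emeasure ?M R"
  proof (rule emeasure_eq_AE)
    show "AE x in ?M. (x \<in> (\<Union>i\<in>I. A i \<inter> R)) = (x \<in> R)"
      using null by (intro AE_I'[OF null(2)]) auto
    show "(\<Union>i\<in>I. A i \<inter> R) \<in> sets ?M" using I R(1) by (intro sets.finite_UN) auto
  qed (use R(1) in simp)
  ultimately show ?thesis by (simp add: measure_def)
qed

text \<open>The test mortar is the indicator of one mortar cell E. It may overlap several cells of S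
  and several facets of U, which is why q has to be known to be constant on both subdomains. Cells
  and facets each cover E up to a null set, so the overlaps add up to the area of E on either
  side.\<close>

lemma test_mortar:
  assumes q: "\<And>\<mu>. \<mu> \<in> mortar_space \<Omega> M \<Longrightarrow> form_b \<Omega> M (0, \<mu>) q = 0"
    and c: "\<And>S T. \<lbrakk>S \<in> SD; T \<in> cells M S\<rbrakk> \<Longrightarrow> q T = c S"
    and g: "(S, U, \<nu>) \<in> ifaces \<Omega>"
  shows "c S = c U"
proof -
  let ?g = "(S, U, \<nu>)" and ?m = "measure (flat_measure S)"
  note gD = ifaceD[OF g]
  have S_ne: "S \<noteq> {}" using SD_props(1)[OF gD(1)] .
  interpret m: smesh S "mortar_cells M ?g" using mortar_smesh[OF g] by simp
  interpret s: smesh S "cells M S" using gD(1) by (rule cells_smesh)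
  have "mortar_cells M ?g \<noteq> {}" using m.Union_C S_ne by (metis Union_empty closure_eq_empty)
  then obtain E where E: "E \<in> mortar_cells M ?g" by auto
  have Ep: "rel_interior E \<subseteq> S" "0 < ?m (rel_interior E)" using mortar_cell_props[OF g E] by auto
  have Eb: "bounded (rel_interior E)" using Ep(1) SD_props(4)[OF gD(1)] bounded_subset by blast
  define \<mu> :: "'a mortar" where "\<mu> = (\<lambda>g' E'. if g' = ?g \<and> E' = E then 1 else 0)"
  have \<mu>: "\<mu> \<in> mortar_space \<Omega> M" using g E by (auto simp: mortar_space_def \<mu>_def)
  have fm: "facet_mean \<mu> g' f = (if g' = ?g then overlap ?g f E / ?m (rel_interior f) else 0)" for g' f
  proof (cases "g' = ?g")
    case True
    have "(\<Sum>E'\<in>mortar_cells M ?g. \<mu> ?g E' * overlap ?g f E') = (\<Sum>E'\<in>mortar_cells M ?g. if E' = E then overlap ?g f E else 0)"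
      by (intro sum.cong) (auto simp: \<mu>_def)
    then show ?thesis using True E m.finite_C by (simp add: facet_mean_def)
  qed (simp add: facet_mean_def \<mu>_def)
  have ec: "lift_coef \<mu> T f = (if (T, f) \<in> iface_facets ?g then overlap ?g f E / ?m (rel_interior f) else 0)" for T f
  proof (cases "(T, f) \<in> iface_facets ?g")
    case True
    then show ?thesis using lift_coef_eq[OF g True] by (simp add: fm)
  next
    case False
    then have "facet_mean \<mu> g' f = 0" if "(T, f) \<in> iface_facets g'" for g' using that fm by auto
    then show ?thesis using False unfolding lift_coef_def by (simp add: sum.neutral)
  qed
  have out: "outflow T (mortar_lift \<mu>) = (\<Sum>f | (T, f) \<in> iface_facets ?g. overlap ?g f E)"
    if T: "S' \<in> SD" "T \<in> cells M S'" for S' T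
  proof (cases "T \<in> flux_cells")
    case True
    have fin: "finite {f. f facet_of T}" using cell.finite_facets[OF flux_cell[OF True]] .
    have "outflow T (mortar_lift \<mu>) = (\<Sum>f | f facet_of T. if (T, f) \<in> iface_facets ?g then overlap ?g f E else 0)"
      unfolding outflow_def
    proof (rule sum.cong[OF refl])
      fix f assume "f \<in> {f. f facet_of T}"
      then have f: "f facet_of T" by simp
      show "measure (flat_measure f) f * ncomp T f (mortar_lift \<mu>) = (if (T, f) \<in> iface_facets ?g then overlap ?g f E else 0)"
      proof (cases "(T, f) \<in> iface_facets ?g")
        case i: True
        have "polyhedron f" "f \<noteq> {}"
          using polyhedron_facet[OF cell.polyhedron_T[OF flux_cell[OF True]] f] f by (auto simp: facet_of_def)
        then have "measure (flat_measure f) f = ?m (rel_interior f)"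
          using measure_rel_interior[of f] iface_facet_props(5)[OF g i] by simp
        then show ?thesis
          using i iface_facet_props(4)[OF g i] by (simp add: ncomp_lift[OF True f] ec)
      qed (simp add: ncomp_lift[OF True f] ec)
    qed
    also have "\<dots> = (\<Sum>f | f facet_of T \<and> (T, f) \<in> iface_facets ?g. overlap ?g f E)"
      using fin by (simp add: sum.If_cases Int_def)
    also have "{f. f facet_of T \<and> (T, f) \<in> iface_facets ?g} = {f. (T, f) \<in> iface_facets ?g}"
      using iface_facet_props(2)[OF g] by auto
    finally show ?thesis .
  next
    case False
    then have "{f. (T, f) \<in> iface_facets ?g} = {}" using iface_facet_props(1)[OF g] by auto
    then show ?thesis using not_flux_cell[OF T False] by (simp add: outflow_def)
  qed
  have out0: "outflow T (mortar_lift \<mu>) = 0" if "S' \<in> SD" "T \<in> cells M S'" "S' \<noteq> U" for S' T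
  proof -
    have "T \<notin> cells M U" using cell_unique_SD[OF that(1,2) gD(2)] that(3) by blast
    then have "{f. (T, f) \<in> iface_facets ?g} = {}" by (auto simp: iface_facets_def)
    then show ?thesis using out[OF that(1,2)] by simp
  qed
  have load: "mortar_load \<mu> S' T = (if S' = S then overlap ?g T E else 0)" for S' T
  proof -
    have "(\<Sum>E'\<in>mortar_cells M g'. \<mu> g' E' * overlap g' T E') = (if g' = ?g then overlap ?g T E else 0)" for g'
    proof (cases "g' = ?g")
      case True
      have "(\<Sum>E'\<in>mortar_cells M ?g. \<mu> ?g E' * overlap ?g T E') = (\<Sum>E'\<in>mortar_cells M ?g. if E' = E then overlap ?g T E else 0)"
        by (intro sum.cong) (auto simp: \<mu>_def)
      then show ?thesis using True E m.finite_C by simp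
    qed (simp add: \<mu>_def)
    then have "mortar_load \<mu> S' T = (\<Sum>g' | g' \<in> ifaces \<Omega> \<and> fst g' = S'. if g' = ?g then overlap ?g T E else 0)"
      by (simp add: mortar_load_def)
    then show ?thesis using g finite_ifaces by auto
  qed
  have zero: "(0 :: 'a flux) \<in> flux_space \<Omega> M" using flux_space_subspace by (rule subspace_0)
  have "(\<Sum>S'\<in>SD. \<Sum>T\<in>cells M S'. q T * (outflow T (mortar_lift \<mu>) - mortar_load \<mu> S' T)) = 0"
    using q[OF \<mu>] by (simp add: form_b_eq[OF zero])
  then have eq: "(\<Sum>S'\<in>SD. \<Sum>T\<in>cells M S'. q T * outflow T (mortar_lift \<mu>)) = (\<Sum>S'\<in>SD. \<Sum>T\<in>cells M S'. q T * mortar_load \<mu> S' T)"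
    by (simp add: right_diff_distrib sum_subtractf)
  have "(\<Sum>S'\<in>SD. \<Sum>T\<in>cells M S'. q T * mortar_load \<mu> S' T) = (\<Sum>S'\<in>SD. if S' = S then (\<Sum>T\<in>cells M S. c S * overlap ?g T E) else 0)"
    by (intro sum.cong refl) (auto simp: load c[OF gD(1)])
  also have "\<dots> = c S * (\<Sum>T\<in>cells M S. overlap ?g T E)"
    using gD(1) finite_SD by (simp add: sum_distrib_left)
  also have "(\<Sum>T\<in>cells M S. overlap ?g T E) = ?m (rel_interior E)"
    unfolding overlap_def fst_conv
  proof (rule measure_partition[OF S_ne s.finite_C _ _ rel_interior_borel Eb])
    show "T = T'" if "T \<in> cells M S" "T' \<in> cells M S" "x \<in> rel_interior T" "x \<in> rel_interior T'" for T T' x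
      using that(4) rel_interior_subset[of T'] by (intro s.C_unique[OF that(1-3)]) auto
    show "rel_interior E - (\<Union>T\<in>cells M S. rel_interior T) \<subseteq> (\<Union>T\<in>cells M S. T - rel_interior T)"
    proof
      fix x assume x: "x \<in> rel_interior E - (\<Union>T\<in>cells M S. rel_interior T)"
      then have "x \<in> \<Union>(cells M S)" using Ep(1) closure_subset[of S] unfolding s.Union_C by auto
      with x show "x \<in> (\<Union>T\<in>cells M S. T - rel_interior T)" by auto
    qed
    show "(\<Union>T\<in>cells M S. T - rel_interior T) \<in> null_sets (flat_measure S)"
    proof (rule null_sets_UN')
      show "T - rel_interior T \<in> null_sets (flat_measure S)" if "T \<in> cells M S" for T
        using flat_measure_frontier_null[OF s.C_props(5,2)[OF that]] s.C_props(10)[OF that] by simp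
    qed (use s.finite_C in \<open>simp add: countable_finite\<close>)
  qed simp
  finally have R: "(\<Sum>S'\<in>SD. \<Sum>T\<in>cells M S'. q T * mortar_load \<mu> S' T) = c S * ?m (rel_interior E)" .
  interpret u: smesh U "cells M U" using gD(2) by (rule cells_smesh)
  have finf: "finite {f. (T, f) \<in> iface_facets ?g}" for T
    using finite_imageI[OF finite_iface_facets[OF g], of snd] by (rule rev_finite_subset) (force simp: image_iff)
  have "(\<Sum>S'\<in>SD. \<Sum>T\<in>cells M S'. q T * outflow T (mortar_lift \<mu>)) = (\<Sum>S'\<in>SD. if S' = U then (\<Sum>T\<in>cells M U. c U * outflow T (mortar_lift \<mu>)) else 0)"
    by (intro sum.cong refl) (auto simp: out0 c[OF gD(2)])
  also have "\<dots> = c U * (\<Sum>T\<in>cells M U. \<Sum>f | (T, f) \<in> iface_facets ?g. overlap ?g f E)"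
    using gD(2) finite_SD out[OF gD(2)] by (simp add: sum_distrib_left)
  also have "(\<Sum>T\<in>cells M U. \<Sum>f | (T, f) \<in> iface_facets ?g. overlap ?g f E) = (\<Sum>i\<in>iface_facets ?g. overlap ?g (snd i) E)"
  proof -
    have "(\<Sum>T\<in>cells M U. \<Sum>f | (T, f) \<in> iface_facets ?g. overlap ?g f E)
      = (\<Sum>(T, f)\<in>(SIGMA T:cells M U. {f. (T, f) \<in> iface_facets ?g}). overlap ?g f E)"
      using u.finite_C finf by (intro sum.Sigma) auto
    also have "(SIGMA T:cells M U. {f. (T, f) \<in> iface_facets ?g}) = iface_facets ?g"
      by (auto simp: iface_facets_def)
    finally show ?thesis by (simp add: case_prod_unfold)
  qed
  also have "\<dots> = ?m (rel_interior E)"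
    unfolding overlap_def fst_conv
  proof (rule measure_partition[OF S_ne finite_iface_facets[OF g] _ _ rel_interior_borel Eb])
    show "i = j" if "i \<in> iface_facets ?g" "j \<in> iface_facets ?g" "x \<in> rel_interior (snd i)" "x \<in> rel_interior (snd j)" for i j x
      using facets_disjoint[OF g that] .
    show "rel_interior E - (\<Union>i\<in>iface_facets ?g. rel_interior (snd i)) \<subseteq> S - (\<Union>(T, f)\<in>iface_facets ?g. rel_interior f)"
      using Ep(1) by auto
    show "S - (\<Union>(T, f)\<in>iface_facets ?g. rel_interior f) \<in> null_sets (flat_measure S)" using g by (rule iface_covered)
  qed simp
  finally have L: "(\<Sum>S'\<in>SD. \<Sum>T\<in>cells M S'. q T * outflow T (mortar_lift \<mu>)) = c U * ?m (rel_interior E)" .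
  show ?thesis using eq L R Ep(2) by simp
qed

lemma form_b_nondegenerate:
  assumes q: "q \<in> pressure_space \<Omega> M" and b: "\<And>r. r \<in> W_space \<Omega> M \<Longrightarrow> form_b \<Omega> M r q = 0"
  shows "q = 0"
proof -
  have b1: "form_b \<Omega> M (v, 0) q = 0" if "v \<in> flux_space0 \<Omega> M" for v
    using that subspace_0[OF mortar_space_subspace] by (intro b) (simp add: W_space_def)
  have b2: "form_b \<Omega> M (0, \<mu>) q = 0" if "\<mu> \<in> mortar_space \<Omega> M" for \<mu>
    using that subspace_0[OF flux_space0_subspace] by (intro b) (simp add: W_space_def)
  define c where "c S = q (SOME T. T \<in> cells M S)" for S
  have c: "q T = c S" if "S \<in> SD" "T \<in> cells M S" for S T
    unfolding c_def using that
    by (intro constant_on_subdomain[OF that(1,2)] test_interior[OF b1 that(1)]) (auto intro: someI)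
  have ci: "c S = c U" if "(S, U, \<nu>) \<in> ifaces \<Omega>" for S U \<nu>
    using b2 c that by (rule test_mortar)
  obtain V T f where V: "V \<in> SD" "aff_dim V = int DIM('a)" "T \<in> cells M V" "f facet_of T" "rel_interior f \<subseteq> dirichlet \<Omega>"
    by (rule dirichlet_facet)
  have dV: "1 \<le> aff_dim V" using V(2) DIM_positive[where 'a = 'a] by linarith
  have "q T = 0" using b1 V(1) dV V(3,4,5) by (rule test_dirichlet)
  then have "c V = 0" using c[OF V(1,3)] by simp
  moreover have "c S = c V" if "S \<in> SD" for S using ci V(1,2) that by (rule all_constant)
  ultimately have "c S = 0" if "S \<in> SD" for S using that by simp
  then have "q T = 0" if "S \<in> SD" "T \<in> cells M S" for S T using c[OF that] that(1) by simp
  moreover have "q T = 0" if "\<forall>S\<in>SD. T \<notin> cells M S" for T using q that by (auto simp: pressure_space_def)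
  ultimately show ?thesis by (intro ext) (metis zero_fun_apply)
qed

end

section \<open>Equivalence of the bilinear forms\<close>

lemma sum_fun_apply: "(\<Sum>i\<in>I. g i) j = (\<Sum>i\<in>I. g i j)"
  by (induction I rule: infinite_finite_induct) auto

lemma finite_dim_fun:
  fixes B :: "'b::real_vector set" and V :: "('i \<Rightarrow> 'b) set"
  assumes I: "finite I" and B: "finite B"
    and V: "\<And>u i. \<lbrakk>u \<in> V; i \<notin> I\<rbrakk> \<Longrightarrow> u i = 0" "\<And>u i. \<lbrakk>u \<in> V; i \<in> I\<rbrakk> \<Longrightarrow> u i \<in> span B"
  shows "\<exists>F. finite F \<and> V \<subseteq> span F"
proof -
  define L :: "'i \<Rightarrow> 'b \<Rightarrow> 'i \<Rightarrow> 'b" where "L i b = (\<lambda>j. if j = i then b else 0)" for i b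
  define F where "F = (\<Union>i\<in>I. L i ` B)"
  have lin: "linear (L i)" for i
    by (rule linearI) (auto simp: L_def fun_eq_iff scaleR_fun_def)
  have "u \<in> span F" if u: "u \<in> V" for u
  proof -
    have "u = (\<Sum>i\<in>I. L i (u i))"
    proof
      fix j show "u j = (\<Sum>i\<in>I. L i (u i)) j"
        unfolding sum_fun_apply L_def using I V(1)[OF u, of j] by (cases "j \<in> I") auto
    qed
    also have "\<dots> \<in> span F"
    proof (rule span_sum)
      fix i assume i: "i \<in> I"
      have "L i (u i) \<in> L i ` span B" using V(2)[OF u i] by simp
      also have "\<dots> = span (L i ` B)" by (rule linear_span_image[OF lin, symmetric])
      also have "\<dots> \<subseteq> span F" using i by (intro span_mono) (auto simp: F_def)
      finally show "L i (u i) \<in> span F" .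
    qed
    finally show ?thesis .
  qed
  moreover have "finite F" using I B by (simp add: F_def)
  ultimately show ?thesis by blast
qed

lemma finite_dim_Times:
  fixes V :: "'a::real_vector set" and W :: "'b::real_vector set"
  assumes "\<exists>F. finite F \<and> V \<subseteq> span F" "\<exists>F. finite F \<and> W \<subseteq> span F"
  shows "\<exists>F. finite F \<and> V \<times> W \<subseteq> span F"
proof -
  obtain F G where F: "finite F" "V \<subseteq> span F" and G: "finite G" "W \<subseteq> span G" using assms by blast
  have l1: "linear (\<lambda>x::'a. (x, 0::'b))" and l2: "linear (\<lambda>y::'b. (0::'a, y))" by (auto intro!: linearI)
  let ?H = "(\<lambda>x. (x, 0)) ` F \<union> (\<lambda>y. (0, y)) ` G"
  have "(x, y) \<in> span ?H" if "x \<in> V" "y \<in> W" for x y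
  proof -
    have "(x, 0) \<in> span ((\<lambda>x. (x, 0::'b)) ` F)" "(0, y) \<in> span ((\<lambda>y. (0::'a, y)) ` G)"
      unfolding linear_span_image[OF l1] linear_span_image[OF l2] using that F G by auto
    then have "(x, 0) \<in> span ?H" "(0, y) \<in> span ?H"
      using span_mono[of "(\<lambda>x. (x, 0::'b)) ` F" ?H] span_mono[of "(\<lambda>y. (0::'a, y)) ` G" ?H] by auto
    then have "(x, 0) + (0, y) \<in> span ?H" by (rule span_add)
    then show ?thesis by simp
  qed
  then show ?thesis using F(1) G(1) by (intro exI[of _ ?H]) auto
qed

text \<open>The shape parameter normalised to be at least 1, so that powers of it increase with the
  exponent.\<close>

definition shape_const :: "real \<Rightarrow> real" where "shape_const \<sigma> = max 1 \<bar>\<sigma>\<bar>"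

text \<open>The constant of \<open>diag_le_cell_form\<close>, made uniform over cells: the ambient
  dimension replaces that of the cell, and \<open>max 1 \<kappa>\<close> bounds hi / lo.\<close>

definition diag_const :: "nat \<Rightarrow> real \<Rightarrow> real \<Rightarrow> real" where
  "diag_const n \<sigma> \<kappa> = (real n + 1) *
     (max 1 \<kappa> * (shape_const \<sigma>)\<^sup>2 * ((4 * shape_const \<sigma>)\<^sup>2 * (8 * shape_const \<sigma>) ^ n))"

locale discretization = meshed_medium \<Omega> M \<sigma>
  for \<Omega> :: "'a::euclidean_space medium" and M :: "'a mesh" and \<sigma> :: real +
  fixes P :: "'a params" and \<kappa> :: real
  assumes phys: "physical_params \<Omega> P" and bnd: "perm_bounded \<Omega> \<kappa> P"
begin

lemma inscribed_ball:
  assumes "S \<in> SD" "T \<in> cells M S"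
  obtains z r where "z \<in> T" "0 < r" "cball z r \<inter> affine hull T \<subseteq> T" "1 \<le> shape_const \<sigma>" "diameter T \<le> shape_const \<sigma> * r"
proof -
  obtain z r where z: "z \<in> T" "0 < r" "cball z r \<inter> affine hull T \<subseteq> T" "diameter T \<le> \<sigma> * r"
    using cells_shape_regular[OF assms] unfolding shape_regular_def by blast
  have "\<sigma> * r \<le> shape_const \<sigma> * r" using z(2) by (intro mult_right_mono) (auto simp: shape_const_def)
  with z(4) have "diameter T \<le> shape_const \<sigma> * r" by linarith
  moreover have "1 \<le> shape_const \<sigma>" by (simp add: shape_const_def)
  ultimately show thesis by (intro that[OF z(1-3)])
qed

text \<open>The inverse tensor has the bounds 1 / (\<kappa> k) and 1 / k. Their quotient is free of
  k, which is why the size of the permeability and its variation between subdomains leave no trace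
  in the constants.\<close>

lemma cell_tensor_ex:
  assumes S: "S \<in> SD" "1 \<le> aff_dim S" and T: "T \<in> cells M S"
  obtains lo hi where "cell_tensor T (inv_perm P S) lo hi" "hi / lo \<le> max 1 \<kappa>"
proof -
  interpret s: smesh S "cells M S" using S(1) by (rule cells_smesh)
  interpret c: cell T using s.cell_C[OF T S(2)] .
  let ?V = "tangent S"
  have V: "tangent T = ?V" using s.C_props(9)[OF T] .
  have sub: "subspace ?V" by (rule subspace_tangent)
  have spd: "spd_tensor ?V (perm P S)" using phys S(1) by (simp add: physical_params_def)
  have "\<exists>k>0. \<forall>x\<in>?V. k * (norm x)\<^sup>2 \<le> perm P S x \<bullet> x \<and> perm P S x \<bullet> x \<le> \<kappa> * k * (norm x)\<^sup>2"
    using bnd S(1) unfolding perm_bounded_def by simp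
  then obtain k where k: "0 < k" "\<And>x. x \<in> ?V \<Longrightarrow> k * (norm x)\<^sup>2 \<le> perm P S x \<bullet> x"
    "\<And>x. x \<in> ?V \<Longrightarrow> perm P S x \<bullet> x \<le> \<kappa> * k * (norm x)\<^sup>2" by blast
  \<comment> \<open>Testing the two-sided bound with a unit tangent vector forces \<kappa> to be at
    least 1, so that the inverse bounds are positive.\<close>
  obtain e where e: "e \<in> tangent T" "norm e = 1" by (rule c.unit_tangent)
  have "k * 1 \<le> \<kappa> * k" using k(2,3)[of e] e V by simp
  then have \<kappa>1: "1 \<le> \<kappa>" using k(1) by simp
  then have u: "0 < \<kappa> * k" using k(1) by simp
  obtain G where G: "linear G" "\<And>x. x \<in> ?V \<Longrightarrow> inv_into ?V (perm P S) x = G x" "\<And>x. x \<in> ?V \<Longrightarrow> G x \<in> ?V"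
    "\<And>x. x \<in> ?V \<Longrightarrow> perm P S (G x) = x"
    by (rule spd_inverse[OF sub spd]) (rule that)
  have f1: "G x \<bullet> y = x \<bullet> G y" if "x \<in> ?V" "y \<in> ?V" for x y
    using sub spd G(3,4) that by (rule spd_inverse_form(1))
  have f3: "G y \<bullet> y \<le> (norm y)\<^sup>2 / k" if "y \<in> ?V" for y
    using sub spd G(3,4) k(1,2) that by (rule spd_inverse_form(3))
  have f4: "(norm y)\<^sup>2 / (\<kappa> * k) \<le> G y \<bullet> y" if "y \<in> ?V" for y
    using sub spd G(3,4) u k(3) that by (rule spd_inverse_form(4))
  have ig: "inv_perm P S x = G x" if "x \<in> ?V" for x using G(2)[OF that] by (simp add: inv_perm_def)
  have "cell_tensor T (inv_perm P S) (1 / (\<kappa> * k)) (1 / k)"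
  proof
    show "\<exists>G. linear G \<and> (\<forall>x\<in>tangent T. inv_perm P S x = G x)" using G(1) ig V by auto
    show "inv_perm P S x \<bullet> y = x \<bullet> inv_perm P S y" if "x \<in> tangent T" "y \<in> tangent T" for x y
      using f1[of x y] that V ig by simp
    show "1 / (\<kappa> * k) * (norm x)\<^sup>2 \<le> inv_perm P S x \<bullet> x" if "x \<in> tangent T" for x
      using f4[of x] that V ig by simp
    show "inv_perm P S x \<bullet> x \<le> 1 / k * (norm x)\<^sup>2" if "x \<in> tangent T" for x
      using f3[of x] that V ig by simp
  qed (use k(1) u in auto)
  moreover have "1 / k / (1 / (\<kappa> * k)) \<le> max 1 \<kappa>" using k(1) by simp
  ultimately show thesis by (rule that)
qed

definition cell_a :: "'a set \<Rightarrow> 'a set \<Rightarrow> 'a flux \<Rightarrow> 'a flux \<Rightarrow> real" where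
  "cell_a S T u v = cell_form T (inv_perm P S) (u T) (v T)"

definition cell_d :: "'a set \<Rightarrow> 'a set \<Rightarrow> 'a flux \<Rightarrow> 'a flux \<Rightarrow> real" where
  "cell_d S T u v = (\<Sum>f | f facet_of T. ncomp T f u * ncomp T f v *
     cell_form T (inv_perm P S) (RT0_basis T f) (RT0_basis T f))"

lemma cell_a_trivial:
  assumes "S \<in> SD" "T \<in> cells M S" "T \<notin> flux_cells" "v \<in> flux_space \<Omega> M"
  shows "cell_a S T u v = 0" "cell_d S T u w = 0" "v T = 0"
  using flux_zero[OF assms(4,3)] not_flux_cell[OF assms(1-3)]
  by (simp_all add: cell_a_def cell_d_def cell_form_def set_lebesgue_integral_def)

lemma flux_cell_dim: "\<lbrakk>S \<in> SD; T \<in> cells M S; T \<in> flux_cells\<rbrakk> \<Longrightarrow> 1 \<le> aff_dim S"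
  using cell_unique_SD unfolding flux_cells_def by blast

lemma cell_a_props:
  assumes S: "S \<in> SD" "T \<in> cells M S" and u: "u \<in> flux_space \<Omega> M" and v: "v \<in> flux_space \<Omega> M"
  shows "w \<in> flux_space \<Omega> M \<Longrightarrow> cell_a S T (u + w) v = cell_a S T u v + cell_a S T w v"
    and "cell_a S T (c *\<^sub>R u) v = c * cell_a S T u v"
    and "cell_a S T u v = cell_a S T v u"
    and "0 \<le> cell_a S T u u"
    and "u T \<noteq> 0 \<Longrightarrow> 0 < cell_a S T u u"
    and "cell_a S T u u \<le> (real DIM('a) + 1) * cell_d S T u u"
    and "cell_d S T u u \<le> (diag_const DIM('a) \<sigma> \<kappa>) * cell_a S T u u"
proof -
  have "(w \<in> flux_space \<Omega> M \<longrightarrow> cell_a S T (u + w) v = cell_a S T u v + cell_a S T w v) \<and>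
    cell_a S T (c *\<^sub>R u) v = c * cell_a S T u v \<and> cell_a S T u v = cell_a S T v u \<and>
    0 \<le> cell_a S T u u \<and> (u T \<noteq> 0 \<longrightarrow> 0 < cell_a S T u u) \<and>
    cell_a S T u u \<le> (real DIM('a) + 1) * cell_d S T u u \<and> cell_d S T u u \<le> (diag_const DIM('a) \<sigma> \<kappa>) * cell_a S T u u"
  proof (cases "T \<in> flux_cells")
    case True
    have d: "1 \<le> aff_dim S" using flux_cell_dim[OF S True] .
    obtain lo hi where lh: "cell_tensor T (inv_perm P S) lo hi" "hi / lo \<le> max 1 \<kappa>"
      by (rule cell_tensor_ex[OF S(1) d S(2)])
    interpret c: cell_tensor T "inv_perm P S" lo hi by (rule lh(1))
    obtain z r where z: "z \<in> T" "0 < r" "cball z r \<inter> affine hull T \<subseteq> T" "1 \<le> shape_const \<sigma>" "diameter T \<le> shape_const \<sigma> * r"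
      by (rule inscribed_ball[OF S])
    note R = flux_RT0[OF _ True]
    have ad: "aff_dim T \<le> int DIM('a)" by (rule aff_dim_le_DIM)
    have ad': "of_int (aff_dim T) + 1 \<le> (real DIM('a) + 1)" using ad by simp
    have cd: "cell_d S T u u = (\<Sum>f | f facet_of T. (normal_comp T f (u T))\<^sup>2 * cell_form T (inv_perm P S) (c.shape f) (c.shape f))"
      unfolding cell_d_def ncomp_def by (intro sum.cong) (auto simp: c.RT0_basis_eq power2_eq_square)
    have cd0: "0 \<le> cell_d S T u u" unfolding cd
      by (intro sum_nonneg mult_nonneg_nonneg c.cell_form_nonneg c.shape_RT0) auto
    have ca0: "0 \<le> cell_a S T u u" unfolding cell_a_def by (rule c.cell_form_nonneg[OF R[OF u]])
    have "cell_a S T u u \<le> (of_int (aff_dim T) + 1) * cell_d S T u u"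
      using c.cell_form_le_diag[OF R[OF u]] unfolding cell_a_def cd .
    also have "\<dots> \<le> (real DIM('a) + 1) * cell_d S T u u" using ad' cd0 by (rule mult_right_mono)
    finally have le1: "cell_a S T u u \<le> (real DIM('a) + 1) * cell_d S T u u" .
    let ?s = "shape_const \<sigma>"
    have "cell_d S T u u \<le> (of_int (aff_dim T) + 1) * (hi / lo * ?s\<^sup>2 * ((4 * ?s)\<^sup>2 * (8 * ?s) ^ nat (aff_dim T))) * cell_a S T u u"
      using c.diag_le_cell_form[OF z R[OF u]] unfolding cell_a_def cd .
    also have "\<dots> \<le> (diag_const DIM('a) \<sigma> \<kappa>) * cell_a S T u u"
    proof (rule mult_right_mono[OF _ ca0])
      have pw: "(8 * ?s) ^ nat (aff_dim T) \<le> (8 * ?s) ^ DIM('a)"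
        using ad z(4) by (intro power_increasing) auto
      have "hi / lo * ?s\<^sup>2 * ((4 * ?s)\<^sup>2 * (8 * ?s) ^ nat (aff_dim T)) \<le> max 1 \<kappa> * ?s\<^sup>2 * ((4 * ?s)\<^sup>2 * (8 * ?s) ^ DIM('a))"
        using lh(2) pw z(4) c.lo c.hi by (intro mult_mono) auto
      note X = this
      have X0: "0 \<le> hi / lo * ?s\<^sup>2 * ((4 * ?s)\<^sup>2 * (8 * ?s) ^ nat (aff_dim T))"
        using z(4) c.lo c.hi by simp
      show "(of_int (aff_dim T) + 1) * (hi / lo * ?s\<^sup>2 * ((4 * ?s)\<^sup>2 * (8 * ?s) ^ nat (aff_dim T))) \<le> (diag_const DIM('a) \<sigma> \<kappa>)"
        unfolding diag_const_def by (rule mult_mono[OF ad' X _ X0]) simp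
    qed
    finally have le2: "cell_d S T u u \<le> (diag_const DIM('a) \<sigma> \<kappa>) * cell_a S T u u" .
    have pos: "0 < cell_a S T u u" if "u T \<noteq> 0"
      unfolding cell_a_def by (rule c.cell_form_pos[OF z R[OF u] that])
    have "cell_a S T (u + w) v = cell_a S T u v + cell_a S T w v" if w: "w \<in> flux_space \<Omega> M"
      using c.cell_form_add[OF R[OF u] R[OF w] R[OF v]] by (simp add: cell_a_def)
    moreover have "cell_a S T (c *\<^sub>R u) v = c * cell_a S T u v"
      using c.cell_form_scale[OF R[OF u], of c "v T"] by (simp add: cell_a_def scaleR_fun_def[of c u])
    moreover have "cell_a S T u v = cell_a S T v u"
      unfolding cell_a_def by (rule c.cell_form_sym[OF R[OF u] R[OF v]])
    ultimately show ?thesis using ca0 pos le1 le2 by blast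
  next
    case False
    note t = cell_a_trivial[OF S False]
    show ?thesis using t(1)[OF u] t(1)[OF v] t(2)[OF v] t(3)[OF u] by simp
  qed
  then show "w \<in> flux_space \<Omega> M \<Longrightarrow> cell_a S T (u + w) v = cell_a S T u v + cell_a S T w v"
    "cell_a S T (c *\<^sub>R u) v = c * cell_a S T u v" "cell_a S T u v = cell_a S T v u"
    "0 \<le> cell_a S T u u" "u T \<noteq> 0 \<Longrightarrow> 0 < cell_a S T u u"
    "cell_a S T u u \<le> (real DIM('a) + 1) * cell_d S T u u" "cell_d S T u u \<le> (diag_const DIM('a) \<sigma> \<kappa>) * cell_a S T u u"
    by simp_all
qed

text \<open>Positivity and definiteness are inherited from \<open>cell_a\<close>, which is at most n
  + 1 times \<open>cell_d\<close>.\<close>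

lemma cell_d_props:
  assumes S: "S \<in> SD" "T \<in> cells M S" and u: "u \<in> flux_space \<Omega> M" and v: "v \<in> flux_space \<Omega> M"
  shows "w \<in> flux_space \<Omega> M \<Longrightarrow> cell_d S T (u + w) v = cell_d S T u v + cell_d S T w v"
    and "cell_d S T (c *\<^sub>R u) v = c * cell_d S T u v"
    and "cell_d S T u v = cell_d S T v u"
    and "0 \<le> cell_d S T u u"
    and "u T \<noteq> 0 \<Longrightarrow> 0 < cell_d S T u u"
proof -
  show "cell_d S T (u + w) v = cell_d S T u v + cell_d S T w v" if w: "w \<in> flux_space \<Omega> M"
  proof (cases "T \<in> flux_cells")
    case True
    have "cell_d S T (u + w) v = (\<Sum>f | f facet_of T. ncomp T f u * ncomp T f v *
     cell_form T (inv_perm P S) (RT0_basis T f) (RT0_basis T f) + ncomp T f w * ncomp T f v *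
     cell_form T (inv_perm P S) (RT0_basis T f) (RT0_basis T f))"
      unfolding cell_d_def by (intro sum.cong) (auto simp: ncomp_linear(1)[OF True _ u w] algebra_simps)
    then show ?thesis by (simp add: cell_d_def sum.distrib)
  qed (simp add: cell_a_trivial(2)[OF S _ u])
  show "cell_d S T (c *\<^sub>R u) v = c * cell_d S T u v"
  proof (cases "T \<in> flux_cells")
    case True
    show ?thesis
      unfolding cell_d_def sum_distrib_left by (intro sum.cong) (auto simp: ncomp_linear(2)[OF True _ u])
  qed (simp add: cell_a_trivial(2)[OF S _ u])
  show "cell_d S T u v = cell_d S T v u" unfolding cell_d_def by (simp add: mult_ac)
  note a = cell_a_props(4,5,6)[OF S u u]
  have d: "0 < (real DIM('a) + 1)" by simp
  show "0 \<le> cell_d S T u u"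
  proof -
    have "0 \<le> (real DIM('a) + 1) * cell_d S T u u" using a(1,3) by linarith
    then show ?thesis using d by (simp only: zero_le_mult_iff) linarith
  qed
  show "0 < cell_d S T u u" if "u T \<noteq> 0"
  proof -
    have "0 < (real DIM('a) + 1) * cell_d S T u u" using a(2)[OF that] a(3) by linarith
    then show ?thesis using d by (simp only: zero_less_mult_pos)
  qed
qed

definition mortar_weight :: "'a iface \<Rightarrow> 'a set \<Rightarrow> real" where
  "mortar_weight g E = gap P g / normal_perm P g * measure (flat_measure (fst g)) (rel_interior E)"

lemma mortar_weight_pos: "\<lbrakk>g \<in> ifaces \<Omega>; E \<in> mortar_cells M g\<rbrakk> \<Longrightarrow> 0 < mortar_weight g E"
  using phys mortar_cell_props(2) unfolding mortar_weight_def physical_params_def by simp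

lemma mortar_form_eq:
  "mortar_form \<Omega> M P \<eta> \<mu> = (\<Sum>g\<in>ifaces \<Omega>. \<Sum>E\<in>mortar_cells M g. mortar_weight g E * \<eta> g E * \<mu> g E)"
  unfolding mortar_form_def L2_ifaces_def
proof (rule sum.cong[OF refl])
  fix g assume g: "g \<in> ifaces \<Omega>"
  let ?S = "fst g" and ?C = "mortar_cells M g" and ?c = "gap P g / normal_perm P g"
  interpret m: smesh ?S ?C using g by (rule mortar_smesh)
  have SD: "?S \<in> SD" using iface_dim[OF g] by blast
  have dj: "E = E'" if "E \<in> ?C" "E' \<in> ?C" "x \<in> rel_interior E" "x \<in> rel_interior E'" for x E E'
    using m.C_unique[OF that(1,2,3)] that(4) rel_interior_subset[of E'] by auto
  have "?c * mortar_fun M \<eta> g x * mortar_fun M \<mu> g x = (\<Sum>E\<in>?C. (?c * \<eta> g E * \<mu> g E) * indicat_real (rel_interior E) x)" for x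
  proof -
    have "mortar_fun M \<eta> g x * mortar_fun M \<mu> g x = (\<Sum>E\<in>?C. \<eta> g E * \<mu> g E * indicat_real (rel_interior E) x)"
      unfolding mortar_fun_def piecewise_const_def using m.finite_C dj by (intro sum_indicator_product)
    then show ?thesis by (simp only: mult.assoc sum_distrib_left)
  qed
  then have "(LINT x:?S|flat_measure ?S. ?c * mortar_fun M \<eta> g x * mortar_fun M \<mu> g x)
    = (\<Sum>E\<in>?C. (?c * \<eta> g E * \<mu> g E) * measure (flat_measure ?S) (rel_interior E))"
    using set_integral_lincomb(2)[OF m.finite_C SD_props(5,4,1)[OF SD], of rel_interior "\<lambda>E. ?c * \<eta> g E * \<mu> g E"]
      m.rel_interior_sub by simp
  also have "\<dots> = (\<Sum>E\<in>?C. mortar_weight g E * \<eta> g E * \<mu> g E)"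
    by (intro sum.cong) (auto simp: mortar_weight_def)
  finally show "(LINT x:?S|flat_measure ?S. ?c * mortar_fun M \<eta> g x * mortar_fun M \<mu> g x)
    = (\<Sum>E\<in>?C. mortar_weight g E * \<eta> g E * \<mu> g E)" .
qed

lemma mortar_form_props:
  shows "mortar_form \<Omega> M P (\<eta> + \<eta>') \<mu> = mortar_form \<Omega> M P \<eta> \<mu> + mortar_form \<Omega> M P \<eta>' \<mu>"
    and "mortar_form \<Omega> M P (c *\<^sub>R \<eta>) \<mu> = c * mortar_form \<Omega> M P \<eta> \<mu>"
    and "mortar_form \<Omega> M P \<eta> \<mu> = mortar_form \<Omega> M P \<mu> \<eta>"
    and "0 \<le> mortar_form \<Omega> M P \<eta> \<eta>"
    and "\<lbrakk>\<eta> \<in> mortar_space \<Omega> M; \<eta> \<noteq> 0\<rbrakk> \<Longrightarrow> 0 < mortar_form \<Omega> M P \<eta> \<eta>"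
proof -
  show "mortar_form \<Omega> M P (\<eta> + \<eta>') \<mu> = mortar_form \<Omega> M P \<eta> \<mu> + mortar_form \<Omega> M P \<eta>' \<mu>"
    by (simp add: mortar_form_eq algebra_simps sum.distrib)
  show "mortar_form \<Omega> M P (c *\<^sub>R \<eta>) \<mu> = c * mortar_form \<Omega> M P \<eta> \<mu>"
    by (simp add: mortar_form_eq scaleR_fun_def sum_distrib_left mult_ac)
  show "mortar_form \<Omega> M P \<eta> \<mu> = mortar_form \<Omega> M P \<mu> \<eta>"
    by (simp add: mortar_form_eq mult_ac)
  have t: "0 \<le> mortar_weight g E * \<eta> g E * \<eta> g E" if "g \<in> ifaces \<Omega>" "E \<in> mortar_cells M g" for g E
    using mortar_weight_pos[OF that] by (simp add: mult.assoc)
  then show "0 \<le> mortar_form \<Omega> M P \<eta> \<eta>"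
    unfolding mortar_form_eq by (intro sum_nonneg) auto
  assume \<eta>: "\<eta> \<in> mortar_space \<Omega> M" "\<eta> \<noteq> 0"
  then obtain g E where ge: "\<eta> g E \<noteq> 0" by (metis ext zero_fun_apply)
  then have g: "g \<in> ifaces \<Omega>" "E \<in> mortar_cells M g" using \<eta>(1) unfolding mortar_space_def mem_Collect_eq by blast+
  have "0 < (\<Sum>E\<in>mortar_cells M g. mortar_weight g E * \<eta> g E * \<eta> g E)"
  proof (rule sum_pos2[OF finite_mortar[OF g(1)] g(2)])
    have "0 < \<eta> g E * \<eta> g E" using ge by (simp add: zero_less_mult_iff) linarith
    then show "0 < mortar_weight g E * \<eta> g E * \<eta> g E" using mortar_weight_pos[OF g] by (simp add: mult.assoc)
  qed (rule t[OF g(1)])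
  then show "0 < mortar_form \<Omega> M P \<eta> \<eta>"
    unfolding mortar_form_eq using t by (intro sum_pos2[OF finite_ifaces g(1)]) (auto intro: sum_nonneg)
qed

lemma mortar_zero: "\<lbrakk>\<mu> \<in> mortar_space \<Omega> M; \<not> (g \<in> ifaces \<Omega> \<and> E \<in> mortar_cells M g)\<rbrakk> \<Longrightarrow> \<mu> g E = 0"
  unfolding mortar_space_def by blast

lemma W_finite_dim: "\<exists>F. finite F \<and> W_space \<Omega> M \<subseteq> span F"
  unfolding W_space_def
proof (rule finite_dim_Times)
  have fin: "finite flux_cells"
  proof -
    have "flux_cells \<subseteq> (\<Union>S\<in>SD. cells M S)" by (auto simp: flux_cells_def)
    moreover have "finite (\<Union>S\<in>SD. cells M S)" using finite_SD smesh.finite_C[OF cells_smesh] by blast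
    ultimately show ?thesis by (rule finite_subset)
  qed
  let ?B = "insert (\<lambda>x. x) ((\<lambda>e. (\<lambda>x. e)) ` (Basis :: 'a set)) :: ('a \<Rightarrow> 'a) set"
  show "\<exists>F. finite F \<and> flux_space0 \<Omega> M \<subseteq> span F"
  proof (rule finite_dim_fun[OF fin, of ?B])
    fix u :: "'a flux" and T assume u: "u \<in> flux_space0 \<Omega> M"
    show "u T = 0" if "T \<notin> flux_cells" using flux_zero[OF flux0_flux[OF u] that] .
    show "u T \<in> span ?B" if T: "T \<in> flux_cells"
    proof -
      obtain a b where ab: "\<And>x. u T x = a + b *\<^sub>R x"
        using flux_RT0[OF flux0_flux[OF u] T] by (auto simp: RT0_def)
      have "u T = (\<Sum>e\<in>Basis. (a \<bullet> e) *\<^sub>R (\<lambda>x. e)) + b *\<^sub>R (\<lambda>x. x)"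
        by (rule ext) (simp add: ab sum_fun_apply scaleR_fun_def euclidean_representation)
      also have "\<dots> \<in> span ?B" by (intro span_add span_sum span_scale span_base) auto
      finally show ?thesis .
    qed
  qed simp
  let ?E = "\<Union>g\<in>ifaces \<Omega>. mortar_cells M g"
  let ?B = "(\<lambda>E. (\<lambda>E'. if E' = E then 1 else 0)) ` ?E :: ('a set \<Rightarrow> real) set"
  have finE: "finite ?E" using finite_ifaces finite_mortar by blast
  show "\<exists>F. finite F \<and> mortar_space \<Omega> M \<subseteq> span F"
  proof (rule finite_dim_fun[OF finite_ifaces, of ?B])
    show "finite ?B" using finE by simp
    fix \<mu> :: "'a mortar" and g assume \<mu>: "\<mu> \<in> mortar_space \<Omega> M"
    show "\<mu> g = 0" if "g \<notin> ifaces \<Omega>" using mortar_zero[OF \<mu>] that by (simp add: fun_eq_iff)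
    show "\<mu> g \<in> span ?B" if g: "g \<in> ifaces \<Omega>"
    proof -
      have "\<mu> g = (\<Sum>E\<in>?E. \<mu> g E *\<^sub>R (\<lambda>E'. if E' = E then 1 else 0))"
      proof
        fix E'
        have "\<mu> g E' = 0" if "E' \<notin> ?E" using mortar_zero[OF \<mu>, of g E'] that g by blast
        then show "\<mu> g E' = (\<Sum>E\<in>?E. \<mu> g E *\<^sub>R (\<lambda>E'. if E' = E then 1 else 0)) E'"
          unfolding sum_fun_apply scaleR_fun_def using finE by (cases "E' \<in> ?E") (simp_all add: if_distrib cong: if_cong)
      qed
      also have "\<dots> \<in> span ?B" by (intro span_sum span_scale span_base) auto
      finally show ?thesis .
    qed
  qed
qed

lemma Q_finite_dim: "\<exists>F. finite F \<and> pressure_space \<Omega> M \<subseteq> span F"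
proof (rule finite_dim_fun[of "\<Union>S\<in>SD. cells M S" "{1::real}"])
  show "finite (\<Union>S\<in>SD. cells M S)" using finite_SD smesh.finite_C[OF cells_smesh] by blast
  fix q :: "'a pressure" and T assume q: "q \<in> pressure_space \<Omega> M"
  show "q T = 0" if "T \<notin> (\<Union>S\<in>SD. cells M S)" using q that by (auto simp: pressure_space_def)
  have "q T *\<^sub>R 1 \<in> span {1::real}" by (intro span_scale span_base) simp
  then show "q T \<in> span {1}" by simp
qed simp

text \<open>Stated for an abstract cell contribution h to serve both forms. The sum with the lift
  could vanish for a nonzero pair, so definiteness splits: a nonzero mortar is seen by the mortar
  form, and for a zero mortar the lift disappears and h sees the flux itself.\<close>

lemma spd_mixed_form:
  assumes add: "\<And>S T u v w. \<lbrakk>S \<in> SD; T \<in> cells M S; u \<in> flux_space \<Omega> M; v \<in> flux_space \<Omega> M; w \<in> flux_space \<Omega> M\<rbrakk>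
      \<Longrightarrow> h S T (u + w) v = h S T u v + h S T w v"
    and scale: "\<And>S T u v c. \<lbrakk>S \<in> SD; T \<in> cells M S; u \<in> flux_space \<Omega> M; v \<in> flux_space \<Omega> M\<rbrakk> \<Longrightarrow> h S T (c *\<^sub>R u) v = c * h S T u v"
    and sym: "\<And>S T u v. \<lbrakk>S \<in> SD; T \<in> cells M S; u \<in> flux_space \<Omega> M; v \<in> flux_space \<Omega> M\<rbrakk> \<Longrightarrow> h S T u v = h S T v u"
    and nn: "\<And>S T u. \<lbrakk>S \<in> SD; T \<in> cells M S; u \<in> flux_space \<Omega> M\<rbrakk> \<Longrightarrow> 0 \<le> h S T u u"
    and pos: "\<And>S T u. \<lbrakk>S \<in> SD; T \<in> cells M S; u \<in> flux_space \<Omega> M; u T \<noteq> 0\<rbrakk> \<Longrightarrow> 0 < (h S T u u :: real)"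
    and F: "\<And>u \<eta> v \<mu>. F (u, \<eta>) (v, \<mu>) = (\<Sum>S\<in>SD. \<Sum>T\<in>cells M S. h S T (u + mortar_lift \<eta>) (v + mortar_lift \<mu>)) + mortar_form \<Omega> M P \<eta> \<mu>"
  shows "spd_form (W_space \<Omega> M) F"
proof
  show "subspace (W_space \<Omega> M)" by (rule W_space_subspace)
  show "\<exists>F. finite F \<and> W_space \<Omega> M \<subseteq> span F" by (rule W_finite_dim)
  have W: "u + mortar_lift \<eta> \<in> flux_space \<Omega> M" if "(u, \<eta>) \<in> W_space \<Omega> M" for u \<eta>
    using that by (intro flux_add_lift flux0_flux) (simp add: W_space_def)
  note fin = smesh.finite_C[OF cells_smesh]
  fix x y z :: "'a flux \<times> 'a mortar"
  obtain u \<eta> v \<mu> w \<theta> where e: "x = (u, \<eta>)" "y = (v, \<mu>)" "z = (w, \<theta>)" by (metis surj_pair)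
  assume x: "x \<in> W_space \<Omega> M"
  note Wx = W[OF x[unfolded e]]
  show "F (c *\<^sub>R x) z = c * F x z" if z: "z \<in> W_space \<Omega> M" for c
  proof -
    note Wz = W[OF z[unfolded e]]
    have "c *\<^sub>R u + mortar_lift (c *\<^sub>R \<eta>) = c *\<^sub>R (u + mortar_lift \<eta>)" by (simp add: mortar_lift_linear scaleR_add_right)
    then show ?thesis unfolding e scaleR_Pair F
      by (simp only: scale[OF _ _ Wx Wz] mortar_form_props(2) distrib_left sum_distrib_left cong: sum.cong)
  qed
  show "0 < F x x" if "x \<noteq> 0"
  proof (cases "\<eta> = 0")
    case False
    then have "0 < mortar_form \<Omega> M P \<eta> \<eta>" using x by (intro mortar_form_props(5)) (auto simp: e W_space_def)
    moreover have "0 \<le> (\<Sum>S\<in>SD. \<Sum>T\<in>cells M S. h S T (u + mortar_lift \<eta>) (u + mortar_lift \<eta>))"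
      using Wx nn by (intro sum_nonneg) auto
    ultimately show ?thesis unfolding e F by linarith
  next
    case True
    then have u0: "u \<noteq> 0" using that by (auto simp: e zero_prod_def)
    have ue: "u + mortar_lift \<eta> = u" by (simp add: True mortar_lift_zero)
    have uf: "u \<in> flux_space \<Omega> M" using Wx unfolding ue .
    obtain T where T: "u T \<noteq> 0" using u0 by (metis ext zero_fun_apply)
    then have "T \<in> flux_cells" using flux_zero[OF uf] by blast
    then obtain S where S: "S \<in> SD" "T \<in> cells M S" by (auto simp: flux_cells_def)
    have "0 < (\<Sum>T\<in>cells M S. h S T u u)"
      by (rule sum_pos2[where i = T and f = "\<lambda>T. h S T u u", OF fin[OF S(1)] S(2) pos[OF S uf T] nn[OF S(1) _ uf]])
    then have "0 < (\<Sum>S\<in>SD. \<Sum>T\<in>cells M S. h S T u u)"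
      by (rule sum_pos2[OF finite_SD S(1)]) (intro sum_nonneg nn[OF _ _ uf])
    then show ?thesis unfolding e F ue using mortar_form_props(4)[of \<eta>] by linarith
  qed
  assume y: "y \<in> W_space \<Omega> M"
  note Wy = W[OF y[unfolded e]]
  show "F x y = F y x"
    unfolding e F by (simp only: sym[OF _ _ Wx Wy] mortar_form_props(3)[of \<eta> \<mu>] cong: sum.cong)
  show "F (x + y) z = F x z + F y z" if z: "z \<in> W_space \<Omega> M"
  proof -
    note Wz = W[OF z[unfolded e]]
    have eq: "u + v + mortar_lift (\<eta> + \<mu>) = (u + mortar_lift \<eta>) + (v + mortar_lift \<mu>)" by (simp add: mortar_lift_linear)
    have "(\<Sum>S\<in>SD. \<Sum>T\<in>cells M S. h S T ((u + mortar_lift \<eta>) + (v + mortar_lift \<mu>)) (w + mortar_lift \<theta>))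
      = (\<Sum>S\<in>SD. \<Sum>T\<in>cells M S. h S T (u + mortar_lift \<eta>) (w + mortar_lift \<theta>) + h S T (v + mortar_lift \<mu>) (w + mortar_lift \<theta>))"
      by (intro sum.cong refl add[OF _ _ Wx Wz Wy])
    then show ?thesis unfolding e add_Pair F eq by (simp add: sum.distrib mortar_form_props(1))
  qed
qed

lemma form_a_eq: "form_a \<Omega> M P (u, \<eta>) (v, \<mu>)
    = (\<Sum>S\<in>SD. \<Sum>T\<in>cells M S. cell_a S T (u + mortar_lift \<eta>) (v + mortar_lift \<mu>)) + mortar_form \<Omega> M P \<eta> \<mu>"
  by (simp add: form_a_def flux_form_def extension_eq cell_a_def cell_form_def)

lemma form_aD_eq: "form_aD \<Omega> M P (u, \<eta>) (v, \<mu>)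
    = (\<Sum>S\<in>SD. \<Sum>T\<in>cells M S. cell_d S T (u + mortar_lift \<eta>) (v + mortar_lift \<mu>)) + mortar_form \<Omega> M P \<eta> \<mu>"
  by (simp add: form_aD_def flux_form_D_def extension_eq cell_d_def cell_form_def ncomp_def)

text \<open>Both forms contain the same mortar term, so the comparison holds for it with any
  constant that is at least 1; this is the origin of the \<open>max 1\<close> in the second
  bound.\<close>

lemma form_le:
  assumes x: "x \<in> W_space \<Omega> M"
  shows "form_a \<Omega> M P x x \<le> (real DIM('a) + 1) * form_aD \<Omega> M P x x"
    and "form_aD \<Omega> M P x x \<le> max 1 (diag_const DIM('a) \<sigma> \<kappa>) * form_a \<Omega> M P x x"
proof -
  obtain u \<eta> where e: "x = (u, \<eta>)" by fastforce
  have W: "u + mortar_lift \<eta> \<in> flux_space \<Omega> M"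
    using x unfolding e by (intro flux_add_lift flux0_flux) (simp add: W_space_def)
  let ?v = "u + mortar_lift \<eta>"
  note m0 = mortar_form_props(4)[of \<eta>]
  have "(\<Sum>S\<in>SD. \<Sum>T\<in>cells M S. cell_a S T ?v ?v) \<le> (\<Sum>S\<in>SD. \<Sum>T\<in>cells M S. (real DIM('a) + 1) * cell_d S T ?v ?v)"
    by (intro sum_mono cell_a_props(6)[OF _ _ W W])
  moreover have "mortar_form \<Omega> M P \<eta> \<eta> \<le> (real DIM('a) + 1) * mortar_form \<Omega> M P \<eta> \<eta>"
    using m0 mult_right_mono[of 1 "real DIM('a) + 1"] by simp
  ultimately show "form_a \<Omega> M P x x \<le> (real DIM('a) + 1) * form_aD \<Omega> M P x x"
    unfolding e form_a_eq form_aD_eq by (simp add: sum_distrib_left distrib_left)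
  have "(\<Sum>S\<in>SD. \<Sum>T\<in>cells M S. cell_d S T ?v ?v) \<le> (\<Sum>S\<in>SD. \<Sum>T\<in>cells M S. max 1 (diag_const DIM('a) \<sigma> \<kappa>) * cell_a S T ?v ?v)"
  proof (intro sum_mono)
    fix S T assume S: "S \<in> SD" "T \<in> cells M S"
    have "cell_d S T ?v ?v \<le> (diag_const DIM('a) \<sigma> \<kappa>) * cell_a S T ?v ?v" by (rule cell_a_props(7)[OF S W W])
    also have "\<dots> \<le> max 1 (diag_const DIM('a) \<sigma> \<kappa>) * cell_a S T ?v ?v"
      by (intro mult_right_mono cell_a_props(4)[OF S W W]) auto
    finally show "cell_d S T ?v ?v \<le> max 1 (diag_const DIM('a) \<sigma> \<kappa>) * cell_a S T ?v ?v" .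
  qed
  moreover have "mortar_form \<Omega> M P \<eta> \<eta> \<le> max 1 (diag_const DIM('a) \<sigma> \<kappa>) * mortar_form \<Omega> M P \<eta> \<eta>"
    using m0 mult_right_mono[of 1 "max 1 (diag_const DIM('a) \<sigma> \<kappa>)"] by simp
  ultimately show "form_aD \<Omega> M P x x \<le> max 1 (diag_const DIM('a) \<sigma> \<kappa>) * form_a \<Omega> M P x x"
    unfolding e form_a_eq form_aD_eq by (simp add: sum_distrib_left distrib_left)
qed

sublocale SP: saddle_point "W_space \<Omega> M" "form_a \<Omega> M P" "form_aD \<Omega> M P" "pressure_space \<Omega> M" "form_b \<Omega> M"
    "real DIM('a) + 1" "max 1 (diag_const DIM('a) \<sigma> \<kappa>)"
proof -
  interpret A: spd_form "W_space \<Omega> M" "form_a \<Omega> M P"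
    by (rule spd_mixed_form[where h = cell_a]) (rule cell_a_props form_a_eq; assumption)+
  interpret D: spd_form "W_space \<Omega> M" "form_aD \<Omega> M P"
    by (rule spd_mixed_form[where h = cell_d]) (rule cell_d_props form_aD_eq; assumption)+
  have W: "fst x \<in> flux_space \<Omega> M" if "x \<in> W_space \<Omega> M" for x
    using that flux0_flux by (auto simp: W_space_def)
  show "saddle_point (W_space \<Omega> M) (form_a \<Omega> M P) (form_aD \<Omega> M P) (pressure_space \<Omega> M) (form_b \<Omega> M) (real DIM('a) + 1) (max 1 (diag_const DIM('a) \<sigma> \<kappa>))"
  proof
    fix x y :: "'a flux \<times> 'a mortar" and p q :: "'a pressure" and c :: real
    assume x: "x \<in> W_space \<Omega> M"
    obtain u \<eta> v \<mu> where e: "x = (u, \<eta>)" "y = (v, \<mu>)" by (metis surj_pair)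
    have u: "u \<in> flux_space \<Omega> M" using W[OF x] by (simp add: e)
    show "form_b \<Omega> M (x + y) q = form_b \<Omega> M x q + form_b \<Omega> M y q" if "y \<in> W_space \<Omega> M"
      using form_b_linear(1)[OF u, of v \<eta> \<mu> q] W[OF that] by (simp add: e)
    show "form_b \<Omega> M (c *\<^sub>R x) q = c * form_b \<Omega> M x q"
      using form_b_linear(2)[OF u, of c \<eta> q] by (simp add: e)
    show "form_b \<Omega> M x (p + q) = form_b \<Omega> M x p + form_b \<Omega> M x q"
      using form_b_linear(3)[OF u] by (simp add: e)
    show "form_b \<Omega> M x (c *\<^sub>R q) = c * form_b \<Omega> M x q"
      using form_b_linear(4)[OF u] by (simp add: e)
  qed (use form_le form_b_nondegenerate Q_finite_dim pressure_space_subspace in auto)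
qed

section \<open>From the operators of the statement to the abstract saddle point problem\<close>

lemma inner_inv_eq:
  assumes "x \<in> X_space \<Omega> M" "y \<in> X_space \<Omega> M"
  shows "inner_inv \<Omega> M (precond_D \<Omega> M P) x y = SP.inner_D x y"
proof -
  have opA: "op_A \<Omega> M P = SP.A.riesz" by (rule ext) (simp add: op_A_def SP.A.riesz_def)
  have opS: "op_S \<Omega> M P p = SP.S.riesz p" for p
  proof -
    have "op_DA \<Omega> M P = SP.D.riesz" by (rule ext) (simp add: op_DA_def SP.D.riesz_def)
    moreover have "op_BT \<Omega> M p = SP.BT p" by (simp add: op_BT_def SP.BT_def)
    ultimately have "op_S \<Omega> M P p = restrict (form_b \<Omega> M (SP.lift_d p)) (pressure_space \<Omega> M)"
      by (simp add: op_S_def op_B_def SP.lift_d_def)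
    moreover have "SP.s p = form_b \<Omega> M (SP.lift_d p)" by (rule ext) (simp add: SP.s_def)
    ultimately show ?thesis by (simp add: SP.S.riesz_def)
  qed
  have bD: "block_op \<Omega> M (op_A \<Omega> M P) 0 0 (op_S \<Omega> M P) = SP.block_D"
    by (rule ext) (auto simp: block_op_def SP.block_D_def opA opS SP.A.riesz_def SP.S.riesz_def)
  have "inv_into (X_dual_space \<Omega> M) (precond_D \<Omega> M P) x = SP.block_D x"
    unfolding precond_D_def bD using SP.block_D_bij assms
    by (simp add: X_dual_space_def X_space_def inv_into_inv_into_eq)
  moreover obtain w p r q where e: "x = (w, p)" "y = (r, q)" by (metis surj_pair)
  moreover have "r \<in> W_space \<Omega> M" "q \<in> pressure_space \<Omega> M" using assms(2) by (auto simp: e X_space_def)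
  ultimately show ?thesis
    by (simp add: inner_inv_def pairing_def SP.block_D_def SP.inner_D_def SP.A.riesz_def SP.S.riesz_def)
qed

lemma precond_L_calA:
  "precond_L \<Omega> M P (calA \<Omega> M P x) = inv_into (W_space \<Omega> M \<times> pressure_space \<Omega> M) SP.block_L (SP.block_A x)"
proof -
  have opS: "op_S \<Omega> M P p = restrict (SP.s p) (pressure_space \<Omega> M)" for p
  proof -
    have "op_DA \<Omega> M P = SP.D.riesz" by (rule ext) (simp add: op_DA_def SP.D.riesz_def)
    moreover have "op_BT \<Omega> M p = SP.BT p" by (simp add: op_BT_def SP.BT_def)
    ultimately have "op_S \<Omega> M P p = restrict (form_b \<Omega> M (SP.lift_d p)) (pressure_space \<Omega> M)"
      by (simp add: op_S_def op_B_def SP.lift_d_def)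
    moreover have "SP.s p = form_b \<Omega> M (SP.lift_d p)" by (rule ext) (simp add: SP.s_def)
    ultimately show ?thesis by simp
  qed
  have "block_op \<Omega> M (op_A \<Omega> M P) 0 (- op_B \<Omega> M) (op_S \<Omega> M P) = SP.block_L"
    by (rule ext)
      (auto simp: block_op_def SP.block_L_def op_A_def opS op_B_def SP.A.riesz_def restrict_def fun_eq_iff)
  moreover have "calA \<Omega> M P x = SP.block_A x"
    by (auto simp: calA_def block_op_def SP.block_A_def op_A_def op_B_def op_BT_def restrict_def fun_eq_iff split: prod.split)
  ultimately show ?thesis by (simp add: precond_L_def X_space_def)
qed

lemma field_of_values:
  assumes x: "x \<in> X_space \<Omega> M" "x \<noteq> 0"
  defines "y \<equiv> precond_L \<Omega> M P (calA \<Omega> M P x)"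
  shows "1 / (2 * (real DIM('a) + 1)) \<le> inner_inv \<Omega> M (precond_D \<Omega> M P) y x / inner_inv \<Omega> M (precond_D \<Omega> M P) x x"
    and "norm_inv \<Omega> M (precond_D \<Omega> M P) y / norm_inv \<Omega> M (precond_D \<Omega> M P) x
      \<le> sqrt (2 + 2 * max 1 (diag_const DIM('a) \<sigma> \<kappa>) + (max 1 (diag_const DIM('a) \<sigma> \<kappa>))\<^sup>2)"
proof -
  obtain w p where e: "x = (w, p)" by fastforce
  have wp: "w \<in> W_space \<Omega> M" "p \<in> pressure_space \<Omega> M" using x(1) by (auto simp: e X_space_def)
  have y: "y = inv_into (W_space \<Omega> M \<times> pressure_space \<Omega> M) SP.block_L (SP.block_A (w, p))"
    unfolding y_def precond_L_calA e ..
  note b = SP.precond_L_bounds[OF wp, folded y, folded e]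
  have yX: "y \<in> X_space \<Omega> M" using b(3) by (simp add: X_space_def)
  have pos: "0 < SP.inner_D x x"
  proof (cases "w = 0")
    case True
    then have "p \<noteq> 0" using x(2) by (auto simp: e zero_prod_def)
    then show ?thesis using SP.S.pos[OF wp(2)] SP.A.nonneg[OF wp(1)] by (simp add: e SP.inner_D_def)
  next
    case False
    then show ?thesis using SP.A.pos[OF wp(1)] SP.S.nonneg[OF wp(2)] by (simp add: e SP.inner_D_def)
  qed
  show "1 / (2 * (real DIM('a) + 1)) \<le> inner_inv \<Omega> M (precond_D \<Omega> M P) y x / inner_inv \<Omega> M (precond_D \<Omega> M P) x x"
    unfolding inner_inv_eq[OF yX x(1)] inner_inv_eq[OF x(1) x(1)] using b(1) pos by (simp add: le_divide_eq)
  have "sqrt (SP.inner_D y y) \<le> sqrt ((2 + 2 * max 1 (diag_const DIM('a) \<sigma> \<kappa>) + (max 1 (diag_const DIM('a) \<sigma> \<kappa>))\<^sup>2) * SP.inner_D x x)"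
    using b(2) by (rule real_sqrt_le_mono)
  then show "norm_inv \<Omega> M (precond_D \<Omega> M P) y / norm_inv \<Omega> M (precond_D \<Omega> M P) x
      \<le> sqrt (2 + 2 * max 1 (diag_const DIM('a) \<sigma> \<kappa>) + (max 1 (diag_const DIM('a) \<sigma> \<kappa>))\<^sup>2)"
    unfolding norm_inv_def inner_inv_eq[OF yX yX] inner_inv_eq[OF x(1) x(1)] using pos
    by (simp add: real_sqrt_mult divide_le_eq)
qed

end

text \<open>The lower constant can be chosen before \<kappa>, because it comes only from the facet
  count n + 1. The upper one contains \<open>diag_const\<close> and thus depends on shape regularity
  and on the anisotropy bound.\<close>

theorem theorem4p6:
  fixes \<Omega> :: "'a::euclidean_space medium" and \<sigma> :: real
  assumes "DIM('a) = 2 \<or> DIM('a) = 3"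
    and "fractured_medium \<Omega>"
  shows "\<exists>\<xi>\<^sub>1>0. \<forall>\<kappa>. \<exists>\<xi>\<^sub>2>0. \<forall>(M :: 'a mesh) (P :: 'a params).
    medium_mesh \<Omega> \<sigma> M \<longrightarrow> physical_params \<Omega> P \<longrightarrow> perm_bounded \<Omega> \<kappa> P \<longrightarrow>
    (\<forall>x\<in>X_space \<Omega> M. x \<noteq> 0 \<longrightarrow>
       \<xi>\<^sub>1 \<le> inner_inv \<Omega> M (precond_D \<Omega> M P) (precond_L \<Omega> M P (calA \<Omega> M P x)) x
              / inner_inv \<Omega> M (precond_D \<Omega> M P) x x \<and>
       norm_inv \<Omega> M (precond_D \<Omega> M P) (precond_L \<Omega> M P (calA \<Omega> M P x))
              / norm_inv \<Omega> M (precond_D \<Omega> M P) x \<le> \<xi>\<^sub>2)"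
proof -
  define \<xi>\<^sub>1 where "\<xi>\<^sub>1 = 1 / (2 * (real DIM('a) + 1))"
  define \<xi>\<^sub>2 where "\<xi>\<^sub>2 \<kappa> = sqrt (2 + 2 * max 1 (diag_const DIM('a) \<sigma> \<kappa>) + (max 1 (diag_const DIM('a) \<sigma> \<kappa>))\<^sup>2)" for \<kappa>
  have "\<xi>\<^sub>1 \<le> inner_inv \<Omega> M (precond_D \<Omega> M P) (precond_L \<Omega> M P (calA \<Omega> M P x)) x
              / inner_inv \<Omega> M (precond_D \<Omega> M P) x x \<and>
       norm_inv \<Omega> M (precond_D \<Omega> M P) (precond_L \<Omega> M P (calA \<Omega> M P x))
              / norm_inv \<Omega> M (precond_D \<Omega> M P) x \<le> \<xi>\<^sub>2 \<kappa>"
    if "medium_mesh \<Omega> \<sigma> M" "physical_params \<Omega> P" "perm_bounded \<Omega> \<kappa> P" "x \<in> X_space \<Omega> M" "x \<noteq> 0"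
    for M :: "'a mesh" and P :: "'a params" and \<kappa> x
  proof -
    interpret discretization \<Omega> M \<sigma> P \<kappa> using assms(2) that(1-3) by unfold_locales
    show ?thesis using field_of_values[OF that(4,5)] by (simp add: \<xi>\<^sub>1_def \<xi>\<^sub>2_def)
  qed
  note main = this
  show ?thesis
  proof (rule exI[of _ \<xi>\<^sub>1], rule conjI, goal_cases)
    case 1
    show ?case by (simp add: \<xi>\<^sub>1_def)
  next
    case 2
    show ?case
    proof (rule allI, rule exI, rule conjI)
      show "0 < \<xi>\<^sub>2 \<kappa>" for \<kappa> by (simp add: \<xi>\<^sub>2_def add_pos_nonneg)
    qed (intro allI impI ballI main)
  qed
qed

end
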